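(* Let $H_0,H_1$ be separable Hilbert spaces, $\nu_0>0$ and $r>\frac{1}{2\nu_0}$. Let $(M_n)_{n\in\mathbb{N}}$ and $(N^{ij}_n)_{n\in\mathbb{N}}$ be bounded sequences in $\mathcal{H}^\infty(B(r,r);L(H_0))$ and $\mathcal{H}^\infty(B(r,r);L(H_j,H_i))$, respectively ($i,j\in\{0,1\}$). Assume there exists $c>0$ such that for all $n\in\mathbb{N}$, all $(\phi,\psi)\in H_0\oplus H_1$ and all $z\in B(r,r)$ $$\operatorname{Re}\langle M_n(z)\phi,\phi\rangle_{H_0}\geq c|\phi|_{H_0}^2,\qquad\operatorname{Re}\langle N^{11}_n(z)\psi,\psi\rangle_{H_1}\geq c|\psi|_{H_1}^2 .$$ Put $N_n:=N^{00}_n-N^{01}_n(N^{11}_n)^{-1}N^{10}_n$ for $n\in\mathbb{N}$ (pointwise in $z$). Then there exist $\nu,\nu_1$ with $\nu>\nu_1\geq\nu_0$ and a subsequence $(n_k)_k$ of $(n)_n$ such that for all $z\in B\left(\frac{1}{2\nu_1},\frac{1}{2\nu_1}\right)$ and all integers $\ell\geq0$ the following limits exist in the weak operator topology and define bounded analytic operator-valued functions of $z$: \begin{align*} M_{hom,\ell,00}(z)&=\tau_{\mathrm{w}}\text{-}\lim_{k\to\infty}M_{n_k}(z)^{-1}\left(-N_{n_k}(z)M_{n_k}(z)^{-1}\right)^{\ell},\\ M_{hom,\ell,01}(z)&=\tau_{\mathrm{w}}\text{-}\lim_{k\to\infty}-M_{n_k}(z)^{-1}\left(-N_{n_k}(z)M_{n_k}(z)^{-1}\right)^{\ell}N^{01}_{n_k}(z)\left(N^{11}_{n_k}(z)\right)^{-1},\\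 M_{hom,\ell,10}(z)&=\tau_{\mathrm{w}}\text{-}\lim_{k\to\infty}-\left(N^{11}_{n_k}(z)\right)^{-1}N^{10}_{n_k}(z)M_{n_k}(z)^{-1}\left(-N_{n_k}(z)M_{n_k}(z)^{-1}\right)^{\ell},\\ M_{hom,\ell,11}(z)&=\tau_{\mathrm{w}}\text{-}\lim_{k\to\infty}\left(N^{11}_{n_k}(z)\right)^{-1}N^{10}_{n_k}(z)M_{n_k}(z)^{-1}\left(-N_{n_k}(z)M_{n_k}(z)^{-1}\right)^{\ell}N^{01}_{n_k}(z)\left(N^{11}_{n_k}(z)\right)^{-1},\\ N_{hom,-1,11}(z)&=\tau_{\mathrm{w}}\text{-}\lim_{k\to\infty}\left(N^{11}_{n_k}(z)\right)^{-1}, \end{align*} and, with $$M^{(1)}(\partial_0^{-1}):=\begin{pmatrix}\sum_{\ell=1}^\infty M_{hom,\ell,00}(\partial_0^{-1})(\partial_0^{-1})^{\ell}&\sum_{\ell=0}^\infty M_{hom,\ell,01}(\partial_0^{-1})(\partial_0^{-1})^{\ell+1}\\ \sum_{\ell=0}^\infty M_{hom,\ell,10}(\partial_0^{-1})(\partial_0^{-1})^{\ell}&\sum_{\ell=0}^\infty M_{hom,\ell,11}(\partial_0^{-1})(\partial_0^{-1})^{\ell+1}\end{pmatrix},$$ $$D:=\begin{pmatrix}M_{hom,0,00}(\partial_0^{-1})^{-1}&0\\0&N_{hom,-1,11}(\partial_0^{-1})^{-1}\end{pmatrix},$$ we have, as $k\to\infty$, $$\partial_0\begin{pmatrix}M_{n_k}(\partial_0^{-1})&0\\0&0\end{pmatrix}+\begin{pmatrix}N^{00}_{n_k}(\partial_0^{-1})&N^{01}_{n_k}(\partial_0^{-1})\\N^{10}_{n_k}(\partial_0^{-1})&N^{11}_{n_k}(\partial_0^{-1})\end{pmatrix}\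 \stackrel{G}{\longrightarrow}\ \begin{pmatrix}\partial_0&0\\0&1\end{pmatrix}\left(D+\sum_{\ell=1}^\infty\left(-D\,M^{(1)}(\partial_0^{-1})\right)^{\ell}D\right)$$ in $L^2_\nu(\mathbb{R};H_0\oplus H_1)$.
   Context: **Weighted spaces and time derivative.** For a Hilbert space $H$ and $\nu>0$, $L^2_\nu(\mathbb{R};H)$ is the space of (classes of) measurable $f:\mathbb{R}\to H$ with $\int_{\mathbb{R}}|f(t)|_H^2e^{-2\nu t}\,dt<\infty$, with the natural weighted scalar product. $H_{\nu,1}(\mathbb{R};H)$ is the set of $f\in L^2_\nu(\mathbb{R};H)$ whose distributional derivative lies in $L^2_\nu(\mathbb{R};H)$, and $\partial_0:H_{\nu,1}(\mathbb{R};H)\subseteq L^2_\nu(\mathbb{R};H)\to L^2_\nu(\mathbb{R};H)$, $f\mapsto f'$. This operator is continuously invertible, with $\|\partial_0^{-1}\|\leq 1/\nu$. **Functions of $\partial_0^{-1}$.** The Fourier–Laplace transform $\mathcal{L}_\nu:L^2_\nu(\mathbb{R};H)\to L^2(\mathbb{R};H)$ is the unitary operator obtained as the closure of $\phi\mapsto\left(x\mapsto\frac{1}{\sqrt{2\pi}}\int_{\mathbb{R}}e^{-ixy-\nu y}\phi(y)\,dy\right)$ on smooth compactly supported $\phi$. With $m$ the multiplication-by-argument operator, $\partial_0^{-1}=\mathcal{L}_\nu^*\left(\frac{1}{im+\nu}\right)\mathcal{L}_\nu$. Let $B(r,r)=\{z\in\mathbb{C}:|z-r|<r\}$. For Hilbert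 spaces $H_0,H_1$, $\mathcal{H}^\infty(B(r,r);L(H_0,H_1))$ is the set of bounded analytic functions $M:B(r,r)\to L(H_0,H_1)$, and $L(H)=L(H,H)$. A family $(M_\iota)_{\iota\in I}$ in it is bounded if $\sup\{\|M_\iota(z)\|:z\in B(r,r),\iota\in I\}<\infty$. For $r>\frac{1}{2\nu}$ and such $M$, define $M(\partial_0^{-1}):=\mathcal{L}_\nu^*M\left(\frac{1}{im+\nu}\right)\mathcal{L}_\nu$, a bounded operator from $L^2_\nu(\mathbb{R};H_0)$ to $L^2_\nu(\mathbb{R};H_1)$, where $\left(M\left(\frac{1}{im+\nu}\right)\phi\right)(t):=M\left(\frac{1}{it+\nu}\right)\phi(t)$ for a.e. $t\in\mathbb{R}$. **$G$-convergence.** Let $X$ be a Hilbert space, $(A_n:D(A_n)\subseteq X\to X)_n$ a sequence of continuously invertible linear operators onto $X$, and $B:D(B)\subseteq X\to X$ linear and one-to-one. $(A_n)_n$ $G$-converges to $B$, written $A_n\stackrel{G}{\longrightarrow}B$, if $(A_n^{-1})_n$ converges in the weak operator topology to $B^{-1}$, i.e. for all $f\in X$ the sequence $(A_n^{-1}f)_n$ converges weakly to some $u\in D(B)$ with $Bu=f$. **Conventions.** $\tau_{\mathrm{w}}$ is the weak operator topology and $\tau_{\mathrm{w}}\text{-}\lim$ the limit in it. $L^2_\nu(\mathbb{R};H_0\oplus H_1)$ is identified with $L^2_\nu(\mathbb{R};H_0)\oplus L^2_\nu(\mathbb{R};H_1)$. Infinite sums of operators converge in operator norm. The operators in the sequence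 have domain $\{(u,v):M_{n_k}(\partial_0^{-1})u\in D(\partial_0)\}$, and the limit operator $\begin{pmatrix}\partial_0&0\\0&1\end{pmatrix}T$ ($T$ bounded) has domain $\{w:\text{the first component of }Tw\text{ lies in }D(\partial_0)\}$. The $G$-convergence assertion includes continuous invertibility of the operators in the sequence. *)

theory Defs
  imports "HOL-Analysis.Analysis"
begin

section \<open>Complex Hilbert spaces and operator-valued functions\<close>

class complex_vector = ab_group_add +
  fixes scaleC :: "complex \<Rightarrow> 'a \<Rightarrow> 'a" (infixr "*\<^sub>C" 75)
  assumes scaleC_add_right: "c *\<^sub>C (x + y) = c *\<^sub>C x + c *\<^sub>C y"
    and scaleC_add_left: "(c + d) *\<^sub>C x = c *\<^sub>C x + d *\<^sub>C x"
    and scaleC_scaleC: "c *\<^sub>C d *\<^sub>C x = (c * d) *\<^sub>C x"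
    and scaleC_one: "1 *\<^sub>C x = x"

text \<open>The complex inner product is antilinear in its first argument; the topology, the norm and
  the real structure are those of the underlying real inner product \<open>Re (cinner x y)\<close>.\<close>

class complex_inner = complex_vector + real_inner +
  fixes cinner :: "'a \<Rightarrow> 'a \<Rightarrow> complex"
  assumes scaleR_scaleC: "r *\<^sub>R x = complex_of_real r *\<^sub>C x"
    and cinner_commute: "cinner x y = cnj (cinner y x)"
    and cinner_add_left: "cinner (x + y) z = cinner x z + cinner y z"
    and cinner_scaleC_left: "cinner (c *\<^sub>C x) y = cnj c * cinner x y"
    and inner_eq_Re_cinner: "x \<bullet> y = Re (cinner x y)"

text \<open>For metric spaces, separability and second countability coincide; the latter is what the
  library's Bochner integral is based on.\<close>

class separable_chilbert = complex_inner + banach + second_countable_topology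

lemma norm_scaleC: "norm (c *\<^sub>C x) = cmod c * norm (x :: 'a :: complex_inner)"
proof -
  have "Im (cinner x x) = 0"
    using cinner_commute[of x x] by (metis complex_cnj_cancel_iff Reals_cnj_iff complex_is_Real_iff)
  moreover have "cinner (c *\<^sub>C x) (c *\<^sub>C x) = cnj c * (c * cinner x x)"
    by (metis cinner_commute cinner_scaleC_left complex_cnj_cnj complex_cnj_mult)
  then have "cinner (c *\<^sub>C x) (c *\<^sub>C x) = complex_of_real ((cmod c)\<^sup>2) * cinner x x"
    using complex_norm_square[of c] by (simp add: mult.assoc mult.commute mult.left_commute)
  ultimately have "(c *\<^sub>C x) \<bullet> (c *\<^sub>C x) = (cmod c)\<^sup>2 * (x \<bullet> x)"
    by (simp add: inner_eq_Re_cinner)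
  then show ?thesis
    by (simp add: norm_eq_sqrt_inner real_sqrt_mult)
qed

lemma bounded_linear_scaleC: "bounded_linear (\<lambda>x :: 'a :: complex_inner. c *\<^sub>C x)"
  by (rule bounded_linear_intro[where K = "cmod c"])
     (simp_all add: scaleC_add_right norm_scaleC scaleR_scaleC scaleC_scaleC mult.commute)

instantiation blinfun :: (real_normed_vector, complex_inner) complex_vector
begin

lift_definition scaleC_blinfun ::
  "complex \<Rightarrow> 'a \<Rightarrow>\<^sub>L 'b \<Rightarrow> 'a \<Rightarrow>\<^sub>L 'b" is "\<lambda>c A x. c *\<^sub>C A x"
  by (rule bounded_linear_compose[OF bounded_linear_scaleC])

instance
  by standard (transfer; simp add: fun_eq_iff scaleC_add_right scaleC_add_left scaleC_scaleC scaleC_one)+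

end

instantiation prod :: (complex_vector, complex_vector) complex_vector
begin

definition scaleC_prod :: "complex \<Rightarrow> 'a \<times> 'b \<Rightarrow> 'a \<times> 'b" where
  "scaleC_prod c w = (c *\<^sub>C fst w, c *\<^sub>C snd w)"

instance
  by standard (simp_all add: scaleC_prod_def prod_eq_iff scaleC_add_right scaleC_add_left
      scaleC_scaleC scaleC_one)

end

text \<open>\<open>'a \<Rightarrow>\<^sub>L 'b\<close> consists of the bounded \<^emph>\<open>real\<close>-linear operators, so complex
  linearity has to be required separately. The real and complex operator norms agree.\<close>

definition complex_linear :: "('a::complex_inner \<Rightarrow>\<^sub>L 'b::complex_inner) \<Rightarrow> bool" where
  "complex_linear A \<longleftrightarrow> (\<forall>c x. A (c *\<^sub>C x) = c *\<^sub>C A x)"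

definition Hinfty :: "complex set \<Rightarrow> (complex \<Rightarrow> 'a::complex_inner \<Rightarrow>\<^sub>L 'b::complex_inner) set" where
  "Hinfty U = {M. (\<forall>z\<in>U. complex_linear (M z)) \<and>
     (\<forall>z\<in>U. \<exists>D. (M has_derivative (\<lambda>h. h *\<^sub>C D)) (at z)) \<and>
     bounded (M ` U)}"

definition bounded_family ::
  "complex set \<Rightarrow> ('i \<Rightarrow> complex \<Rightarrow> 'a::complex_inner \<Rightarrow>\<^sub>L 'b::complex_inner) \<Rightarrow> bool" where
  "bounded_family U M \<longleftrightarrow> (\<forall>i. M i \<in> Hinfty U) \<and> (\<exists>C. \<forall>i. \<forall>z\<in>U. norm (M i z) \<le> C)"

definition wot_tendsto ::
  "(nat \<Rightarrow> 'a::complex_inner \<Rightarrow>\<^sub>L 'b::complex_inner) \<Rightarrow> 'a \<Rightarrow>\<^sub>L 'b \<Rightarrow> bool" where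
  "wot_tendsto A L \<longleftrightarrow> (\<forall>x y. (\<lambda>k. cinner y (A k x)) \<longlonglongrightarrow> cinner y (L x))"

definition blinfun_inv :: "'a::real_normed_vector \<Rightarrow>\<^sub>L 'b::real_normed_vector \<Rightarrow> 'b \<Rightarrow>\<^sub>L 'a" where
  "blinfun_inv A = (THE B. B o\<^sub>L A = id_blinfun \<and> A o\<^sub>L B = id_blinfun)"

definition blinfun_pow :: "'a::real_normed_vector \<Rightarrow>\<^sub>L 'a \<Rightarrow> nat \<Rightarrow> 'a \<Rightarrow>\<^sub>L 'a" where
  "blinfun_pow A l = ((\<lambda>B. A o\<^sub>L B) ^^ l) id_blinfun"

section \<open>Weighted spaces of (classes of) functions\<close>

text \<open>Measurable functions modulo equality almost everywhere. The null sets do not depend on the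
  weight, so all the spaces \<open>L\<^sup>2\<^sub>\<nu>\<close> are subspaces of this one.\<close>

definition ae_rel :: "(real \<Rightarrow> 'a::separable_chilbert) \<Rightarrow> (real \<Rightarrow> 'a) \<Rightarrow> bool" where
  "ae_rel f g \<longleftrightarrow> f \<in> borel_measurable lborel \<and> g \<in> borel_measurable lborel \<and>
     (AE t in lborel. f t = g t)"

quotient_type (overloaded) 'a mfun = "real \<Rightarrow> 'a::separable_chilbert" / partial: ae_rel
  morphisms rep_mfun abs_mfun
proof (rule part_equivpI)
  show "\<exists>f :: real \<Rightarrow> 'a. ae_rel f f"
    by (rule exI[of _ "\<lambda>_. 0"]) (simp add: ae_rel_def)
  show "symp (ae_rel :: (real \<Rightarrow> 'a) \<Rightarrow> _)"
    by (rule sympI) (auto simp: ae_rel_def)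
  show "transp (ae_rel :: (real \<Rightarrow> 'a) \<Rightarrow> _)"
  proof (rule transpI)
    fix f g h :: "real \<Rightarrow> 'a"
    assume "ae_rel f g" "ae_rel g h"
    then show "ae_rel f h"
      unfolding ae_rel_def by auto
  qed
qed

lemma measurable_scaleC:
  fixes f :: "real \<Rightarrow> 'a::separable_chilbert"
  assumes "f \<in> borel_measurable borel"
  shows "(\<lambda>t. c *\<^sub>C f t) \<in> borel_measurable borel"
  by (rule borel_measurable_continuous_on[OF _ assms])
     (rule linear_continuous_on[OF bounded_linear_scaleC])

instantiation mfun :: (separable_chilbert) complex_vector
begin

lift_definition zero_mfun :: "'a mfun" is "\<lambda>_. 0"
  by (simp add: ae_rel_def)

lift_definition plus_mfun :: "'a mfun \<Rightarrow> 'a mfun \<Rightarrow> 'a mfun" is "\<lambda>f g t. f t + g t"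
  unfolding ae_rel_def by auto

lift_definition minus_mfun :: "'a mfun \<Rightarrow> 'a mfun \<Rightarrow> 'a mfun" is "\<lambda>f g t. f t - g t"
  unfolding ae_rel_def by auto

lift_definition uminus_mfun :: "'a mfun \<Rightarrow> 'a mfun" is "\<lambda>f t. - f t"
  unfolding ae_rel_def by auto

lift_definition scaleC_mfun :: "complex \<Rightarrow> 'a mfun \<Rightarrow> 'a mfun" is "\<lambda>c f t. c *\<^sub>C f t"
  unfolding ae_rel_def by (auto intro!: measurable_scaleC)

instance
  by standard
     (transfer; auto simp: ae_rel_def algebra_simps scaleC_add_right scaleC_add_left scaleC_scaleC
        scaleC_one intro!: measurable_scaleC borel_measurable_add)+

end

text \<open>The weighted spaces depend on the value \<open>\<nu>\<close>, so Hilbert spaces of functions are given by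
  a carrier and an inner product.\<close>

record 'v hilb =
  hcarrier :: "'v set"
  hinner :: "'v \<Rightarrow> 'v \<Rightarrow> complex"

definition hnorm :: "'v hilb \<Rightarrow> 'v \<Rightarrow> real" where
  "hnorm X x = sqrt (Re (hinner X x x))"

definition L2w :: "real \<Rightarrow> 'a::separable_chilbert mfun hilb" where
  "L2w \<nu> = \<lparr>
     hcarrier = {f. integrable lborel (\<lambda>t. (norm (rep_mfun f t))\<^sup>2 * exp (- 2 * \<nu> * t))},
     hinner = (\<lambda>f g. \<integral>t. cinner (rep_mfun f t) (rep_mfun g t) * exp (- 2 * \<nu> * t) \<partial>lborel)\<rparr>"

definition hsum :: "'v hilb \<Rightarrow> 'w hilb \<Rightarrow> ('v \<times> 'w) hilb" (infixr "\<oplus>\<^sub>H" 65) where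
  "X \<oplus>\<^sub>H Y = \<lparr>
     hcarrier = hcarrier X \<times> hcarrier Y,
     hinner = (\<lambda>w w'. hinner X (fst w) (fst w') + hinner Y (snd w) (snd w'))\<rparr>"

section \<open>Operators\<close>

text \<open>A possibly unbounded operator is a pair of its domain and a function, whose values off
  the domain are irrelevant.\<close>

type_synonym 'v unb_op = "'v set \<times> ('v \<Rightarrow> 'v)"

definition clinear_on :: "'v::complex_vector set \<Rightarrow> ('v \<Rightarrow> 'w::complex_vector) \<Rightarrow> bool" where
  "clinear_on S A \<longleftrightarrow> (\<forall>x\<in>S. \<forall>y\<in>S. A (x + y) = A x + A y) \<and> (\<forall>c. \<forall>x\<in>S. A (c *\<^sub>C x) = c *\<^sub>C A x)"

definition linear_op :: "'v::complex_vector hilb \<Rightarrow> 'v unb_op \<Rightarrow> bool" where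
  "linear_op X A \<longleftrightarrow> module.subspace (*\<^sub>C) (fst A) \<and> fst A \<subseteq> hcarrier X \<and>
     snd A ` fst A \<subseteq> hcarrier X \<and> clinear_on (fst A) (snd A)"

definition inv_op :: "'v unb_op \<Rightarrow> 'v \<Rightarrow> 'v" where
  "inv_op A = the_inv_into (fst A) (snd A)"

definition cont_invertible :: "'v::complex_vector hilb \<Rightarrow> 'v unb_op \<Rightarrow> bool" where
  "cont_invertible X A \<longleftrightarrow> linear_op X A \<and> bij_betw (snd A) (fst A) (hcarrier X) \<and>
     (\<exists>C. \<forall>f\<in>hcarrier X. hnorm X (inv_op A f) \<le> C * hnorm X f)"

definition G_converges :: "'v::complex_vector hilb \<Rightarrow> (nat \<Rightarrow> 'v unb_op) \<Rightarrow> 'v unb_op \<Rightarrow> bool" where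
  "G_converges X A B \<longleftrightarrow>
     (\<forall>n. cont_invertible X (A n)) \<and> linear_op X B \<and> inj_on (snd B) (fst B) \<and>
     (\<forall>f\<in>hcarrier X. \<exists>u\<in>fst B. snd B u = f \<and>
        (\<forall>g\<in>hcarrier X. (\<lambda>n. hinner X g (inv_op (A n) f)) \<longlonglongrightarrow> hinner X g u))"

definition bounded_op ::
  "'v::complex_vector hilb \<Rightarrow> 'w::complex_vector hilb \<Rightarrow> ('v \<Rightarrow> 'w) \<Rightarrow> bool" where
  "bounded_op X Y A \<longleftrightarrow> A ` hcarrier X \<subseteq> hcarrier Y \<and> clinear_on (hcarrier X) A \<and>
     (\<exists>C. \<forall>x\<in>hcarrier X. hnorm Y (A x) \<le> C * hnorm X x)"

text \<open>\<open>S\<close> is the sum of the series of bounded operators \<open>F l\<close> in operator norm.\<close>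

definition op_sums ::
  "'v::complex_vector hilb \<Rightarrow> 'w::complex_vector hilb \<Rightarrow> (nat \<Rightarrow> 'v \<Rightarrow> 'w) \<Rightarrow> ('v \<Rightarrow> 'w) \<Rightarrow> bool" where
  "op_sums X Y F S \<longleftrightarrow> (\<forall>l. bounded_op X Y (F l)) \<and> bounded_op X Y S \<and>
     (\<forall>\<epsilon>>0. \<exists>n0. \<forall>n\<ge>n0. \<forall>x\<in>hcarrier X. hnorm Y ((\<Sum>l<n. F l x) - S x) \<le> \<epsilon> * hnorm X x)"

definition adjoint_op :: "'v hilb \<Rightarrow> 'w hilb \<Rightarrow> ('v \<Rightarrow> 'w) \<Rightarrow> 'w \<Rightarrow> 'v" where
  "adjoint_op X Y A y =
     (THE x. x \<in> hcarrier X \<and> (\<forall>x'\<in>hcarrier X. hinner X x' x = hinner Y (A x') y))"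

definition block_op ::
  "('v \<Rightarrow> 'v::plus) \<Rightarrow> ('w \<Rightarrow> 'v) \<Rightarrow> ('v \<Rightarrow> 'w::plus) \<Rightarrow> ('w \<Rightarrow> 'w) \<Rightarrow> 'v \<times> 'w \<Rightarrow> 'v \<times> 'w" where
  "block_op A B C D w = (A (fst w) + B (snd w), C (fst w) + D (snd w))"

section \<open>The time derivative and its functional calculus\<close>

definition smooth :: "(real \<Rightarrow> 'a::real_normed_vector) \<Rightarrow> bool" where
  "smooth \<phi> \<longleftrightarrow> (\<forall>n. ((\<lambda>f t. vector_derivative f (at t)) ^^ n) \<phi> differentiable_on UNIV)"

definition test_function :: "(real \<Rightarrow> 'a::real_normed_vector) \<Rightarrow> bool" where
  "test_function \<phi> \<longleftrightarrow> smooth \<phi> \<and> compact (closure {t. \<phi> t \<noteq> 0})"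

definition distr_derivative :: "'a::separable_chilbert mfun \<Rightarrow> 'a mfun \<Rightarrow> bool" where
  "distr_derivative f g \<longleftrightarrow> (\<forall>\<phi> :: real \<Rightarrow> complex. test_function \<phi> \<longrightarrow>
     (\<integral>t. \<phi> t *\<^sub>C rep_mfun g t \<partial>lborel) = - (\<integral>t. vector_derivative \<phi> (at t) *\<^sub>C rep_mfun f t \<partial>lborel))"

text \<open>The operator \<open>\<partial>\<^sub>0\<close> with domain \<open>H\<^bsub>\<nu>,1\<^esub>\<close>.\<close>

definition H1w :: "real \<Rightarrow> 'a::separable_chilbert mfun set" where
  "H1w \<nu> = {f \<in> hcarrier (L2w \<nu>). \<exists>g\<in>hcarrier (L2w \<nu>). distr_derivative f g}"

definition d0 :: "real \<Rightarrow> 'a::separable_chilbert mfun \<Rightarrow> 'a mfun" where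
  "d0 \<nu> f = (THE g. g \<in> hcarrier (L2w \<nu>) \<and> distr_derivative f g)"

definition d0_inv :: "real \<Rightarrow> 'a::separable_chilbert mfun \<Rightarrow> 'a mfun" where
  "d0_inv \<nu> = inv_op (H1w \<nu>, d0 \<nu>)"

definition fourier_laplace_test :: "real \<Rightarrow> (real \<Rightarrow> 'a::separable_chilbert) \<Rightarrow> real \<Rightarrow> 'a" where
  "fourier_laplace_test \<nu> \<phi> x =
     (1 / sqrt (2 * pi)) *\<^sub>R (\<integral>y. exp (- \<i> * x * y - \<nu> * y) *\<^sub>C \<phi> y \<partial>lborel)"

text \<open>The closure of the above, as an operator from \<open>L\<^sup>2\<^sub>\<nu>\<close> to \<open>L\<^sup>2 = L\<^sup>2\<^sub>0\<close>.\<close>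

definition fourier_laplace :: "real \<Rightarrow> 'a::separable_chilbert mfun \<Rightarrow> 'a mfun" where
  "fourier_laplace \<nu> f = (THE g. g \<in> hcarrier (L2w 0) \<and>
     (\<exists>\<phi> :: nat \<Rightarrow> real \<Rightarrow> 'a. (\<forall>n. test_function (\<phi> n)) \<and>
        (\<lambda>n. hnorm (L2w \<nu>) (abs_mfun (\<phi> n) - f)) \<longlonglongrightarrow> 0 \<and>
        (\<lambda>n. hnorm (L2w 0) (abs_mfun (fourier_laplace_test \<nu> (\<phi> n)) - g)) \<longlonglongrightarrow> 0))"

definition mult_op ::
  "(real \<Rightarrow> 'a \<Rightarrow>\<^sub>L 'b) \<Rightarrow> 'a::separable_chilbert mfun \<Rightarrow> 'b::separable_chilbert mfun" where
  "mult_op F f = abs_mfun (\<lambda>t. F t (rep_mfun f t))"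

text \<open>The operator \<open>M(\<partial>\<^sub>0\<^sup>-\<^sup>1)\<close> on \<open>L\<^sup>2\<^sub>\<nu>\<close>.\<close>

definition fct_calc ::
  "real \<Rightarrow> (complex \<Rightarrow> 'a \<Rightarrow>\<^sub>L 'b) \<Rightarrow> 'a::separable_chilbert mfun \<Rightarrow> 'b::separable_chilbert mfun" where
  "fct_calc \<nu> M f = adjoint_op (L2w \<nu>) (L2w 0) (fourier_laplace \<nu>)
     (mult_op (\<lambda>t. M (1 / (\<i> * t + \<nu>))) (fourier_laplace \<nu> f))"

text \<open>The operators of the sequence and of the limit, both in \<open>L\<^sup>2\<^sub>\<nu> \<oplus> L\<^sup>2\<^sub>\<nu>\<close>.\<close>

definition evo_op ::
  "real \<Rightarrow> (complex \<Rightarrow> 'a \<Rightarrow>\<^sub>L 'a) \<Rightarrow> (complex \<Rightarrow> 'a \<Rightarrow>\<^sub>L 'a) \<Rightarrow> (complex \<Rightarrow> 'b \<Rightarrow>\<^sub>L 'a) \<Rightarrow>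
   (complex \<Rightarrow> 'a \<Rightarrow>\<^sub>L 'b) \<Rightarrow> (complex \<Rightarrow> 'b \<Rightarrow>\<^sub>L 'b) \<Rightarrow>
   ('a::separable_chilbert mfun \<times> 'b::separable_chilbert mfun) unb_op" where
  "evo_op \<nu> M N00 N01 N10 N11 =
     ({w \<in> hcarrier (L2w \<nu> \<oplus>\<^sub>H L2w \<nu>). fct_calc \<nu> M (fst w) \<in> H1w \<nu>},
      \<lambda>w. (d0 \<nu> (fct_calc \<nu> M (fst w)), 0) +
          block_op (fct_calc \<nu> N00) (fct_calc \<nu> N01) (fct_calc \<nu> N10) (fct_calc \<nu> N11) w)"

definition d0_one_op ::
  "real \<Rightarrow> ('a mfun \<times> 'b mfun \<Rightarrow> 'a mfun \<times> 'b mfun) \<Rightarrow>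
   ('a::separable_chilbert mfun \<times> 'b::separable_chilbert mfun) unb_op" where
  "d0_one_op \<nu> T =
     ({w \<in> hcarrier (L2w \<nu> \<oplus>\<^sub>H L2w \<nu>). fst (T w) \<in> H1w \<nu>},
      \<lambda>w. (d0 \<nu> (fst (T w)), snd (T w)))"

end

theory Submission
  imports Defs "HOL-Probability.Characteristic_Functions" "HOL-Complex_Analysis.Cauchy_Integral_Formula" "HOL-Library.Diagonal_Subsequence"
begin

text \<open>Put \<open>J = \<partial>\<^sub>0\<^sup>-\<^sup>1\<close>. The Fourier-Laplace transform is unitary and turns all functions of \<open>J\<close> into
  multiplication operators: \<open>J\<close> becomes multiplication by \<open>1 / (\<i> t + \<nu>)\<close>, of norm at most \<open>1 / \<nu>\<close>, and
  \<open>M(J)\<close> multiplication by \<open>M (1 / (\<i> t + \<nu>))\<close>. Hence \<open>J\<close> commutes with the coefficients and is as small as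
  desired when \<open>\<nu>\<close> is large, so that power series in \<open>J\<close> with geometrically bounded coefficients converge.

  The operators of the sequence are inverted by a Schur complement. For \<open>\<partial>\<^sub>0 M u + N\<^sub>0\<^sub>0 u + N\<^sub>0\<^sub>1 v = f\<close> and
  \<open>N\<^sub>1\<^sub>0 u + N\<^sub>1\<^sub>1 v = g\<close>, eliminating \<open>v\<close> and writing \<open>y = \<partial>\<^sub>0 M u\<close> gives
  \<open>(1 - A J) y = f - N\<^sub>0\<^sub>1 N\<^sub>1\<^sub>1\<^sup>-\<^sup>1 g\<close> with \<open>A = - N M\<^sup>-\<^sup>1\<close>. The Neumann series for \<open>1 - A J\<close> expresses the
  inverse operator by four power series in \<open>J\<close>, whose coefficients are exactly the functions whose weak limits
  are claimed to exist, and the extra summand \<open>N\<^sub>1\<^sub>1\<^sup>-\<^sup>1\<close> in the lower right entry (locale \<open>evo_system\<close>).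

  These coefficients are bounded by \<open>C q\<^sup>l\<close>, uniformly in the sequence index and in \<open>z\<close>. A weak form of
  Montel's theorem (\<open>weak_montel\<close>) extracts one subsequence along which all of them converge in the weak
  operator topology, at every \<open>z\<close> and with analytic limits. By dominated convergence the multiplication
  operators converge (\<open>mulop_wot_tendsto\<close>), and by Tannery's theorem so do the power series
  (\<open>wot_tendsto_sums\<close>). Therefore the inverses of the operators of the sequence converge weakly, to the block
  operator formed by the limit series.

  It remains to recognize this block operator as the inverse of the asserted limit (\<open>limit_operator\<close>). A
  factor \<open>J\<close> splits off from the first column, so the block operator is \<open>(D\<^sup>-\<^sup>1 + M\<^sup>(\<^sup>1\<^sup>)) diag(J, 1)\<close>, where \<open>D\<^sup>-\<^sup>1\<close> is
  diagonal with entries the limits of \<open>M\<^sup>-\<^sup>1\<close> and \<open>N\<^sub>1\<^sub>1\<^sup>-\<^sup>1\<close>. These are invertible, because coercivity passes from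
  an operator to its inverse and on to weak limits. The operator \<open>1 + D M\<^sup>(\<^sup>1\<^sup>)\<close> is inverted by a Neumann series
  although \<open>D M\<^sup>(\<^sup>1\<^sup>)\<close> need not be small: all its entries but the lower left one are of order \<open>1 / \<nu>\<close>, which
  makes its powers decay (\<open>norm_block_pow_le\<close>).

  The transform itself is built from two facts. Plancherel's theorem for Hilbert space valued functions follows
  from a Gaussian regularization, because the squared norm of the transform is the transform of the
  autocorrelation (\<open>plancherel_fourier_int\<close>). And \<open>g\<close> is the distributional derivative of \<open>f\<close> exactly if the
  transform of \<open>f\<close> is that of \<open>g\<close> times \<open>1 / (\<i> t + \<nu>)\<close> (\<open>distr_derivative_iff_FL\<close>); here the weight
  matters, since it keeps the constants out of the space.\<close>

section \<open>Hilbert space preliminaries\<close>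

interpretation cvec: module "scaleC :: complex \<Rightarrow> 'a::complex_vector \<Rightarrow> 'a"
  by standard (simp_all add: scaleC_add_right scaleC_add_left scaleC_scaleC scaleC_one)

lemma cinner_add_right: "cinner x (y + z) = cinner x y + cinner x z"
  by (metis cinner_add_left cinner_commute complex_cnj_add)

lemma cinner_scaleC_right: "cinner x (c *\<^sub>C y) = c * cinner x y"
  by (metis cinner_commute cinner_scaleC_left complex_cnj_cnj complex_cnj_mult)

lemma cinner_eq_Complex: "cinner x y = Complex (x \<bullet> y) ((\<i> *\<^sub>C x) \<bullet> y)"
  by (simp add: complex_eq_iff inner_eq_Re_cinner cinner_scaleC_left)

lemma cinner_self: "cinner x x = complex_of_real ((norm x)\<^sup>2)"
proof -
  have "Im (cinner x x) = 0"
    by (metis cinner_commute complex_cnj_cancel_iff Reals_cnj_iff complex_is_Real_iff)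
  then show ?thesis
    by (simp add: complex_eq_iff power2_norm_eq_inner inner_eq_Re_cinner[symmetric])
qed

text \<open>The complex Cauchy-Schwarz inequality follows from the real one once \<open>x\<close> is rotated so that the
  inner product becomes real and nonnegative.\<close>

lemma norm_cinner_le: "cmod (cinner x y) \<le> norm x * norm y"
proof (cases "cinner x y = 0")
  case False
  define c where "c = cinner x y / cmod (cinner x y)"
  have c: "cmod c = 1" using False by (simp add: c_def norm_divide)
  have "cinner (c *\<^sub>C x) y = cmod (cinner x y)"
    using False complex_norm_square[of "cinner x y"]
    by (simp add: c_def cinner_scaleC_left power2_eq_square field_simps)
  then have "cmod (cinner x y) = (c *\<^sub>C x) \<bullet> y" by (simp add: inner_eq_Re_cinner)
  also have "\<dots> \<le> norm (c *\<^sub>C x) * norm y" by (rule norm_cauchy_schwarz)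
  finally show ?thesis by (simp add: norm_scaleC c)
qed simp

lemma bounded_bilinear_cinner: "bounded_bilinear cinner"
proof
  show "\<exists>K. \<forall>a b. cmod (cinner a b) \<le> norm a * norm b * K"
    by (rule exI[of _ 1]) (simp add: norm_cinner_le)
qed (simp_all add: cinner_add_left cinner_add_right scaleR_scaleC cinner_scaleC_left cinner_scaleC_right
    scaleR_conv_of_real)

lemma bounded_bilinear_scaleC: "bounded_bilinear (scaleC :: complex \<Rightarrow> 'a::complex_inner \<Rightarrow> 'a)"
proof
  show "\<exists>K. \<forall>a (b::'a). norm (a *\<^sub>C b) \<le> cmod a * norm b * K"
    by (rule exI[of _ 1]) (simp add: norm_scaleC)
qed (simp_all add: scaleC_add_left scaleC_add_right scaleR_scaleC scaleC_scaleC scaleR_conv_of_real mult_ac)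

interpretation cinner: bounded_bilinear "cinner :: 'a::complex_inner \<Rightarrow> 'a \<Rightarrow> complex"
  by (rule bounded_bilinear_cinner)

interpretation blinfun_compose: bounded_bilinear
    "blinfun_compose :: ('b::real_normed_vector \<Rightarrow>\<^sub>L 'c::real_normed_vector) \<Rightarrow> ('a::real_normed_vector \<Rightarrow>\<^sub>L 'b) \<Rightarrow> _"
  by (rule bounded_bilinear_blinfun_compose)

interpretation scaleC: bounded_bilinear "scaleC :: complex \<Rightarrow> 'a::complex_inner \<Rightarrow> 'a"
  by (rule bounded_bilinear_scaleC)

text \<open>Real parts suffice to test weak convergence, because the imaginary part of \<open>\<langle>y, x\<rangle>\<close> is the real part
  of \<open>\<langle>\<i> y, x\<rangle>\<close>.\<close>

lemma tendsto_cinner_iff: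
  fixes L :: "'a::complex_inner"
  shows "(\<forall>y. (\<lambda>k. cinner y (A k)) \<longlonglongrightarrow> cinner y L) \<longleftrightarrow> (\<forall>y. (\<lambda>k. y \<bullet> A k) \<longlonglongrightarrow> y \<bullet> L)"
proof
  assume *: "\<forall>y. (\<lambda>k. y \<bullet> A k) \<longlonglongrightarrow> y \<bullet> L"
  then show "\<forall>y. (\<lambda>k. cinner y (A k)) \<longlonglongrightarrow> cinner y L"
    unfolding cinner_eq_Complex by (intro allI tendsto_Complex) blast+
qed (auto simp: inner_eq_Re_cinner intro: tendsto_Re)

lemma wot_tendsto_iff_inner: "wot_tendsto A L \<longleftrightarrow> (\<forall>x y. (\<lambda>k. y \<bullet> A k x) \<longlonglongrightarrow> y \<bullet> L x)"
  unfolding wot_tendsto_def using tendsto_cinner_iff[of "\<lambda>k. A k x" "L x" for x] by blast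

lemma norm_blinfun_le_inner:
  fixes A :: "'a::real_normed_vector \<Rightarrow>\<^sub>L 'b::real_inner"
  assumes "0 \<le> K" and "\<And>x y. y \<bullet> A x \<le> K * norm x * norm y"
  shows "norm A \<le> K"
proof (rule norm_blinfun_bound[OF assms(1)])
  fix x
  have "(norm (A x))\<^sup>2 \<le> K * norm x * norm (A x)"
    using assms(2)[of "A x" x] by (simp add: power2_norm_eq_inner)
  then show "norm (A x) \<le> K * norm x"
    by (cases "A x = 0") (auto simp: power2_eq_square assms(1))
qed

instantiation prod :: (complex_inner, complex_inner) complex_inner
begin

definition cinner_prod :: "'a \<times> 'b \<Rightarrow> 'a \<times> 'b \<Rightarrow> complex" where
  "cinner_prod v w = cinner (fst v) (fst w) + cinner (snd v) (snd w)"

instance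
proof
  fix x y z :: "'a \<times> 'b" and r c
  show "r *\<^sub>R x = complex_of_real r *\<^sub>C x"
    by (simp add: scaleC_prod_def prod_eq_iff scaleR_scaleC)
  show "cinner x y = cnj (cinner y x)"
    unfolding cinner_prod_def by (metis cinner_commute complex_cnj_add)
  show "cinner (c *\<^sub>C x) y = cnj c * cinner x y"
    by (simp add: cinner_prod_def scaleC_prod_def cinner_scaleC_left ring_distribs)
qed (simp_all add: cinner_prod_def cinner_add_left inner_prod_def inner_eq_Re_cinner)

end

text \<open>A minimizing sequence of the energy \<open>\<parallel>x\<parallel>\<^sup>2 / 2 - f x\<close> is Cauchy by the parallelogram law, and
  the energy is stationary at the minimizer.\<close>

lemma riesz_representation:
  fixes f :: "'a::{real_inner,banach} \<Rightarrow> real"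
  assumes "bounded_linear f"
  shows "\<exists>v. \<forall>x. f x = v \<bullet> x"
proof -
  interpret f: bounded_linear f by fact
  define J where "J x = (x \<bullet> x) / 2 - f x" for x
  obtain K where K: "\<And>x. \<bar>f x\<bar> \<le> norm x * K" using f.bounded by (auto simp: real_norm_def)
  have low: "- K\<^sup>2 / 2 \<le> J x" for x
  proof -
    have "0 \<le> (norm x - K)\<^sup>2" by simp
    with K[of x] show ?thesis
      by (simp add: J_def power2_norm_eq_inner[symmetric] power2_diff field_simps abs_le_iff)
  qed
  define m where "m = Inf (range J)"
  have bdd: "bdd_below (range J)" using low by (intro bdd_belowI[of _ "- K\<^sup>2/2"]) auto
  have m: "m \<le> J x" for x unfolding m_def by (rule cInf_lower[OF _ bdd]) simp
  have "\<exists>x. J x < m + inverse (real (Suc n))" for n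
  proof -
    have "Inf (range J) < m + inverse (real (Suc n))" by (simp add: m_def)
    from cInf_lessD[OF _ this] show ?thesis by auto
  qed
  then obtain X where X: "\<And>n. J (X n) < m + inverse (real (Suc n))" by metis
  have par: "(norm (x - y))\<^sup>2 = 4 * (J x + J y - 2 * J ((1/2) *\<^sub>R (x + y)))" for x y
    by (simp add: J_def power2_norm_eq_inner f.scaleR f.add inner_add_left inner_add_right
        inner_diff_left inner_diff_right inner_commute field_simps)
  have "Cauchy X"
  proof (rule CauchyI)
    fix e :: real assume e: "e > 0"
    then obtain N where N: "inverse (real (Suc N)) < e\<^sup>2 / 8" using reals_Archimedean[of "e\<^sup>2/8"] by auto
    show "\<exists>M. \<forall>k\<ge>M. \<forall>n\<ge>M. norm (X k - X n) < e"
    proof (intro exI allI impI)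
      fix k n assume "N \<le> k" "N \<le> n"
      then have "inverse (real (Suc k)) \<le> inverse (real (Suc N))"
                "inverse (real (Suc n)) \<le> inverse (real (Suc N))" by (simp_all add: le_imp_inverse_le)
      then have "(norm (X k - X n))\<^sup>2 < e\<^sup>2"
        using X[of k] X[of n] m[of "(1/2) *\<^sub>R (X k + X n)"] N unfolding par by argo
      then show "norm (X k - X n) < e" using e by (simp add: power_less_imp_less_base)
    qed
  qed
  then obtain v where v: "X \<longlonglongrightarrow> v" using Cauchy_convergent convergent_def by blast
  have "(\<lambda>n. J (X n)) \<longlonglongrightarrow> J v"
    unfolding J_def by (intro tendsto_intros v f.tendsto) simp
  moreover have "(\<lambda>n. m + inverse (real (Suc n))) \<longlonglongrightarrow> m"
    using tendsto_add[OF tendsto_const LIMSEQ_inverse_real_of_nat, of m] by simp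
  ultimately have Jv: "J v \<le> m"
    using X by (intro LIMSEQ_le) (auto intro: less_imp_le)
  have "f h = v \<bullet> h" for h
  proof (rule ccontr)
    assume ne: "f h \<noteq> v \<bullet> h"
    define d where "d = f h - v \<bullet> h"
    have quad: "t * d \<le> t\<^sup>2 * ((h \<bullet> h) / 2)" for t
      using m[of "v + t *\<^sub>R h"] Jv
      by (simp add: J_def d_def f.add f.scaleR inner_add_left inner_add_right inner_commute
          power2_eq_square field_simps)
    have "h \<noteq> 0" using ne by (auto simp: f.zero)
    then have h: "h \<bullet> h > 0" by simp
    have "(d / (h \<bullet> h)) * d \<le> (d / (h \<bullet> h))\<^sup>2 * ((h \<bullet> h) / 2)" by (rule quad)
    with h have "d * d \<le> 0" by (simp add: power2_eq_square field_simps)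
    then have "d = 0" by (auto simp: mult_le_0_iff)
    with ne show False by (simp add: d_def)
  qed
  then show ?thesis by blast
qed

section \<open>Inverting bounded operators\<close>

lemma blinfun_compose_id [simp]: "A o\<^sub>L id_blinfun = A" "id_blinfun o\<^sub>L A = A"
  by (rule blinfun_eqI, simp)+

lemma blinfun_comp_idD: "A o\<^sub>L B = id_blinfun \<Longrightarrow> A (B x) = x"
  by (drule arg_cong[where f = "\<lambda>F. blinfun_apply F x"]) simp

lemma blinfun_inv_eqI:
  assumes "B o\<^sub>L A = id_blinfun" "A o\<^sub>L B = id_blinfun"
  shows "blinfun_inv A = B"
  unfolding blinfun_inv_def
proof (rule the_equality)
  fix C assume "C o\<^sub>L A = id_blinfun \<and> A o\<^sub>L C = id_blinfun"
  then have "C (A x) = x" for x by (simp add: blinfun_comp_idD)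
  moreover have "A (B y) = y" for y by (rule blinfun_comp_idD[OF assms(2)])
  ultimately show "C = B" by (metis blinfun_eqI)
qed (use assms in simp)

text \<open>For small \<open>\<tau>\<close> the map \<open>x \<mapsto> x - \<tau> (A x - y)\<close> is a contraction, and its fixed point solves
  \<open>A x = y\<close>.\<close>

lemma coercive_surj:
  fixes A :: "'a::{real_inner,banach} \<Rightarrow>\<^sub>L 'a"
  assumes c: "c > 0" and co: "\<And>x. c * (norm x)\<^sup>2 \<le> x \<bullet> A x"
  shows "\<exists>x. A x = y"
proof -
  define K where "K = max c (norm A)"
  have K: "K > 0" "c \<le> K" "norm A \<le> K" using c by (auto simp: K_def)
  define \<tau> where "\<tau> = c / K\<^sup>2"
  define q where "q = sqrt (1 - c\<^sup>2 / K\<^sup>2)"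
  have "c\<^sup>2 \<le> K\<^sup>2" using K c by (simp add: power_mono)
  then have q: "0 \<le> q" "q < 1" using c K by (auto simp: q_def field_simps)
  have tau: "\<tau> > 0" using c K by (simp add: \<tau>_def)
  have contr: "norm (x - \<tau> *\<^sub>R A x) \<le> q * norm x" for x
  proof -
    have "norm (A x) \<le> K * norm x"
      using norm_blinfun[of A x] K(3) mult_right_mono[of "norm A" K "norm x"] by simp
    then have "(norm (A x))\<^sup>2 \<le> K\<^sup>2 * (norm x)\<^sup>2"
      by (metis norm_ge_zero power_mono power_mult_distrib)
    moreover have "(norm (x - \<tau> *\<^sub>R A x))\<^sup>2 = (norm x)\<^sup>2 - 2 * \<tau> * (x \<bullet> A x) + \<tau>\<^sup>2 * (norm (A x))\<^sup>2"
      unfolding power2_norm_eq_inner by (simp add: inner_diff_left inner_diff_right inner_commute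
          power2_eq_square algebra_simps)
    ultimately have "(norm (x - \<tau> *\<^sub>R A x))\<^sup>2
        \<le> (norm x)\<^sup>2 - 2 * \<tau> * (c * (norm x)\<^sup>2) + \<tau>\<^sup>2 * (K\<^sup>2 * (norm x)\<^sup>2)"
      using co[of x] tau by (smt (verit) mult_left_mono zero_le_power2)
    also have "\<dots> = (1 - c\<^sup>2 / K\<^sup>2) * (norm x)\<^sup>2"
      using K by (simp add: \<tau>_def power2_eq_square field_simps)
    also have "\<dots> = (q * norm x)\<^sup>2"
      using \<open>c\<^sup>2 \<le> K\<^sup>2\<close> K by (simp add: q_def power_mult_distrib)
    finally show ?thesis by (rule power2_le_imp_le) (simp add: q)
  qed
  define T where "T x = x - \<tau> *\<^sub>R (A x - y)" for x
  have "dist (T x) (T x') \<le> q * dist x x'" for x x'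
    using contr[of "x - x'"] by (simp add: T_def dist_norm blinfun.diff_right algebra_simps)
  then obtain x where "T x = x" using banach_fix_type[OF q, of T] by blast
  then have "A x = y" using tau by (simp add: T_def)
  then show ?thesis by blast
qed

lemma coercive_norm_le:
  fixes A :: "'a::real_inner \<Rightarrow>\<^sub>L 'a"
  assumes "c > 0" and co: "c * (norm x)\<^sup>2 \<le> x \<bullet> A x"
  shows "norm x \<le> norm (A x) / c"
proof (cases "x = 0")
  case False
  have "c * (norm x)\<^sup>2 \<le> norm x * norm (A x)" using co norm_cauchy_schwarz[of x "A x"] by linarith
  with False show ?thesis using assms(1) by (simp add: power2_eq_square field_simps)
qed (use assms in simp)

lemma coercive_inverse:
  fixes A :: "'a::{real_inner,banach} \<Rightarrow>\<^sub>L 'a"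
  assumes c: "c > 0" and co: "\<And>x. c * (norm x)\<^sup>2 \<le> x \<bullet> A x"
  shows "blinfun_inv A o\<^sub>L A = id_blinfun" and "A o\<^sub>L blinfun_inv A = id_blinfun"
    and "norm (blinfun_inv A) \<le> 1 / c"
proof -
  have low: "norm x \<le> norm (A x) / c" for x by (rule coercive_norm_le[OF c co])
  have inj: "x = y" if "A x = A y" for x y
    using low[of "x - y"] that by (simp add: blinfun.diff_right)
  obtain g where g: "\<And>y. A (g y) = y" using coercive_surj[OF c co] by metis
  have "bounded_linear g"
  proof (rule bounded_linear_intro[where K = "1 / c"])
    show "g (x + y) = g x + g y" for x y by (rule inj) (simp add: g blinfun.add_right)
    show "g (r *\<^sub>R x) = r *\<^sub>R g x" for r x by (rule inj) (simp add: g blinfun.scaleR_right)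
    show "norm (g x) \<le> norm x * (1 / c)" for x using low[of "g x"] by (simp add: g)
  qed
  then have ap: "blinfun_apply (Blinfun g) = g" by (simp add: bounded_linear_Blinfun_apply)
  have 1: "Blinfun g o\<^sub>L A = id_blinfun" "A o\<^sub>L Blinfun g = id_blinfun"
    by (rule blinfun_eqI, simp add: ap inj g)+
  have eq: "blinfun_inv A = Blinfun g" by (rule blinfun_inv_eqI[OF 1])
  show "blinfun_inv A o\<^sub>L A = id_blinfun" "A o\<^sub>L blinfun_inv A = id_blinfun" using 1 eq by auto
  show "norm (blinfun_inv A) \<le> 1 / c"
    unfolding eq by (rule norm_blinfun_bound) (use c low[of "g x" for x] in \<open>auto simp: ap g\<close>)
qed

lemma complex_linear_inv:
  assumes "complex_linear A" "B o\<^sub>L A = id_blinfun" "A o\<^sub>L B = id_blinfun"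
  shows "complex_linear B"
proof -
  have BA: "B (A x) = x" for x by (rule blinfun_comp_idD[OF assms(2)])
  have AB: "A (B x) = x" for x by (rule blinfun_comp_idD[OF assms(3)])
  have "B (c *\<^sub>C y) = c *\<^sub>C B y" for c y
  proof -
    have "B (c *\<^sub>C y) = B (A (c *\<^sub>C B y))" using assms(1) by (simp add: complex_linear_def AB)
    then show ?thesis by (simp add: BA)
  qed
  then show ?thesis by (simp add: complex_linear_def)
qed

text \<open>Coercivity of \<open>A\<close> at \<open>B y\<close> becomes coercivity of \<open>B\<close> at \<open>y\<close>, because \<open>\<parallel>y\<parallel> \<le> K \<parallel>B y\<parallel>\<close>. A lower bound for
  the form \<open>\<langle>y, B y\<rangle>\<close>, unlike invertibility itself, survives weak limits, and so makes the weak limits of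
  the inverses invertible.\<close>

lemma inner_inverse_coercive:
  fixes A B :: "'a::real_inner \<Rightarrow>\<^sub>L 'a"
  assumes c: "c \<ge> 0" and co: "\<And>x. c * (norm x)\<^sup>2 \<le> x \<bullet> A x" and inv: "A o\<^sub>L B = id_blinfun"
    and K: "norm A \<le> K" "K > 0"
  shows "c / K\<^sup>2 * (norm y)\<^sup>2 \<le> y \<bullet> B y"
proof -
  have AB: "A (B y) = y" by (rule blinfun_comp_idD[OF inv])
  have "norm y \<le> K * norm (B y)"
    using norm_blinfun[of A "B y"] K mult_right_mono[of "norm A" K "norm (B y)"] by (simp add: AB)
  then have "(norm y)\<^sup>2 \<le> K\<^sup>2 * (norm (B y))\<^sup>2" by (metis norm_ge_zero power_mono power_mult_distrib)
  then have "(norm y)\<^sup>2 / K\<^sup>2 \<le> (norm (B y))\<^sup>2" using K by (simp add: field_simps)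
  from mult_left_mono[OF this c] have "c / K\<^sup>2 * (norm y)\<^sup>2 \<le> c * (norm (B y))\<^sup>2" by simp
  also have "\<dots> \<le> y \<bullet> B y" using co[of "B y"] by (simp add: AB inner_commute)
  finally show ?thesis .
qed

lemma blinfun_pow_0 [simp]: "blinfun_pow A 0 = id_blinfun"
  by (simp add: blinfun_pow_def)

lemma blinfun_pow_Suc: "blinfun_pow A (Suc l) = A o\<^sub>L blinfun_pow A l"
  by (simp add: blinfun_pow_def)

lemma blinfun_pow_apply: "blinfun_pow A l x = (blinfun_apply A ^^ l) x"
  by (induction l) (simp_all add: blinfun_pow_Suc)

lemma blinfun_pow_Suc2: "blinfun_pow A (Suc l) = blinfun_pow A l o\<^sub>L A"
  by (rule blinfun_eqI) (simp add: blinfun_pow_apply funpow_swap1)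

lemma norm_blinfun_pow_le: "norm A \<le> q \<Longrightarrow> norm (blinfun_pow A l) \<le> q ^ l"
proof (induction l)
  case 0
  then show ?case by (simp add: norm_blinfun_id_le)
next
  case (Suc l)
  have "norm (blinfun_pow A (Suc l)) \<le> norm A * norm (blinfun_pow A l)"
    by (simp add: blinfun_pow_Suc norm_blinfun_compose)
  also have "\<dots> \<le> q * q ^ l" using Suc norm_ge_zero[of A] by (intro mult_mono norm_ge_zero) (linarith | simp)+
  finally show ?case by simp
qed

text \<open>The assumption bounds the powers of \<open>B\<close>, not \<open>B\<close> itself: the operator that governs the limit has a large
  norm but decaying powers.\<close>

lemma neumann_series:
  fixes B :: "'a::banach \<Rightarrow>\<^sub>L 'a"
  assumes bd: "\<And>l. norm (blinfun_pow B l) \<le> C * q ^ l" and q: "0 \<le> q" "q < 1"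
  shows "\<exists>\<Theta>. blinfun_pow B sums \<Theta> \<and> \<Theta> o\<^sub>L (id_blinfun - B) = id_blinfun \<and>
     (id_blinfun - B) o\<^sub>L \<Theta> = id_blinfun"
proof -
  have sm: "summable (\<lambda>l. C * q ^ l)" using q by (simp add: summable_mult)
  have "summable (blinfun_pow B)"
    by (rule summable_comparison_test'[OF sm, of 0]) (rule bd)
  then obtain \<Theta> where T: "blinfun_pow B sums \<Theta>" by (auto simp: summable_def)
  have "(\<lambda>l. C * q ^ l) \<longlonglongrightarrow> 0" by (rule summable_LIMSEQ_zero[OF sm])
  then have "blinfun_pow B \<longlonglongrightarrow> 0" by (rule Lim_null_comparison[rotated]) (simp add: bd)
  then have lim: "(\<lambda>n. id_blinfun - blinfun_pow B n) \<longlonglongrightarrow> id_blinfun"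
    using tendsto_diff[OF tendsto_const] by fastforce
  have 1: "(\<Sum>l<n. blinfun_pow B l) o\<^sub>L (id_blinfun - B) = id_blinfun - blinfun_pow B n" for n
  proof (induction n)
    case (Suc n)
    have "(\<Sum>l<Suc n. blinfun_pow B l) o\<^sub>L (id_blinfun - B)
        = (id_blinfun - blinfun_pow B n) + (blinfun_pow B n - blinfun_pow B (Suc n))"
      unfolding sum.lessThan_Suc blinfun_compose.add_left Suc
      by (simp add: blinfun_compose.diff_right blinfun_pow_Suc2)
    then show ?case by simp
  qed simp
  have 2: "(id_blinfun - B) o\<^sub>L (\<Sum>l<n. blinfun_pow B l) = id_blinfun - blinfun_pow B n" for n
    by (induction n) (simp_all add: blinfun_compose.add_right blinfun_compose.diff_left
        blinfun_pow_Suc[symmetric] blinfun_compose.zero_right)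
  have "(\<lambda>n. (\<Sum>l<n. blinfun_pow B l) o\<^sub>L (id_blinfun - B)) \<longlonglongrightarrow> (\<Theta> o\<^sub>L (id_blinfun - B))"
    by (intro blinfun_compose.tendsto tendsto_const T[unfolded sums_def])
  moreover have "(\<lambda>n. (id_blinfun - B) o\<^sub>L (\<Sum>l<n. blinfun_pow B l)) \<longlonglongrightarrow> ((id_blinfun - B) o\<^sub>L \<Theta>)"
    by (intro blinfun_compose.tendsto tendsto_const T[unfolded sums_def])
  ultimately show ?thesis using T lim unfolding 1 2 by (metis LIMSEQ_unique)
qed

section \<open>Analytic operator functions\<close>

lemma norm_scaleC_blinfun:
  fixes A :: "'a::real_normed_vector \<Rightarrow>\<^sub>L 'b::complex_inner"
  shows "norm (c *\<^sub>C A) = cmod c * norm A"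
proof -
  have le: "norm (c *\<^sub>C A) \<le> cmod c * norm A" for c and A :: "'a \<Rightarrow>\<^sub>L 'b"
    by (rule norm_blinfun_bound)
       (simp_all add: scaleC_blinfun.rep_eq norm_scaleC mult.assoc mult_left_mono norm_blinfun)
  show ?thesis
  proof (cases "c = 0")
    case False
    then have "norm A \<le> cmod (inverse c) * norm (c *\<^sub>C A)"
      using le[of "inverse c" "c *\<^sub>C A"] by simp
    with False have "cmod c * norm A \<le> norm (c *\<^sub>C A)" by (simp add: norm_divide field_simps)
    with le[of c A] show ?thesis by simp
  qed simp
qed

lemma bounded_linear_scaleC_left:
  fixes D :: "'a::real_normed_vector \<Rightarrow>\<^sub>L 'b::complex_inner"
  shows "bounded_linear (\<lambda>h. h *\<^sub>C D)"
  by (rule bounded_linear_intro[where K = "norm D"])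
     (simp_all add: scaleC_add_left norm_scaleC_blinfun blinfun_eqI scaleC_blinfun.rep_eq
       scaleR_blinfun.rep_eq scaleR_scaleC scaleC_scaleC scaleR_conv_of_real)

text \<open>Derivatives in operator norm are obtained below from quadratic bounds for the remainder, which pass to
  inverses and to weak limits.\<close>

lemma has_derivative_quadratic:
  fixes F :: "complex \<Rightarrow> 'a::real_normed_vector \<Rightarrow>\<^sub>L 'b::complex_inner"
  assumes d: "d > 0" and K: "0 \<le> K"
    and est: "\<And>h. cmod h \<le> d \<Longrightarrow> norm (F (z + h) - F z - h *\<^sub>C D) \<le> K * (cmod h)\<^sup>2"
  shows "(F has_derivative (\<lambda>h. h *\<^sub>C D)) (at z)"
  unfolding has_derivative_at_alt
proof (intro conjI allI impI bounded_linear_scaleC_left)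
  fix e :: real assume e: "e > 0"
  show "\<exists>d>0. \<forall>w. norm (w - z) < d \<longrightarrow> norm (F w - F z - (w - z) *\<^sub>C D) \<le> e * norm (w - z)"
  proof (intro exI[of _ "min d (e / (K + 1))"] conjI allI impI)
    fix w assume w: "norm (w - z) < min d (e / (K + 1))"
    have "K * cmod (w - z) \<le> (K + 1) * cmod (w - z)" by (simp add: mult_right_mono)
    also have "\<dots> \<le> e" using w K by (simp add: field_simps)
    finally have "K * cmod (w - z) * cmod (w - z) \<le> e * cmod (w - z)" by (simp add: mult_right_mono)
    moreover have "norm (F w - F z - (w - z) *\<^sub>C D) \<le> K * (cmod (w - z))\<^sup>2"
      using est[of "w - z"] w by simp
    ultimately show "norm (F w - F z - (w - z) *\<^sub>C D) \<le> e * norm (w - z)"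
      by (simp add: power2_eq_square)
  qed (use d e K in simp)
qed

lemma HinftyI:
  assumes "\<And>z. z \<in> U \<Longrightarrow> complex_linear (F z)"
    and "\<And>z. z \<in> U \<Longrightarrow> \<exists>D. (F has_derivative (\<lambda>h. h *\<^sub>C D)) (at z)"
    and "\<And>z. z \<in> U \<Longrightarrow> norm (F z) \<le> C"
  shows "F \<in> Hinfty U"
  using assms unfolding Hinfty_def bounded_iff by blast

lemma HinftyE:
  assumes "F \<in> Hinfty U"
  obtains C where "C \<ge> 0" "\<And>z. z \<in> U \<Longrightarrow> norm (F z) \<le> C"
proof -
  obtain B where "\<And>z. z \<in> U \<Longrightarrow> norm (F z) \<le> B"
    using assms by (auto simp: Hinfty_def bounded_iff)
  then have "\<And>z. z \<in> U \<Longrightarrow> norm (F z) \<le> max B 0" by (meson max.coboundedI1)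
  then show ?thesis using that[of "max B 0"] by simp
qed

lemma Hinfty_complex_linear: "F \<in> Hinfty U \<Longrightarrow> z \<in> U \<Longrightarrow> complex_linear (F z)"
  and Hinfty_has_derivative:
    "F \<in> Hinfty U \<Longrightarrow> z \<in> U \<Longrightarrow> \<exists>D. (F has_derivative (\<lambda>h. h *\<^sub>C D)) (at z)"
  by (simp_all add: Hinfty_def)

lemma Hinfty_continuous_on: "F \<in> Hinfty U \<Longrightarrow> continuous_on U F"
  by (meson Hinfty_has_derivative continuous_at_imp_continuous_on has_derivative_continuous)

lemma Hinfty_subset: "F \<in> Hinfty U \<Longrightarrow> V \<subseteq> U \<Longrightarrow> F \<in> Hinfty V"
  by (auto simp: Hinfty_def intro: bounded_subset[OF _ image_mono])

text \<open>Cauchy's estimate for the second derivative turns a bound on a disc into a remainder estimate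
  that depends on the function only through that bound. This is what makes all estimates below
  uniform over bounded families.\<close>

lemma scalar_taylor_estimate:
  fixes f :: "complex \<Rightarrow> complex"
  assumes hol: "f holomorphic_on ball z0 \<rho>" and \<rho>: "\<rho> > 0"
    and bd: "\<And>z. z \<in> ball z0 \<rho> \<Longrightarrow> cmod (f z) \<le> C" and h: "cmod h \<le> \<rho> / 2"
  shows "cmod (f (z0 + h) - f z0 - deriv f z0 * h) \<le> 32 * C / \<rho>\<^sup>2 * (cmod h)\<^sup>2"
proof -
  define S where "S = cball z0 (\<rho> / 2)"
  have SB: "S \<subseteq> ball z0 \<rho>" using \<rho> by (auto simp: S_def)
  have second: "cmod ((deriv ^^ Suc 1) f w) \<le> 32 * C / \<rho>\<^sup>2" if w: "w \<in> S" for w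
  proof -
    have sub: "cball w (\<rho> / 4) \<subseteq> ball z0 \<rho>"
    proof
      fix x assume "x \<in> cball w (\<rho> / 4)"
      then have "dist z0 x \<le> \<rho> / 2 + \<rho> / 4"
        using w dist_triangle[of z0 x w] by (simp add: S_def)
      then show "x \<in> ball z0 \<rho>" using \<rho> by simp
    qed
    have "cmod ((deriv ^^ 2) f w) \<le> fact 2 * C / (\<rho> / 4) ^ 2"
    proof (rule Cauchy_inequality)
      show "f holomorphic_on ball w (\<rho> / 4)"
        using hol sub ball_subset_cball by (meson holomorphic_on_subset order_trans)
      show "continuous_on (cball w (\<rho> / 4)) f"
        using hol sub by (meson holomorphic_on_imp_continuous_on holomorphic_on_subset)
      show "cmod (f x) \<le> C" if "cmod (w - x) = \<rho> / 4" for x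
        using sub that by (intro bd) (auto simp: dist_norm subset_iff)
    qed (use \<rho> in simp)
    also have "\<dots> = 32 * C / \<rho>\<^sup>2" by (simp add: power2_eq_square)
    finally show ?thesis by (simp add: numeral_2_eq_2)
  qed
  have "cmod ((deriv ^^ 0) f (z0 + h) - (\<Sum>i\<le>1. (deriv ^^ i) f z0 * (z0 + h - z0) ^ i / fact i))
      \<le> 32 * C / \<rho>\<^sup>2 * cmod (z0 + h - z0) ^ Suc 1 / fact 1"
  proof (rule complex_Taylor[where S = S])
    show "((deriv ^^ i) f has_field_derivative (deriv ^^ Suc i) f x) (at x within S)"
      if "x \<in> S" for i x
    proof -
      have "(deriv ^^ i) f holomorphic_on ball z0 \<rho>"
        by (rule holomorphic_higher_deriv[OF hol open_ball])
      then have "((deriv ^^ i) f has_field_derivative deriv ((deriv ^^ i) f) x) (at x)"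
        using that SB by (intro holomorphic_derivI[OF _ open_ball]) auto
      then show ?thesis by (simp add: has_field_derivative_at_within)
    qed
  qed (use second h \<rho> in \<open>auto simp: S_def dist_norm\<close>)
  then show ?thesis by (simp add: power2_eq_square algebra_simps)
qed

lemma Hinfty_matrix_coefficient:
  fixes F :: "complex \<Rightarrow> 'a::complex_inner \<Rightarrow>\<^sub>L 'b::complex_inner"
  assumes "(F has_derivative (\<lambda>h. h *\<^sub>C D)) (at z)"
  shows "((\<lambda>z. cinner y (F z x)) has_field_derivative cinner y (D x)) (at z)"
proof -
  have "((\<lambda>z. F z x) has_derivative (\<lambda>h. (h *\<^sub>C D) x)) (at z)"
    by (rule bounded_linear.has_derivative[OF blinfun.bounded_linear_left assms])
  then have "((\<lambda>z. cinner y (F z x)) has_derivative (\<lambda>h. cinner y ((h *\<^sub>C D) x))) (at z)"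
    by (rule bounded_linear.has_derivative[OF cinner.bounded_linear_right])
  then show ?thesis
    by (simp add: has_field_derivative_def scaleC_blinfun.rep_eq cinner_scaleC_right mult_commute_abs)
qed

text \<open>An operator inequality can be checked on matrix coefficients, which are scalar holomorphic functions.\<close>

lemma Hinfty_taylor_estimate:
  assumes F: "F \<in> Hinfty U" and sub: "ball z0 \<rho> \<subseteq> U" and \<rho>: "\<rho> > 0"
    and bd: "\<And>z. z \<in> U \<Longrightarrow> norm (F z) \<le> C"
    and D: "(F has_derivative (\<lambda>h. h *\<^sub>C D)) (at z0)" and h: "cmod h \<le> \<rho> / 2"
  shows "norm (F (z0 + h) - F z0 - h *\<^sub>C D) \<le> 32 * C / \<rho>\<^sup>2 * (cmod h)\<^sup>2"
proof (rule norm_blinfun_le_inner)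
  have "z0 \<in> U" using sub \<rho> by auto
  then have C: "C \<ge> 0" using bd[of z0] norm_ge_zero order_trans by blast
  then show "0 \<le> 32 * C / \<rho>\<^sup>2 * (cmod h)\<^sup>2" by simp
  fix x y
  define f where "f = (\<lambda>z. cinner y (F z x))"
  have "f holomorphic_on ball z0 \<rho>"
    unfolding holomorphic_on_open[OF open_ball] f_def
    using Hinfty_has_derivative[OF F] Hinfty_matrix_coefficient sub by blast
  moreover have "cmod (f z) \<le> C * norm x * norm y" if "z \<in> ball z0 \<rho>" for z
  proof -
    have "cmod (f z) \<le> norm y * norm (F z x)" by (simp add: f_def norm_cinner_le)
    also have "\<dots> \<le> norm y * (norm (F z) * norm x)" by (intro mult_left_mono norm_blinfun) simp
    also have "\<dots> \<le> norm y * (C * norm x)"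
      using bd[of z] that sub by (intro mult_left_mono mult_right_mono) auto
    finally show ?thesis by (simp add: mult_ac)
  qed
  ultimately have "cmod (f (z0 + h) - f z0 - deriv f z0 * h)
      \<le> 32 * (C * norm x * norm y) / \<rho>\<^sup>2 * (cmod h)\<^sup>2"
    using \<rho> h by (intro scalar_taylor_estimate)
  moreover have "deriv f z0 = cinner y (D x)"
    unfolding f_def by (rule DERIV_imp_deriv[OF Hinfty_matrix_coefficient[OF D]])
  ultimately have "cmod (cinner y ((F (z0 + h) - F z0 - h *\<^sub>C D) x))
      \<le> 32 * (C * norm x * norm y) / \<rho>\<^sup>2 * (cmod h)\<^sup>2"
    by (simp add: f_def blinfun.diff_left cinner.diff_right scaleC_blinfun.rep_eq
        cinner_scaleC_right mult.commute)
  then show "y \<bullet> (F (z0 + h) - F z0 - h *\<^sub>C D) x \<le> 32 * C / \<rho>\<^sup>2 * (cmod h)\<^sup>2 * norm x * norm y"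
    using complex_Re_le_cmod[of "cinner y ((F (z0 + h) - F z0 - h *\<^sub>C D) x)"]
    by (simp add: inner_eq_Re_cinner mult_ac)
qed

lemma Hinfty_derivative_bound:
  assumes F: "F \<in> Hinfty U" and sub: "ball z0 \<rho> \<subseteq> U" and \<rho>: "\<rho> > 0"
    and bd: "\<And>z. z \<in> U \<Longrightarrow> norm (F z) \<le> C"
    and D: "(F has_derivative (\<lambda>h. h *\<^sub>C D)) (at z0)"
  shows "norm D \<le> 20 * C / \<rho>"
proof -
  define h where "h = complex_of_real (\<rho> / 2)"
  have h: "cmod h = \<rho> / 2" using \<rho> by (simp add: h_def)
  have est: "norm (F (z0 + h) - F z0 - h *\<^sub>C D) \<le> 8 * C"
    using Hinfty_taylor_estimate[OF F sub \<rho> bd D, of h] h \<rho> by (simp add: power2_eq_square)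
  have "z0 \<in> U" "z0 + h \<in> U" using sub \<rho> h by (auto simp: subset_iff dist_norm)
  then have "norm (F (z0 + h) - F z0) \<le> 2 * C"
    using norm_triangle_ineq4[of "F (z0 + h)" "F z0"] bd[of z0] bd[of "z0 + h"] by linarith
  then have "norm (h *\<^sub>C D) \<le> 10 * C"
    using est norm_triangle_sub[of "h *\<^sub>C D" "F (z0 + h) - F z0"]
    by (simp add: norm_minus_commute)
  then show ?thesis using h \<rho> by (simp add: norm_scaleC_blinfun field_simps)
qed

lemma Hinfty_lipschitz_estimate:
  assumes F: "F \<in> Hinfty U" and sub: "ball z0 \<rho> \<subseteq> U" and \<rho>: "\<rho> > 0"
    and bd: "\<And>z. z \<in> U \<Longrightarrow> norm (F z) \<le> C" and h: "cmod h \<le> \<rho> / 2"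
  shows "norm (F (z0 + h) - F z0) \<le> 36 * C / \<rho> * cmod h"
proof -
  have "z0 \<in> U" using sub \<rho> by auto
  then have C: "C \<ge> 0" using bd[of z0] norm_ge_zero order_trans by blast
  obtain D where D: "(F has_derivative (\<lambda>h. h *\<^sub>C D)) (at z0)"
    using Hinfty_has_derivative[OF F \<open>z0 \<in> U\<close>] by blast
  have "norm (F (z0 + h) - F z0) \<le> norm (F (z0 + h) - F z0 - h *\<^sub>C D) + norm (h *\<^sub>C D)"
    by (metis norm_triangle_sub add.commute)
  also have "\<dots> \<le> 32 * C / \<rho>\<^sup>2 * (cmod h)\<^sup>2 + cmod h * (20 * C / \<rho>)"
    unfolding norm_scaleC_blinfun
    by (intro add_mono mult_left_mono Hinfty_taylor_estimate[OF F sub \<rho> bd D h]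
        Hinfty_derivative_bound[OF F sub \<rho> bd D]) auto
  also have "32 * C / \<rho>\<^sup>2 * (cmod h)\<^sup>2 \<le> 32 * C / \<rho>\<^sup>2 * (cmod h * (\<rho> / 2))"
    unfolding power2_eq_square[of "cmod h"] using C h by (intro mult_left_mono) auto
  also have "32 * C / \<rho>\<^sup>2 * (cmod h * (\<rho> / 2)) + cmod h * (20 * C / \<rho>) = 36 * C / \<rho> * cmod h"
    using \<rho> by (simp add: power2_eq_square field_simps)
  finally show ?thesis by simp
qed

lemma complex_linear_compose: "complex_linear A \<Longrightarrow> complex_linear B \<Longrightarrow> complex_linear (A o\<^sub>L B)"
  by (simp add: complex_linear_def)

lemma complex_linear_add: "complex_linear A \<Longrightarrow> complex_linear B \<Longrightarrow> complex_linear (A + B)"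
  and complex_linear_diff: "complex_linear A \<Longrightarrow> complex_linear B \<Longrightarrow> complex_linear (A - B)"
  and complex_linear_uminus: "complex_linear A \<Longrightarrow> complex_linear (- A)"
  and complex_linear_id: "complex_linear id_blinfun"
  and complex_linear_0: "complex_linear 0"
  by (simp_all add: complex_linear_def blinfun.add_left blinfun.diff_left blinfun.minus_left
      scaleC_add_right scaleC.diff_right scaleC.minus_right)

lemma complex_linear_pow: "complex_linear A \<Longrightarrow> complex_linear (blinfun_pow A l)"
  by (induction l) (simp_all add: complex_linear_id blinfun_pow_Suc complex_linear_compose)

lemma scaleC_compose_left: "(c *\<^sub>C A) o\<^sub>L B = c *\<^sub>C (A o\<^sub>L B)"
  by (rule blinfun_eqI) (simp add: scaleC_blinfun.rep_eq)

lemma scaleC_compose_right: "complex_linear A \<Longrightarrow> A o\<^sub>L (c *\<^sub>C B) = c *\<^sub>C (A o\<^sub>L B)"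
  by (rule blinfun_eqI) (simp add: scaleC_blinfun.rep_eq complex_linear_def)

lemma Hinfty_compose:
  assumes A: "A \<in> Hinfty U" and B: "B \<in> Hinfty U"
  shows "(\<lambda>z. A z o\<^sub>L B z) \<in> Hinfty U"
proof -
  obtain CA where CA: "CA \<ge> 0" "\<And>z. z \<in> U \<Longrightarrow> norm (A z) \<le> CA" using HinftyE[OF A] by blast
  obtain CB where CB: "CB \<ge> 0" "\<And>z. z \<in> U \<Longrightarrow> norm (B z) \<le> CB" using HinftyE[OF B] by blast
  show ?thesis
  proof (rule HinftyI)
    fix z assume z: "z \<in> U"
    note lin = Hinfty_complex_linear[OF A z] Hinfty_complex_linear[OF B z]
    show "complex_linear (A z o\<^sub>L B z)" using lin by (rule complex_linear_compose)
    obtain DA DB where D: "(A has_derivative (\<lambda>h. h *\<^sub>C DA)) (at z)" "(B has_derivative (\<lambda>h. h *\<^sub>C DB)) (at z)"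
      using Hinfty_has_derivative[OF A z] Hinfty_has_derivative[OF B z] by blast
    have "((\<lambda>z. A z o\<^sub>L B z) has_derivative (\<lambda>h. h *\<^sub>C ((A z o\<^sub>L DB) + (DA o\<^sub>L B z)))) (at z)"
      using blinfun_compose.FDERIV[OF D]
      by (simp add: scaleC_compose_left scaleC_compose_right[OF lin(1)] scaleC_add_right)
    then show "\<exists>D. ((\<lambda>z. A z o\<^sub>L B z) has_derivative (\<lambda>h. h *\<^sub>C D)) (at z)" by blast
    show "norm (A z o\<^sub>L B z) \<le> CA * CB"
      using CA CB z by (meson norm_blinfun_compose mult_mono norm_ge_zero order_trans)
  qed
qed

lemma Hinfty_diff:
  assumes A: "A \<in> Hinfty U" and B: "B \<in> Hinfty U"
  shows "(\<lambda>z. A z - B z) \<in> Hinfty U"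
proof -
  obtain CA where CA: "CA \<ge> 0" "\<And>z. z \<in> U \<Longrightarrow> norm (A z) \<le> CA" using HinftyE[OF A] by blast
  obtain CB where CB: "CB \<ge> 0" "\<And>z. z \<in> U \<Longrightarrow> norm (B z) \<le> CB" using HinftyE[OF B] by blast
  show ?thesis
  proof (rule HinftyI)
    fix z assume z: "z \<in> U"
    show "complex_linear (A z - B z)"
      using Hinfty_complex_linear[OF A z] Hinfty_complex_linear[OF B z] by (rule complex_linear_diff)
    obtain DA DB where "(A has_derivative (\<lambda>h. h *\<^sub>C DA)) (at z)" "(B has_derivative (\<lambda>h. h *\<^sub>C DB)) (at z)"
      using Hinfty_has_derivative[OF A z] Hinfty_has_derivative[OF B z] by blast
    from has_derivative_diff[OF this]
    have "((\<lambda>z. A z - B z) has_derivative (\<lambda>h. h *\<^sub>C (DA - DB))) (at z)"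
      by (simp add: cvec.scale_right_diff_distrib)
    then show "\<exists>D. ((\<lambda>z. A z - B z) has_derivative (\<lambda>h. h *\<^sub>C D)) (at z)" by blast
    show "norm (A z - B z) \<le> CA + CB"
      using CA CB z by (meson norm_triangle_ineq4 add_mono order_trans)
  qed
qed

lemma Hinfty_const: "complex_linear A \<Longrightarrow> (\<lambda>_. A) \<in> Hinfty U"
  by (rule HinftyI[where C = "norm A"])
     (auto intro!: exI[of _ 0] simp: has_derivative_const)

lemma Hinfty_uminus: "A \<in> Hinfty U \<Longrightarrow> (\<lambda>z. - A z) \<in> Hinfty U"
  using Hinfty_diff[OF Hinfty_const[OF complex_linear_0]] by simp

lemma Hinfty_pow: "A \<in> Hinfty U \<Longrightarrow> (\<lambda>z. blinfun_pow (A z) l) \<in> Hinfty U"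
  by (induction l) (simp_all add: Hinfty_const complex_linear_id blinfun_pow_Suc Hinfty_compose)

text \<open>With \<open>I = F\<^sup>-\<^sup>1\<close> and \<open>E = F (z + h) - F z\<close> one has \<open>I (z + h) - I z = - I (z + h) E I z\<close>. Replacing
  \<open>I (z + h)\<close> by \<open>I z\<close> and \<open>E\<close> by \<open>h F' z\<close> on the right changes it by a term of second order in \<open>h\<close>.\<close>

lemma Hinfty_inverse:
  fixes F :: "complex \<Rightarrow> 'a::{complex_inner,banach} \<Rightarrow>\<^sub>L 'a"
  assumes U: "open U" and F: "F \<in> Hinfty U" and c: "c > 0"
    and co: "\<And>z x. z \<in> U \<Longrightarrow> c * (norm x)\<^sup>2 \<le> x \<bullet> F z x"
  shows "(\<lambda>z. blinfun_inv (F z)) \<in> Hinfty U"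
proof (rule HinftyI)
  obtain C where C: "C \<ge> 0" "\<And>z. z \<in> U \<Longrightarrow> norm (F z) \<le> C" using HinftyE[OF F] by blast
  define I where "I z = blinfun_inv (F z)" for z
  have I: "I z o\<^sub>L F z = id_blinfun" "F z o\<^sub>L I z = id_blinfun" "norm (I z) \<le> 1 / c" if "z \<in> U" for z
    unfolding I_def by (rule coercive_inverse[OF c co[OF that]])+
  fix z assume z: "z \<in> U"
  show "norm (blinfun_inv (F z)) \<le> 1 / c" using I(3)[OF z] by (simp add: I_def)
  have Ilin: "complex_linear (I z)"
    using I[OF z] Hinfty_complex_linear[OF F z] complex_linear_inv by blast
  then show "complex_linear (blinfun_inv (F z))" by (simp add: I_def)
  obtain D where D: "(F has_derivative (\<lambda>h. h *\<^sub>C D)) (at z)"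
    using Hinfty_has_derivative[OF F z] by blast
  obtain \<rho> where \<rho>: "\<rho> > 0" "ball z \<rho> \<subseteq> U" using U z by (auto simp: open_contains_ball)
  define L where "L = 36 * C / \<rho>"
  define K where "K = 32 * C / \<rho>\<^sup>2"
  have LK: "0 \<le> L" "0 \<le> K" using C \<rho> by (simp_all add: L_def K_def)
  have "(I has_derivative (\<lambda>h. h *\<^sub>C (- (I z o\<^sub>L D o\<^sub>L I z)))) (at z)"
  proof (rule has_derivative_quadratic)
    show "\<rho> / 2 > 0" "0 \<le> (1 / c) * L * (1 / c) * L * (1 / c) + (1 / c) * K * (1 / c)"
      using \<rho> c LK by simp_all
    fix h assume h: "cmod h \<le> \<rho> / 2"
    define w where "w = z + h"
    define E where "E = F w - F z"
    define R where "R = E - h *\<^sub>C D"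
    have w: "w \<in> U" using h \<rho> by (auto simp: w_def subset_iff dist_norm)
    have E: "norm E \<le> L * cmod h" unfolding E_def w_def L_def
      by (rule Hinfty_lipschitz_estimate[OF F \<rho>(2) \<rho>(1) C(2) h])
    have R: "norm R \<le> K * (cmod h)\<^sup>2" unfolding R_def E_def w_def K_def
      by (rule Hinfty_taylor_estimate[OF F \<rho>(2) \<rho>(1) C(2) D h])
    have diff: "I w - I z = - (I w o\<^sub>L E o\<^sub>L I z)"
      using I[OF z] I[OF w] by (auto intro!: blinfun_eqI simp: E_def blinfun.diff_left blinfun.diff_right
          blinfun.minus_left blinfun_comp_idD)
    have Ez: "E = R + h *\<^sub>C D" by (simp add: R_def)
    have "I w - I z - h *\<^sub>C (- (I z o\<^sub>L D o\<^sub>L I z))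
        = - ((I w - I z) o\<^sub>L E o\<^sub>L I z) - (I z o\<^sub>L R o\<^sub>L I z)"
    proof (rule blinfun_eqI)
      fix x
      have "(I w - I z) x = - I w (E (I z x))" by (simp add: diff blinfun.minus_left)
      moreover have "I z (E (I z x)) = I z (R (I z x)) + h *\<^sub>C I z (D (I z x))"
        using Ilin by (simp add: Ez blinfun.add_left blinfun.add_right scaleC_blinfun.rep_eq complex_linear_def)
      ultimately show "(I w - I z - h *\<^sub>C (- (I z o\<^sub>L D o\<^sub>L I z))) x
          = (- ((I w - I z) o\<^sub>L E o\<^sub>L I z) - (I z o\<^sub>L R o\<^sub>L I z)) x"
        by (simp add: blinfun.add_left blinfun.diff_left blinfun.minus_left scaleC_blinfun.rep_eq scaleC.minus_right)
    qed
    then have "norm (I w - I z - h *\<^sub>C (- (I z o\<^sub>L D o\<^sub>L I z)))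
        \<le> norm ((I w - I z) o\<^sub>L E o\<^sub>L I z) + norm (I z o\<^sub>L R o\<^sub>L I z)"
      by (metis norm_triangle_ineq4 norm_minus_cancel)
    also have "\<dots> \<le> norm (I w - I z) * norm E * norm (I z) + norm (I z) * norm R * norm (I z)"
      by (intro add_mono order_trans[OF norm_blinfun_compose] mult_right_mono norm_blinfun_compose) auto
    also have "\<dots> \<le> ((1 / c) * (L * cmod h) * (1 / c)) * (L * cmod h) * (1 / c)
        + (1 / c) * (K * (cmod h)\<^sup>2) * (1 / c)"
    proof (intro add_mono mult_mono E R I z mult_nonneg_nonneg)
      have "norm (I w - I z) \<le> norm (I w) * norm E * norm (I z)"
        unfolding diff norm_minus_cancel
        by (intro order_trans[OF norm_blinfun_compose] mult_right_mono norm_blinfun_compose) auto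
      also have "\<dots> \<le> (1 / c) * (L * cmod h) * (1 / c)"
        using c LK by (intro mult_mono E I z w) auto
      finally show "norm (I w - I z) \<le> (1 / c) * (L * cmod h) * (1 / c)" .
    qed (use c LK in auto)
    also have "\<dots> = ((1 / c) * L * (1 / c) * L * (1 / c) + (1 / c) * K * (1 / c)) * (cmod h)\<^sup>2"
      by (simp add: power2_eq_square algebra_simps)
    finally show "norm (I (z + h) - I z - h *\<^sub>C (- (I z o\<^sub>L D o\<^sub>L I z)))
      \<le> ((1 / c) * L * (1 / c) * L * (1 / c) + (1 / c) * K * (1 / c)) * (cmod h)\<^sup>2"
      by (simp add: w_def)
  qed
  then show "\<exists>D. ((\<lambda>z. blinfun_inv (F z)) has_derivative (\<lambda>h. h *\<^sub>C D)) (at z)"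
    unfolding I_def[abs_def] by blast
qed

section \<open>Weak operator limits\<close>

lemma inner_blinfun_le:
  fixes A :: "'a::real_normed_vector \<Rightarrow>\<^sub>L 'b::real_inner"
  assumes "norm A \<le> C"
  shows "y \<bullet> blinfun_apply A x \<le> C * norm x * norm y"
proof -
  have "y \<bullet> A x \<le> norm y * norm (A x)" by (rule norm_cauchy_schwarz)
  also have "\<dots> \<le> norm y * (C * norm x)"
    using norm_blinfun[of A x] mult_right_mono[OF assms norm_ge_zero[of x]]
    by (intro mult_left_mono) auto
  finally show ?thesis by (simp add: mult_ac)
qed

text \<open>The limits of the matrix coefficients form a bounded bilinear form, which the Riesz theorem represents by
  an operator.\<close>

lemma wot_limit_exists:
  fixes A :: "nat \<Rightarrow> 'a::complex_inner \<Rightarrow>\<^sub>L 'b::{complex_inner,banach}"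
  assumes bd: "\<And>k. norm (A k) \<le> C" and conv: "\<And>x y. convergent (\<lambda>k. y \<bullet> A k x)"
  shows "\<exists>L. wot_tendsto A L"
proof -
  define l where "l x y = lim (\<lambda>k. y \<bullet> A k x)" for x y
  have l: "(\<lambda>k. y \<bullet> A k x) \<longlonglongrightarrow> l x y" for x y
    using conv[of y x] by (simp add: l_def convergent_LIMSEQ_iff)
  have le: "l x y \<le> C * norm x * norm y" for x y
    by (rule LIMSEQ_le_const2[OF l]) (use inner_blinfun_le[OF bd] in blast)
  have lin_y: "l x (y + y') = l x y + l x y'" "l x (r *\<^sub>R y) = r * l x y" for x y y' r
    using tendsto_add[OF l[of y x] l[of y' x]] tendsto_mult_left[OF l[of y x], of r] l[of "y + y'" x] l[of "r *\<^sub>R y" x]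
    by (auto simp: inner_add_left intro: LIMSEQ_unique)
  have lin_x: "l (x + x') y = l x y + l x' y" "l (r *\<^sub>R x) y = r * l x y" for x x' y r
    using tendsto_add[OF l[of y x] l[of y x']] tendsto_mult_left[OF l[of y x], of r] l[of y "x + x'"] l[of y "r *\<^sub>R x"]
    by (auto simp: inner_add_right blinfun.add_right blinfun.scaleR_right intro: LIMSEQ_unique)
  have "bounded_linear (l x)" for x
  proof (rule bounded_linear_intro[where K = "C * norm x"])
    fix y
    show "norm (l x y) \<le> norm y * (C * norm x)"
      using le[of x y] le[of x "- y"] lin_y(2)[of x "-1" y] by (simp add: abs_le_iff mult_ac)
  qed (simp_all add: lin_y)
  from riesz_representation[OF this] obtain v where v: "\<And>x y. l x y = v x \<bullet> y" by metis
  have "bounded_linear v"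
  proof (rule bounded_linear_intro[where K = C])
    have "v (x + x') \<bullet> y = (v x + v x') \<bullet> y" for x x' y
      by (simp add: v[symmetric] lin_x inner_add_left)
    then show "v (x + x') = v x + v x'" for x x' by (metis vector_eq_rdot)
    have "v (r *\<^sub>R x) \<bullet> y = (r *\<^sub>R v x) \<bullet> y" for r x y
      by (simp add: v[symmetric] lin_x)
    then show "v (r *\<^sub>R x) = r *\<^sub>R v x" for r x by (metis vector_eq_rdot)
    show "norm (v x) \<le> norm x * C" for x
    proof -
      have "(norm (v x))\<^sup>2 \<le> C * norm x * norm (v x)"
        using le[of x "v x"] by (simp add: v power2_norm_eq_inner)
      moreover have "0 \<le> C" using bd[of 0] norm_ge_zero order_trans by blast
      ultimately show ?thesis
        by (cases "v x = 0") (auto simp: power2_eq_square mult_ac)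
    qed
  qed
  then have "wot_tendsto A (Blinfun v)"
    unfolding wot_tendsto_iff_inner using l by (simp add: bounded_linear_Blinfun_apply v inner_commute)
  then show ?thesis by blast
qed

lemma wot_tendsto_norm_le:
  assumes "wot_tendsto A L" and "\<And>k. norm (A k) \<le> C"
  shows "norm L \<le> C"
proof (rule norm_blinfun_le_inner)
  show "0 \<le> C" using assms(2) norm_ge_zero order_trans by blast
  show "y \<bullet> L x \<le> C * norm x * norm y" for x y
    using assms(1)[unfolded wot_tendsto_iff_inner] inner_blinfun_le[OF assms(2)]
    by (meson LIMSEQ_le_const2)
qed

lemma cinner_extensionality: "(\<And>y. cinner y u = cinner y v) \<Longrightarrow> u = v"
  by (metis inner_eq_Re_cinner vector_eq_ldot)

lemma wot_tendsto_complex_linear: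
  assumes "wot_tendsto A L" and "\<And>k. complex_linear (A k)"
  shows "complex_linear L"
  unfolding complex_linear_def
proof (intro allI)
  fix c x
  show "L (c *\<^sub>C x) = c *\<^sub>C L x"
  proof (rule cinner_extensionality)
    fix y
    have "(\<lambda>k. c * cinner y (A k x)) \<longlonglongrightarrow> c * cinner y (L x)"
      using assms(1) by (intro tendsto_mult_left) (simp add: wot_tendsto_def)
    moreover have "(\<lambda>k. cinner y (A k (c *\<^sub>C x))) \<longlonglongrightarrow> cinner y (L (c *\<^sub>C x))"
      using assms(1) by (simp add: wot_tendsto_def)
    ultimately show "cinner y (L (c *\<^sub>C x)) = cinner y (c *\<^sub>C L x)"
      using assms(2) by (simp add: complex_linear_def cinner_scaleC_right LIMSEQ_unique)
  qed
qed

lemma wot_tendsto_diff: "wot_tendsto A L \<Longrightarrow> wot_tendsto B K \<Longrightarrow> wot_tendsto (\<lambda>k. A k - B k) (L - K)"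
  by (simp add: wot_tendsto_def blinfun.diff_left cinner.diff_right tendsto_diff)

lemma wot_tendsto_scaleC: "wot_tendsto A L \<Longrightarrow> wot_tendsto (\<lambda>k. c *\<^sub>C A k) (c *\<^sub>C L)"
  by (simp add: wot_tendsto_def scaleC_blinfun.rep_eq cinner_scaleC_right tendsto_mult_left)

lemma wot_tendsto_subseq: "wot_tendsto A L \<Longrightarrow> strict_mono \<sigma> \<Longrightarrow> wot_tendsto (\<lambda>k. A (\<sigma> k)) L"
  unfolding wot_tendsto_def using LIMSEQ_subseq_LIMSEQ[unfolded comp_def] by blast

lemma convergent_uniform_approx:
  fixes a :: "nat \<Rightarrow> real"
  assumes "\<And>e. e > 0 \<Longrightarrow> \<exists>b. convergent b \<and> (\<forall>k. \<bar>a k - b k\<bar> \<le> e)"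
  shows "convergent a"
  unfolding Cauchy_convergent_iff[symmetric]
proof (rule CauchyI)
  fix e :: real assume "e > 0"
  then obtain b where b: "convergent b" "\<And>k. \<bar>a k - b k\<bar> \<le> e / 4" using assms[of "e / 4"] by auto
  then obtain N where N: "\<And>m n. m \<ge> N \<Longrightarrow> n \<ge> N \<Longrightarrow> \<bar>b m - b n\<bar> < e / 4"
    using \<open>e > 0\<close> CauchyD[of b "e / 4"] by (auto simp: Cauchy_convergent_iff)
  show "\<exists>M. \<forall>m\<ge>M. \<forall>n\<ge>M. norm (a m - a n) < e"
  proof (intro exI allI impI)
    fix m n assume "N \<le> m" "N \<le> n"
    with N[of m n] b(2)[of m] b(2)[of n] \<open>e > 0\<close> show "norm (a m - a n) < e" by (simp add: abs_if split: if_splits)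
  qed
qed

lemma abs_inner_blinfun_le:
  fixes A :: "'a::real_normed_vector \<Rightarrow>\<^sub>L 'b::real_inner"
  assumes "norm A \<le> C"
  shows "\<bar>y \<bullet> blinfun_apply A x\<bar> \<le> C * norm x * norm y"
  using inner_blinfun_le[OF assms, of y x] inner_blinfun_le[OF assms, of "- y" x]
  by (simp add: abs_le_iff)

lemma convergent_dense:
  assumes Dd: "\<And>(x::'a::metric_space) d. d > 0 \<Longrightarrow> \<exists>x'\<in>S. dist x' x < d"
    and L: "\<And>x x' k. \<bar>a x k - a x' k\<bar> \<le> K * dist x' x"
    and conv: "\<And>x. x \<in> S \<Longrightarrow> convergent (a x :: nat \<Rightarrow> real)"
  shows "convergent (a x)"
proof (rule convergent_uniform_approx)
  fix e :: real assume e: "e > 0"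
  define d where "d = e / (\<bar>K\<bar> + 1)"
  have "d > 0" using e by (simp add: d_def)
  then obtain x' where x': "x' \<in> S" "dist x' x < d" using Dd by blast
  have "\<bar>a x k - a x' k\<bar> \<le> e" for k
  proof -
    have "K * dist x' x \<le> (\<bar>K\<bar> + 1) * dist x' x" by (intro mult_right_mono) auto
    also have "\<dots> \<le> (\<bar>K\<bar> + 1) * d" using x' by (intro mult_left_mono) auto
    also have "\<dots> = e" by (simp add: d_def)
    finally show ?thesis using L[of x k x'] by linarith
  qed
  with conv[OF x'(1)] show "\<exists>b. convergent b \<and> (\<forall>k. \<bar>a x k - b k\<bar> \<le> e)" by blast
qed

lemma diagonal_subsequence:
  fixes a :: "nat \<Rightarrow> nat \<Rightarrow> real"
  assumes "\<And>j. \<exists>C. \<forall>k. \<bar>a j k\<bar> \<le> C"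
  shows "\<exists>\<sigma>. strict_mono (\<sigma> :: nat \<Rightarrow> nat) \<and> (\<forall>j. convergent (\<lambda>k. a j (\<sigma> k)))"
proof -
  interpret subseqs "\<lambda>j s. convergent (\<lambda>k. a j (s k))"
  proof
    fix j and s :: "nat \<Rightarrow> nat" assume "strict_mono s"
    have "bounded (range (\<lambda>k. a j (s k)))" using assms[of j] by (auto simp: bounded_iff)
    then obtain l r where "strict_mono (r :: nat \<Rightarrow> nat)" "((\<lambda>k. a j (s k)) \<circ> r) \<longlonglongrightarrow> l"
      using bounded_imp_convergent_subsequence by blast
    then show "\<exists>r'. strict_mono r' \<and> convergent (\<lambda>k. a j ((s \<circ> r') k))"
      by (auto simp: convergent_def o_def)
  qed
  have "convergent (\<lambda>k. a j (diagseq k))" for j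
  proof -
    have "convergent (\<lambda>k. a j ((diagseq \<circ> (+) (Suc j)) k))"
    proof (rule diagseq_holds)
      fix r s :: "nat \<Rightarrow> nat" and n assume "strict_mono r" "convergent (\<lambda>k. a n (s k))"
      then show "convergent (\<lambda>k. a n ((s \<circ> r) k))"
        using convergent_subseq_convergent[of "\<lambda>k. a n (s k)" r] by (simp add: o_def)
    qed
    then show ?thesis
      using convergent_ignore_initial_segment[of "\<lambda>k. a j (diagseq k)" "Suc j"]
      by (simp add: o_def add.commute)
  qed
  with subseq_diagseq show ?thesis by blast
qed

text \<open>A weak Montel theorem. A diagonal subsequence converges for a countable dense set of points and
  vectors; the Lipschitz estimate extends this to all points. The difference quotients of the limit
  are controlled by the Taylor estimate uniformly in the family, so the derivatives converge as well
  and the limit is differentiable in operator norm. The index \<open>j\<close> numbers countably many sequences that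
  are to converge along a common subsequence.\<close>

lemma weak_montel:
  fixes F :: "nat \<Rightarrow> nat \<Rightarrow> complex \<Rightarrow> 'a::separable_chilbert \<Rightarrow>\<^sub>L 'b::separable_chilbert"
  assumes U: "open U" and F: "\<And>j k. F j k \<in> Hinfty U"
    and bd: "\<And>j k z. z \<in> U \<Longrightarrow> norm (F j k z) \<le> C j"
  shows "\<exists>\<sigma> G. strict_mono (\<sigma> :: nat \<Rightarrow> nat) \<and>
    (\<forall>j. G j \<in> Hinfty U \<and> (\<forall>z\<in>U. wot_tendsto (\<lambda>k. F j (\<sigma> k) z) (G j z)))"
proof -
  obtain X :: "'a set" where X: "countable X" "\<And>V. open V \<Longrightarrow> V \<noteq> {} \<Longrightarrow> \<exists>d\<in>X. d \<in> V"
    using countable_dense_exists by blast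
  obtain Y :: "'b set" where Y: "countable Y" "\<And>V. open V \<Longrightarrow> V \<noteq> {} \<Longrightarrow> \<exists>d\<in>Y. d \<in> V"
    using countable_dense_exists by blast
  obtain Z :: "complex set" where Z: "countable Z" "\<And>V. open V \<Longrightarrow> V \<noteq> {} \<Longrightarrow> \<exists>d\<in>Z. d \<in> V"
    using countable_dense_exists by blast
  define I where "I = (UNIV :: nat set) \<times> Z \<times> X \<times> Y"
  have "I \<noteq> {}" using X(2)[of UNIV] Y(2)[of UNIV] Z(2)[of UNIV] by (auto simp: I_def)
  moreover have "countable I" using X Y Z by (auto simp: I_def)
  ultimately have I: "range (from_nat_into I) = I" by (rule range_from_nat_into)
  define a where "a i k = (case from_nat_into I i of (j, z, x, y) \<Rightarrow> if z \<in> U then y \<bullet> F j k z x else 0)" for i k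
  have "\<exists>K. \<forall>k. \<bar>a i k\<bar> \<le> K" for i
  proof -
    obtain j z x y where i: "from_nat_into I i = (j, z, x, y)" by (cases "from_nat_into I i") auto
    show ?thesis
      by (cases "z \<in> U") (auto simp: a_def i intro: exI abs_inner_blinfun_le[OF bd])
  qed
  then obtain \<sigma> where \<sigma>: "strict_mono (\<sigma> :: nat \<Rightarrow> nat)" "\<And>i. convergent (\<lambda>k. a i (\<sigma> k))"
    using diagonal_subsequence by blast
  have conv0: "convergent (\<lambda>k. y \<bullet> F j (\<sigma> k) z x)" if "z \<in> Z" "z \<in> U" "x \<in> X" "y \<in> Y" for j z x y
  proof -
    have "(j, z, x, y) \<in> range (from_nat_into I)" unfolding I using that by (simp add: I_def)
    then obtain i where "from_nat_into I i = (j, z, x, y)" by (metis imageE)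
    with \<sigma>(2)[of i] that show ?thesis by (simp add: a_def)
  qed
  have conv1: "convergent (\<lambda>k. y \<bullet> F j (\<sigma> k) z x)" if z: "z \<in> Z" "z \<in> U" and y: "y \<in> Y" for j z x y
  proof (rule convergent_dense[where S = X and K = "C j * norm y" and a = "\<lambda>x k. y \<bullet> F j (\<sigma> k) z x"])
    show "\<exists>x'\<in>X. dist x' x < d" if "d > 0" for x d
      using X(2)[of "ball x d"] that by (auto simp: dist_commute)
    show "\<bar>y \<bullet> F j (\<sigma> k) z x - y \<bullet> F j (\<sigma> k) z x'\<bar> \<le> C j * norm y * dist x' x" for x x' k
      using abs_inner_blinfun_le[OF bd[OF z(2)], of y j "\<sigma> k" "x - x'"]
      by (simp add: blinfun.diff_right inner_diff_right dist_norm norm_minus_commute mult_ac)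
  qed (use conv0 z y in blast)
  have conv2: "convergent (\<lambda>k. y \<bullet> F j (\<sigma> k) z x)" if z: "z \<in> Z" "z \<in> U" for j z x y
  proof (rule convergent_dense[where S = Y and K = "C j * norm x" and a = "\<lambda>y k. y \<bullet> F j (\<sigma> k) z x"])
    show "\<exists>y'\<in>Y. dist y' y < d" if "d > 0" for y d
      using Y(2)[of "ball y d"] that by (auto simp: dist_commute)
    show "\<bar>y \<bullet> F j (\<sigma> k) z x - y' \<bullet> F j (\<sigma> k) z x\<bar> \<le> C j * norm x * dist y' y" for y y' k
      using abs_inner_blinfun_le[OF bd[OF z(2)], of "y - y'" j "\<sigma> k" x]
      by (simp add: inner_diff_left dist_norm norm_minus_commute mult_ac)
  qed (use conv1 z in blast)
  have conv: "convergent (\<lambda>k. y \<bullet> F j (\<sigma> k) z x)" if z: "z \<in> U" for j z x y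
  proof (rule convergent_uniform_approx)
    fix e :: real assume e: "e > 0"
    obtain \<rho> where \<rho>: "\<rho> > 0" "ball z \<rho> \<subseteq> U"
      using U z unfolding open_contains_ball by blast
    have Cj: "0 \<le> C j" using bd[OF z, of j 0] norm_ge_zero order_trans by blast
    define K where "K = 36 * C j / \<rho> * norm x * norm y"
    have K: "0 \<le> K" using Cj \<rho> by (simp add: K_def)
    define d where "d = min (\<rho> / 2) (e / (K + 1))"
    have "d > 0" using \<rho> e K by (simp add: d_def)
    then obtain w where w: "w \<in> Z" "dist z w < d" using Z(2)[of "ball z d"] by auto
    have wU: "w \<in> U" using w \<rho> by (auto simp: d_def subset_iff)
    have wz: "cmod (w - z) \<le> \<rho> / 2" using w by (simp add: d_def dist_norm norm_minus_commute)
    have "\<bar>y \<bullet> F j (\<sigma> k) z x - y \<bullet> F j (\<sigma> k) w x\<bar> \<le> e" for k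
    proof -
      have "norm (F j (\<sigma> k) w - F j (\<sigma> k) z) \<le> 36 * C j / \<rho> * cmod (w - z)"
        using Hinfty_lipschitz_estimate[OF F \<rho>(2) \<rho>(1) bd wz, of j "\<sigma> k"] by simp
      from abs_inner_blinfun_le[OF this, of y x]
      have "\<bar>y \<bullet> F j (\<sigma> k) z x - y \<bullet> F j (\<sigma> k) w x\<bar> \<le> K * cmod (w - z)"
        by (simp add: blinfun.diff_left inner_diff_right abs_minus_commute K_def mult_ac)
      also have "\<dots> \<le> (K + 1) * d"
        using w K by (intro mult_mono) (auto simp: dist_norm norm_minus_commute)
      also have "\<dots> \<le> (K + 1) * (e / (K + 1))" using K by (intro mult_left_mono) (auto simp: d_def)
      also have "\<dots> = e" using K by simp
      finally show ?thesis .
    qed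
    with conv2[OF w(1) wU] show "\<exists>b. convergent b \<and> (\<forall>k. \<bar>y \<bullet> F j (\<sigma> k) z x - b k\<bar> \<le> e)" by blast
  qed
  have "\<exists>L. wot_tendsto (\<lambda>k. F j (\<sigma> k) z) L" if "z \<in> U" for j z
    by (rule wot_limit_exists[OF bd[OF that] conv[OF that]])
  then have G: "wot_tendsto (\<lambda>k. F j (\<sigma> k) z) (SOME L. wot_tendsto (\<lambda>k. F j (\<sigma> k) z) L)"
    if "z \<in> U" for j z by (rule someI_ex) (use that in blast)
  define G where "G j z = (SOME L. wot_tendsto (\<lambda>k. F j (\<sigma> k) z) L)" for j z
  note G = G[folded G_def]
  have "G j \<in> Hinfty U" for j
  proof (rule HinftyI)
    fix z assume z: "z \<in> U"
    show "norm (G j z) \<le> C j" by (rule wot_tendsto_norm_le[OF G[OF z] bd[OF z]])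
    show "complex_linear (G j z)"
      by (rule wot_tendsto_complex_linear[OF G[OF z]]) (rule Hinfty_complex_linear[OF F z])
    obtain \<rho> where \<rho>: "\<rho> > 0" "ball z \<rho> \<subseteq> U"
      using U z unfolding open_contains_ball by blast
    have Cj: "0 \<le> C j" using bd[OF z, of j 0] norm_ge_zero order_trans by blast
    define K where "K = 32 * C j / \<rho>\<^sup>2"
    have K: "0 \<le> K" using Cj \<rho> by (simp add: K_def)
    have "\<forall>k. \<exists>D. (F j (\<sigma> k) has_derivative (\<lambda>h. h *\<^sub>C D)) (at z)"
      using Hinfty_has_derivative[OF F z] by blast
    from choice[OF this] obtain D
      where D: "\<And>k. (F j (\<sigma> k) has_derivative (\<lambda>h. h *\<^sub>C D k)) (at z)" by blast
    have tay: "norm (F j (\<sigma> k) (z + h) - F j (\<sigma> k) z - h *\<^sub>C D k) \<le> K * (cmod h)\<^sup>2"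
      if "cmod h \<le> \<rho> / 2" for k h
      unfolding K_def by (rule Hinfty_taylor_estimate[OF F \<rho>(2) \<rho>(1) bd D that])
    have "convergent (\<lambda>k. y \<bullet> D k x)" for x y
    proof (rule convergent_uniform_approx)
      fix e :: real assume e: "e > 0"
      define K' where "K' = K * norm x * norm y"
      have K': "0 \<le> K'" using K by (simp add: K'_def)
      define t where "t = min (\<rho> / 2) (e / (K' + 1))"
      have t: "t > 0" using \<rho> e K' by (simp add: t_def)
      have t2: "t * 2 \<le> \<rho>" by (simp add: t_def min_def)
      define b where "b k = (y \<bullet> F j (\<sigma> k) (z + of_real t) x - y \<bullet> F j (\<sigma> k) z x) / t" for k
      have zt: "z + of_real t \<in> U" using \<rho> t by (auto simp: t_def subset_iff dist_norm)
      obtain l1 l2 where l12: "(\<lambda>k. y \<bullet> F j (\<sigma> k) (z + of_real t) x) \<longlonglongrightarrow> l1"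
          "(\<lambda>k. y \<bullet> F j (\<sigma> k) z x) \<longlonglongrightarrow> l2"
        using conv[OF zt, of y j x] conv[OF z, of y j x] by (auto simp: convergent_def)
      have "b \<longlonglongrightarrow> (l1 - l2) / t" unfolding b_def by (intro tendsto_intros l12) (use t in simp)
      then have "convergent b" by (rule convergentI)
      moreover have "\<bar>y \<bullet> D k x - b k\<bar> \<le> e" for k
      proof -
        have "norm (F j (\<sigma> k) (z + of_real t) - F j (\<sigma> k) z - of_real t *\<^sub>C D k) \<le> K * t\<^sup>2"
          using tay[of "of_real t" k] t t2 by simp
        from abs_inner_blinfun_le[OF this, of y x]
        have "\<bar>y \<bullet> F j (\<sigma> k) (z + of_real t) x - y \<bullet> F j (\<sigma> k) z x - t * (y \<bullet> D k x)\<bar> \<le> K' * t\<^sup>2"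
          by (simp add: blinfun.diff_left inner_diff_right scaleC_blinfun.rep_eq scaleR_scaleC[symmetric]
              K'_def mult_ac)
        also have "y \<bullet> F j (\<sigma> k) (z + of_real t) x - y \<bullet> F j (\<sigma> k) z x - t * (y \<bullet> D k x)
            = t * (b k - y \<bullet> D k x)" using t by (simp add: b_def field_simps)
        finally have "t * \<bar>b k - y \<bullet> D k x\<bar> \<le> t * (K' * t)"
          using t by (simp add: abs_mult power2_eq_square mult_ac)
        then have "\<bar>y \<bullet> D k x - b k\<bar> \<le> K' * t" using t by (simp add: abs_minus_commute)
        also have "\<dots> \<le> (K' + 1) * (e / (K' + 1))" using K' t by (intro mult_mono) (auto simp: t_def)
        also have "\<dots> = e" using K' by simp
        finally show ?thesis .
      qed
      ultimately show "\<exists>b. convergent b \<and> (\<forall>k. \<bar>y \<bullet> D k x - b k\<bar> \<le> e)" by blast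
    qed
    then obtain D' where D': "wot_tendsto D D'"
      using wot_limit_exists[of D, OF Hinfty_derivative_bound[OF F \<rho>(2) \<rho>(1) bd D]] by blast
    have "(G j has_derivative (\<lambda>h. h *\<^sub>C D')) (at z)"
    proof (rule has_derivative_quadratic)
      show "\<rho> / 2 > 0" "0 \<le> K" using \<rho> K by auto
      fix h assume h: "cmod h \<le> \<rho> / 2"
      have zh: "z + h \<in> U" using \<rho> h by (auto simp: subset_iff dist_norm)
      show "norm (G j (z + h) - G j z - h *\<^sub>C D') \<le> K * (cmod h)\<^sup>2"
        by (rule wot_tendsto_norm_le[OF wot_tendsto_diff[OF wot_tendsto_diff[OF G[OF zh] G[OF z]]
            wot_tendsto_scaleC[OF D']] tay[OF h]])
    qed
    then show "\<exists>D. (G j has_derivative (\<lambda>h. h *\<^sub>C D)) (at z)" by blast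
  qed
  with \<sigma>(1) G show ?thesis by blast
qed

section \<open>Smooth functions and test functions\<close>

abbreviation vder :: "(real \<Rightarrow> 'a::real_normed_vector) \<Rightarrow> real \<Rightarrow> 'a" where
  "vder f \<equiv> \<lambda>t. vector_derivative f (at t)"

text \<open>Differentiability \<open>n + 1\<close> times, by recursion on \<open>n\<close>, which suits inductive proofs better than the
  iterated derivative.\<close>

primrec diff_times :: "nat \<Rightarrow> (real \<Rightarrow> 'a::real_normed_vector) \<Rightarrow> bool" where
  "diff_times 0 f = (f differentiable_on UNIV)"
| "diff_times (Suc n) f = (f differentiable_on UNIV \<and> diff_times n (vder f))"

lemma smooth_iff_diff_times: "smooth f \<longleftrightarrow> (\<forall>n. diff_times n f)"
proof -
  have "(\<forall>m\<le>n. (vder ^^ m) f differentiable_on UNIV) \<longleftrightarrow> diff_times n f" for n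
  proof (induction n arbitrary: f)
    case (Suc n)
    have "(\<forall>m\<le>Suc n. (vder ^^ m) f differentiable_on UNIV) \<longleftrightarrow>
      f differentiable_on UNIV \<and> (\<forall>m\<le>n. (vder ^^ Suc m) f differentiable_on UNIV)"
      by (metis (mono_tags, lifting) funpow_0 Suc_le_mono not0_implies_Suc zero_le)
    then show ?case using Suc[of "vder f"] by (simp add: funpow_Suc_right del: funpow.simps)
  qed simp
  then show ?thesis unfolding smooth_def by blast
qed

lemma has_vector_derivative_vder:
  "f differentiable_on UNIV \<Longrightarrow> (f has_vector_derivative vder f t) (at t)"
  using vector_derivative_works by (auto simp: differentiable_on_def)

lemma differentiable_onI:
  "(\<And>t. (f has_vector_derivative f' t) (at t)) \<Longrightarrow> f differentiable_on UNIV"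
  by (auto simp: differentiable_on_def intro: differentiableI_vector)

lemma vder_eqI: "(\<And>t. (f has_vector_derivative f' t) (at t)) \<Longrightarrow> vder f = f'"
  by (auto intro: vector_derivative_at)

lemma smooth_differentiable: "smooth f \<Longrightarrow> f differentiable_on UNIV"
  unfolding smooth_iff_diff_times by (metis diff_times.simps(1))

lemma smooth_vder: "smooth f \<Longrightarrow> smooth (vder f)"
  unfolding smooth_iff_diff_times by (metis diff_times.simps(2))

lemma smooth_continuous_on: "smooth f \<Longrightarrow> continuous_on A f"
  by (meson smooth_differentiable differentiable_imp_continuous_on continuous_on_subset subset_UNIV)

lemma smooth_intro:
  assumes "\<And>t. (f has_vector_derivative f' t) (at t)" and "smooth f'"
  shows "smooth f"
proof -
  have "vder f = f'" using assms(1) by (rule vder_eqI)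
  then have "diff_times n f" for n
    using differentiable_onI[OF assms(1)] assms(2) by (cases n) (auto simp: smooth_iff_diff_times)
  then show ?thesis by (simp add: smooth_iff_diff_times)
qed

text \<open>A coinduction principle: to see that a function is smooth, exhibit a class that contains it and that
  is closed under derivatives, such as the multiples of an exponential function.\<close>

lemma smooth_coinduct:
  assumes "P f" and step: "\<And>f. P f \<Longrightarrow> \<exists>f'. P f' \<and> (\<forall>t. (f has_vector_derivative f' t) (at t))"
  shows "smooth f"
proof -
  have "diff_times n f" if "P f" for n f
    using that
  proof (induction n arbitrary: f)
    case 0
    then show ?case using step[of f] by (auto intro: differentiable_onI)
  next
    case (Suc n)
    obtain f' where "P f'" and d: "\<And>t. (f has_vector_derivative f' t) (at t)" using step[OF Suc.prems] by blast
    then show ?case using Suc.IH[of f'] differentiable_onI[OF d] vder_eqI[OF d] by simp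
  qed
  with assms(1) show ?thesis by (simp add: smooth_iff_diff_times)
qed

lemma diff_times_SucD: "diff_times (Suc n) f \<Longrightarrow> diff_times n f"
proof (induction n arbitrary: f)
  case (Suc n)
  then show ?case using Suc.IH[of "vder f"] by auto
qed simp

lemma diff_times_differentiable: "diff_times n f \<Longrightarrow> f differentiable_on UNIV"
  by (cases n) auto

lemma diff_times_add: "diff_times n f \<Longrightarrow> diff_times n g \<Longrightarrow> diff_times n (\<lambda>t. f t + g t)"
proof (induction n arbitrary: f g)
  case (Suc n)
  have "vder (\<lambda>t. f t + g t) = (\<lambda>t. vder f t + vder g t)"
    using Suc.prems by (intro vder_eqI has_vector_derivative_add has_vector_derivative_vder) auto
  with Suc show ?case by auto
qed simp

lemma diff_times_bilinear:
  assumes "bounded_bilinear B"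
  shows "diff_times n f \<Longrightarrow> diff_times n g \<Longrightarrow> diff_times n (\<lambda>t. B (f t) (g t))"
proof (induction n arbitrary: f g)
  case 0
  then show ?case
    by (auto intro!: differentiable_onI bounded_bilinear.has_vector_derivative[OF assms]
        intro: has_vector_derivative_vder)
next
  case (Suc n)
  note d = diff_times_differentiable[OF Suc.prems(1)] diff_times_differentiable[OF Suc.prems(2)]
  have D: "((\<lambda>t. B (f t) (g t)) has_vector_derivative (B (f t) (vder g t) + B (vder f t) (g t))) (at t)" for t
    by (intro bounded_bilinear.has_vector_derivative[OF assms] has_vector_derivative_vder d)
  have "diff_times n (\<lambda>t. B (f t) (vder g t) + B (vder f t) (g t))"
    using Suc.prems diff_times_SucD[OF Suc.prems(1)] diff_times_SucD[OF Suc.prems(2)]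
    by (intro diff_times_add Suc.IH) auto
  with vder_eqI[OF D] differentiable_onI[OF D] show ?case by simp
qed

lemma smooth_bilinear: "bounded_bilinear B \<Longrightarrow> smooth f \<Longrightarrow> smooth g \<Longrightarrow> smooth (\<lambda>t. B (f t) (g t))"
  by (simp add: smooth_iff_diff_times diff_times_bilinear)

lemma smooth_add: "smooth f \<Longrightarrow> smooth g \<Longrightarrow> smooth (\<lambda>t. f t + g t)"
  by (simp add: smooth_iff_diff_times diff_times_add)

lemma smooth_linear:
  assumes L: "bounded_linear L" and f: "smooth f"
  shows "smooth (\<lambda>t. L (f t))"
proof (rule smooth_coinduct[where P = "\<lambda>g. \<exists>f. smooth f \<and> g = (\<lambda>t. L (f t))"])
  fix g assume "\<exists>f. smooth f \<and> g = (\<lambda>t. L (f t))"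
  then obtain f where f: "smooth f" "g = (\<lambda>t. L (f t))" by blast
  then show "\<exists>f'. (\<exists>f. smooth f \<and> f' = (\<lambda>t. L (f t))) \<and> (\<forall>t. (g has_vector_derivative f' t) (at t))"
    using bounded_linear.has_vector_derivative[OF L has_vector_derivative_vder[OF smooth_differentiable[OF f(1)]]]
    by (intro exI[of _ "\<lambda>t. L (vder f t)"]) (auto intro: smooth_vder)
qed (use f in blast)

lemma smooth_affine:
  assumes f: "smooth f"
  shows "smooth (\<lambda>t. f (a * t + b))"
proof (rule smooth_coinduct[where P = "\<lambda>g. \<exists>f c. smooth f \<and> g = (\<lambda>t. c *\<^sub>R f (a * t + b))"])
  fix g :: "real \<Rightarrow> 'a" assume "\<exists>f c. smooth f \<and> g = (\<lambda>t. c *\<^sub>R f (a * t + b))"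
  then obtain f c where f: "smooth f" "g = (\<lambda>t. c *\<^sub>R f (a * t + b))" by blast
  have lin: "((\<lambda>t. a * t + b) has_real_derivative a) (at t)" for t
    by (auto intro!: derivative_eq_intros)
  have "((f \<circ> (\<lambda>t. a * t + b)) has_vector_derivative a *\<^sub>R vder f (a * t + b)) (at t)" for t
    using lin has_vector_derivative_vder[OF smooth_differentiable[OF f(1)]]
    by (intro vector_diff_chain_at) (auto simp: has_real_derivative_iff_has_vector_derivative)
  then have "(g has_vector_derivative c *\<^sub>R (a *\<^sub>R vder f (a * t + b))) (at t)" for t
    unfolding f(2) o_def by (intro bounded_linear.has_vector_derivative[OF bounded_linear_scaleR_right])
  then show "\<exists>f'. (\<exists>f c. smooth f \<and> f' = (\<lambda>t. c *\<^sub>R f (a * t + b))) \<and> (\<forall>t. (g has_vector_derivative f' t) (at t))"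
    using smooth_vder[OF f(1)] by (intro exI[of _ "\<lambda>t. (c * a) *\<^sub>R vder f (a * t + b)"]) auto
qed (use f in \<open>intro exI[of _ f] exI[of _ 1]; simp\<close>)

lemma smooth_exp: "smooth (\<lambda>t::real. exp (c * t))"
proof (rule smooth_coinduct[where P = "\<lambda>f. \<exists>a. f = (\<lambda>t::real. a * exp (c * t))"])
  fix f :: "real \<Rightarrow> real" assume "\<exists>a. f = (\<lambda>t. a * exp (c * t))"
  then obtain a where a: "f = (\<lambda>t. a * exp (c * t))" by blast
  show "\<exists>f'. (\<exists>a. f' = (\<lambda>t. a * exp (c * t))) \<and> (\<forall>t. (f has_vector_derivative f' t) (at t))"
    by (intro exI[of _ "\<lambda>t. (a * c) * exp (c * t)"])
       (auto simp: a has_real_derivative_iff_has_vector_derivative[symmetric] intro!: derivative_eq_intros)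
qed (intro exI[of _ 1], simp)

text \<open>The functions \<open>p (1 / t) exp (- 1 / t)\<close>, extended by zero, are closed under taking derivatives:
  the derivative belongs to the polynomial \<open>X\<^sup>2 (p - p')\<close>.\<close>

definition flat_fun :: "real poly \<Rightarrow> real \<Rightarrow> real" where
  "flat_fun p t = (if t > 0 then poly p (1 / t) * exp (- 1 / t) else 0)"

lemma poly_exp_decay: "((\<lambda>s. poly p s * exp (- s)) \<longlongrightarrow> (0::real)) at_top"
proof -
  have "((\<lambda>s. s ^ i / exp s) \<longlongrightarrow> (0::real)) at_top" for i by (rule tendsto_power_div_exp_0)
  then have mono: "((\<lambda>s. s ^ i * exp (- s)) \<longlongrightarrow> (0::real)) at_top" for i
    by (simp add: exp_minus divide_inverse)
  have "((\<lambda>s. \<Sum>i\<le>degree p. coeff p i * (s ^ i * exp (- s))) \<longlongrightarrow> (\<Sum>i\<le>degree p. coeff p i * 0)) at_top"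
    by (intro tendsto_sum tendsto_mult_left mono)
  then show ?thesis by (simp add: poly_altdef sum_distrib_right mult.assoc)
qed

lemma flat_fun_derivative:
  "(flat_fun p has_real_derivative flat_fun ([:0, 0, 1:] * (p - pderiv p)) t) (at t)"
proof -
  consider "t < 0" | "t > 0" | "t = 0" by linarith
  then show ?thesis
  proof cases
    case 1
    have "((\<lambda>_. 0) has_real_derivative 0) (at t)" by simp
    then have "(flat_fun p has_real_derivative 0) (at t)"
      by (rule has_field_derivative_transform_within_open[where S = "{..<0}"])
         (use 1 in \<open>auto simp: flat_fun_def\<close>)
    with 1 show ?thesis by (simp add: flat_fun_def)
  next
    case 2
    have inner: "((\<lambda>s. 1 / s) has_real_derivative - 1 / t\<^sup>2) (at t)"
      using 2 by (auto intro!: derivative_eq_intros simp: power2_eq_square)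
    have "((\<lambda>s. poly p (1 / s)) has_real_derivative poly (pderiv p) (1 / t) * (- 1 / t\<^sup>2)) (at t)"
      by (rule DERIV_chain2[OF poly_DERIV inner])
    moreover have "((\<lambda>s. exp (- 1 / s)) has_real_derivative exp (- 1 / t) * (1 / t\<^sup>2)) (at t)"
      using 2 by (auto intro!: derivative_eq_intros simp: power2_eq_square)
    ultimately have "((\<lambda>s. poly p (1 / s) * exp (- 1 / s)) has_real_derivative
        poly (pderiv p) (1 / t) * (- 1 / t\<^sup>2) * exp (- 1 / t) + exp (- 1 / t) * (1 / t\<^sup>2) * poly p (1 / t)) (at t)"
      by (rule DERIV_mult)
    also have "poly (pderiv p) (1 / t) * (- 1 / t\<^sup>2) * exp (- 1 / t) + exp (- 1 / t) * (1 / t\<^sup>2) * poly p (1 / t)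
        = flat_fun ([:0, 0, 1:] * (p - pderiv p)) t"
      using 2 by (simp add: flat_fun_def power2_eq_square field_simps)
    finally show ?thesis
      by (rule has_field_derivative_transform_within_open[where S = "{0<..}"])
         (use 2 in \<open>auto simp: flat_fun_def\<close>)
  next
    case 3
    have "((\<lambda>s. poly ([:0, 1:] * p) s * exp (- s)) \<longlongrightarrow> 0) at_top" by (rule poly_exp_decay)
    then have "((\<lambda>h. poly ([:0, 1:] * p) (inverse h) * exp (- inverse h)) \<longlongrightarrow> 0) (at_right 0)"
      by (rule filterlim_compose) (rule filterlim_inverse_at_top_right)
    then have "((\<lambda>h. flat_fun p h / h) \<longlongrightarrow> 0) (at_right 0)"
      by (rule Lim_transform_eventually)
         (auto simp: flat_fun_def eventually_at_right_less field_simps eventually_at_filter)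
    moreover have "((\<lambda>h. flat_fun p h / h) \<longlongrightarrow> 0) (at_left 0)"
      by (rule Lim_transform_eventually[OF tendsto_const])
         (auto simp: flat_fun_def eventually_at_filter)
    ultimately have "((\<lambda>h. flat_fun p h / h) \<longlongrightarrow> 0) (at 0)" by (rule filterlim_split_at[rotated])
    with 3 show ?thesis by (simp add: DERIV_def flat_fun_def)
  qed
qed

lemma smooth_flat_fun: "smooth (flat_fun p)"
proof (rule smooth_coinduct[where P = "\<lambda>f. \<exists>p. f = flat_fun p"])
  fix f assume "\<exists>p. f = flat_fun p"
  then show "\<exists>f'. (\<exists>p. f' = flat_fun p) \<and> (\<forall>t. (f has_vector_derivative f' t) (at t))"
    using flat_fun_derivative by (force simp: has_real_derivative_iff_has_vector_derivative)
qed blast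

text \<open>As \<open>n\<close> grows these bumps increase to the indicator function of \<open>(a, b)\<close>.\<close>

definition bump :: "real \<Rightarrow> real \<Rightarrow> nat \<Rightarrow> real \<Rightarrow> real" where
  "bump a b n t = flat_fun 1 (real (Suc n) * (t - a)) * flat_fun 1 (real (Suc n) * (b - t))"

lemma flat_fun_1: "flat_fun 1 t = (if t > 0 then exp (- 1 / t) else 0)"
  by (simp add: flat_fun_def)

lemma smooth_bump: "smooth (bump a b n)"
proof -
  have "smooth (\<lambda>t. flat_fun 1 (real (Suc n) * t + (- real (Suc n) * a)) *
      flat_fun 1 ((- real (Suc n)) * t + real (Suc n) * b))"
    by (intro smooth_bilinear[OF bounded_bilinear_mult] smooth_affine smooth_flat_fun)
  then show ?thesis by (simp add: bump_def[abs_def] algebra_simps)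
qed

lemma bump_nonneg: "0 \<le> bump a b n t"
  by (simp add: bump_def flat_fun_1)

lemma bump_le_1: "bump a b n t \<le> 1"
  unfolding bump_def flat_fun_1 by (auto intro!: mult_le_one simp: divide_nonpos_pos)

lemma bump_pos: "a < t \<Longrightarrow> t < b \<Longrightarrow> 0 < bump a b n t"
  by (simp add: bump_def flat_fun_1)

lemma bump_outside: "t \<notin> {a<..<b} \<Longrightarrow> bump a b n t = 0"
  by (auto simp: bump_def flat_fun_1 zero_less_mult_iff)

lemma bump_tendsto_indicator: "(\<lambda>n. bump a b n t) \<longlonglongrightarrow> indicator {a<..<b} t"
proof (cases "t \<in> {a<..<b}")
  case True
  have "(\<lambda>n. exp (- (1 / c) * inverse (real (Suc n))) ) \<longlonglongrightarrow> exp (- (1 / c) * 0)" for c :: real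
    by (intro tendsto_exp tendsto_mult_left LIMSEQ_inverse_real_of_nat)
  then have "(\<lambda>n. exp (- 1 / (real (Suc n) * c))) \<longlonglongrightarrow> 1" for c :: real
    by (simp add: divide_inverse mult.commute del: of_nat_Suc)
  from tendsto_mult[OF this[of "t - a"] this[of "b - t"]] True show ?thesis
    by (simp add: bump_def flat_fun_1 del: of_nat_Suc)
qed (simp add: bump_outside)

text \<open>The Fourier integral is first studied on continuous functions with compact support. They contain the
  test functions and are stable under the constructions that lead to Plancherel's identity, such as
  autocorrelation.\<close>

definition ccont :: "(real \<Rightarrow> 'a::real_normed_vector) \<Rightarrow> bool" where
  "ccont f \<longleftrightarrow> continuous_on UNIV f \<and> (\<exists>R. \<forall>t. R < \<bar>t\<bar> \<longrightarrow> f t = 0)"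

lemma support_bounded_iff:
  "compact (closure {t::real. f t \<noteq> (0::'a::real_normed_vector)}) \<longleftrightarrow> (\<exists>R. \<forall>t. R < \<bar>t\<bar> \<longrightarrow> f t = 0)"
proof -
  have "compact (closure {t. f t \<noteq> 0}) \<longleftrightarrow> bounded {t. f t \<noteq> 0}"
    by (rule compact_closure)
  also have "\<dots> \<longleftrightarrow> (\<exists>R. \<forall>t. R < \<bar>t\<bar> \<longrightarrow> f t = 0)"
    by (auto simp: bounded_iff) (metis not_less)+
  finally show ?thesis .
qed

lemma test_function_iff: "test_function f \<longleftrightarrow> smooth f \<and> (\<exists>R. \<forall>t. R < \<bar>t\<bar> \<longrightarrow> f t = 0)"
  unfolding test_function_def support_bounded_iff ..

lemma test_function_ccont: "test_function f \<Longrightarrow> ccont f"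
  by (simp add: test_function_iff ccont_def smooth_continuous_on)

lemma test_function_bump: "test_function (bump a b n)"
proof -
  have "bump a b n t = 0" if "max \<bar>a\<bar> \<bar>b\<bar> < \<bar>t\<bar>" for t
    by (rule bump_outside) (use that in auto)
  then show ?thesis unfolding test_function_iff using smooth_bump by blast
qed

lemma test_function_linear: "bounded_linear L \<Longrightarrow> test_function f \<Longrightarrow> test_function (\<lambda>t. L (f t))"
  using linear_simps(3) by (fastforce simp: test_function_iff smooth_linear)

lemma test_function_exp_scaleR: "test_function f \<Longrightarrow> test_function (\<lambda>t. exp (c * t) *\<^sub>R f t)"
  using smooth_bilinear[OF bounded_bilinear_scaleR smooth_exp]
  by (fastforce simp: test_function_iff)

lemma test_function_add:
  assumes "test_function f" "test_function g"
  shows "test_function (\<lambda>t. f t + g t)"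
proof -
  obtain R R' where "\<And>t. R < \<bar>t\<bar> \<Longrightarrow> f t = 0" "\<And>t. R' < \<bar>t\<bar> \<Longrightarrow> g t = 0"
    using assms by (auto simp: test_function_iff)
  then have "\<forall>t. max R R' < \<bar>t\<bar> \<longrightarrow> f t + g t = 0" by simp
  with assms show ?thesis unfolding test_function_iff using smooth_add by blast
qed

lemma test_function_vder:
  assumes "test_function f"
  shows "test_function (vder f)"
proof -
  obtain R where R: "\<And>t. R < \<bar>t\<bar> \<Longrightarrow> f t = 0" using assms by (auto simp: test_function_iff)
  have "vder f t = 0" if "R < \<bar>t\<bar>" for t
  proof -
    have "((\<lambda>_. 0) has_vector_derivative 0) (at t)" by simp
    then have "(f has_vector_derivative 0) (at t)"
      by (rule has_vector_derivative_transform_within_open[where S = "{t. R < \<bar>t\<bar>}"])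
         (use that R in \<open>auto intro!: open_Collect_less continuous_intros\<close>)
    then show ?thesis by (rule vector_derivative_at)
  qed
  with assms show ?thesis by (auto simp: test_function_iff smooth_vder)
qed

lemma ccont_integrable:
  fixes f :: "real \<Rightarrow> 'a::{banach,second_countable_topology}"
  assumes "ccont f"
  shows "integrable lborel f"
proof -
  obtain R where R: "\<And>t. R < \<bar>t\<bar> \<Longrightarrow> f t = 0" and c: "continuous_on UNIV f"
    using assms by (auto simp: ccont_def)
  have "integrable lborel (\<lambda>t. indicator {-R..R} t *\<^sub>R f t)"
    by (rule borel_integrable_compact) (auto intro: continuous_on_subset[OF c])
  also have "(\<lambda>t. indicator {-R..R} t *\<^sub>R f t) = f"
  proof
    fix t
    show "indicator {-R..R} t *\<^sub>R f t = f t"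
      using R[of t] by (cases "R < \<bar>t\<bar>") (auto simp: indicator_def abs_le_iff)
  qed
  finally show ?thesis .
qed

lemma ccont_measurable:
  fixes f :: "real \<Rightarrow> 'a::{banach,second_countable_topology}"
  shows "ccont f \<Longrightarrow> f \<in> borel_measurable borel"
  by (auto simp: ccont_def intro: borel_measurable_continuous_onI)

lemma ccont_bounded:
  assumes "ccont f"
  shows "\<exists>C. \<forall>t. norm (f t) \<le> C"
proof -
  obtain R where R: "\<And>t. R < \<bar>t\<bar> \<Longrightarrow> f t = 0" and c: "continuous_on UNIV f"
    using assms by (auto simp: ccont_def)
  have "compact (f ` {-R..R})"
    by (intro compact_continuous_image) (auto intro: continuous_on_subset[OF c])
  then obtain C where C: "\<And>t. t \<in> {-R..R} \<Longrightarrow> norm (f t) \<le> C"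
    by (metis compact_imp_bounded bounded_iff imageI)
  have "norm (f t) \<le> max C 0" for t
    using C[of t] R[of t] by (cases "R < \<bar>t\<bar>") (force simp: abs_le_iff not_less)+
  then show ?thesis by blast
qed

text \<open>Applied to a product, this is integration by parts without boundary terms.\<close>

lemma integral_vder_test_function:
  fixes f :: "real \<Rightarrow> 'a::euclidean_space"
  assumes "test_function f"
  shows "(\<integral>t. vder f t \<partial>lborel) = 0"
proof -
  obtain R0 where R0: "\<And>t. R0 < \<bar>t\<bar> \<Longrightarrow> f t = 0" and sm: "smooth f"
    using assms by (auto simp: test_function_iff)
  obtain R1 where R1: "\<And>t. R1 < \<bar>t\<bar> \<Longrightarrow> vder f t = 0"
    using test_function_vder[OF assms] by (auto simp: test_function_iff)
  define R where "R = max (max R0 R1) 0 + 1"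
  have R: "R > 0" "f R = 0" "f (- R) = 0" "\<And>t. R < \<bar>t\<bar> \<Longrightarrow> vder f t = 0"
    using R0[of R] R0[of "- R"] R1 by (auto simp: R_def)
  have "(\<integral>t. indicator {-R..R} t *\<^sub>R vder f t \<partial>lborel) = f R - f (- R)"
    by (rule integral_FTC_Icc)
       (use R sm in \<open>auto intro: smooth_continuous_on smooth_vder has_vector_derivative_at_within
          has_vector_derivative_vder smooth_differentiable\<close>)
  moreover have "(\<lambda>t. indicator {-R..R} t *\<^sub>R vder f t) = vder f"
  proof
    fix t
    show "indicator {-R..R} t *\<^sub>R vder f t = vder f t"
      using R(4)[of t] by (cases "R < \<bar>t\<bar>") (auto simp: indicator_def abs_le_iff)
  qed
  ultimately show ?thesis using R by simp
qed

text \<open>The primitive that vanishes to the left of the support is constant to the right of it, and the constant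
  is the integral.\<close>

lemma test_function_primitive:
  fixes f :: "real \<Rightarrow> 'a::euclidean_space"
  assumes tf: "test_function f" and int: "(\<integral>t. f t \<partial>lborel) = 0"
  shows "\<exists>g. test_function g \<and> vder g = f"
proof -
  obtain R0 where R0: "\<And>t. R0 < \<bar>t\<bar> \<Longrightarrow> f t = 0" and sm: "smooth f"
    using tf by (auto simp: test_function_iff)
  define R where "R = max R0 0 + 1"
  have R: "R > 0" "\<And>t. R \<le> \<bar>t\<bar> \<Longrightarrow> f t = 0" using R0 by (auto simp: R_def)
  have cont: "continuous_on A f" for A by (rule smooth_continuous_on[OF sm])
  define g where "g t = integral {-R..t} f" for t
  have far: "g t = 0" if "t \<ge> R" for t
  proof -
    have "integral {-R..t} f = (\<integral>s. indicator {-R..t} s *\<^sub>R f s \<partial>lborel)"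
      using set_borel_integral_eq_integral(2)[of "{-R..t}" f]
        borel_integrable_compact[OF _ cont, of "{-R..t}"]
      by (simp add: set_integrable_def set_lebesgue_integral_def)
    also have "(\<lambda>s. indicator {-R..t} s *\<^sub>R f s) = f"
    proof
      fix s
      show "indicator {-R..t} s *\<^sub>R f s = f s"
        using R(2)[of s] that by (cases "R \<le> \<bar>s\<bar>") (auto simp: indicator_def abs_le_iff)
    qed
    finally show ?thesis using int by (simp add: g_def)
  qed
  have der: "(g has_vector_derivative f t) (at t)" for t
  proof (cases "t > - R")
    case True
    have "((\<lambda>u. integral {-R..u} f) has_vector_derivative f t) (at t within {-R..t + 1})"
      using True by (intro integral_has_vector_derivative cont) auto
    moreover have "at t within {-R..t + 1} = at t"
      using True by (intro at_within_interior) auto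
    ultimately show ?thesis by (simp add: g_def[abs_def])
  next
    case False
    show ?thesis
    proof -
      have zero: "g u = 0" if "u < - R + 1" for u
        unfolding g_def using that R0
        by (intro integral_unique has_integral_is_0 R0) (auto simp: R_def)
      have "((\<lambda>_. 0) has_vector_derivative 0) (at t)" by simp
      then have "(g has_vector_derivative 0) (at t)"
        by (rule has_vector_derivative_transform_within_open[where S = "{..<- R + 1}"])
           (use False zero in auto)
      moreover have "f t = 0" using R(2)[of t] False R(1) by auto
      ultimately show ?thesis by simp
    qed
  qed
  have "g t = 0" if "R < \<bar>t\<bar>" for t
    using far[of t] that by (cases "t \<ge> R") (auto simp: g_def abs_if split: if_splits)
  then have "test_function g"
    using smooth_intro[OF der sm] by (auto simp: test_function_iff)
  with vder_eqI[OF der] show ?thesis by blast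
qed

section \<open>The Hilbert space of square integrable functions\<close>

lemma rep_mfun_measurable [measurable, simp]: "rep_mfun f \<in> borel_measurable borel"
  using Quotient_rep_reflp[OF Quotient_mfun, of f] by (simp add: ae_rel_def)

lemma abs_rep_mfun: "abs_mfun (rep_mfun f) = f"
  by (rule Quotient_abs_rep[OF Quotient_mfun])

lemma rep_abs_mfun: "\<phi> \<in> borel_measurable borel \<Longrightarrow> AE t in lborel. rep_mfun (abs_mfun \<phi>) t = \<phi> t"
  using Quotient_rep_abs[OF Quotient_mfun, of \<phi>] by (simp add: ae_rel_def)

lemma mfun_eqI: "(AE t in lborel. rep_mfun f t = rep_mfun g t) \<Longrightarrow> f = g"
  using Quotient_rel_abs[OF Quotient_mfun, of "rep_mfun f" "rep_mfun g"] by (simp add: ae_rel_def abs_rep_mfun)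

lemma rep_mfun_add: "AE t in lborel. rep_mfun (f + g) t = rep_mfun f t + rep_mfun g t"
proof -
  have "f + g = abs_mfun (\<lambda>t. rep_mfun f t + rep_mfun g t)"
    unfolding plus_mfun_def by simp
  then show ?thesis by (simp add: rep_abs_mfun)
qed

lemma rep_mfun_diff: "AE t in lborel. rep_mfun (f - g) t = rep_mfun f t - rep_mfun g t"
proof -
  have "f - g = abs_mfun (\<lambda>t. rep_mfun f t - rep_mfun g t)"
    unfolding minus_mfun_def by simp
  then show ?thesis by (simp add: rep_abs_mfun)
qed

lemma measurable_scaleC2 [measurable (raw)]:
  fixes f :: "'x \<Rightarrow> 'a::separable_chilbert"
  assumes "c \<in> borel_measurable M" "f \<in> borel_measurable M"
  shows "(\<lambda>t. c t *\<^sub>C f t) \<in> borel_measurable M"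
  by (rule borel_measurable_continuous_Pair[OF assms])
     (intro scaleC.continuous_on continuous_intros)

lemma measurable_cinner [measurable (raw)]:
  fixes f :: "'x \<Rightarrow> 'a::separable_chilbert"
  assumes "f \<in> borel_measurable M" "g \<in> borel_measurable M"
  shows "(\<lambda>t. cinner (f t) (g t)) \<in> borel_measurable M"
  by (rule borel_measurable_continuous_Pair[OF assms])
     (intro cinner.continuous_on continuous_intros)

lemma rep_mfun_scaleC: "AE t in lborel. rep_mfun (c *\<^sub>C f) t = c *\<^sub>C rep_mfun f t"
proof -
  have "c *\<^sub>C f = abs_mfun (\<lambda>t. c *\<^sub>C rep_mfun f t)"
    unfolding scaleC_mfun_def by simp
  then show ?thesis by (simp add: rep_abs_mfun)
qed

lemma rep_mfun_0: "AE t in lborel. rep_mfun 0 t = 0"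
  unfolding zero_mfun_def by (simp add: rep_abs_mfun)

definition sq_int :: "(real \<Rightarrow> 'a::separable_chilbert) \<Rightarrow> bool" where
  "sq_int f \<longleftrightarrow> f \<in> borel_measurable borel \<and> integrable lborel (\<lambda>t. (norm (f t))\<^sup>2)"

lemma sq_int_measurable [measurable_dest]: "sq_int f \<Longrightarrow> f \<in> borel_measurable borel"
  by (simp add: sq_int_def)

lemma sq_int_bound:
  assumes "g \<in> borel_measurable borel" "integrable lborel h" "AE t in lborel. (norm (g t))\<^sup>2 \<le> h t"
  shows "sq_int g"
  unfolding sq_int_def
proof
  show "integrable lborel (\<lambda>t. (norm (g t))\<^sup>2)"
    by (rule Bochner_Integration.integrable_bound[OF assms(2)]) (use assms in auto)
qed fact

lemma power2_norm_add_le: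
  fixes x y :: "'a::real_normed_vector"
  shows "(norm (x + y))\<^sup>2 \<le> 2 * (norm x)\<^sup>2 + 2 * (norm y)\<^sup>2"
proof -
  have "(norm (x + y))\<^sup>2 \<le> (norm x + norm y)\<^sup>2" by (simp add: power_mono norm_triangle_ineq)
  also have "\<dots> \<le> 2 * (norm x)\<^sup>2 + 2 * (norm y)\<^sup>2"
    using zero_le_power2[of "norm x - norm y"] by (simp add: power2_sum power2_diff)
  finally show ?thesis .
qed

lemma sq_int_add: "sq_int f \<Longrightarrow> sq_int g \<Longrightarrow> sq_int (\<lambda>t. f t + g t)"
  by (rule sq_int_bound[where h = "\<lambda>t. 2 * (norm (f t))\<^sup>2 + 2 * (norm (g t))\<^sup>2"])
     (auto simp: power2_norm_add_le sq_int_def)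

lemma sq_int_scaleC: "sq_int f \<Longrightarrow> sq_int (\<lambda>t. c *\<^sub>C f t)"
  by (auto simp: sq_int_def norm_scaleC power_mult_distrib intro!: measurable_scaleC)

lemma sq_int_scaleR: "sq_int f \<Longrightarrow> sq_int (\<lambda>t. r *\<^sub>R f t)"
  by (simp add: scaleR_scaleC sq_int_scaleC)

lemma sq_int_uminus: "sq_int f \<Longrightarrow> sq_int (\<lambda>t. - f t)"
  using sq_int_scaleR[of f "-1"] by simp

lemma sq_int_diff: "sq_int f \<Longrightarrow> sq_int g \<Longrightarrow> sq_int (\<lambda>t. f t - g t)"
  using sq_int_add[OF _ sq_int_uminus, of f g] by simp

lemma sq_int_0: "sq_int (\<lambda>_. 0)"
  by (simp add: sq_int_def)

lemma sq_int_AE_cong: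
  assumes "sq_int f" "g \<in> borel_measurable borel" "AE t in lborel. g t = f t"
  shows "sq_int g"
  by (rule sq_int_bound[where h = "\<lambda>t. (norm (f t))\<^sup>2"]) (use assms in \<open>auto simp: sq_int_def\<close>)

lemma sq_int_ccont:
  assumes "ccont f"
  shows "sq_int f"
proof -
  have "ccont (\<lambda>t. (norm (f t))\<^sup>2)" using assms by (auto simp: ccont_def intro!: continuous_intros)
  then show ?thesis using assms by (simp add: sq_int_def ccont_measurable ccont_integrable)
qed

lemma norm_mult_le_sum_squares: "norm x * norm y \<le> (norm x)\<^sup>2 + (norm y)\<^sup>2"
  for x :: "'a::real_normed_vector" and y :: "'b::real_normed_vector"
proof -
  have "0 \<le> (norm x - norm y)\<^sup>2" "0 \<le> (norm x)\<^sup>2" "0 \<le> (norm y)\<^sup>2" by simp_all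
  then show ?thesis unfolding power2_diff by linarith
qed

lemma sq_int_integrable_bilinear:
  fixes B :: "'a::separable_chilbert \<Rightarrow> 'b::separable_chilbert \<Rightarrow> 'c::{banach,second_countable_topology}"
  assumes f: "sq_int f" and g: "sq_int g" and m: "(\<lambda>t. B (f t) (g t)) \<in> borel_measurable borel"
    and B: "\<And>x y. norm (B x y) \<le> norm x * norm y"
  shows "integrable lborel (\<lambda>t. B (f t) (g t))"
proof (rule Bochner_Integration.integrable_bound)
  show "integrable lborel (\<lambda>t. (norm (f t))\<^sup>2 + (norm (g t))\<^sup>2)" using f g by (simp add: sq_int_def)
  show "AE t in lborel. norm (B (f t) (g t)) \<le> norm ((norm (f t))\<^sup>2 + (norm (g t))\<^sup>2)"
    using order_trans[OF B norm_mult_le_sum_squares] by auto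
qed (use m in simp)

lemma sq_int_integrable_cinner: "sq_int f \<Longrightarrow> sq_int g \<Longrightarrow> integrable lborel (\<lambda>t. cinner (f t) (g t))"
  by (rule sq_int_integrable_bilinear[where B = cinner]) (auto simp: norm_cinner_le)

lemma sq_int_integrable_inner: "sq_int f \<Longrightarrow> sq_int g \<Longrightarrow> integrable lborel (\<lambda>t. f t \<bullet> g t)"
  by (rule sq_int_integrable_bilinear[where B = inner]) (auto simp: Cauchy_Schwarz_ineq2)

text \<open>The weighted spaces are carriers inside one type, and their operators act on all of that type. The
  unweighted space is now made a type of its own, so that the Hilbert space classes and the type of bounded
  operators apply to it. The weighted spaces are later identified with it.\<close>

typedef (overloaded) 'a l2 = "{f :: 'a::separable_chilbert mfun. sq_int (rep_mfun f)}"
  morphisms mfun_of_l2 Abs_l2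
proof (rule exI[of _ 0])
  have "sq_int (rep_mfun (0 :: 'a mfun))"
    by (rule sq_int_AE_cong[OF sq_int_0 _ rep_mfun_0]) simp
  then show "(0 :: 'a mfun) \<in> {f. sq_int (rep_mfun f)}" by simp
qed

definition rep_l2 :: "'a::separable_chilbert l2 \<Rightarrow> real \<Rightarrow> 'a" where
  "rep_l2 v = rep_mfun (mfun_of_l2 v)"

definition l2_of :: "(real \<Rightarrow> 'a::separable_chilbert) \<Rightarrow> 'a l2" where
  "l2_of \<phi> = Abs_l2 (abs_mfun \<phi>)"

lemma sq_int_rep_l2 [simp]: "sq_int (rep_l2 v)"
  using mfun_of_l2[of v] by (simp add: rep_l2_def)

lemma rep_l2_measurable [measurable, simp]: "rep_l2 v \<in> borel_measurable borel"
  by (simp add: rep_l2_def)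

lemma sq_int_abs_mfun: "sq_int \<phi> \<Longrightarrow> sq_int (rep_mfun (abs_mfun \<phi>))"
  by (rule sq_int_AE_cong[OF _ _ rep_abs_mfun]) (auto simp: sq_int_def)

lemma mfun_of_l2_l2_of: "sq_int \<phi> \<Longrightarrow> mfun_of_l2 (l2_of \<phi>) = abs_mfun \<phi>"
  by (simp add: l2_of_def Abs_l2_inverse sq_int_abs_mfun)

lemma rep_l2_of: "sq_int \<phi> \<Longrightarrow> AE t in lborel. rep_l2 (l2_of \<phi>) t = \<phi> t"
  by (simp add: rep_l2_def mfun_of_l2_l2_of rep_abs_mfun sq_int_measurable)

lemma l2_eqI: "(AE t in lborel. rep_l2 v t = rep_l2 w t) \<Longrightarrow> v = w"
  unfolding rep_l2_def mfun_of_l2_inject[symmetric] by (rule mfun_eqI)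

lemma l2_of_rep [simp]: "l2_of (rep_l2 v) = v"
  by (simp add: l2_of_def rep_l2_def abs_rep_mfun mfun_of_l2_inverse)

lemma l2_of_eqI: "sq_int \<phi> \<Longrightarrow> (AE t in lborel. rep_l2 v t = \<phi> t) \<Longrightarrow> l2_of \<phi> = v"
  by (rule l2_eqI) (use rep_l2_of[of \<phi>] in auto)

instantiation l2 :: (separable_chilbert) complex_inner
begin

definition zero_l2 :: "'a l2" where "zero_l2 = l2_of (\<lambda>_. 0)"
definition plus_l2 :: "'a l2 \<Rightarrow> 'a l2 \<Rightarrow> 'a l2" where
  "plus_l2 v w = l2_of (\<lambda>t. rep_l2 v t + rep_l2 w t)"
definition minus_l2 :: "'a l2 \<Rightarrow> 'a l2 \<Rightarrow> 'a l2" where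
  "minus_l2 v w = l2_of (\<lambda>t. rep_l2 v t - rep_l2 w t)"
definition uminus_l2 :: "'a l2 \<Rightarrow> 'a l2" where "uminus_l2 v = l2_of (\<lambda>t. - rep_l2 v t)"
definition scaleC_l2 :: "complex \<Rightarrow> 'a l2 \<Rightarrow> 'a l2" where
  "scaleC_l2 c v = l2_of (\<lambda>t. c *\<^sub>C rep_l2 v t)"
definition scaleR_l2 :: "real \<Rightarrow> 'a l2 \<Rightarrow> 'a l2" where
  "scaleR_l2 r v = l2_of (\<lambda>t. r *\<^sub>R rep_l2 v t)"
definition cinner_l2 :: "'a l2 \<Rightarrow> 'a l2 \<Rightarrow> complex" where
  "cinner_l2 v w = (\<integral>t. cinner (rep_l2 v t) (rep_l2 w t) \<partial>lborel)"
definition inner_l2 :: "'a l2 \<Rightarrow> 'a l2 \<Rightarrow> real" where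
  "inner_l2 v w = (\<integral>t. rep_l2 v t \<bullet> rep_l2 w t \<partial>lborel)"
definition norm_l2 :: "'a l2 \<Rightarrow> real" where "norm_l2 v = sqrt (inner v v)"
definition dist_l2 :: "'a l2 \<Rightarrow> 'a l2 \<Rightarrow> real" where "dist_l2 v w = norm (v - w)"
definition sgn_l2 :: "'a l2 \<Rightarrow> 'a l2" where "sgn_l2 v = inverse (norm v) *\<^sub>R v"
definition uniformity_l2 :: "('a l2 \<times> 'a l2) filter" where
  "uniformity_l2 = (INF e\<in>{0<..}. principal {(v, w). dist v w < e})"
definition open_l2 :: "'a l2 set \<Rightarrow> bool" where
  "open_l2 U = (\<forall>v\<in>U. \<forall>\<^sub>F (v', w) in uniformity. v' = v \<longrightarrow> w \<in> U)"

lemma rep_l2_add: "AE t in lborel. rep_l2 (v + w) t = rep_l2 v t + rep_l2 (w :: 'a l2) t"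
  unfolding plus_l2_def by (intro rep_l2_of sq_int_add) simp_all

lemma rep_l2_diff: "AE t in lborel. rep_l2 (v - w) t = rep_l2 v t - rep_l2 (w :: 'a l2) t"
  unfolding minus_l2_def by (intro rep_l2_of sq_int_diff) simp_all

lemma rep_l2_uminus: "AE t in lborel. rep_l2 (- v) t = - rep_l2 (v :: 'a l2) t"
  unfolding uminus_l2_def by (intro rep_l2_of sq_int_uminus) simp

lemma rep_l2_scaleC: "AE t in lborel. rep_l2 (c *\<^sub>C v) t = c *\<^sub>C rep_l2 (v :: 'a l2) t"
  unfolding scaleC_l2_def by (intro rep_l2_of sq_int_scaleC) simp

lemma rep_l2_scaleR: "AE t in lborel. rep_l2 (r *\<^sub>R v) t = r *\<^sub>R rep_l2 (v :: 'a l2) t"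
  unfolding scaleR_l2_def by (intro rep_l2_of sq_int_scaleR) simp

lemma rep_l2_0: "AE t in lborel. rep_l2 (0 :: 'a l2) t = 0"
  unfolding zero_l2_def by (intro rep_l2_of sq_int_0)

instance
proof
  fix u v w :: "'a l2" and c d :: complex and r s :: real
  show "u + v + w = u + (v + w)"
    by (rule l2_eqI) (use rep_l2_add[of "u + v" w] rep_l2_add[of u v] rep_l2_add[of u "v + w"]
      rep_l2_add[of v w] in \<open>eventually_elim; simp add: add.assoc\<close>)
  show "u + v = v + u" by (simp add: plus_l2_def add.commute)
  show "0 + u = u"
    by (rule l2_eqI) (use rep_l2_add[of 0 u] rep_l2_0 in \<open>eventually_elim; simp\<close>)
  show "- u + u = 0"
    by (rule l2_eqI) (use rep_l2_add[of "- u" u] rep_l2_uminus[of u] rep_l2_0 in \<open>eventually_elim; simp\<close>)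
  show "u - v = u + - v"
    by (rule l2_eqI) (use rep_l2_add[of u "- v"] rep_l2_uminus[of v] rep_l2_diff[of u v] in \<open>eventually_elim; simp\<close>)
  show "c *\<^sub>C (u + v) = c *\<^sub>C u + c *\<^sub>C v"
    by (rule l2_eqI) (use rep_l2_add[of u v] rep_l2_scaleC[of c "u + v"] rep_l2_scaleC[of c u]
      rep_l2_scaleC[of c v] rep_l2_add[of "c *\<^sub>C u" "c *\<^sub>C v"] in \<open>eventually_elim; simp add: scaleC_add_right\<close>)
  show "(c + d) *\<^sub>C u = c *\<^sub>C u + d *\<^sub>C u"
    by (rule l2_eqI) (use rep_l2_scaleC[of "c + d" u] rep_l2_scaleC[of c u]
      rep_l2_scaleC[of d u] rep_l2_add[of "c *\<^sub>C u" "d *\<^sub>C u"] in \<open>eventually_elim; simp add: scaleC_add_left\<close>)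
  show "c *\<^sub>C d *\<^sub>C u = (c * d) *\<^sub>C u"
    by (rule l2_eqI) (use rep_l2_scaleC[of "c * d" u] rep_l2_scaleC[of c "d *\<^sub>C u"]
      rep_l2_scaleC[of d u] in \<open>eventually_elim; simp add: scaleC_scaleC\<close>)
  show "1 *\<^sub>C u = u"
    by (rule l2_eqI) (use rep_l2_scaleC[of 1 u] in \<open>eventually_elim; simp add: scaleC_one\<close>)
  show "r *\<^sub>R (u + v) = r *\<^sub>R u + r *\<^sub>R v"
    by (rule l2_eqI) (use rep_l2_add[of u v] rep_l2_scaleR[of r "u + v"] rep_l2_scaleR[of r u]
      rep_l2_scaleR[of r v] rep_l2_add[of "r *\<^sub>R u" "r *\<^sub>R v"] in \<open>eventually_elim; simp add: scaleR_add_right\<close>)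
  show "(r + s) *\<^sub>R u = r *\<^sub>R u + s *\<^sub>R u"
    by (rule l2_eqI) (use rep_l2_scaleR[of "r + s" u] rep_l2_scaleR[of r u]
      rep_l2_scaleR[of s u] rep_l2_add[of "r *\<^sub>R u" "s *\<^sub>R u"] in \<open>eventually_elim; simp add: scaleR_add_left\<close>)
  show "r *\<^sub>R s *\<^sub>R u = (r * s) *\<^sub>R u"
    by (rule l2_eqI) (use rep_l2_scaleR[of "r * s" u] rep_l2_scaleR[of r "s *\<^sub>R u"]
      rep_l2_scaleR[of s u] in \<open>eventually_elim; simp\<close>)
  show "1 *\<^sub>R u = u"
    by (rule l2_eqI) (use rep_l2_scaleR[of 1 u] in \<open>eventually_elim; simp\<close>)
  show "r *\<^sub>R u = complex_of_real r *\<^sub>C u"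
    by (simp add: scaleR_l2_def scaleC_l2_def scaleR_scaleC)
  show "u \<bullet> v = v \<bullet> u" by (simp add: inner_l2_def inner_commute)
  have "(u + v) \<bullet> w = (\<integral>t. rep_l2 u t \<bullet> rep_l2 w t + rep_l2 v t \<bullet> rep_l2 w t \<partial>lborel)"
    unfolding inner_l2_def
    by (rule integral_cong_AE) (use rep_l2_add[of u v] in \<open>auto simp: inner_add_left\<close>)
  then show "(u + v) \<bullet> w = u \<bullet> w + v \<bullet> w"
    by (simp add: inner_l2_def sq_int_integrable_inner)
  have "r *\<^sub>R u \<bullet> w = (\<integral>t. r * (rep_l2 u t \<bullet> rep_l2 w t) \<partial>lborel)"
    unfolding inner_l2_def
    by (rule integral_cong_AE) (use rep_l2_scaleR[of r u] in auto)
  then show "r *\<^sub>R u \<bullet> w = r * (u \<bullet> w)" by (simp add: inner_l2_def)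
  show "0 \<le> u \<bullet> u" by (simp add: inner_l2_def)
  have "u \<bullet> u = 0 \<longleftrightarrow> (AE t in lborel. rep_l2 u t \<bullet> rep_l2 u t = 0)"
    unfolding inner_l2_def by (rule integral_nonneg_eq_0_iff_AE) (auto simp: sq_int_integrable_inner)
  also have "\<dots> \<longleftrightarrow> (AE t in lborel. rep_l2 u t = rep_l2 0 t)"
    using rep_l2_0 by auto
  also have "\<dots> \<longleftrightarrow> u = 0" using l2_eqI[of u 0] by auto
  finally show "u \<bullet> u = 0 \<longleftrightarrow> u = 0" .
  show "norm u = sqrt (u \<bullet> u)" by (rule norm_l2_def)
  show "dist u v = norm (u - v)" by (rule dist_l2_def)
  show "sgn u = inverse (norm u) *\<^sub>R u" by (rule sgn_l2_def)
  show "uniformity = (INF e\<in>{0<..}. principal {(x, y :: 'a l2). dist x y < e})" by (rule uniformity_l2_def)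
  show "open U = (\<forall>x\<in>U. \<forall>\<^sub>F (x', y) in uniformity. x' = x \<longrightarrow> y \<in> U)" for U :: "'a l2 set"
    by (rule open_l2_def)
  show "cinner u v = cnj (cinner v u)"
    unfolding cinner_l2_def
    by (subst integral_bounded_linear[OF bounded_linear_cnj, symmetric])
       (simp_all add: sq_int_integrable_cinner cinner_commute[symmetric])
  have "cinner (u + v) w = (\<integral>t. cinner (rep_l2 u t) (rep_l2 w t) + cinner (rep_l2 v t) (rep_l2 w t) \<partial>lborel)"
    unfolding cinner_l2_def
    by (rule integral_cong_AE) (use rep_l2_add[of u v] in \<open>auto simp: cinner_add_left\<close>)
  then show "cinner (u + v) w = cinner u w + cinner v w"
    by (simp add: cinner_l2_def sq_int_integrable_cinner)
  have "cinner (c *\<^sub>C u) w = (\<integral>t. cnj c * cinner (rep_l2 u t) (rep_l2 w t) \<partial>lborel)" for w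
    unfolding cinner_l2_def
    by (rule integral_cong_AE) (use rep_l2_scaleC[of c u] in \<open>auto simp: cinner_scaleC_left\<close>)
  then show "cinner (c *\<^sub>C u) w = cnj c * cinner u w" by (simp add: cinner_l2_def)
  show "u \<bullet> v = Re (cinner u v)"
    unfolding inner_l2_def cinner_l2_def
    by (subst integral_Re[symmetric]) (simp_all add: sq_int_integrable_cinner inner_eq_Re_cinner)
qed

end

lemma cinner_l2_of:
  assumes "sq_int f" "sq_int g"
  shows "cinner (l2_of f) (l2_of g) = (\<integral>t. cinner (f t) (g t) \<partial>lborel)"
  unfolding cinner_l2_def
  by (rule integral_cong_AE) (use assms rep_l2_of[OF assms(1)] rep_l2_of[OF assms(2)] in \<open>auto simp: sq_int_def\<close>)

lemma power2_norm_l2: "(norm v)\<^sup>2 = (\<integral>t. (norm (rep_l2 v t))\<^sup>2 \<partial>lborel)"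
  by (simp add: power2_norm_eq_inner inner_l2_def)

lemma power2_norm_l2_of:
  assumes "sq_int f"
  shows "(norm (l2_of f))\<^sup>2 = (\<integral>t. (norm (f t))\<^sup>2 \<partial>lborel)"
  unfolding power2_norm_l2
  by (rule integral_cong_AE) (use assms rep_l2_of[OF assms] in \<open>auto simp: sq_int_def\<close>)

lemma l2_of_add: "sq_int f \<Longrightarrow> sq_int g \<Longrightarrow> l2_of (\<lambda>t. f t + g t) = l2_of f + l2_of g"
  by (rule l2_of_eqI[OF sq_int_add])
     (use rep_l2_add[of "l2_of f" "l2_of g"] rep_l2_of[of f] rep_l2_of[of g] in auto)

lemma l2_of_diff: "sq_int f \<Longrightarrow> sq_int g \<Longrightarrow> l2_of (\<lambda>t. f t - g t) = l2_of f - l2_of g"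
  by (rule l2_of_eqI[OF sq_int_diff])
     (use rep_l2_diff[of "l2_of f" "l2_of g"] rep_l2_of[of f] rep_l2_of[of g] in auto)

lemma l2_of_scaleC: "sq_int f \<Longrightarrow> l2_of (\<lambda>t. c *\<^sub>C f t) = c *\<^sub>C l2_of f"
  by (rule l2_of_eqI[OF sq_int_scaleC]) (use rep_l2_scaleC[of c "l2_of f"] rep_l2_of[of f] in auto)

lemma l2_of_0: "l2_of (\<lambda>_. 0) = 0"
  by (simp add: zero_l2_def)

lemma nn_integral_norm_l2: "(\<integral>\<^sup>+t. ennreal ((norm (rep_l2 v t))\<^sup>2) \<partial>lborel) = ennreal ((norm v)\<^sup>2)"
  unfolding power2_norm_l2
  by (rule nn_integral_eq_integral) (use sq_int_rep_l2[of v] in \<open>auto simp: sq_int_def\<close>)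

text \<open>Completeness (Riesz and Fischer). A subsequence whose consecutive distances are at most
  \<open>2\<^sup>-\<^sup>n\<close> converges almost everywhere, because \<open>\<delta> \<le> 2\<^sup>-\<^sup>n + 2\<^sup>n \<delta>\<^sup>2\<close> for the pointwise distances
  \<open>\<delta>\<close> and the integrals of \<open>2\<^sup>n \<delta>\<^sup>2\<close> are summable. Fatou's lemma shows that the pointwise limit is
  the limit in norm.\<close>

instance l2 :: (separable_chilbert) banach
proof
  fix X :: "nat \<Rightarrow> 'a l2" assume C: "Cauchy X"
  have "\<exists>N. \<forall>m\<ge>N. \<forall>k\<ge>N. norm (X m - X k) < (1/2) ^ n" for n :: nat
    using C by (auto dest!: CauchyD[of X "(1/2) ^ n"])
  then obtain N where N: "\<And>n m k. m \<ge> N n \<Longrightarrow> k \<ge> N n \<Longrightarrow> norm (X m - X k) < (1/2) ^ n" by metis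
  define r where "r n = (\<Sum>i\<le>n. N i)" for n
  have rN: "N n \<le> r m" if "n \<le> m" for n m
    unfolding r_def using that by (intro member_le_sum) auto
  define Y where "Y n = rep_l2 (X (r n))" for n
  have Ym [measurable]: "Y n \<in> borel_measurable borel" for n by (simp add: Y_def)
  have int: "(\<integral>\<^sup>+t. ennreal ((norm (Y m t - Y n t))\<^sup>2) \<partial>lborel) \<le> ennreal ((1/4) ^ n)" if "n \<le> m" for m n
  proof -
    have "(\<integral>\<^sup>+t. ennreal ((norm (Y m t - Y n t))\<^sup>2) \<partial>lborel)
        = (\<integral>\<^sup>+t. ennreal ((norm (rep_l2 (X (r m) - X (r n)) t))\<^sup>2) \<partial>lborel)"
      unfolding Y_def
      by (rule nn_integral_cong_AE) (use rep_l2_diff[of "X (r m)" "X (r n)"] in auto)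
    also have "\<dots> = ennreal ((norm (X (r m) - X (r n)))\<^sup>2)" by (rule nn_integral_norm_l2)
    also have "\<dots> \<le> ennreal (((1/2) ^ n)\<^sup>2)"
      using N[OF rN[OF that] rN[of n n]] by (intro ennreal_leI power_mono) auto
    also have "((1/2) ^ n)\<^sup>2 = (1/4 :: real) ^ n"
      by (simp add: power2_eq_square power_mult_distrib[symmetric])
    finally show ?thesis .
  qed
  define \<delta> where "\<delta> n t = norm (Y (Suc n) t - Y n t)" for n t
  have dm [measurable]: "\<delta> n \<in> borel_measurable borel" for n unfolding \<delta>_def by measurable
  have "(\<integral>\<^sup>+t. (\<Sum>n. ennreal (2 ^ n * (\<delta> n t)\<^sup>2)) \<partial>lborel) = (\<Sum>n. \<integral>\<^sup>+t. ennreal (2 ^ n * (\<delta> n t)\<^sup>2) \<partial>lborel)"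
    by (rule nn_integral_suminf) simp
  also have "\<dots> \<le> (\<Sum>n. ennreal ((1/2) ^ n))"
  proof (rule suminf_le)
    fix n
    have "(\<integral>\<^sup>+t. ennreal (2 ^ n * (\<delta> n t)\<^sup>2) \<partial>lborel) = ennreal (2 ^ n) * (\<integral>\<^sup>+t. ennreal ((\<delta> n t)\<^sup>2) \<partial>lborel)"
      by (subst nn_integral_cmult[symmetric]) (auto simp: ennreal_mult)
    also have "\<dots> \<le> ennreal (2 ^ n) * ennreal ((1/4) ^ n)"
      using int[of n "Suc n"] by (intro mult_left_mono) (auto simp: \<delta>_def)
    also have "\<dots> = ennreal ((1/2) ^ n)"
      by (simp add: ennreal_mult[symmetric] power_mult_distrib[symmetric])
    finally show "(\<integral>\<^sup>+t. ennreal (2 ^ n * (\<delta> n t)\<^sup>2) \<partial>lborel) \<le> ennreal ((1/2) ^ n)" .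
  qed auto
  also have "\<dots> = ennreal (\<Sum>n. (1/2) ^ n)" by (intro suminf_ennreal2 summable_geometric) auto
  also have "\<dots> < top" by simp
  finally have "AE t in lborel. (\<Sum>n. ennreal (2 ^ n * (\<delta> n t)\<^sup>2)) \<noteq> \<infinity>"
    by (intro nn_integral_PInf_AE) auto
  then have conv: "AE t in lborel. convergent (\<lambda>n. Y n t)"
  proof eventually_elim
    fix t assume "(\<Sum>n. ennreal (2 ^ n * (\<delta> n t)\<^sup>2)) \<noteq> \<infinity>"
    then have "summable (\<lambda>n. 2 ^ n * (\<delta> n t)\<^sup>2)" by (intro summable_suminf_not_top) auto
    then have "summable (\<lambda>n. (1/2) ^ n + 2 ^ n * (\<delta> n t)\<^sup>2)"
      by (intro summable_add summable_geometric) auto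
    then have "summable (\<lambda>n. Y (Suc n) t - Y n t)"
    proof (rule summable_comparison_test')
      fix n :: nat
      define p :: real where "p = 2 ^ n"
      have p: "p \<ge> 1" by (simp add: p_def)
      have "0 \<le> (\<delta> n t * p - 1)\<^sup>2 + \<delta> n t * p" using p by (simp add: \<delta>_def)
      then have "\<delta> n t * p \<le> 1 + p\<^sup>2 * (\<delta> n t)\<^sup>2" by (simp add: power2_diff power_mult_distrib mult_ac)
      then have "\<delta> n t \<le> 1 / p + p * (\<delta> n t)\<^sup>2" using p by (simp add: field_simps power2_eq_square)
      then show "norm (Y (Suc n) t - Y n t) \<le> (1/2) ^ n + 2 ^ n * (\<delta> n t)\<^sup>2"
        by (simp add: \<delta>_def p_def power_divide)
    qed
    then have "(\<lambda>n. Y 0 t + (\<Sum>i<n. Y (Suc i) t - Y i t)) \<longlonglongrightarrow> Y 0 t + (\<Sum>n. Y (Suc n) t - Y n t)"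
      by (intro tendsto_add tendsto_const summable_LIMSEQ)
    moreover have "Y 0 t + (\<Sum>i<n. Y (Suc i) t - Y i t) = Y n t" for n
      by (subst sum_lessThan_telescope) simp
    ultimately show "convergent (\<lambda>n. Y n t)" by (auto simp: convergent_def)
  qed
  define f where "f t = lim (\<lambda>n. Y n t)" for t
  have fm [measurable]: "f \<in> borel_measurable borel" unfolding f_def by measurable
  have lim: "AE t in lborel. (\<lambda>n. Y n t) \<longlonglongrightarrow> f t"
    using conv by eventually_elim (simp add: f_def convergent_LIMSEQ_iff)
  have dist: "(\<integral>\<^sup>+t. ennreal ((norm (f t - Y n t))\<^sup>2) \<partial>lborel) \<le> ennreal ((1/4) ^ n)" for n
  proof -
    have "(\<integral>\<^sup>+t. ennreal ((norm (f t - Y n t))\<^sup>2) \<partial>lborel)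
        = (\<integral>\<^sup>+t. liminf (\<lambda>m. ennreal ((norm (Y m t - Y n t))\<^sup>2)) \<partial>lborel)"
    proof (rule nn_integral_cong_AE, use lim in eventually_elim)
      fix t assume l: "(\<lambda>m. Y m t) \<longlonglongrightarrow> f t"
      have "(\<lambda>m. ennreal ((norm (Y m t - Y n t))\<^sup>2)) \<longlonglongrightarrow> ennreal ((norm (f t - Y n t))\<^sup>2)"
        by (intro tendsto_intros l tendsto_ennrealI)
      then show "ennreal ((norm (f t - Y n t))\<^sup>2) = liminf (\<lambda>m. ennreal ((norm (Y m t - Y n t))\<^sup>2))"
        by (rule lim_imp_Liminf[OF trivial_limit_sequentially, symmetric])
    qed
    also have "\<dots> \<le> liminf (\<lambda>m. \<integral>\<^sup>+t. ennreal ((norm (Y m t - Y n t))\<^sup>2) \<partial>lborel)"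
      by (rule nn_integral_liminf) simp
    also have "\<dots> \<le> ennreal ((1/4) ^ n)"
      using int by (intro Liminf_le) (auto simp: eventually_sequentially)
    finally show ?thesis .
  qed
  have sq: "sq_int (\<lambda>t. f t - Y n t)" for n
    unfolding sq_int_def
    using dist[of n] by (auto intro!: integrableI_bounded simp: order.strict_trans1 ennreal_less_top)
  have "sq_int (\<lambda>t. (f t - Y 0 t) + Y 0 t)" by (rule sq_int_add[OF sq]) (simp add: Y_def)
  then have sf: "sq_int f" by simp
  have le: "norm (l2_of f - X (r n)) \<le> (1/2) ^ n" for n
  proof -
    have eq: "l2_of f - X (r n) = l2_of (\<lambda>t. f t - Y n t)"
      using l2_of_diff[OF sf, of "Y n"] by (simp add: Y_def)
    have "ennreal ((norm (l2_of f - X (r n)))\<^sup>2) = (\<integral>\<^sup>+t. ennreal ((norm (f t - Y n t))\<^sup>2) \<partial>lborel)"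
      unfolding eq power2_norm_l2_of[OF sq]
      by (rule nn_integral_eq_integral[symmetric]) (use sq[of n] in \<open>auto simp: sq_int_def\<close>)
    with dist[of n] have "ennreal ((norm (l2_of f - X (r n)))\<^sup>2) \<le> ennreal ((1/4) ^ n)" by metis
    then have "(norm (l2_of f - X (r n)))\<^sup>2 \<le> (1/4) ^ n" by (subst (asm) ennreal_le_iff) auto
    also have "(1/4 :: real) ^ n = ((1/2) ^ n)\<^sup>2"
      by (simp add: power2_eq_square power_mult_distrib[symmetric])
    finally show ?thesis by (rule power2_le_imp_le) simp
  qed
  have "X \<longlonglongrightarrow> l2_of f"
  proof (rule LIMSEQ_I)
    fix e :: real assume e: "e > 0"
    then obtain n where n: "(1/2) ^ n < e / 2" using real_arch_pow_inv[of "e/2" "1/2"] by auto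
    have "norm (X m - l2_of f) < e" if "m \<ge> N n" for m
    proof -
      have "norm (X m - l2_of f) \<le> norm (X m - X (r n)) + norm (X (r n) - l2_of f)"
        by (metis norm_triangle_ineq diff_add_cancel add_diff_eq)
      also have "\<dots> < e" using N[OF that rN[of n n]] le[of n] n by (simp add: norm_minus_commute)
      finally show ?thesis .
    qed
    then show "\<exists>no. \<forall>m\<ge>no. norm (X m - l2_of f) < e" by blast
  qed
  then show "convergent X" by (rule convergentI)
qed

section \<open>Density of the test functions\<close>

lemma l2_of_tendsto:
  assumes \<phi>: "\<And>n. sq_int (\<phi> n)" and \<psi>: "sq_int \<psi>" and g: "integrable lborel g"
    and lim: "\<And>t. (\<lambda>n. \<phi> n t) \<longlonglongrightarrow> \<psi> t" and le: "\<And>n t. (norm (\<phi> n t - \<psi> t))\<^sup>2 \<le> g t"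
  shows "(\<lambda>n. l2_of (\<phi> n)) \<longlonglongrightarrow> l2_of \<psi>"
proof -
  have "(\<lambda>n. \<integral>t. (norm (\<phi> n t - \<psi> t))\<^sup>2 \<partial>lborel) \<longlonglongrightarrow> integral\<^sup>L lborel (\<lambda>t::real. 0 :: real)"
  proof (rule integral_dominated_convergence[OF _ _ g])
    show "AE t in lborel. (\<lambda>n. (norm (\<phi> n t - \<psi> t))\<^sup>2) \<longlonglongrightarrow> 0"
    proof (rule AE_I2)
      fix t
      have "(\<lambda>n. (norm (\<phi> n t - \<psi> t))\<^sup>2) \<longlonglongrightarrow> (norm (\<psi> t - \<psi> t))\<^sup>2" by (intro tendsto_intros lim)
      then show "(\<lambda>n. (norm (\<phi> n t - \<psi> t))\<^sup>2) \<longlonglongrightarrow> 0" by simp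
    qed
  qed (use sq_int_measurable[OF \<phi>] sq_int_measurable[OF \<psi>] le in
      \<open>auto intro!: borel_measurable_power borel_measurable_norm borel_measurable_diff\<close>)
  moreover have "(norm (l2_of (\<phi> n) - l2_of \<psi>))\<^sup>2 = (\<integral>t. (norm (\<phi> n t - \<psi> t))\<^sup>2 \<partial>lborel)" for n
    using power2_norm_l2_of[OF sq_int_diff[OF \<phi> \<psi>], of n] by (simp add: l2_of_diff \<phi> \<psi>)
  ultimately have "(\<lambda>n. (norm (l2_of (\<phi> n) - l2_of \<psi>))\<^sup>2) \<longlonglongrightarrow> 0" by simp
  from tendsto_real_sqrt[OF this] have "(\<lambda>n. norm (l2_of (\<phi> n) - l2_of \<psi>)) \<longlonglongrightarrow> 0" by simp
  then show ?thesis by (metis LIM_zero_cancel tendsto_norm_zero_iff)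
qed

lemma integrable_indicator_Icc [simp]: "integrable lborel (indicator {a..b::real} :: real \<Rightarrow> real)"
  using borel_integrable_compact[of "{a..b}" "\<lambda>_. 1::real"] by simp

lemma sq_int_bounded_support:
  assumes [measurable]: "f \<in> borel_measurable borel" and "\<And>t. norm (f t) \<le> K" and "\<And>t. t \<notin> {-R..R} \<Longrightarrow> f t = 0"
  shows "sq_int f"
proof (rule sq_int_bound)
  show "integrable lborel (\<lambda>t. K\<^sup>2 * indicator {-R..R} t :: real)" by simp
  show "AE t in lborel. (norm (f t))\<^sup>2 \<le> K\<^sup>2 * indicator {- R..R} t"
  proof (rule AE_I2)
    fix t
    show "(norm (f t))\<^sup>2 \<le> K\<^sup>2 * indicator {- R..R} t"
      using assms(2)[of t] assms(3)[of t] by (cases "t \<in> {-R..R}") (auto intro: power_mono)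
  qed
qed simp

lemma sq_int_indicator:
  assumes [measurable]: "A \<in> sets borel" and "A \<subseteq> {-R..R}"
  shows "sq_int (\<lambda>t. indicator A t *\<^sub>R a)"
  by (rule sq_int_bounded_support[where K = "norm a" and R = R]) (use assms(2) in \<open>auto simp: indicator_def\<close>)

lemma sq_int_test_function: "test_function \<phi> \<Longrightarrow> sq_int \<phi>"
  by (simp add: sq_int_ccont test_function_ccont)

lemma test_function_0: "test_function (\<lambda>_. 0 :: 'a::separable_chilbert)"
  using test_function_linear[OF bounded_linear_zero test_function_bump[of 0 1 0]] by simp

text \<open>The bumps with vector coefficients are total: a closed subspace that contains them all contains
  the indicator functions of bounded intervals, hence of bounded Borel sets by Dynkin's theorem, hence
  all limits of simple functions.\<close>

context
  fixes V :: "'a::separable_chilbert l2 set"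
  assumes V_closed: "closed V" and V_0: "0 \<in> V"
    and V_add: "\<And>u v. u \<in> V \<Longrightarrow> v \<in> V \<Longrightarrow> u + v \<in> V"
    and V_scaleR: "\<And>r v. v \<in> V \<Longrightarrow> r *\<^sub>R v \<in> V"
    and V_bump: "\<And>c d n a. l2_of (\<lambda>t. bump c d n t *\<^sub>R a) \<in> V"
begin

lemma V_diff: "u \<in> V \<Longrightarrow> v \<in> V \<Longrightarrow> u - v \<in> V"
  using V_add[OF _ V_scaleR, of u v "-1"] by simp

lemma V_limit: "(\<And>n. x n \<in> V) \<Longrightarrow> x \<longlonglongrightarrow> u \<Longrightarrow> u \<in> V"
  using V_closed closed_sequentially by blast

lemma interval_in_V: "l2_of (\<lambda>t. indicator {c<..<d} t *\<^sub>R a) \<in> V"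
proof (rule V_limit)
  define R where "R = max \<bar>c\<bar> \<bar>d\<bar>"
  have sub: "{c<..<d} \<subseteq> {-R..R}" by (auto simp: R_def)
  have tf: "test_function (\<lambda>t. bump c d n t *\<^sub>R a)" for n
    by (rule test_function_linear[OF bounded_linear_scaleR_left test_function_bump])
  show "l2_of (\<lambda>t. bump c d n t *\<^sub>R a) \<in> V" for n by (rule V_bump)
  show "(\<lambda>n. l2_of (\<lambda>t. bump c d n t *\<^sub>R a)) \<longlonglongrightarrow> l2_of (\<lambda>t. indicator {c<..<d} t *\<^sub>R a)"
  proof (rule l2_of_tendsto)
    show "integrable lborel (\<lambda>t. (norm a)\<^sup>2 * indicator {-R..R} t :: real)" by simp
    show "(norm (bump c d n t *\<^sub>R a - indicator {c<..<d} t *\<^sub>R a))\<^sup>2 \<le> (norm a)\<^sup>2 * indicator {-R..R} t" for n t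
    proof (cases "t \<in> {c<..<d}")
      case True
      have "norm (bump c d n t *\<^sub>R a - indicator {c<..<d} t *\<^sub>R a) = \<bar>bump c d n t - 1\<bar> * norm a"
        using True norm_scaleR[of "bump c d n t - 1" a] by (simp add: scaleR_diff_left)
      also have "\<dots> \<le> 1 * norm a"
        using bump_nonneg[of c d n t] bump_le_1[of c d n t] by (intro mult_right_mono) auto
      finally have "(norm (bump c d n t *\<^sub>R a - indicator {c<..<d} t *\<^sub>R a))\<^sup>2 \<le> (norm a)\<^sup>2"
        by (intro power_mono) auto
      with True sub show ?thesis by auto
    qed (simp add: bump_outside)
  qed (auto intro!: sq_int_test_function tf sq_int_indicator[OF _ sub] tendsto_scaleR bump_tendsto_indicator)
qed

lemma indicator_in_V:
  assumes A: "A \<in> sets borel"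
  shows "l2_of (\<lambda>t. indicator (A \<inter> {-R<..<R}) t *\<^sub>R a) \<in> V"
proof -
  define G where "G = range (\<lambda>(c, d). {c<..<d::real})"
  have borel: "sets borel = sigma_sets UNIV G"
    unfolding G_def box_real(1)[symmetric] borel_eq_box by (rule sets_measure_of) auto
  have sub: "A \<inter> {-R<..<R} \<subseteq> {-R..R}" for A by auto
  have inter: "{c<..<d} \<inter> {c'<..<d'} = {max c c'<..<min d d'}" for c d c' d' :: real by auto
  have "{c<..<d} \<inter> {c'<..<d'} \<in> G" for c d c' d'
    unfolding inter G_def by (rule image_eqI[of _ _ "(max c c', min d d')"]) auto
  then have "Int_stable G" by (auto simp: Int_stable_def G_def)
  moreover have "G \<subseteq> Pow UNIV" by simp
  moreover have "A \<in> sigma_sets UNIV G" using A borel by simp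
  ultimately show ?thesis
  proof (induction A rule: sigma_sets_induct_disjoint)
    case (basic A)
    then show ?case using interval_in_V by (auto simp: G_def inter)
  next
    case empty
    then show ?case by (simp add: l2_of_0 V_0)
  next
    case (compl A)
    have A: "A \<in> sets borel" using compl borel by simp
    have "(\<lambda>t. indicator ((UNIV - A) \<inter> {-R<..<R}) t *\<^sub>R a)
        = (\<lambda>t. indicator {-R<..<R} t *\<^sub>R a - indicator (A \<inter> {-R<..<R}) t *\<^sub>R a)"
      by (auto simp: indicator_def fun_eq_iff)
    moreover have "sq_int (\<lambda>t. indicator {-R<..<R} t *\<^sub>R a)" "sq_int (\<lambda>t. indicator (A \<inter> {-R<..<R}) t *\<^sub>R a)"
      using A by (auto intro!: sq_int_indicator[where R = R])
    ultimately show ?case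
      using V_diff[OF interval_in_V compl.IH] by (simp add: l2_of_diff)
  next
    case (union A)
    have A: "A i \<in> sets borel" for i using union borel by auto
    define B where "B n = (\<Union>i<n. A i)" for n :: nat
    have B: "B n \<in> sets borel" for n using A by (auto simp: B_def)
    have P: "l2_of (\<lambda>t. indicator (B n \<inter> {-R<..<R}) t *\<^sub>R a) \<in> V" for n
    proof (induction n)
      case 0
      then show ?case by (simp add: B_def l2_of_0 V_0)
    next
      case (Suc n)
      have "A n \<inter> B n = {}" using union.hyps(1)
        by (auto simp: B_def disjoint_family_on_def) (metis disjoint_iff less_irrefl)
      then have "(\<lambda>t. indicator (B (Suc n) \<inter> {-R<..<R}) t *\<^sub>R a)
        = (\<lambda>t. indicator (B n \<inter> {-R<..<R}) t *\<^sub>R a + indicator (A n \<inter> {-R<..<R}) t *\<^sub>R a)"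
        by (auto simp: indicator_def fun_eq_iff B_def lessThan_Suc)
      moreover have "sq_int (\<lambda>t. indicator (B n \<inter> {-R<..<R}) t *\<^sub>R a)"
          "sq_int (\<lambda>t. indicator (A n \<inter> {-R<..<R}) t *\<^sub>R a)"
        using A B by (auto intro!: sq_int_indicator[OF _ sub])
      ultimately show ?case
        using Suc union.IH by (simp add: l2_of_add V_add)
    qed
    have "(\<lambda>n. l2_of (\<lambda>t. indicator (B n \<inter> {-R<..<R}) t *\<^sub>R a))
        \<longlonglongrightarrow> l2_of (\<lambda>t. indicator ((\<Union>i. A i) \<inter> {-R<..<R}) t *\<^sub>R a)"
    proof (rule l2_of_tendsto)
      show "integrable lborel (\<lambda>t. (norm a)\<^sup>2 * indicator {-R..R} t :: real)" by simp
      show "(norm (indicator (B n \<inter> {-R<..<R}) t *\<^sub>R a - indicator ((\<Union>i. A i) \<inter> {-R<..<R}) t *\<^sub>R a))\<^sup>2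
          \<le> (norm a)\<^sup>2 * indicator {-R..R} t" for n t
        by (auto simp: indicator_def B_def)
      show "(\<lambda>n. indicator (B n \<inter> {-R<..<R}) t *\<^sub>R a) \<longlonglongrightarrow> indicator ((\<Union>i. A i) \<inter> {-R<..<R}) t *\<^sub>R a" for t
      proof (cases "t \<in> (\<Union>i. A i)")
        case True
        then obtain i where "t \<in> A i" by blast
        then have "t \<in> B n" if "n > i" for n using that by (auto simp: B_def)
        then have "\<forall>\<^sub>F n in sequentially. indicator ((\<Union>i. A i) \<inter> {-R<..<R}) t *\<^sub>R a = indicator (B n \<inter> {-R<..<R}) t *\<^sub>R a"
          using True by (auto simp: eventually_sequentially indicator_def intro!: exI[of _ "Suc i"])
        then show ?thesis by (rule Lim_transform_eventually[OF tendsto_const])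
      qed (auto simp: B_def)
    qed (use A B in \<open>auto intro!: sq_int_indicator[OF _ sub]\<close>)
    then show ?case by (rule V_limit[OF P])
  qed
qed

theorem bumps_total: "V = UNIV"
proof -
  have "v \<in> V" for v :: "'a l2"
  proof -
    define f where "f = rep_l2 v"
    have sf: "sq_int f" and fm: "f \<in> borel_measurable lborel" by (simp_all add: f_def)
    from borel_measurable_implies_sequence_metric[OF fm, of 0] obtain F where
      F: "\<And>i. simple_function lborel (F i)" "\<And>t. (\<lambda>i. F i t) \<longlonglongrightarrow> f t" "\<And>i t. norm (F i t) \<le> 2 * norm (f t)"
      by auto
    define I where "I n = {- real n<..<real n}" for n
    define \<phi> where "\<phi> n t = indicator (I n) t *\<^sub>R F n t" for n t
    have Fm: "F n \<in> borel_measurable borel" for n using borel_measurable_simple_function[OF F(1)] by simp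
    have \<phi>le: "norm (\<phi> n t) \<le> 2 * norm (f t)" for n t using F(3)[of n t] by (simp add: \<phi>_def indicator_def)
    have sphi: "sq_int (\<phi> n)" for n
    proof (rule sq_int_bound)
      show "\<phi> n \<in> borel_measurable borel" unfolding \<phi>_def I_def using Fm by measurable
      show "integrable lborel (\<lambda>t. 4 * (norm (f t))\<^sup>2)" using sf by (simp add: sq_int_def)
      show "AE t in lborel. (norm (\<phi> n t))\<^sup>2 \<le> 4 * (norm (f t))\<^sup>2"
        using power_mono[OF \<phi>le norm_ge_zero, of _ _ 2] by (simp add: power_mult_distrib)
    qed
    have "l2_of (\<phi> n) \<in> V" for n
    proof -
      define A where "A y = F n -` {y}" for y
      have fin: "finite (range (F n))" using F(1)[of n] by (simp add: simple_function_def)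
      have A: "A y \<in> sets borel" for y
        using measurable_sets[OF Fm, of "{y}" n] by (simp add: A_def)
      have sum: "\<phi> n = (\<lambda>t. \<Sum>y\<in>range (F n). indicator (A y \<inter> I n) t *\<^sub>R y)"
      proof
        fix t
        have "(\<Sum>y\<in>range (F n). indicator (A y \<inter> I n) t *\<^sub>R y) = (\<Sum>y\<in>range (F n). if y = F n t then indicator (I n) t *\<^sub>R y else 0)"
          by (intro sum.cong) (auto simp: A_def indicator_def)
        then show "\<phi> n t = (\<Sum>y\<in>range (F n). indicator (A y \<inter> I n) t *\<^sub>R y)"
          using fin by (simp add: \<phi>_def)
      qed
      have "sq_int (\<lambda>t. \<Sum>y\<in>Z. indicator (A y \<inter> I n) t *\<^sub>R y) \<and>
          l2_of (\<lambda>t. \<Sum>y\<in>Z. indicator (A y \<inter> I n) t *\<^sub>R y) \<in> V" if "finite Z" for Z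
        using that
      proof (induction Z)
        case empty
        then show ?case by (simp add: sq_int_0 l2_of_0 V_0)
      next
        case (insert y Z)
        have "sq_int (\<lambda>t. indicator (A y \<inter> I n) t *\<^sub>R y)"
          by (rule sq_int_indicator[where R = "real n"]) (use A in \<open>auto simp: I_def\<close>)
        moreover have "l2_of (\<lambda>t. indicator (A y \<inter> I n) t *\<^sub>R y) \<in> V"
          unfolding I_def by (rule indicator_in_V[OF A])
        ultimately show ?case
          using insert unfolding sum.insert[OF insert.hyps(1,2)]
          by (auto simp: l2_of_add simp del: sum_indicator_scaleR intro!: sq_int_add V_add)
      qed
      then show ?thesis unfolding sum using fin by blast
    qed
    moreover have "(\<lambda>n. l2_of (\<phi> n)) \<longlonglongrightarrow> l2_of f"
    proof (rule l2_of_tendsto[OF sphi sf])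
      show "integrable lborel (\<lambda>t. 9 * (norm (f t))\<^sup>2)" using sf by (simp add: sq_int_def)
      show "(norm (\<phi> n t - f t))\<^sup>2 \<le> 9 * (norm (f t))\<^sup>2" for n t
      proof -
        have "norm (\<phi> n t - f t) \<le> 3 * norm (f t)"
          using norm_triangle_ineq4[of "\<phi> n t" "f t"] \<phi>le[of n t] by linarith
        from power_mono[OF this norm_ge_zero, of 2] show ?thesis by (simp add: power_mult_distrib)
      qed
      show "(\<lambda>n. \<phi> n t) \<longlonglongrightarrow> f t" for t
      proof -
        obtain k where k: "\<bar>t\<bar> < real k" using reals_Archimedean2 by blast
        have "\<forall>\<^sub>F n in sequentially. F n t = \<phi> n t"
          using k by (auto simp: eventually_sequentially \<phi>_def I_def indicator_def abs_less_iff intro!: exI[of _ k])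
        then show ?thesis by (rule Lim_transform_eventually[OF F(2)])
      qed
    qed
    ultimately show ?thesis using V_limit by (fastforce simp: f_def)
  qed
  then show ?thesis by blast
qed

end

definition test_l2 :: "'a::separable_chilbert l2 set" where
  "test_l2 = {l2_of \<phi> | \<phi>. test_function \<phi>}"

lemma closure_test_l2_add: "u \<in> closure test_l2 \<Longrightarrow> v \<in> closure test_l2 \<Longrightarrow> u + v \<in> closure test_l2"
proof -
  assume "u \<in> closure test_l2" "v \<in> closure test_l2"
  then obtain x y where x: "\<And>n. x n \<in> test_l2" "x \<longlonglongrightarrow> u" and y: "\<And>n. y n \<in> test_l2" "y \<longlonglongrightarrow> v"
    by (auto simp: closure_sequential)
  have "x n + y n \<in> test_l2" for n
  proof -
    obtain f g where f: "x n = l2_of f" "test_function f" and g: "y n = l2_of g" "test_function g"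
      using x(1)[of n] y(1)[of n] by (auto simp: test_l2_def)
    have "x n + y n = l2_of (\<lambda>t. f t + g t)" using f g by (simp add: l2_of_add sq_int_test_function)
    with test_function_add[OF f(2) g(2)] show ?thesis by (auto simp: test_l2_def)
  qed
  with tendsto_add[OF x(2) y(2)] show ?thesis
    unfolding closure_sequential by (intro exI[of _ "\<lambda>n. x n + y n"]) simp
qed

lemma closure_test_l2_scaleR: "u \<in> closure test_l2 \<Longrightarrow> r *\<^sub>R u \<in> closure test_l2"
proof -
  assume "u \<in> closure test_l2"
  then obtain x where x: "\<And>n. x n \<in> test_l2" "x \<longlonglongrightarrow> u"
    by (auto simp: closure_sequential)
  have "r *\<^sub>R x n \<in> test_l2" for n
  proof -
    obtain f where f: "x n = l2_of f" "test_function f"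
      using x(1)[of n] by (auto simp: test_l2_def)
    have "r *\<^sub>R x n = l2_of (\<lambda>t. r *\<^sub>R f t)"
      using f by (simp add: scaleR_scaleC l2_of_scaleC sq_int_test_function)
    with test_function_linear[OF bounded_linear_scaleR_right f(2)] show ?thesis by (auto simp: test_l2_def)
  qed
  with tendsto_scaleR[OF tendsto_const x(2), of r] show ?thesis
    unfolding closure_sequential by (intro exI[of _ "\<lambda>n. r *\<^sub>R x n"]) simp
qed

lemma closure_test_l2_0: "0 \<in> closure test_l2"
  using test_function_0 closure_subset l2_of_0 by (force simp: test_l2_def)

theorem test_l2_dense: "closure test_l2 = (UNIV :: 'a::separable_chilbert l2 set)"
proof (rule bumps_total)
  fix c d n and a :: 'a
  have "test_function (\<lambda>t. bump c d n t *\<^sub>R a)"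
    by (rule test_function_linear[OF bounded_linear_scaleR_left test_function_bump])
  then show "l2_of (\<lambda>t. bump c d n t *\<^sub>R a) \<in> closure test_l2"
    using closure_subset by (force simp: test_l2_def)
qed (auto intro: closure_test_l2_0 closure_test_l2_add closure_test_l2_scaleR)

section \<open>The Plancherel theorem\<close>

declare cinner.zero_left [simp] cinner.zero_right [simp]

text \<open>This is the characteristic function of the standard normal distribution, rescaled.\<close>

lemma gaussian_fourier_integral:
  assumes \<epsilon>: "\<epsilon> > 0"
  shows "(\<integral>x. cis (u * x) * complex_of_real (exp (- (\<epsilon> * x)\<^sup>2 / 2)) \<partial>lborel) = sqrt (2 * pi) / \<epsilon> * complex_of_real (exp (- (u / \<epsilon>)\<^sup>2 / 2))"
proof -
  have "complex_of_real (exp (- (u / \<epsilon>)\<^sup>2 / 2)) = char std_normal_distribution (u / \<epsilon>)"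
    by (simp add: char_std_normal_distribution)
  also have "\<dots> = (\<integral>y. std_normal_density y *\<^sub>R iexp (u / \<epsilon> * y) \<partial>lborel)"
    unfolding char_def by (subst integral_density) auto
  also have "\<dots> = \<bar>\<epsilon>\<bar> *\<^sub>R (\<integral>x. std_normal_density (0 + \<epsilon> * x) *\<^sub>R iexp (u / \<epsilon> * (0 + \<epsilon> * x)) \<partial>lborel)"
    using \<epsilon> by (intro lborel_integral_real_affine) simp
  also have "(\<lambda>x. std_normal_density (0 + \<epsilon> * x) *\<^sub>R iexp (u / \<epsilon> * (0 + \<epsilon> * x)))
      = (\<lambda>x. complex_of_real (1 / sqrt (2 * pi)) * (cis (u * x) * complex_of_real (exp (- (\<epsilon> * x)\<^sup>2 / 2))))"
    using \<epsilon> by (auto simp: fun_eq_iff std_normal_density_def cis_conv_exp scaleR_conv_of_real mult_ac exp_of_real)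
  finally have "complex_of_real (exp (- (u / \<epsilon>)\<^sup>2 / 2)) =
      \<epsilon> * (complex_of_real (1 / sqrt (2 * pi)) * (\<integral>x. cis (u * x) * complex_of_real (exp (- (\<epsilon> * x)\<^sup>2 / 2)) \<partial>lborel))"
    using \<epsilon> by (simp add: scaleR_conv_of_real)
  then show ?thesis using \<epsilon> by (simp add: field_simps)
qed

lemma integrable_gaussian:
  assumes "\<epsilon> > 0"
  shows "integrable lborel (\<lambda>x::real. exp (- (\<epsilon> * x)\<^sup>2 / 2))"
proof -
  have "integrable lborel (\<lambda>x. sqrt (2 * pi) * std_normal_density (0 + \<epsilon> * x))"
    using assms by (intro integrable_mult_right lborel_integrable_real_affine integrable_normal_density) auto
  then show ?thesis by (simp add: std_normal_density_def)
qed

lemma measurable_cis [measurable (raw)]: "f \<in> borel_measurable M \<Longrightarrow> (\<lambda>x. cis (f x)) \<in> borel_measurable M"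
  unfolding cis_conv_exp by measurable

lemma continuous_on_cis' [continuous_intros]: "continuous_on A f \<Longrightarrow> continuous_on A (\<lambda>x. cis (f x))"
  unfolding cis_conv_exp by (intro continuous_intros)

text \<open>Fourier inversion at the origin. The Gaussian factor makes the double integral absolutely convergent;
  after exchanging the integrals it has become an approximate identity, which concentrates \<open>K\<close> at the
  origin. The sign \<open>s\<close> is \<open>1\<close> or \<open>-1\<close>.\<close>

lemma gaussian_inversion_at_0:
  fixes K :: "real \<Rightarrow> complex"
  assumes K: "ccont K" and s: "s * s = 1"
  shows "(\<lambda>n. \<integral>x. (\<integral>u. cis (- (s * x * u)) * K u \<partial>lborel) * complex_of_real (exp (- (inverse (Suc n) * x)\<^sup>2 / 2)) \<partial>lborel)
     \<longlonglongrightarrow> 2 * pi * K 0"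
proof -
  obtain C where C: "\<And>u. cmod (K u) \<le> C" using ccont_bounded[OF K] by blast
  have [measurable]: "K \<in> borel_measurable borel" by (rule ccont_measurable[OF K])
  have Kint: "integrable lborel K" by (rule ccont_integrable[OF K])
  have eq: "(\<integral>x. (\<integral>u. cis (- (s * x * u)) * K u \<partial>lborel) * complex_of_real (exp (- (\<epsilon> * x)\<^sup>2 / 2)) \<partial>lborel)
      = sqrt (2 * pi) * (\<integral>v. complex_of_real (exp (- v\<^sup>2 / 2)) * K (\<epsilon> * v) \<partial>lborel)" if \<epsilon>: "\<epsilon> > 0" for \<epsilon>
  proof -
    define g where "g x = exp (- (\<epsilon> * x)\<^sup>2 / 2)" for x :: real
    have g: "integrable lborel g" unfolding g_def by (rule integrable_gaussian[OF \<epsilon>])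
    have gm [measurable]: "g \<in> borel_measurable borel" unfolding g_def by measurable
    have gpos: "g x > 0" for x by (simp add: g_def)
    define f where "f x u = cis (- (s * x * u)) * K u * g x" for x u
    have fn: "cmod (f x u) = cmod (K u) * g x" for x u
      using gpos[of x] by (simp add: f_def norm_mult)
    have fm: "f x \<in> borel_measurable borel" for x unfolding f_def by measurable
    have "integrable (lborel \<Otimes>\<^sub>M lborel) (\<lambda>(x, u). f x u)"
    proof (rule lborel_pair.Fubini_integrable)
      show "(\<lambda>(x, u). f x u) \<in> borel_measurable (lborel \<Otimes>\<^sub>M lborel)" unfolding f_def by measurable
      show "integrable lborel (\<lambda>x. \<integral>u. norm (case (x, u) of (x, u) \<Rightarrow> f x u) \<partial>lborel)"
        using g by (simp add: fn)
      show "AE x in lborel. integrable lborel (\<lambda>u. case (x, u) of (x, u) \<Rightarrow> f x u)"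
      proof (rule AE_I2)
        fix x
        have "integrable lborel (\<lambda>u. cmod (K u) * g x)" using Kint by simp
        then show "integrable lborel (\<lambda>u. case (x, u) of (x, u) \<Rightarrow> f x u)"
          by (rule Bochner_Integration.integrable_bound)
             (simp_all add: fn fm gpos less_imp_le abs_mult)
      qed
    qed
    from lborel_pair.Fubini_integral[OF this]
    have "(\<integral>x. (\<integral>u. f x u \<partial>lborel) \<partial>lborel) = (\<integral>u. (\<integral>x. f x u \<partial>lborel) \<partial>lborel)" by simp
    also have "(\<lambda>u. \<integral>x. f x u \<partial>lborel) = (\<lambda>u. K u * (sqrt (2 * pi) / \<epsilon> * complex_of_real (exp (- (u / \<epsilon>)\<^sup>2 / 2))))"
    proof
      fix u
      have "(\<integral>x. f x u \<partial>lborel) = (\<integral>x. K u * (cis ((- s * u) * x) * g x) \<partial>lborel)"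
        by (simp add: f_def mult_ac)
      also have "\<dots> = K u * (\<integral>x. cis ((- s * u) * x) * complex_of_real (exp (- (\<epsilon> * x)\<^sup>2 / 2)) \<partial>lborel)"
        by (simp add: g_def)
      also have "(- s * u / \<epsilon>)\<^sup>2 = (u / \<epsilon>)\<^sup>2"
        using s by (simp add: power2_eq_square mult_ac)
      then have "K u * (\<integral>x. cis ((- s * u) * x) * complex_of_real (exp (- (\<epsilon> * x)\<^sup>2 / 2)) \<partial>lborel)
          = K u * (sqrt (2 * pi) / \<epsilon> * complex_of_real (exp (- (u / \<epsilon>)\<^sup>2 / 2)))"
        by (subst gaussian_fourier_integral[OF \<epsilon>]) simp
      finally show "(\<integral>x. f x u \<partial>lborel) = K u * (sqrt (2 * pi) / \<epsilon> * complex_of_real (exp (- (u / \<epsilon>)\<^sup>2 / 2)))" .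
    qed
    also have "(\<integral>u. K u * (sqrt (2 * pi) / \<epsilon> * complex_of_real (exp (- (u / \<epsilon>)\<^sup>2 / 2))) \<partial>lborel)
        = \<bar>\<epsilon>\<bar> *\<^sub>R (\<integral>v. K (0 + \<epsilon> * v) * (sqrt (2 * pi) / \<epsilon> * complex_of_real (exp (- ((0 + \<epsilon> * v) / \<epsilon>)\<^sup>2 / 2))) \<partial>lborel)"
      using \<epsilon> by (intro lborel_integral_real_affine) simp
    also have "(\<lambda>v. K (0 + \<epsilon> * v) * (sqrt (2 * pi) / \<epsilon> * complex_of_real (exp (- ((0 + \<epsilon> * v) / \<epsilon>)\<^sup>2 / 2))))
        = (\<lambda>v. complex_of_real (sqrt (2 * pi) / \<epsilon>) * (complex_of_real (exp (- v\<^sup>2 / 2)) * K (\<epsilon> * v)))"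
      using \<epsilon> by (auto simp: fun_eq_iff)
    also have "\<bar>\<epsilon>\<bar> *\<^sub>R (\<integral>v. complex_of_real (sqrt (2 * pi) / \<epsilon>) * (complex_of_real (exp (- v\<^sup>2 / 2)) * K (\<epsilon> * v)) \<partial>lborel)
        = sqrt (2 * pi) * (\<integral>v. complex_of_real (exp (- v\<^sup>2 / 2)) * K (\<epsilon> * v) \<partial>lborel)"
      unfolding integral_mult_right_zero using \<epsilon> by (simp add: scaleR_conv_of_real)
    finally show ?thesis by (simp add: f_def g_def)
  qed
  have "(\<lambda>n. \<integral>v. complex_of_real (exp (- v\<^sup>2 / 2)) * K (inverse (Suc n) * v) \<partial>lborel)
      \<longlonglongrightarrow> (\<integral>v. complex_of_real (exp (- v\<^sup>2 / 2)) * K 0 \<partial>lborel)"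
  proof (rule integral_dominated_convergence)
    show "integrable lborel (\<lambda>v. exp (- v\<^sup>2 / 2) * C)" using integrable_gaussian[of 1] by simp
    show "AE v in lborel. (\<lambda>n. complex_of_real (exp (- v\<^sup>2 / 2)) * K (inverse (Suc n) * v))
        \<longlonglongrightarrow> complex_of_real (exp (- v\<^sup>2 / 2)) * K 0"
    proof (rule AE_I2)
      fix v :: real
      have "(\<lambda>n. inverse (real (Suc n)) * v) \<longlonglongrightarrow> 0 * v"
        by (intro tendsto_mult_right LIMSEQ_inverse_real_of_nat)
      moreover have "isCont K 0" using K by (simp add: ccont_def continuous_on_eq_continuous_at)
      ultimately have "(\<lambda>n. K (inverse (real (Suc n)) * v)) \<longlonglongrightarrow> K 0"
        using isCont_tendsto_compose[of 0 K] by simp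
      then show "(\<lambda>n. complex_of_real (exp (- v\<^sup>2 / 2)) * K (inverse (Suc n) * v))
        \<longlonglongrightarrow> complex_of_real (exp (- v\<^sup>2 / 2)) * K 0" by (intro tendsto_mult_left)
    qed
    show "AE v in lborel. norm (complex_of_real (exp (- v\<^sup>2 / 2)) * K (inverse (Suc n) * v)) \<le> exp (- v\<^sup>2 / 2) * C" for n
      using C by (simp add: norm_mult del: of_nat_Suc)
  qed simp_all
  moreover have "(\<integral>v. complex_of_real (exp (- v\<^sup>2 / 2)) * K 0 \<partial>lborel) = sqrt (2 * pi) * K 0"
    using gaussian_fourier_integral[of 1 0] by simp
  ultimately have "(\<lambda>n. sqrt (2 * pi) * (\<integral>v. complex_of_real (exp (- v\<^sup>2 / 2)) * K (inverse (Suc n) * v) \<partial>lborel))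
      \<longlonglongrightarrow> sqrt (2 * pi) * (sqrt (2 * pi) * K 0)"
    by (auto intro: tendsto_mult_left)
  moreover have "complex_of_real (sqrt (2 * pi)) * (sqrt (2 * pi) * K 0) = 2 * pi * K 0"
    by (simp add: mult.assoc[symmetric] of_real_mult[symmetric] del: of_real_mult)
  ultimately show ?thesis by (subst eq) auto
qed

lemma integrable_cont_compact2:
  fixes f :: "real \<times> real \<Rightarrow> complex"
  assumes c: "continuous_on UNIV f" and R: "\<And>x y. R < \<bar>x\<bar> \<or> R < \<bar>y\<bar> \<Longrightarrow> f (x, y) = 0"
  shows "integrable (lborel \<Otimes>\<^sub>M lborel) f"
proof -
  have "integrable lborel (\<lambda>p. indicator ({-R..R} \<times> {-R..R}) p *\<^sub>R f p)"
    by (rule borel_integrable_compact) (auto intro: compact_Times continuous_on_subset[OF c])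
  also have "(\<lambda>p. indicator ({-R..R} \<times> {-R..R}) p *\<^sub>R f p) = f"
  proof
    fix p :: "real \<times> real"
    obtain x y where p: "p = (x, y)" by (cases p)
    show "indicator ({-R..R} \<times> {-R..R}) p *\<^sub>R f p = f p"
      using R[of x y] by (cases "R < \<bar>x\<bar> \<or> R < \<bar>y\<bar>") (auto simp: p indicator_def abs_le_iff not_less)
  qed
  finally show ?thesis by (simp add: lborel_prod)
qed

lemma fubini_cont_compact:
  fixes f :: "real \<Rightarrow> real \<Rightarrow> complex"
  assumes "continuous_on UNIV (\<lambda>p. f (fst p) (snd p))" and "\<And>x y. R < \<bar>x\<bar> \<or> R < \<bar>y\<bar> \<Longrightarrow> f x y = 0"
  shows "(\<integral>x. \<integral>y. f x y \<partial>lborel \<partial>lborel) = (\<integral>y. \<integral>x. f x y \<partial>lborel \<partial>lborel)"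
  using lborel_pair.Fubini_integral[of f, symmetric]
    integrable_cont_compact2[of "\<lambda>p. f (fst p) (snd p)" R] assms
  by (simp add: split_beta')

text \<open>For \<open>s = 1\<close> this is the Fourier transform, for \<open>s = -1\<close> the inverse transform. The two are treated
  together because they turn out to be adjoint to each other.\<close>

definition fourier_int :: "real \<Rightarrow> (real \<Rightarrow> 'a::separable_chilbert) \<Rightarrow> real \<Rightarrow> 'a" where
  "fourier_int s \<phi> x = (1 / sqrt (2 * pi)) *\<^sub>R (\<integral>y. cis (- (s * x * y)) *\<^sub>C \<phi> y \<partial>lborel)"

lemma ccont_from_zeros:
  "ccont f \<Longrightarrow> continuous_on UNIV g \<Longrightarrow> (\<And>t. f t = 0 \<Longrightarrow> g t = 0) \<Longrightarrow> ccont g"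
  unfolding ccont_def by blast

lemma ccont_cis_scaleC:
  fixes \<phi> :: "real \<Rightarrow> 'a::complex_inner"
  shows "ccont \<phi> \<Longrightarrow> ccont (\<lambda>y. cis (- (s * x * y)) *\<^sub>C \<phi> y)"
proof (rule ccont_from_zeros[of \<phi>])
  assume "ccont \<phi>"
  then have "continuous_on UNIV \<phi>" by (simp add: ccont_def)
  then show "continuous_on UNIV (\<lambda>y. cis (- (s * x * y)) *\<^sub>C \<phi> y)"
    by (intro scaleC.continuous_on continuous_intros)
qed simp_all

lemma ccont_add: "ccont f \<Longrightarrow> ccont g \<Longrightarrow> ccont (\<lambda>t. f t + g t)"
proof -
  assume f: "ccont f" and g: "ccont g"
  obtain R R' where "\<And>t. R < \<bar>t\<bar> \<Longrightarrow> f t = 0" "\<And>t. R' < \<bar>t\<bar> \<Longrightarrow> g t = 0"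
    using f g by (auto simp: ccont_def)
  then have "\<forall>t. max R R' < \<bar>t\<bar> \<longrightarrow> f t + g t = 0" by simp
  moreover have "continuous_on UNIV (\<lambda>t. f t + g t)" using f g by (auto simp: ccont_def intro: continuous_intros)
  ultimately show ?thesis unfolding ccont_def by blast
qed

lemma ccont_scaleC:
  fixes f :: "real \<Rightarrow> 'a::complex_inner"
  shows "ccont f \<Longrightarrow> ccont (\<lambda>t. c *\<^sub>C f t)"
proof (rule ccont_from_zeros[of f])
  assume "ccont f"
  then have "continuous_on UNIV f" by (simp add: ccont_def)
  then show "continuous_on UNIV (\<lambda>t. c *\<^sub>C f t)" by (intro scaleC.continuous_on continuous_intros)
qed simp_all

lemma fourier_int_add:
  assumes "ccont f" "ccont g"
  shows "fourier_int s (\<lambda>t. f t + g t) = (\<lambda>x. fourier_int s f x + fourier_int s g x)"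
  using ccont_integrable[OF ccont_cis_scaleC[OF assms(1)]] ccont_integrable[OF ccont_cis_scaleC[OF assms(2)]]
  by (simp add: fun_eq_iff fourier_int_def scaleC_add_right scaleR_add_right)

lemma fourier_int_scaleC:
  assumes "ccont f"
  shows "fourier_int s (\<lambda>t. c *\<^sub>C f t) = (\<lambda>x. c *\<^sub>C fourier_int s f x)"
proof
  fix x
  have "(\<integral>y. cis (- (s * x * y)) *\<^sub>C c *\<^sub>C f y \<partial>lborel) = (\<integral>y. c *\<^sub>C cis (- (s * x * y)) *\<^sub>C f y \<partial>lborel)"
    by (simp add: scaleC_scaleC mult.commute)
  also have "\<dots> = c *\<^sub>C (\<integral>y. cis (- (s * x * y)) *\<^sub>C f y \<partial>lborel)"
    by (rule integral_bounded_linear[OF bounded_linear_scaleC ccont_integrable[OF ccont_cis_scaleC[OF assms]]])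
  finally show "fourier_int s (\<lambda>t. c *\<^sub>C f t) x = c *\<^sub>C fourier_int s f x"
    by (simp add: fourier_int_def scaleR_scaleC scaleC_scaleC mult.commute)
qed

lemma fourier_int_bound:
  assumes "ccont \<phi>"
  shows "norm (fourier_int s \<phi> x) \<le> (1 / sqrt (2 * pi)) * (\<integral>y. norm (\<phi> y) \<partial>lborel)"
proof -
  have "norm (\<integral>y. cis (- (s * x * y)) *\<^sub>C \<phi> y \<partial>lborel) \<le> (\<integral>y. norm (cis (- (s * x * y)) *\<^sub>C \<phi> y) \<partial>lborel)"
    by (rule integral_norm_bound)
  then show ?thesis by (simp add: fourier_int_def norm_scaleC divide_right_mono)
qed

lemma fourier_int_continuous:
  assumes \<phi>: "ccont \<phi>"
  shows "continuous_on UNIV (fourier_int s \<phi>)"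
proof -
  have [measurable]: "\<phi> \<in> borel_measurable borel" by (rule ccont_measurable[OF \<phi>])
  have "(\<lambda>n. \<integral>y. cis (- (s * u n * y)) *\<^sub>C \<phi> y \<partial>lborel) \<longlonglongrightarrow> (\<integral>y. cis (- (s * x * y)) *\<^sub>C \<phi> y \<partial>lborel)"
    if u: "u \<longlonglongrightarrow> x" for u x
  proof (rule integral_dominated_convergence)
    show "integrable lborel (\<lambda>y. norm (\<phi> y))" using ccont_integrable[OF \<phi>] by simp
    show "AE y in lborel. (\<lambda>n. cis (- (s * u n * y)) *\<^sub>C \<phi> y) \<longlonglongrightarrow> cis (- (s * x * y)) *\<^sub>C \<phi> y"
      unfolding cis_conv_exp by (intro AE_I2 scaleC.tendsto tendsto_intros u)
  qed (simp_all add: norm_scaleC)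
  then have "continuous_on UNIV (\<lambda>x. \<integral>y. cis (- (s * x * y)) *\<^sub>C \<phi> y \<partial>lborel)"
    by (simp add: continuous_on_sequentially o_def)
  then show ?thesis unfolding fourier_int_def by (intro continuous_intros)
qed

text \<open>The squared norm of a Fourier integral is the Fourier integral of the autocorrelation
  \<open>K u = \<integral> \<langle>\<phi> y, \<phi> (y + u)\<rangle> dy\<close>, whose value at the origin is the squared norm of \<open>\<phi>\<close>. The Gaussian
  inversion formula and monotone convergence therefore give Plancherel's identity.\<close>

lemma autocorrelation_ccont:
  fixes \<phi> :: "real \<Rightarrow> 'a::separable_chilbert"
  assumes \<phi>: "ccont \<phi>"
  shows "ccont (\<lambda>u. \<integral>y. cinner (\<phi> y) (\<phi> (y + u)) \<partial>lborel)"
proof -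
  obtain R where R: "\<And>t. R < \<bar>t\<bar> \<Longrightarrow> \<phi> t = 0" and cont: "continuous_on UNIV \<phi>"
    using \<phi> by (auto simp: ccont_def)
  have [measurable]: "\<phi> \<in> borel_measurable borel" by (rule ccont_measurable[OF \<phi>])
  obtain C where C: "\<And>u. norm (\<phi> u) \<le> C" using ccont_bounded[OF \<phi>] by blast
  have "(\<lambda>n. \<integral>y. cinner (\<phi> y) (\<phi> (y + u n)) \<partial>lborel) \<longlonglongrightarrow> (\<integral>y. cinner (\<phi> y) (\<phi> (y + x)) \<partial>lborel)"
    if u: "u \<longlonglongrightarrow> x" for u x
  proof (rule integral_dominated_convergence)
    show "integrable lborel (\<lambda>y. norm (\<phi> y) * C)" using ccont_integrable[OF \<phi>] by simp
    show "AE y in lborel. (\<lambda>n. cinner (\<phi> y) (\<phi> (y + u n))) \<longlonglongrightarrow> cinner (\<phi> y) (\<phi> (y + x))"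
      using cont by (intro AE_I2 cinner.tendsto tendsto_const isCont_tendsto_compose[of _ \<phi>] tendsto_add u)
        (simp add: continuous_on_eq_continuous_at)
    show "AE y in lborel. norm (cinner (\<phi> y) (\<phi> (y + u n))) \<le> norm (\<phi> y) * C" for n
      using C by (intro AE_I2 order_trans[OF norm_cinner_le] mult_left_mono) auto
  qed simp_all
  then have "continuous_on UNIV (\<lambda>u. \<integral>y. cinner (\<phi> y) (\<phi> (y + u)) \<partial>lborel)"
    by (simp add: continuous_on_sequentially o_def)
  moreover have "(\<integral>y. cinner (\<phi> y) (\<phi> (y + u)) \<partial>lborel) = 0" if "2 * R < \<bar>u\<bar>" for u
  proof -
    have "cinner (\<phi> y) (\<phi> (y + u)) = 0" for y
    proof (cases "R < \<bar>y\<bar>")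
      case False
      then have "R < \<bar>y + u\<bar>" using that by linarith
      then show ?thesis by (simp add: R)
    qed (simp add: R)
    then show ?thesis by simp
  qed
  ultimately show ?thesis unfolding ccont_def by blast
qed

lemma norm_fourier_int_squared:
  assumes \<phi>: "ccont \<phi>"
  shows "complex_of_real ((norm (fourier_int s \<phi> x))\<^sup>2) =
    1 / (2 * pi) * (\<integral>u. cis (- (s * x * u)) * (\<integral>y. cinner (\<phi> y) (\<phi> (y + u)) \<partial>lborel) \<partial>lborel)"
proof -
  obtain R where R: "\<And>t. R < \<bar>t\<bar> \<Longrightarrow> \<phi> t = 0" and cont: "continuous_on UNIV \<phi>"
    using \<phi> by (auto simp: ccont_def)
  define e where "e y = cis (- (s * x * y))" for y
  define I where "I = (\<integral>y. e y *\<^sub>C \<phi> y \<partial>lborel)"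
  note int = ccont_integrable[OF ccont_cis_scaleC[OF \<phi>, of s x], folded e_def]
  have "cinner I I = (\<integral>y. cinner (e y *\<^sub>C \<phi> y) I \<partial>lborel)"
    unfolding I_def by (rule integral_bounded_linear[OF cinner.bounded_linear_left int, symmetric])
  also have "\<dots> = (\<integral>y. \<integral>u. e u * cinner (\<phi> y) (\<phi> (y + u)) \<partial>lborel \<partial>lborel)"
  proof (rule Bochner_Integration.integral_cong[OF refl])
    fix y
    have "cinner (e y *\<^sub>C \<phi> y) I = (\<integral>z. cinner (e y *\<^sub>C \<phi> y) (e z *\<^sub>C \<phi> z) \<partial>lborel)"
      unfolding I_def by (rule integral_bounded_linear[OF cinner.bounded_linear_right int, symmetric])
    also have "\<dots> = (\<integral>u. cinner (e y *\<^sub>C \<phi> y) (e (y + 1 * u) *\<^sub>C \<phi> (y + 1 * u)) \<partial>lborel)"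
      using lborel_integral_real_affine[of 1 "\<lambda>z. cinner (e y *\<^sub>C \<phi> y) (e z *\<^sub>C \<phi> z)" y] by simp
    also have "(\<lambda>u. cinner (e y *\<^sub>C \<phi> y) (e (y + 1 * u) *\<^sub>C \<phi> (y + 1 * u))) = (\<lambda>u. e u * cinner (\<phi> y) (\<phi> (y + u)))"
    proof
      fix u
      have "cnj (e y) * e (y + u) = e u"
        by (simp add: e_def cis_cnj cis_mult algebra_simps)
      then show "cinner (e y *\<^sub>C \<phi> y) (e (y + 1 * u) *\<^sub>C \<phi> (y + 1 * u)) = e u * cinner (\<phi> y) (\<phi> (y + u))"
        by (metis (no_types) cinner_scaleC_left cinner_scaleC_right mult.assoc mult.commute mult_1)
    qed
    finally show "cinner (e y *\<^sub>C \<phi> y) I = (\<integral>u. e u * cinner (\<phi> y) (\<phi> (y + u)) \<partial>lborel)" .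
  qed
  also have "\<dots> = (\<integral>u. \<integral>y. e u * cinner (\<phi> y) (\<phi> (y + u)) \<partial>lborel \<partial>lborel)"
  proof (rule fubini_cont_compact[where R = "2 * \<bar>R\<bar>"])
    show "continuous_on UNIV (\<lambda>p. e (snd p) * cinner (\<phi> (fst p)) (\<phi> (fst p + snd p)))"
      unfolding e_def
      by (intro continuous_intros cinner.continuous_on continuous_on_compose2[OF cont]) auto
    fix y u assume *: "2 * \<bar>R\<bar> < \<bar>y\<bar> \<or> 2 * \<bar>R\<bar> < \<bar>u\<bar>"
    have "R < \<bar>y\<bar> \<or> R < \<bar>y + u\<bar>" using * by linarith
    then show "e u * cinner (\<phi> y) (\<phi> (y + u)) = 0" using R by auto
  qed
  also have "\<dots> = (\<integral>u. e u * (\<integral>y. cinner (\<phi> y) (\<phi> (y + u)) \<partial>lborel) \<partial>lborel)" by simp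
  finally have "complex_of_real ((norm I)\<^sup>2) = (\<integral>u. e u * (\<integral>y. cinner (\<phi> y) (\<phi> (y + u)) \<partial>lborel) \<partial>lborel)"
    by (simp add: cinner_self)
  moreover have "(norm (fourier_int s \<phi> x))\<^sup>2 = 1 / (2 * pi) * (norm I)\<^sup>2"
    by (simp add: fourier_int_def I_def e_def power_divide)
  ultimately show ?thesis by (simp add: e_def)
qed

lemma plancherel_fourier_int:
  assumes \<phi>: "ccont \<phi>" and s: "s * s = 1"
  shows "sq_int (fourier_int s \<phi>)" and "norm (l2_of (fourier_int s \<phi>)) = norm (l2_of \<phi>)"
proof -
  define F where "F = fourier_int s \<phi>"
  define K where "K u = (\<integral>y. cinner (\<phi> y) (\<phi> (y + u)) \<partial>lborel)" for u
  have K: "ccont K" unfolding K_def by (rule autocorrelation_ccont[OF \<phi>])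
  have K0: "K 0 = complex_of_real (\<integral>y. (norm (\<phi> y))\<^sup>2 \<partial>lborel)"
    by (simp add: K_def cinner_self del: of_real_power)
  have Fm [measurable]: "F \<in> borel_measurable borel"
    unfolding F_def by (intro borel_measurable_continuous_onI fourier_int_continuous \<phi>)
  define g where "g n x = exp (- (inverse (real (Suc n)) * x)\<^sup>2 / 2)" for n :: nat and x :: real
  have gm [measurable]: "g n \<in> borel_measurable borel" for n unfolding g_def by measurable
  define h where "h n x = (norm (F x))\<^sup>2 * g n x" for n x
  define B where "B = (1 / sqrt (2 * pi)) * (\<integral>y. norm (\<phi> y) \<partial>lborel)"
  have B: "norm (F x) \<le> B" for x unfolding F_def B_def by (rule fourier_int_bound[OF \<phi>])
  have hint: "integrable lborel (h n)" for n
  proof (rule Bochner_Integration.integrable_bound)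
    show "integrable lborel (\<lambda>x. B\<^sup>2 * g n x)"
      unfolding g_def by (intro integrable_mult_right integrable_gaussian) simp
    show "AE x in lborel. norm (h n x) \<le> norm (B\<^sup>2 * g n x)"
      by (intro AE_I2) (simp add: h_def g_def abs_mult power_mono B)
  qed (unfold h_def, measurable)
  have "(\<lambda>n. complex_of_real (\<integral>x. h n x \<partial>lborel)) \<longlonglongrightarrow> 1 / (2 * pi) * (2 * pi * K 0)"
  proof -
    have "complex_of_real (\<integral>x. h n x \<partial>lborel)
        = 1 / (2 * pi) * (\<integral>x. (\<integral>u. cis (- (s * x * u)) * K u \<partial>lborel) * complex_of_real (exp (- (inverse (Suc n) * x)\<^sup>2 / 2)) \<partial>lborel)" for n
    proof -
      have "complex_of_real (h n x)
          = 1 / (2 * pi) * ((\<integral>u. cis (- (s * x * u)) * K u \<partial>lborel) * complex_of_real (exp (- (inverse (Suc n) * x)\<^sup>2 / 2)))" for x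
        unfolding h_def F_def of_real_mult norm_fourier_int_squared[OF \<phi>] K_def g_def by simp
      then show ?thesis by (subst integral_complex_of_real[symmetric]) (simp del: of_nat_Suc)
    qed
    then show ?thesis using tendsto_mult_left[OF gaussian_inversion_at_0[OF K s]] by presburger
  qed
  then have "(\<lambda>n. complex_of_real (\<integral>x. h n x \<partial>lborel)) \<longlonglongrightarrow> complex_of_real (\<integral>y. (norm (\<phi> y))\<^sup>2 \<partial>lborel)"
    by (simp add: K0)
  then have lim: "(\<lambda>n. \<integral>x. h n x \<partial>lborel) \<longlonglongrightarrow> (\<integral>y. (norm (\<phi> y))\<^sup>2 \<partial>lborel)"
    by (simp add: tendsto_of_real_iff)
  have mono: "mono (\<lambda>n. h n x)" for x
  proof (rule monoI)
    fix m n :: nat assume "m \<le> n"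
    then have "inverse (real (Suc n)) \<le> inverse (real (Suc m))" by (simp add: le_imp_inverse_le)
    then have "(inverse (real (Suc n)))\<^sup>2 \<le> (inverse (real (Suc m)))\<^sup>2" by (intro power_mono) auto
    then have "(inverse (real (Suc n)))\<^sup>2 * x\<^sup>2 \<le> (inverse (real (Suc m)))\<^sup>2 * x\<^sup>2" by (intro mult_right_mono) auto
    then have "g m x \<le> g n x" by (simp add: g_def power_mult_distrib del: of_nat_Suc)
    then show "h m x \<le> h n x" by (simp add: h_def mult_left_mono)
  qed
  have ptw: "(\<lambda>n. h n x) \<longlonglongrightarrow> (norm (F x))\<^sup>2" for x
  proof -
    have "(\<lambda>n. (norm (F x))\<^sup>2 * exp (- (inverse (real (Suc n)) * x)\<^sup>2 / 2)) \<longlonglongrightarrow> (norm (F x))\<^sup>2 * exp (- (0 * x)\<^sup>2 / 2)"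
      by (intro tendsto_intros LIMSEQ_inverse_real_of_nat) simp
    then show ?thesis by (simp add: h_def g_def)
  qed
  have Fm2: "(\<lambda>x. (norm (F x))\<^sup>2) \<in> borel_measurable lborel" by measurable
  have pos: "0 \<le> h n x" for n x by (simp add: h_def g_def)
  note res = integral_monotone_convergence_nonneg[OF hint AE_I2[OF mono] AE_I2[OF pos] AE_I2[OF ptw] lim
    Fm2]
  show sq: "sq_int (fourier_int s \<phi>)" using res(1) Fm by (simp add: sq_int_def F_def)
  have "(norm (l2_of (fourier_int s \<phi>)))\<^sup>2 = (norm (l2_of \<phi>))\<^sup>2"
    using res(2) by (simp add: power2_norm_l2_of[OF sq] power2_norm_l2_of[OF sq_int_ccont[OF \<phi>]] F_def)
  then show "norm (l2_of (fourier_int s \<phi>)) = norm (l2_of \<phi>)" by simp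
qed

lemma fourier_int_adjoint:
  assumes \<phi>: "ccont \<phi>" and \<psi>: "ccont \<psi>" and s: "s * s = 1"
  shows "cinner (l2_of (fourier_int s \<phi>)) (l2_of \<psi>) = cinner (l2_of \<phi>) (l2_of (fourier_int (- s) \<psi>))"
proof -
  obtain R where R: "\<And>t. R < \<bar>t\<bar> \<Longrightarrow> \<phi> t = 0" and c\<phi>: "continuous_on UNIV \<phi>"
    using \<phi> by (auto simp: ccont_def)
  obtain R' where R': "\<And>t. R' < \<bar>t\<bar> \<Longrightarrow> \<psi> t = 0" and c\<psi>: "continuous_on UNIV \<psi>"
    using \<psi> by (auto simp: ccont_def)
  define a where "a = 1 / sqrt (2 * pi)"
  have s': "- s * - s = 1" using s by simp
  have 1: "cinner (fourier_int s \<phi> x) (\<psi> x) = a * (\<integral>y. cis (s * x * y) * cinner (\<phi> y) (\<psi> x) \<partial>lborel)" for x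
  proof -
    have "cinner (\<integral>y. cis (- (s * x * y)) *\<^sub>C \<phi> y \<partial>lborel) (\<psi> x) = (\<integral>y. cinner (cis (- (s * x * y)) *\<^sub>C \<phi> y) (\<psi> x) \<partial>lborel)"
      by (rule integral_bounded_linear[OF cinner.bounded_linear_left ccont_integrable[OF ccont_cis_scaleC[OF \<phi>]], symmetric])
    then show ?thesis by (simp add: fourier_int_def a_def cinner_scaleC_left cis_cnj scaleR_scaleC)
  qed
  have 2: "cinner (\<phi> y) (fourier_int (- s) \<psi> y) = a * (\<integral>x. cis (s * x * y) * cinner (\<phi> y) (\<psi> x) \<partial>lborel)" for y
  proof -
    have "cinner (\<phi> y) (\<integral>x. cis (- (- s * y * x)) *\<^sub>C \<psi> x \<partial>lborel) = (\<integral>x. cinner (\<phi> y) (cis (- (- s * y * x)) *\<^sub>C \<psi> x) \<partial>lborel)"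
      by (rule integral_bounded_linear[OF cinner.bounded_linear_right ccont_integrable[OF ccont_cis_scaleC[OF \<psi>]], symmetric])
    then show ?thesis by (simp add: fourier_int_def a_def cinner_scaleC_right scaleR_scaleC mult_ac)
  qed
  have "cinner (l2_of (fourier_int s \<phi>)) (l2_of \<psi>) = (\<integral>x. cinner (fourier_int s \<phi> x) (\<psi> x) \<partial>lborel)"
    by (intro cinner_l2_of plancherel_fourier_int(1) sq_int_ccont assms)
  also have "\<dots> = a * (\<integral>x. \<integral>y. cis (s * x * y) * cinner (\<phi> y) (\<psi> x) \<partial>lborel \<partial>lborel)"
    by (simp add: 1)
  also have "(\<integral>x. \<integral>y. cis (s * x * y) * cinner (\<phi> y) (\<psi> x) \<partial>lborel \<partial>lborel)
      = (\<integral>y. \<integral>x. cis (s * x * y) * cinner (\<phi> y) (\<psi> x) \<partial>lborel \<partial>lborel)"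
  proof (rule fubini_cont_compact[where R = "max R R'"])
    show "continuous_on UNIV (\<lambda>p. cis (s * fst p * snd p) * cinner (\<phi> (snd p)) (\<psi> (fst p)))"
      by (intro continuous_intros cinner.continuous_on continuous_on_compose2[OF c\<phi>] continuous_on_compose2[OF c\<psi>]) auto
  qed (use R R' in \<open>auto simp: cinner.zero_left cinner.zero_right\<close>)
  also have "a * \<dots> = (\<integral>y. cinner (\<phi> y) (fourier_int (- s) \<psi> y) \<partial>lborel)"
    by (simp add: 2)
  also have "\<dots> = cinner (l2_of \<phi>) (l2_of (fourier_int (- s) \<psi>))"
    by (intro cinner_l2_of[symmetric] plancherel_fourier_int(1) sq_int_ccont assms s')
  finally show ?thesis .
qed

section \<open>The Fourier transform as a unitary operator\<close>

lemma test_l2_sequence: "\<exists>\<phi>. (\<forall>n. test_function (\<phi> n)) \<and> (\<lambda>n. l2_of (\<phi> n)) \<longlonglongrightarrow> (v :: 'a::separable_chilbert l2)"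
proof -
  have "v \<in> closure test_l2" by (simp add: test_l2_dense)
  then obtain x where x: "\<And>n. x n \<in> test_l2" "x \<longlonglongrightarrow> v" unfolding closure_sequential by blast
  have "\<forall>n. \<exists>\<phi>. test_function \<phi> \<and> x n = l2_of \<phi>" using x(1) by (auto simp: test_l2_def)
  from choice[OF this] obtain \<phi> where "\<And>n. test_function (\<phi> n)" "\<And>n. x n = l2_of (\<phi> n)" by blast
  moreover from this have "x = (\<lambda>n. l2_of (\<phi> n))" by blast
  ultimately have "(\<forall>n. test_function (\<phi> n)) \<and> (\<lambda>n. l2_of (\<phi> n)) \<longlonglongrightarrow> v" using x(2) by simp
  then show ?thesis by blast
qed

lemma fourier_int_diff:
  assumes "ccont f" "ccont g"
  shows "fourier_int s (\<lambda>t. f t - g t) = (\<lambda>x. fourier_int s f x - fourier_int s g x)"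
  using fourier_int_add[OF assms(1) ccont_scaleC[OF assms(2)], of s "-1"] fourier_int_scaleC[OF assms(2), of s "-1"]
  by (simp add: scaleC.minus_left scaleC_one)

lemma ccont_diff: "ccont f \<Longrightarrow> ccont g \<Longrightarrow> ccont (\<lambda>t. f t - g t)"
  for f :: "real \<Rightarrow> 'a::separable_chilbert"
  using ccont_add[OF _ ccont_scaleC, of f g "-1"] by (simp add: scaleC.minus_left scaleC_one)

lemma norm_fourier_int_diff:
  assumes "ccont f" "ccont g" "s * s = 1"
  shows "norm (l2_of (fourier_int s f) - l2_of (fourier_int s g)) = norm (l2_of f - l2_of g)"
proof -
  have "l2_of (fourier_int s f) - l2_of (fourier_int s g) = l2_of (fourier_int s (\<lambda>t. f t - g t))"
    unfolding fourier_int_diff[OF assms(1,2)] by (intro l2_of_diff[symmetric] plancherel_fourier_int(1) assms)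
  moreover have "l2_of f - l2_of g = l2_of (\<lambda>t. f t - g t)"
    by (intro l2_of_diff[symmetric] sq_int_ccont assms)
  ultimately show ?thesis using plancherel_fourier_int(2)[OF ccont_diff[OF assms(1,2)] assms(3)] by simp
qed

text \<open>On the test functions the transform is isometric, so it depends only on the class of a function and extends
  to the closure by uniform continuity.\<close>

lemma fourier_extension_exists:
  assumes s: "s * s = 1"
  shows "\<exists>W :: 'a::separable_chilbert l2 \<Rightarrow> 'a l2. continuous_on UNIV W \<and>
    (\<forall>\<phi>. test_function \<phi> \<longrightarrow> W (l2_of \<phi>) = l2_of (fourier_int s \<phi>))"
proof -
  define f where "f v = l2_of (fourier_int s (SOME \<phi>. test_function \<phi> \<and> v = l2_of \<phi>))" for v :: "'a l2"
  have f: "f (l2_of \<phi>) = l2_of (fourier_int s \<phi>)" if \<phi>: "test_function \<phi>" for \<phi>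
  proof -
    define \<psi> where "\<psi> = (SOME \<psi>. test_function \<psi> \<and> l2_of \<phi> = l2_of \<psi>)"
    have "test_function \<psi> \<and> l2_of \<phi> = l2_of \<psi>" unfolding \<psi>_def by (rule someI[of _ \<phi>]) (simp add: \<phi>)
    then have "norm (l2_of (fourier_int s \<psi>) - l2_of (fourier_int s \<phi>)) = 0"
      using norm_fourier_int_diff[OF test_function_ccont test_function_ccont s, of \<psi> \<phi>] \<phi> by simp
    then show ?thesis by (simp add: f_def \<psi>_def)
  qed
  have uc: "uniformly_continuous_on test_l2 f"
    unfolding uniformly_continuous_on_def
  proof (intro allI impI)
    fix e :: real assume "e > 0"
    have "dist (f x') (f x) = dist x' x" if "x \<in> test_l2" "x' \<in> test_l2" for x x'
      using that norm_fourier_int_diff[OF test_function_ccont test_function_ccont s]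
      by (auto simp: test_l2_def f dist_norm)
    with \<open>e > 0\<close> show "\<exists>d>0. \<forall>x\<in>test_l2. \<forall>x'\<in>test_l2. dist x' x < d \<longrightarrow> dist (f x') (f x) < e" by auto
  qed
  obtain W where "uniformly_continuous_on (closure test_l2) W" "\<And>x. x \<in> test_l2 \<Longrightarrow> f x = W x"
    by (rule uniformly_continuous_on_extension_on_closure[OF uc]) (rule that)
  note W = this
  have "continuous_on UNIV W" using uniformly_continuous_imp_continuous[OF W(1)] by (simp add: test_l2_dense)
  moreover have "W (l2_of \<phi>) = l2_of (fourier_int s \<phi>)" if "test_function \<phi>" for \<phi>
  proof -
    have "l2_of \<phi> \<in> test_l2" using that by (auto simp: test_l2_def)
    then show ?thesis using W(2) f[OF that] by simp
  qed
  ultimately show ?thesis by blast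
qed

definition fourier_l2 :: "real \<Rightarrow> 'a::separable_chilbert l2 \<Rightarrow> 'a l2" where
  "fourier_l2 s = (SOME W. continuous_on UNIV W \<and>
    (\<forall>\<phi>. test_function \<phi> \<longrightarrow> W (l2_of \<phi>) = l2_of (fourier_int s \<phi>)))"

context
  fixes s :: real
  assumes s: "s * s = 1"
begin

lemma
  fixes u :: "'a::separable_chilbert l2" and \<phi> :: "real \<Rightarrow> 'a"
  shows fourier_l2_tendsto: "v \<longlonglongrightarrow> u \<Longrightarrow> (\<lambda>n. fourier_l2 s (v n)) \<longlonglongrightarrow> fourier_l2 s u"
  and fourier_l2_test: "test_function \<phi> \<Longrightarrow> fourier_l2 s (l2_of \<phi>) = l2_of (fourier_int s \<phi>)"
proof -
  have *: "continuous_on UNIV (fourier_l2 s :: 'a l2 \<Rightarrow> 'a l2) \<and>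
    (\<forall>\<phi> :: real \<Rightarrow> 'a. test_function \<phi> \<longrightarrow> fourier_l2 s (l2_of \<phi>) = l2_of (fourier_int s \<phi>))"
    unfolding fourier_l2_def by (rule someI_ex[OF fourier_extension_exists[OF s]])
  then have "isCont (fourier_l2 s) u" by (simp add: continuous_on_eq_continuous_at)
  then show "v \<longlonglongrightarrow> u \<Longrightarrow> (\<lambda>n. fourier_l2 s (v n)) \<longlonglongrightarrow> fourier_l2 s u" by (rule isCont_tendsto_compose)
  show "test_function \<phi> \<Longrightarrow> fourier_l2 s (l2_of \<phi>) = l2_of (fourier_int s \<phi>)" using * by blast
qed

lemma fourier_l2_add: "fourier_l2 s (u + v) = fourier_l2 s u + fourier_l2 s (v :: 'a::separable_chilbert l2)"
proof -
  obtain f where f: "\<And>n. test_function (f n)" "(\<lambda>n. l2_of (f n)) \<longlonglongrightarrow> u" using test_l2_sequence[of u] by blast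
  obtain g where g: "\<And>n. test_function (g n)" "(\<lambda>n. l2_of (g n)) \<longlonglongrightarrow> v" using test_l2_sequence[of v] by blast
  have "fourier_l2 s (l2_of (f n) + l2_of (g n)) = fourier_l2 s (l2_of (f n)) + fourier_l2 s (l2_of (g n))" for n
  proof -
    note t = f(1)[of n] g(1)[of n]
    note c = t[THEN test_function_ccont]
    have "l2_of (f n) + l2_of (g n) = l2_of (\<lambda>t. f n t + g n t)" by (intro l2_of_add[symmetric] sq_int_ccont c)
    moreover have "l2_of (fourier_int s (\<lambda>t. f n t + g n t)) = l2_of (fourier_int s (f n)) + l2_of (fourier_int s (g n))"
      unfolding fourier_int_add[OF c] by (intro l2_of_add plancherel_fourier_int(1) c s)
    ultimately show ?thesis by (simp add: fourier_l2_test t test_function_add)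
  qed
  moreover have "(\<lambda>n. fourier_l2 s (l2_of (f n) + l2_of (g n))) \<longlonglongrightarrow> fourier_l2 s (u + v)"
    by (intro fourier_l2_tendsto tendsto_add f g)
  moreover have "(\<lambda>n. fourier_l2 s (l2_of (f n)) + fourier_l2 s (l2_of (g n))) \<longlonglongrightarrow> fourier_l2 s u + fourier_l2 s v"
    by (intro fourier_l2_tendsto tendsto_add f g)
  ultimately show ?thesis by (simp add: LIMSEQ_unique)
qed

lemma fourier_l2_scaleC: "fourier_l2 s (c *\<^sub>C v) = c *\<^sub>C fourier_l2 s (v :: 'a::separable_chilbert l2)"
proof -
  obtain f where f: "\<And>n. test_function (f n)" "(\<lambda>n. l2_of (f n)) \<longlonglongrightarrow> v" using test_l2_sequence[of v] by blast
  have "fourier_l2 s (c *\<^sub>C l2_of (f n)) = c *\<^sub>C fourier_l2 s (l2_of (f n))" for n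
  proof -
    note t = f(1)[of n] and c = f(1)[of n, THEN test_function_ccont]
    have "c *\<^sub>C l2_of (f n) = l2_of (\<lambda>t. c *\<^sub>C f n t)" by (intro l2_of_scaleC[symmetric] sq_int_ccont c)
    moreover have "l2_of (fourier_int s (\<lambda>t. c *\<^sub>C f n t)) = c *\<^sub>C l2_of (fourier_int s (f n))"
      unfolding fourier_int_scaleC[OF c] by (intro l2_of_scaleC plancherel_fourier_int(1) c s)
    ultimately show ?thesis by (simp add: fourier_l2_test t test_function_linear[OF bounded_linear_scaleC])
  qed
  moreover have "(\<lambda>n. fourier_l2 s (c *\<^sub>C l2_of (f n))) \<longlonglongrightarrow> fourier_l2 s (c *\<^sub>C v)"
    by (intro fourier_l2_tendsto scaleC.tendsto tendsto_const f)
  moreover have "(\<lambda>n. c *\<^sub>C fourier_l2 s (l2_of (f n))) \<longlonglongrightarrow> c *\<^sub>C fourier_l2 s v"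
    by (intro fourier_l2_tendsto scaleC.tendsto tendsto_const f)
  ultimately show ?thesis by (simp add: LIMSEQ_unique)
qed

lemma norm_fourier_l2: "norm (fourier_l2 s v) = norm (v :: 'a::separable_chilbert l2)"
proof -
  obtain f where f: "\<And>n. test_function (f n)" "(\<lambda>n. l2_of (f n)) \<longlonglongrightarrow> v" using test_l2_sequence[of v] by blast
  have "(\<lambda>n. norm (fourier_l2 s (l2_of (f n)))) \<longlonglongrightarrow> norm (fourier_l2 s v)"
    by (intro fourier_l2_tendsto tendsto_norm f)
  moreover have "(\<lambda>n. norm (fourier_l2 s (l2_of (f n)))) \<longlonglongrightarrow> norm v"
    using tendsto_norm[OF f(2)] by (simp add: fourier_l2_test f(1) plancherel_fourier_int(2) test_function_ccont s)
  ultimately show ?thesis by (rule LIMSEQ_unique)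
qed

lemma cinner_fourier_l2: "cinner (fourier_l2 s u) (fourier_l2 s v) = cinner u (v :: 'a::separable_chilbert l2)"
proof -
  have re: "fourier_l2 s u \<bullet> fourier_l2 s v = u \<bullet> v" for u v :: "'a l2"
  proof -
    have polar: "x \<bullet> y = ((norm (x + y))\<^sup>2 - (norm x)\<^sup>2 - (norm y)\<^sup>2) / 2" for x y :: "'a l2"
      by (simp add: power2_norm_eq_inner inner_add_left inner_add_right inner_commute)
    show ?thesis unfolding polar by (simp only: fourier_l2_add[symmetric] norm_fourier_l2)
  qed
  then show ?thesis by (simp add: cinner_eq_Complex fourier_l2_scaleC[symmetric])
qed

end

lemma fourier_l2_adjoint:
  assumes s: "s * s = 1"
  shows "cinner (fourier_l2 s u) v = cinner u (fourier_l2 (- s) (v :: 'a::separable_chilbert l2))"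
proof -
  have s': "- s * - s = 1" using s by simp
  obtain f where f: "\<And>n. test_function (f n)" "(\<lambda>n. l2_of (f n)) \<longlonglongrightarrow> u" using test_l2_sequence[of u] by blast
  obtain g where g: "\<And>n. test_function (g n)" "(\<lambda>n. l2_of (g n)) \<longlonglongrightarrow> v" using test_l2_sequence[of v] by blast
  have "(\<lambda>n. cinner (fourier_l2 s (l2_of (f n))) (l2_of (g n))) \<longlonglongrightarrow> cinner (fourier_l2 s u) v"
    by (intro cinner.tendsto fourier_l2_tendsto s f g)
  moreover have "(\<lambda>n. cinner (l2_of (f n)) (fourier_l2 (- s) (l2_of (g n)))) \<longlonglongrightarrow> cinner u (fourier_l2 (- s) v)"
    by (intro cinner.tendsto fourier_l2_tendsto s' f g)
  moreover have "cinner (fourier_l2 s (l2_of (f n))) (l2_of (g n)) = cinner (l2_of (f n)) (fourier_l2 (- s) (l2_of (g n)))" for n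
    using fourier_int_adjoint[OF f(1)[THEN test_function_ccont] g(1)[THEN test_function_ccont] s]
    by (simp add: fourier_l2_test[OF s] fourier_l2_test[OF s'] f g)
  ultimately show ?thesis by (simp add: LIMSEQ_unique)
qed

text \<open>The transforms with the two signs are isometric and adjoint to each other, hence inverse to each
  other.\<close>

lemma fourier_l2_inverse:
  assumes s: "s * s = 1"
  shows "fourier_l2 (- s) (fourier_l2 s v) = (v :: 'a::separable_chilbert l2)"
proof (rule cinner_extensionality)
  fix u :: "'a l2"
  show "cinner u (fourier_l2 (- s) (fourier_l2 s v)) = cinner u v"
    by (simp add: fourier_l2_adjoint[OF s, symmetric] cinner_fourier_l2[OF s])
qed

lemma bij_fourier_l2: "bij (fourier_l2 1 :: 'a::separable_chilbert l2 \<Rightarrow> 'a l2)"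
  using fourier_l2_inverse[of 1] fourier_l2_inverse[of "-1"]
  by (intro o_bij[where g = "fourier_l2 (-1)"]) (auto simp: fun_eq_iff)

section \<open>The weighted spaces as Hilbert spaces\<close>

text \<open>The map \<open>U\<close> identifies a Hilbert space given by a carrier with one that is a type.\<close>

definition unitary_map :: "'v::complex_vector hilb \<Rightarrow> ('v \<Rightarrow> 'h::complex_inner) \<Rightarrow> bool" where
  "unitary_map X U \<longleftrightarrow> cvec.subspace (hcarrier X) \<and> bij_betw U (hcarrier X) UNIV \<and>
     clinear_on (hcarrier X) U \<and> (\<forall>x\<in>hcarrier X. \<forall>y\<in>hcarrier X. hinner X x y = cinner (U x) (U y))"

lemma
  assumes U: "unitary_map X U"
  shows unitary_map_subspace: "cvec.subspace (hcarrier X)"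
    and unitary_map_bij: "bij_betw U (hcarrier X) UNIV"
    and unitary_map_add: "x \<in> hcarrier X \<Longrightarrow> y \<in> hcarrier X \<Longrightarrow> U (x + y) = U x + U y"
    and unitary_map_scaleC: "x \<in> hcarrier X \<Longrightarrow> U (c *\<^sub>C x) = c *\<^sub>C U x"
    and unitary_map_inner: "x \<in> hcarrier X \<Longrightarrow> y \<in> hcarrier X \<Longrightarrow> hinner X x y = cinner (U x) (U y)"
    and unitary_map_carrier_add: "x \<in> hcarrier X \<Longrightarrow> y \<in> hcarrier X \<Longrightarrow> x + y \<in> hcarrier X"
    and unitary_map_carrier_scaleC: "x \<in> hcarrier X \<Longrightarrow> c *\<^sub>C x \<in> hcarrier X"
    and unitary_map_carrier_0: "0 \<in> hcarrier X"
  using U unfolding unitary_map_def clinear_on_def cvec.subspace_def by auto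

lemma unitary_map_carrier_diff:
  "unitary_map X U \<Longrightarrow> x \<in> hcarrier X \<Longrightarrow> y \<in> hcarrier X \<Longrightarrow> x - y \<in> hcarrier X"
  using unitary_map_subspace cvec.subspace_diff by blast

lemma unitary_map_diff:
  assumes "unitary_map X U" "x \<in> hcarrier X" "y \<in> hcarrier X"
  shows "U (x - y) = U x - U y"
  using unitary_map_add[OF assms(1) unitary_map_carrier_diff[OF assms] assms(3)] by simp

lemma unitary_map_hnorm: "unitary_map X U \<Longrightarrow> x \<in> hcarrier X \<Longrightarrow> hnorm X x = norm (U x)"
  by (simp add: hnorm_def unitary_map_inner cinner_self)

lemma unitary_map_inj:
  "unitary_map X U \<Longrightarrow> x \<in> hcarrier X \<Longrightarrow> y \<in> hcarrier X \<Longrightarrow> U x = U y \<longleftrightarrow> x = y"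
  using unitary_map_bij by (meson bij_betw_imp_inj_on inj_on_contraD)

definition unitary_inv :: "'v hilb \<Rightarrow> ('v \<Rightarrow> 'h) \<Rightarrow> 'h \<Rightarrow> 'v" where
  "unitary_inv X U = inv_into (hcarrier X) U"

lemma
  assumes U: "unitary_map X U"
  shows unitary_inv_carrier: "unitary_inv X U v \<in> hcarrier X"
    and unitary_map_inv: "U (unitary_inv X U v) = v"
  using unitary_map_bij[OF U] unfolding unitary_inv_def bij_betw_def
  by (metis UNIV_I inv_into_into, metis UNIV_I f_inv_into_f)

definition wl2 :: "real \<Rightarrow> 'a::separable_chilbert mfun \<Rightarrow> 'a l2" where
  "wl2 \<nu> f = l2_of (\<lambda>t. exp (- \<nu> * t) *\<^sub>R rep_mfun f t)"

lemma exp_weight: "exp (- 2 * \<nu> * t) = exp (- \<nu> * t) * exp (- \<nu> * (t::real))"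
  by (simp add: exp_add[symmetric])

lemma L2w_carrier_iff: "f \<in> hcarrier (L2w \<nu>) \<longleftrightarrow> sq_int (\<lambda>t. exp (- \<nu> * t) *\<^sub>R rep_mfun f t)"
proof -
  have "(norm (exp (- \<nu> * t) *\<^sub>R x))\<^sup>2 = (norm x)\<^sup>2 * exp (- 2 * \<nu> * t)" for t and x :: 'a
    unfolding exp_weight by (simp add: power2_eq_square)
  then show ?thesis by (simp only: L2w_def sq_int_def hilb.simps mem_Collect_eq) simp
qed

lemma rep_wl2: "f \<in> hcarrier (L2w \<nu>) \<Longrightarrow> AE t in lborel. rep_l2 (wl2 \<nu> f) t = exp (- \<nu> * t) *\<^sub>R rep_mfun f t"
  unfolding wl2_def L2w_carrier_iff by (rule rep_l2_of)

lemma wl2_eqI: "f \<in> hcarrier (L2w \<nu>) \<Longrightarrow> (AE t in lborel. exp (- \<nu> * t) *\<^sub>R rep_mfun f t = rep_l2 v t) \<Longrightarrow> wl2 \<nu> f = v"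
  unfolding wl2_def L2w_carrier_iff by (intro l2_of_eqI) auto

lemma abs_mfun_carrier:
  assumes "sq_int (\<lambda>t. exp (- \<nu> * t) *\<^sub>R \<phi> t)" and \<phi>: "\<phi> \<in> borel_measurable borel"
  shows "abs_mfun \<phi> \<in> hcarrier (L2w \<nu>)" and "wl2 \<nu> (abs_mfun \<phi>) = l2_of (\<lambda>t. exp (- \<nu> * t) *\<^sub>R \<phi> t)"
proof -
  have ae: "AE t in lborel. exp (- \<nu> * t) *\<^sub>R rep_mfun (abs_mfun \<phi>) t = exp (- \<nu> * t) *\<^sub>R \<phi> t"
    using rep_abs_mfun[OF \<phi>] by auto
  show c: "abs_mfun \<phi> \<in> hcarrier (L2w \<nu>)"
    unfolding L2w_carrier_iff by (rule sq_int_AE_cong[OF assms(1) _ ae]) simp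
  show "wl2 \<nu> (abs_mfun \<phi>) = l2_of (\<lambda>t. exp (- \<nu> * t) *\<^sub>R \<phi> t)"
    using rep_l2_of[OF assms(1)] ae by (intro wl2_eqI[OF c]) auto
qed

lemma unitary_wl2: "unitary_map (L2w \<nu>) (wl2 \<nu> :: 'a::separable_chilbert mfun \<Rightarrow> 'a l2)"
proof -
  let ?X = "hcarrier (L2w \<nu>) :: 'a mfun set"
  have add: "f + g \<in> ?X" "wl2 \<nu> (f + g) = wl2 \<nu> f + wl2 \<nu> g" if f: "f \<in> ?X" and g: "g \<in> ?X" for f g
  proof -
    have ae: "AE t in lborel. exp (- \<nu> * t) *\<^sub>R rep_mfun (f + g) t = exp (- \<nu> * t) *\<^sub>R rep_mfun f t + exp (- \<nu> * t) *\<^sub>R rep_mfun g t"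
      using rep_mfun_add[of f g] by (auto simp: scaleR_add_right)
    show c: "f + g \<in> ?X"
      unfolding L2w_carrier_iff by (rule sq_int_AE_cong[OF sq_int_add _ ae]) (use f g in \<open>auto simp: L2w_carrier_iff\<close>)
    show "wl2 \<nu> (f + g) = wl2 \<nu> f + wl2 \<nu> g"
      using ae rep_wl2[OF f] rep_wl2[OF g] rep_l2_add[of "wl2 \<nu> f" "wl2 \<nu> g"] by (intro wl2_eqI[OF c]) auto
  qed
  have scale: "c *\<^sub>C f \<in> ?X" "wl2 \<nu> (c *\<^sub>C f) = c *\<^sub>C wl2 \<nu> f" if f: "f \<in> ?X" for f c
  proof -
    have ae: "AE t in lborel. exp (- \<nu> * t) *\<^sub>R rep_mfun (c *\<^sub>C f) t = c *\<^sub>C exp (- \<nu> * t) *\<^sub>R rep_mfun f t"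
      using rep_mfun_scaleC[of c f] by (auto simp: scaleR_scaleC scaleC_scaleC mult.commute)
    show k: "c *\<^sub>C f \<in> ?X"
      unfolding L2w_carrier_iff by (rule sq_int_AE_cong[OF sq_int_scaleC _ ae]) (use f in \<open>auto simp: L2w_carrier_iff\<close>)
    show "wl2 \<nu> (c *\<^sub>C f) = c *\<^sub>C wl2 \<nu> f"
      using ae rep_wl2[OF f] rep_l2_scaleC[of c "wl2 \<nu> f"] by (intro wl2_eqI[OF k]) auto
  qed
  have zero: "0 \<in> ?X"
    unfolding L2w_carrier_iff
    by (rule sq_int_AE_cong[OF sq_int_0]) (use rep_mfun_0 in auto)
  have inj: "inj_on (wl2 \<nu>) ?X"
  proof (rule inj_onI)
    fix f g assume f: "f \<in> ?X" and g: "g \<in> ?X" and "wl2 \<nu> f = wl2 \<nu> g"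
    then have "AE t in lborel. exp (- \<nu> * t) *\<^sub>R rep_mfun f t = exp (- \<nu> * t) *\<^sub>R rep_mfun g t"
      using rep_wl2[OF f] rep_wl2[OF g] by auto
    then show "f = g" by (intro mfun_eqI) auto
  qed
  have surj: "v \<in> wl2 \<nu> ` ?X" for v :: "'a l2"
  proof -
    have eq: "(\<lambda>t. exp (- \<nu> * t) *\<^sub>R exp (\<nu> * t) *\<^sub>R rep_l2 v t) = rep_l2 v"
      by (simp add: exp_add[symmetric])
    have "(\<lambda>t. exp (\<nu> * t) *\<^sub>R rep_l2 v t) \<in> borel_measurable borel" by measurable
    from abs_mfun_carrier[OF _ this, of \<nu>]
    have "abs_mfun (\<lambda>t. exp (\<nu> * t) *\<^sub>R rep_l2 v t) \<in> ?X"
      "wl2 \<nu> (abs_mfun (\<lambda>t. exp (\<nu> * t) *\<^sub>R rep_l2 v t)) = v" unfolding eq by simp_all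
    then show ?thesis by (intro image_eqI) auto
  qed
  have inner: "hinner (L2w \<nu>) f g = cinner (wl2 \<nu> f) (wl2 \<nu> g)" if f: "f \<in> ?X" and g: "g \<in> ?X" for f g
  proof -
    have "cinner (wl2 \<nu> f) (wl2 \<nu> g)
        = (\<integral>t. cinner (exp (- \<nu> * t) *\<^sub>R rep_mfun f t) (exp (- \<nu> * t) *\<^sub>R rep_mfun g t) \<partial>lborel)"
      unfolding wl2_def by (rule cinner_l2_of) (use f g in \<open>auto simp: L2w_carrier_iff\<close>)
    also have "(\<lambda>t. cinner (exp (- \<nu> * t) *\<^sub>R rep_mfun f t) (exp (- \<nu> * t) *\<^sub>R rep_mfun g t))
        = (\<lambda>t. cinner (rep_mfun f t) (rep_mfun g t) * exp (- 2 * \<nu> * t))"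
      unfolding exp_weight by (simp add: fun_eq_iff scaleR_scaleC cinner_scaleC_left cinner_scaleC_right)
    also have "(\<integral>t. cinner (rep_mfun f t) (rep_mfun g t) * exp (- 2 * \<nu> * t) \<partial>lborel) = hinner (L2w \<nu>) f g"
      by (simp add: L2w_def)
    finally show ?thesis ..
  qed
  have img: "wl2 \<nu> ` ?X = UNIV" using surj by blast
  show ?thesis
    unfolding unitary_map_def cvec.subspace_def clinear_on_def bij_betw_def
    by (intro conjI ballI allI zero add scale inj img inner)
qed

text \<open>The Fourier-Laplace transform: remove the weight, then apply the Fourier transform.\<close>

definition FL :: "real \<Rightarrow> 'a::separable_chilbert mfun \<Rightarrow> 'a l2" where
  "FL \<nu> f = fourier_l2 1 (wl2 \<nu> f)"

lemma unitary_FL: "unitary_map (L2w \<nu>) (FL \<nu> :: 'a::separable_chilbert mfun \<Rightarrow> 'a l2)"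
proof -
  note W = unitary_wl2[of \<nu>, where 'a = 'a]
  have "bij_betw (fourier_l2 1 \<circ> wl2 \<nu>) (hcarrier (L2w \<nu>)) (UNIV :: 'a l2 set)"
    by (rule bij_betw_trans[OF unitary_map_bij[OF W] bij_fourier_l2])
  then show ?thesis
    using unitary_map_subspace[OF W]
    by (simp add: unitary_map_def FL_def[abs_def] o_def clinear_on_def unitary_map_add[OF W]
        unitary_map_scaleC[OF W] unitary_map_inner[OF W] fourier_l2_add fourier_l2_scaleC cinner_fourier_l2)
qed

lemma wl2_0_mfun_of_l2: "mfun_of_l2 v \<in> hcarrier (L2w 0)" "wl2 0 (mfun_of_l2 v) = v"
proof -
  show c: "mfun_of_l2 v \<in> hcarrier (L2w 0)"
    using sq_int_rep_l2[of v] by (simp add: L2w_carrier_iff rep_l2_def[symmetric])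
  show "wl2 0 (mfun_of_l2 v) = v"
    by (rule wl2_eqI[OF c]) (simp add: rep_l2_def)
qed

lemma fourier_laplace_test_eq:
  "fourier_laplace_test \<nu> \<phi> = fourier_int 1 (\<lambda>t. exp (- \<nu> * t) *\<^sub>R \<phi> t)"
proof
  fix x
  have "exp (- \<i> * complex_of_real x * complex_of_real y - complex_of_real \<nu> * complex_of_real y) *\<^sub>C \<phi> y
      = cis (- (1 * x * y)) *\<^sub>C exp (- \<nu> * y) *\<^sub>R \<phi> y" for y
  proof -
    have "exp (- \<i> * complex_of_real x * complex_of_real y - complex_of_real \<nu> * complex_of_real y)
        = cis (- (x * y)) * complex_of_real (exp (- \<nu> * y))"
      unfolding cis_conv_exp exp_of_real[symmetric] exp_add[symmetric]
      by (rule arg_cong[of _ _ exp]) (simp add: complex_eq_iff)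
    then show ?thesis by (simp add: scaleR_scaleC scaleC_scaleC)
  qed
  then show "fourier_laplace_test \<nu> \<phi> x = fourier_int 1 (\<lambda>t. exp (- \<nu> * t) *\<^sub>R \<phi> t) x"
    by (simp add: fourier_laplace_test_def fourier_int_def)
qed

text \<open>Test functions that approximate \<open>f\<close> in the weighted norm have transforms that converge to
  \<^term>\<open>FL \<nu> f\<close>, since both norms are preserved; hence the closure that defines the transform is
  single-valued and agrees with \<^term>\<open>FL \<nu>\<close>.\<close>

lemma fourier_laplace_eq:
  assumes f: "f \<in> hcarrier (L2w \<nu>)"
  shows "fourier_laplace \<nu> f = mfun_of_l2 (FL \<nu> f)"
proof -
  note W = unitary_wl2[of \<nu>] and W0 = unitary_wl2[of 0]
  have weighted: "test_function (\<lambda>t. exp (- \<nu> * t) *\<^sub>R \<phi> t)" if "test_function \<phi>" for \<phi> :: "real \<Rightarrow> 'a"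
    by (rule test_function_exp_scaleR[OF that])
  have n1: "hnorm (L2w \<nu>) (abs_mfun \<phi> - f) = norm (l2_of (\<lambda>t. exp (- \<nu> * t) *\<^sub>R \<phi> t) - wl2 \<nu> f)"
    if \<phi>: "test_function \<phi>" for \<phi>
  proof -
    note a = abs_mfun_carrier[OF sq_int_test_function[OF weighted[OF \<phi>]] ccont_measurable[OF test_function_ccont[OF \<phi>]]]
    show ?thesis
      unfolding unitary_map_hnorm[OF W unitary_map_carrier_diff[OF W a(1) f]] unitary_map_diff[OF W a(1) f] a(2) ..
  qed
  have n2: "hnorm (L2w 0) (abs_mfun (fourier_laplace_test \<nu> \<phi>) - g)
      = norm (fourier_l2 1 (l2_of (\<lambda>t. exp (- \<nu> * t) *\<^sub>R \<phi> t)) - wl2 0 g)"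
    if \<phi>: "test_function \<phi>" and g: "g \<in> hcarrier (L2w 0)" for \<phi> and g :: "'a mfun"
  proof -
    have sq: "sq_int (fourier_laplace_test \<nu> \<phi>)"
      unfolding fourier_laplace_test_eq
      by (rule plancherel_fourier_int(1)[OF test_function_ccont[OF weighted[OF \<phi>]]]) simp
    have a: "abs_mfun (fourier_laplace_test \<nu> \<phi>) \<in> hcarrier (L2w 0)"
      "wl2 0 (abs_mfun (fourier_laplace_test \<nu> \<phi>)) = l2_of (fourier_laplace_test \<nu> \<phi>)"
      using abs_mfun_carrier[of 0 "fourier_laplace_test \<nu> \<phi>"] sq by (simp_all add: sq_int_measurable)
    show ?thesis
      unfolding unitary_map_hnorm[OF W0 unitary_map_carrier_diff[OF W0 a(1) g]] unitary_map_diff[OF W0 a(1) g] a(2)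
      unfolding fourier_laplace_test_eq fourier_l2_test[OF mult_1 weighted[OF \<phi>]] ..
  qed
  show ?thesis
    unfolding fourier_laplace_def
  proof (rule the_equality)
    obtain \<psi> where \<psi>: "\<And>n. test_function (\<psi> n)" "(\<lambda>n. l2_of (\<psi> n)) \<longlonglongrightarrow> wl2 \<nu> f"
      using test_l2_sequence by blast
    define \<phi> where "\<phi> n t = exp (\<nu> * t) *\<^sub>R \<psi> n t" for n t
    have \<phi>: "test_function (\<phi> n)" for n unfolding \<phi>_def by (rule test_function_exp_scaleR[OF \<psi>(1)])
    have eq: "(\<lambda>t. exp (- \<nu> * t) *\<^sub>R \<phi> n t) = \<psi> n" for n by (simp add: \<phi>_def exp_add[symmetric])
    have "(\<lambda>n. hnorm (L2w \<nu>) (abs_mfun (\<phi> n) - f)) \<longlonglongrightarrow> 0"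
      unfolding n1[OF \<phi>] eq using \<psi>(2) by (simp add: tendsto_norm_zero LIM_zero)
    moreover have "(\<lambda>n. hnorm (L2w 0) (abs_mfun (fourier_laplace_test \<nu> (\<phi> n)) - mfun_of_l2 (FL \<nu> f))) \<longlonglongrightarrow> 0"
      unfolding n2[OF \<phi> wl2_0_mfun_of_l2(1)] eq wl2_0_mfun_of_l2(2) FL_def
      by (intro tendsto_norm_zero LIM_zero fourier_l2_tendsto \<psi>) simp
    ultimately show "mfun_of_l2 (FL \<nu> f) \<in> hcarrier (L2w 0) \<and> (\<exists>\<phi>. (\<forall>n. test_function (\<phi> n)) \<and>
        (\<lambda>n. hnorm (L2w \<nu>) (abs_mfun (\<phi> n) - f)) \<longlonglongrightarrow> 0 \<and>
        (\<lambda>n. hnorm (L2w 0) (abs_mfun (fourier_laplace_test \<nu> (\<phi> n)) - mfun_of_l2 (FL \<nu> f))) \<longlonglongrightarrow> 0)"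
      using \<phi> wl2_0_mfun_of_l2(1) by blast
  next
    fix g :: "'a mfun"
    assume "g \<in> hcarrier (L2w 0) \<and> (\<exists>\<phi>. (\<forall>n. test_function (\<phi> n)) \<and>
        (\<lambda>n. hnorm (L2w \<nu>) (abs_mfun (\<phi> n) - f)) \<longlonglongrightarrow> 0 \<and>
        (\<lambda>n. hnorm (L2w 0) (abs_mfun (fourier_laplace_test \<nu> (\<phi> n)) - g)) \<longlonglongrightarrow> 0)"
    then obtain \<phi> where g: "g \<in> hcarrier (L2w 0)" and \<phi>: "\<And>n. test_function (\<phi> n)"
      and l1: "(\<lambda>n. hnorm (L2w \<nu>) (abs_mfun (\<phi> n) - f)) \<longlonglongrightarrow> 0"
      and l2: "(\<lambda>n. hnorm (L2w 0) (abs_mfun (fourier_laplace_test \<nu> (\<phi> n)) - g)) \<longlonglongrightarrow> 0" by blast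
    have "(\<lambda>n. fourier_l2 1 (l2_of (\<lambda>t. exp (- \<nu> * t) *\<^sub>R \<phi> n t))) \<longlonglongrightarrow> fourier_l2 1 (wl2 \<nu> f)"
      using l1 unfolding n1[OF \<phi>] tendsto_norm_zero_iff by (intro fourier_l2_tendsto) (auto dest: LIM_zero_cancel)
    moreover have "(\<lambda>n. fourier_l2 1 (l2_of (\<lambda>t. exp (- \<nu> * t) *\<^sub>R \<phi> n t))) \<longlonglongrightarrow> wl2 0 g"
      using l2 unfolding n2[OF \<phi> g] tendsto_norm_zero_iff by (rule LIM_zero_cancel)
    ultimately have "wl2 0 g = wl2 0 (mfun_of_l2 (FL \<nu> f))"
      unfolding wl2_0_mfun_of_l2(2) FL_def by (rule LIMSEQ_unique[symmetric])
    then show "g = mfun_of_l2 (FL \<nu> f)" using unitary_map_inj[OF W0 g wl2_0_mfun_of_l2(1)] by blast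
  qed
qed

section \<open>Multiplication operators\<close>

text \<open>Continuity in operator norm guarantees that \<open>t \<mapsto> F t (f t)\<close> is measurable for measurable \<open>f\<close>.\<close>

definition symbol :: "(real \<Rightarrow> 'a::complex_inner \<Rightarrow>\<^sub>L 'b::complex_inner) \<Rightarrow> bool" where
  "symbol F \<longleftrightarrow> continuous_on UNIV F \<and> bounded (range F) \<and> (\<forall>t. complex_linear (F t))"

lemma symbol_boundedE:
  assumes "symbol F"
  obtains C where "C \<ge> 0" "\<And>t. norm (F t) \<le> C"
proof -
  obtain B where "\<And>t. norm (F t) \<le> B" using assms by (auto simp: symbol_def bounded_iff)
  then show ?thesis using that[of B] norm_ge_zero order_trans by blast
qed

lemma continuous_mult_measurable:
  fixes F :: "real \<Rightarrow> 'a::separable_chilbert \<Rightarrow>\<^sub>L 'b::separable_chilbert"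
  assumes F: "continuous_on UNIV F" and f: "f \<in> borel_measurable borel"
  shows "(\<lambda>t. F t (f t)) \<in> borel_measurable borel"
proof (rule borel_measurable_continuous_Pair[where f = "\<lambda>t. t" and g = f and H = "\<lambda>t x. F t x"])
  show "continuous_on UNIV (\<lambda>x. F (fst x) (snd x))"
    by (intro blinfun.continuous_on continuous_on_compose2[OF F] continuous_intros) auto
qed (use f in auto)

lemma sq_int_mult:
  fixes F :: "real \<Rightarrow> 'a::separable_chilbert \<Rightarrow>\<^sub>L 'b::separable_chilbert"
  assumes F: "symbol F" and f: "sq_int f"
  shows "sq_int (\<lambda>t. F t (f t))"
proof -
  obtain C where C: "C \<ge> 0" "\<And>t. norm (F t) \<le> C" using symbol_boundedE[OF F] by blast
  show ?thesis
  proof (rule sq_int_bound)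
    show "(\<lambda>t. F t (f t)) \<in> borel_measurable borel"
      using F f by (intro continuous_mult_measurable) (auto simp: symbol_def sq_int_def)
    show "integrable lborel (\<lambda>t. C\<^sup>2 * (norm (f t))\<^sup>2)" using f by (simp add: sq_int_def)
    show "AE t in lborel. (norm (F t (f t)))\<^sup>2 \<le> C\<^sup>2 * (norm (f t))\<^sup>2"
    proof (rule AE_I2)
      fix t
      have "norm (F t (f t)) \<le> C * norm (f t)"
        using norm_blinfun[of "F t" "f t"] mult_right_mono[OF C(2)[of t] norm_ge_zero[of "f t"]] by linarith
      from power_mono[OF this norm_ge_zero, of 2] show "(norm (F t (f t)))\<^sup>2 \<le> C\<^sup>2 * (norm (f t))\<^sup>2"
        by (simp add: power_mult_distrib)
    qed
  qed
qed

definition mulop :: "(real \<Rightarrow> 'a \<Rightarrow>\<^sub>L 'b) \<Rightarrow> 'a::separable_chilbert l2 \<Rightarrow>\<^sub>L 'b::separable_chilbert l2" where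
  "mulop F = Blinfun (\<lambda>v. l2_of (\<lambda>t. F t (rep_l2 v t)))"

lemma norm_l2_of_mult_le:
  assumes F: "symbol F" and C: "\<And>t. norm (F t) \<le> C"
  shows "norm (l2_of (\<lambda>t. F t (rep_l2 v t))) \<le> C * norm v"
proof -
  have C0: "C \<ge> 0" using C norm_ge_zero order_trans by blast
  have sq: "sq_int (\<lambda>t. F t (rep_l2 v t))" by (rule sq_int_mult[OF F]) simp
  have "(norm (l2_of (\<lambda>t. F t (rep_l2 v t))))\<^sup>2 = (\<integral>t. (norm (F t (rep_l2 v t)))\<^sup>2 \<partial>lborel)"
    by (rule power2_norm_l2_of[OF sq])
  also have "\<dots> \<le> (\<integral>t. C\<^sup>2 * (norm (rep_l2 v t))\<^sup>2 \<partial>lborel)"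
  proof (rule integral_mono)
    fix t
    have "norm (F t (rep_l2 v t)) \<le> C * norm (rep_l2 v t)"
      using norm_blinfun[of "F t" "rep_l2 v t"] mult_right_mono[OF C[of t] norm_ge_zero[of "rep_l2 v t"]] by linarith
    from power_mono[OF this norm_ge_zero, of 2]
    show "(norm (F t (rep_l2 v t)))\<^sup>2 \<le> C\<^sup>2 * (norm (rep_l2 v t))\<^sup>2" by (simp add: power_mult_distrib)
  qed (use sq sq_int_rep_l2[of v] in \<open>auto simp: sq_int_def\<close>)
  also have "\<dots> = (C * norm v)\<^sup>2" by (simp add: power2_norm_l2 power_mult_distrib)
  finally show ?thesis by (rule power2_le_imp_le) (simp add: C0)
qed

lemma mulop_apply:
  fixes F :: "real \<Rightarrow> 'a::separable_chilbert \<Rightarrow>\<^sub>L 'b::separable_chilbert"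
  assumes F: "symbol F"
  shows "mulop F v = l2_of (\<lambda>t. F t (rep_l2 v t))"
proof -
  obtain C where C: "C \<ge> 0" "\<And>t. norm (F t) \<le> C" using symbol_boundedE[OF F] by blast
  have sq: "sq_int (\<lambda>t. F t (rep_l2 v t))" for v by (rule sq_int_mult[OF F]) simp
  have "bounded_linear (\<lambda>v. l2_of (\<lambda>t. F t (rep_l2 v t)))"
  proof (rule bounded_linear_intro[where K = C])
    fix v w :: "'a l2" and r
    have "l2_of (\<lambda>t. F t (rep_l2 v t)) + l2_of (\<lambda>t. F t (rep_l2 w t)) = l2_of (\<lambda>t. F t (rep_l2 v t) + F t (rep_l2 w t))"
      by (rule l2_of_add[OF sq sq, symmetric])
    also have "\<dots> = l2_of (\<lambda>t. F t (rep_l2 (v + w) t))"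
      by (rule l2_of_eqI[OF sq_int_add[OF sq sq]])
         (use rep_l2_of[OF sq, of "v + w"] rep_l2_add[of v w] in \<open>auto simp: blinfun.add_right\<close>)
    finally show "l2_of (\<lambda>t. F t (rep_l2 (v + w) t)) = l2_of (\<lambda>t. F t (rep_l2 v t)) + l2_of (\<lambda>t. F t (rep_l2 w t))" ..
    have "r *\<^sub>R l2_of (\<lambda>t. F t (rep_l2 v t)) = l2_of (\<lambda>t. r *\<^sub>R F t (rep_l2 v t))"
      by (simp add: scaleR_scaleC l2_of_scaleC[OF sq])
    also have "\<dots> = l2_of (\<lambda>t. F t (rep_l2 (r *\<^sub>R v) t))"
      by (rule l2_of_eqI[OF sq_int_scaleR[OF sq]])
         (use rep_l2_of[OF sq, of "r *\<^sub>R v"] rep_l2_scaleR[of r v] in \<open>auto simp: blinfun.scaleR_right\<close>)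
    finally show "l2_of (\<lambda>t. F t (rep_l2 (r *\<^sub>R v) t)) = r *\<^sub>R l2_of (\<lambda>t. F t (rep_l2 v t))" ..
    show "norm (l2_of (\<lambda>t. F t (rep_l2 v t))) \<le> norm v * C"
      using norm_l2_of_mult_le[OF F C(2), of v] by (simp add: mult.commute)
  qed
  then show ?thesis by (simp add: mulop_def bounded_linear_Blinfun_apply)
qed

lemma rep_mulop: "symbol F \<Longrightarrow> AE t in lborel. rep_l2 (mulop F v) t = F t (rep_l2 v t)"
  unfolding mulop_apply by (intro rep_l2_of sq_int_mult) simp_all

lemma mulop_eqI: "symbol F \<Longrightarrow> (AE t in lborel. F t (rep_l2 v t) = rep_l2 w t) \<Longrightarrow> mulop F v = w"
  by (rule l2_eqI) (use rep_mulop[of F v] in auto)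

lemma norm_mulop_le:
  assumes "symbol F" and "\<And>t. norm (F t) \<le> C"
  shows "norm (mulop F) \<le> C"
proof (rule norm_blinfun_bound)
  show "0 \<le> C" using assms(2) norm_ge_zero order_trans by blast
qed (simp add: mulop_apply[OF assms(1)] norm_l2_of_mult_le[OF assms])

lemma mulop_complex_linear: "symbol F \<Longrightarrow> complex_linear (mulop F)"
  unfolding complex_linear_def
proof (intro allI)
  fix c v assume F: "symbol F"
  show "mulop F (c *\<^sub>C v) = c *\<^sub>C mulop F v"
    by (rule mulop_eqI[OF F])
       (use rep_mulop[OF F, of v] rep_l2_scaleC[of c v] rep_l2_scaleC[of c "mulop F v"] F in
         \<open>auto simp: symbol_def complex_linear_def\<close>)
qed

lemma symbol_compose: "symbol F \<Longrightarrow> symbol G \<Longrightarrow> symbol (\<lambda>t. F t o\<^sub>L G t)"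
proof -
  assume F: "symbol F" and G: "symbol G"
  obtain C where C: "C \<ge> 0" "\<And>t. norm (F t) \<le> C" using symbol_boundedE[OF F] by blast
  obtain D where D: "D \<ge> 0" "\<And>t. norm (G t) \<le> D" using symbol_boundedE[OF G] by blast
  have "norm (F t o\<^sub>L G t) \<le> C * D" for t
    using C D by (meson norm_blinfun_compose mult_mono norm_ge_zero order_trans)
  then have "bounded (range (\<lambda>t. F t o\<^sub>L G t))" by (auto simp: bounded_iff)
  moreover have "continuous_on UNIV (\<lambda>t. F t o\<^sub>L G t)"
    using F G by (intro blinfun_compose.continuous_on) (auto simp: symbol_def)
  ultimately show ?thesis using F G by (simp add: symbol_def complex_linear_compose)
qed

lemma mulop_compose:
  assumes F: "symbol F" and G: "symbol G"
  shows "mulop (\<lambda>t. F t o\<^sub>L G t) = mulop F o\<^sub>L mulop G"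
proof (rule blinfun_eqI)
  fix v
  show "mulop (\<lambda>t. F t o\<^sub>L G t) v = (mulop F o\<^sub>L mulop G) v"
    by (rule mulop_eqI[OF symbol_compose[OF F G]])
       (use rep_mulop[OF F, of "mulop G v"] rep_mulop[OF G, of v] in auto)
qed

text \<open>Weak convergence of the symbols at every point, with a uniform bound, gives weak convergence of
  the multiplication operators by dominated convergence.\<close>

lemma mulop_wot_tendsto:
  fixes F :: "nat \<Rightarrow> real \<Rightarrow> 'a::separable_chilbert \<Rightarrow>\<^sub>L 'b::separable_chilbert"
  assumes F: "\<And>k. symbol (F k)" and G: "symbol G" and C: "\<And>k t. norm (F k t) \<le> C"
    and lim: "\<And>t. wot_tendsto (\<lambda>k. F k t) (G t)"
  shows "wot_tendsto (\<lambda>k. mulop (F k)) (mulop G)"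
  unfolding wot_tendsto_def
proof (intro allI)
  fix v :: "'a l2" and w :: "'b l2"
  have sq: "sq_int (\<lambda>t. H t (rep_l2 v t))" if "symbol H" for H :: "real \<Rightarrow> 'a \<Rightarrow>\<^sub>L 'b"
    by (rule sq_int_mult[OF that]) simp
  have eq: "cinner w (mulop H v) = (\<integral>t. cinner (rep_l2 w t) (H t (rep_l2 v t)) \<partial>lborel)" if "symbol H" for H :: "real \<Rightarrow> 'a \<Rightarrow>\<^sub>L 'b"
    using cinner_l2_of[OF sq_int_rep_l2[of w] sq[OF that]] by (simp add: mulop_apply[OF that])
  have C0: "C \<ge> 0" using C[of 0 0] norm_ge_zero order_trans by blast
  have "(\<lambda>k. \<integral>t. cinner (rep_l2 w t) (F k t (rep_l2 v t)) \<partial>lborel) \<longlonglongrightarrow> (\<integral>t. cinner (rep_l2 w t) (G t (rep_l2 v t)) \<partial>lborel)"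
  proof (rule integral_dominated_convergence)
    show "integrable lborel (\<lambda>t. C * ((norm (rep_l2 w t))\<^sup>2 + (norm (rep_l2 v t))\<^sup>2))"
      using sq_int_rep_l2[of v] sq_int_rep_l2[of w] by (simp add: sq_int_def)
    show "AE t in lborel. (\<lambda>k. cinner (rep_l2 w t) (F k t (rep_l2 v t))) \<longlonglongrightarrow> cinner (rep_l2 w t) (G t (rep_l2 v t))"
      using lim by (simp add: wot_tendsto_def)
    show "AE t in lborel. norm (cinner (rep_l2 w t) (F k t (rep_l2 v t))) \<le> C * ((norm (rep_l2 w t))\<^sup>2 + (norm (rep_l2 v t))\<^sup>2)" for k
    proof (rule AE_I2)
      fix t
      have "cmod (cinner (rep_l2 w t) (F k t (rep_l2 v t))) \<le> norm (rep_l2 w t) * norm (F k t (rep_l2 v t))"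
        by (rule norm_cinner_le)
      also have "\<dots> \<le> norm (rep_l2 w t) * (C * norm (rep_l2 v t))"
        using norm_blinfun[of "F k t" "rep_l2 v t"] mult_right_mono[OF C[of k t] norm_ge_zero[of "rep_l2 v t"]]
        by (intro mult_left_mono) auto
      also have "\<dots> = C * (norm (rep_l2 w t) * norm (rep_l2 v t))" by simp
      also have "\<dots> \<le> C * ((norm (rep_l2 w t))\<^sup>2 + (norm (rep_l2 v t))\<^sup>2)"
        by (rule mult_left_mono[OF norm_mult_le_sum_squares C0])
      finally show "norm (cinner (rep_l2 w t) (F k t (rep_l2 v t))) \<le> C * ((norm (rep_l2 w t))\<^sup>2 + (norm (rep_l2 v t))\<^sup>2)" .
    qed
  qed (use sq[OF F] sq[OF G] in \<open>auto intro!: measurable_cinner simp: sq_int_def\<close>)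
  then show "(\<lambda>k. cinner w (mulop (F k) v)) \<longlonglongrightarrow> cinner w (mulop G v)" by (simp add: eq F G)
qed

lemma mulop_coercive:
  fixes F :: "real \<Rightarrow> 'a::separable_chilbert \<Rightarrow>\<^sub>L 'a"
  assumes F: "symbol F" and co: "\<And>t x. c * (norm x)\<^sup>2 \<le> x \<bullet> F t x"
  shows "c * (norm v)\<^sup>2 \<le> v \<bullet> mulop F v"
proof -
  have sq: "sq_int (\<lambda>t. F t (rep_l2 v t))" by (rule sq_int_mult[OF F]) simp
  have "c * (norm v)\<^sup>2 = (\<integral>t. c * (norm (rep_l2 v t))\<^sup>2 \<partial>lborel)" by (simp add: power2_norm_l2)
  also have "\<dots> \<le> (\<integral>t. rep_l2 v t \<bullet> F t (rep_l2 v t) \<partial>lborel)"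
    by (rule integral_mono)
       (use sq_int_rep_l2[of v] sq_int_integrable_inner[OF sq_int_rep_l2 sq] in \<open>auto simp: sq_int_def co\<close>)
  also have "\<dots> = v \<bullet> mulop F v"
    unfolding inner_l2_def by (rule integral_cong_AE)
      (use rep_mulop[OF F, of v] sq in \<open>auto simp: sq_int_def intro!: borel_measurable_inner\<close>)
  finally show ?thesis .
qed

text \<open>The adjoint in the definition of the functional calculus is the inverse of the transform, so
  \<open>M(\<partial>\<^sub>0\<^sup>-\<^sup>1)\<close> becomes multiplication by \<open>M (1 / (\<i> t + \<nu>))\<close>.\<close>

lemma fct_calc_FL:
  assumes F: "symbol (\<lambda>t. M (1 / (\<i> * complex_of_real t + complex_of_real \<nu>)))" (is "symbol ?F")
    and f: "f \<in> hcarrier (L2w \<nu>)"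
  shows "fct_calc \<nu> M f \<in> hcarrier (L2w \<nu>)" and "FL \<nu> (fct_calc \<nu> M f) = mulop ?F (FL \<nu> f)"
proof -
  note U = unitary_FL[of \<nu>]
  define v where "v = FL \<nu> f"
  define y where "y = mult_op ?F (fourier_laplace \<nu> f)"
  have sq: "sq_int (\<lambda>t. ?F t (rep_l2 v t))" by (rule sq_int_mult[OF F]) simp
  have y: "y = mfun_of_l2 (mulop ?F v)"
    unfolding y_def fourier_laplace_eq[OF f] mult_op_def mulop_apply[OF F] mfun_of_l2_l2_of[OF sq]
    by (simp add: v_def rep_l2_def)
  have hy: "hinner (L2w 0) (fourier_laplace \<nu> x') y = cinner (FL \<nu> x') (mulop ?F v)" if "x' \<in> hcarrier (L2w \<nu>)" for x'
    unfolding fourier_laplace_eq[OF that] y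
    by (simp add: unitary_map_inner[OF unitary_wl2[of 0]] wl2_0_mfun_of_l2)
  define x where "x = unitary_inv (L2w \<nu>) (FL \<nu>) (mulop ?F v)"
  have x: "x \<in> hcarrier (L2w \<nu>)" "FL \<nu> x = mulop ?F v"
    by (simp_all add: x_def unitary_inv_carrier[OF U] unitary_map_inv[OF U])
  have "fct_calc \<nu> M f = x"
    unfolding fct_calc_def adjoint_op_def y_def[symmetric]
  proof (rule the_equality)
    show "x \<in> hcarrier (L2w \<nu>) \<and> (\<forall>x'\<in>hcarrier (L2w \<nu>). hinner (L2w \<nu>) x' x = hinner (L2w 0) (fourier_laplace \<nu> x') y)"
      using x by (simp add: hy unitary_map_inner[OF U])
    fix z assume z: "z \<in> hcarrier (L2w \<nu>) \<and> (\<forall>x'\<in>hcarrier (L2w \<nu>). hinner (L2w \<nu>) x' z = hinner (L2w 0) (fourier_laplace \<nu> x') y)"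
    have "cinner w (FL \<nu> z) = cinner w (FL \<nu> x)" for w
    proof -
      have "cinner (FL \<nu> x') (FL \<nu> z) = cinner (FL \<nu> x') (FL \<nu> x)" if "x' \<in> hcarrier (L2w \<nu>)" for x'
        using z x that by (simp add: hy unitary_map_inner[OF U, symmetric])
      from this[OF unitary_inv_carrier[OF U, of w]] show ?thesis by (simp add: unitary_map_inv[OF U])
    qed
    then have "FL \<nu> z = FL \<nu> x" by (rule cinner_extensionality)
    then show "z = x" using unitary_map_inj[OF U] z x by blast
  qed
  then show "fct_calc \<nu> M f \<in> hcarrier (L2w \<nu>)" "FL \<nu> (fct_calc \<nu> M f) = mulop ?F (FL \<nu> f)"
    using x by (simp_all add: v_def)
qed

section \<open>The time derivative\<close>

text \<open>The symbol of \<open>\<partial>\<^sub>0\<^sup>-\<^sup>1\<close>. It parametrizes the image of a vertical line under inversion, a circle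
  through the origin.\<close>

definition inv_line :: "real \<Rightarrow> real \<Rightarrow> complex" where
  "inv_line \<nu> t = 1 / (\<i> * complex_of_real t + complex_of_real \<nu>)"

definition J_op :: "real \<Rightarrow> 'a::separable_chilbert l2 \<Rightarrow>\<^sub>L 'a l2" where
  "J_op \<nu> = mulop (\<lambda>t. inv_line \<nu> t *\<^sub>C id_blinfun)"

lemma line_nonzero: "\<nu> > 0 \<Longrightarrow> \<i> * complex_of_real t + complex_of_real \<nu> \<noteq> 0"
  by (simp add: complex_eq_iff)

lemma norm_inv_line_le:
  assumes "\<nu> > 0"
  shows "cmod (inv_line \<nu> t) \<le> 1 / \<nu>"
proof -
  have "\<nu> \<le> cmod (\<i> * complex_of_real t + complex_of_real \<nu>)"
    using complex_Re_le_cmod[of "\<i> * complex_of_real t + complex_of_real \<nu>"] by simp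
  then show ?thesis using assms by (simp add: inv_line_def norm_divide frac_le)
qed

lemma continuous_inv_line: "\<nu> > 0 \<Longrightarrow> continuous_on A (inv_line \<nu>)"
  unfolding inv_line_def by (intro continuous_intros) (simp add: line_nonzero)

lemma complex_linear_scaleC_id: "complex_linear (c *\<^sub>C id_blinfun)"
  by (simp add: complex_linear_def scaleC_blinfun.rep_eq scaleC_scaleC mult.commute)

lemma norm_scaleC_id_le: "norm (c *\<^sub>C (id_blinfun :: 'a::complex_inner \<Rightarrow>\<^sub>L 'a)) \<le> cmod c"
  by (rule norm_blinfun_bound) (simp_all add: scaleC_blinfun.rep_eq norm_scaleC)

lemma symbol_inv_line:
  assumes "\<nu> > 0"
  shows "symbol (\<lambda>t. inv_line \<nu> t *\<^sub>C (id_blinfun :: 'a::complex_inner \<Rightarrow>\<^sub>L 'a))"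
  unfolding symbol_def
proof (intro conjI allI complex_linear_scaleC_id)
  have "norm (inv_line \<nu> t *\<^sub>C (id_blinfun :: 'a \<Rightarrow>\<^sub>L 'a)) \<le> 1 / \<nu>" for t
    using norm_scaleC_id_le norm_inv_line_le[OF assms] order_trans by blast
  then show "bounded (range (\<lambda>t. inv_line \<nu> t *\<^sub>C (id_blinfun :: 'a \<Rightarrow>\<^sub>L 'a)))" by (auto simp: bounded_iff)
  show "continuous_on UNIV (\<lambda>t. inv_line \<nu> t *\<^sub>C (id_blinfun :: 'a \<Rightarrow>\<^sub>L 'a))"
    by (rule bounded_linear.continuous_on[OF bounded_linear_scaleC_left continuous_inv_line[OF assms]])
qed

lemma norm_J_op_le: "\<nu> > 0 \<Longrightarrow> norm (J_op \<nu> :: 'a::separable_chilbert l2 \<Rightarrow>\<^sub>L 'a l2) \<le> 1 / \<nu>"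
  unfolding J_op_def using symbol_inv_line norm_scaleC_id_le norm_inv_line_le order_trans
  by (intro norm_mulop_le) blast+

lemma J_op_complex_linear: "\<nu> > 0 \<Longrightarrow> complex_linear (J_op \<nu>)"
  unfolding J_op_def by (intro mulop_complex_linear symbol_inv_line)

lemma rep_J_op: "\<nu> > 0 \<Longrightarrow> AE t in lborel. rep_l2 (J_op \<nu> v) t = inv_line \<nu> t *\<^sub>C rep_l2 v t"
  unfolding J_op_def using rep_mulop[OF symbol_inv_line, of \<nu> v] by (simp add: scaleC_blinfun.rep_eq)

lemma J_op_inj:
  assumes \<nu>: "\<nu> > 0" and "J_op \<nu> v = J_op \<nu> w"
  shows "v = w"
proof (rule l2_eqI)
  have "AE t in lborel. inv_line \<nu> t *\<^sub>C rep_l2 v t = inv_line \<nu> t *\<^sub>C rep_l2 w t"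
    using rep_J_op[OF \<nu>, of v] rep_J_op[OF \<nu>, of w] assms(2) by auto
  then show "AE t in lborel. rep_l2 v t = rep_l2 w t"
  proof eventually_elim
    fix t assume "inv_line \<nu> t *\<^sub>C rep_l2 v t = inv_line \<nu> t *\<^sub>C rep_l2 w t"
    then have "inverse (inv_line \<nu> t) *\<^sub>C inv_line \<nu> t *\<^sub>C rep_l2 v t = inverse (inv_line \<nu> t) *\<^sub>C inv_line \<nu> t *\<^sub>C rep_l2 w t"
      by simp
    moreover have "inv_line \<nu> t \<noteq> 0" by (simp add: inv_line_def line_nonzero[OF \<nu>])
    ultimately show "rep_l2 v t = rep_l2 w t" by (simp add: scaleC_scaleC scaleC_one)
  qed
qed

lemma J_op_commute:
  assumes \<nu>: "\<nu> > 0" and F: "symbol F"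
  shows "mulop F o\<^sub>L J_op \<nu> = J_op \<nu> o\<^sub>L mulop F"
proof -
  have "(\<lambda>t. F t o\<^sub>L (inv_line \<nu> t *\<^sub>C id_blinfun)) = (\<lambda>t. (inv_line \<nu> t *\<^sub>C id_blinfun) o\<^sub>L F t)"
    using F by (simp add: symbol_def scaleC_compose_right scaleC_compose_left)
  then show ?thesis
    using mulop_compose[OF F symbol_inv_line[OF \<nu>]] mulop_compose[OF symbol_inv_line[OF \<nu>] F]
    by (simp add: J_op_def)
qed

lemma smooth_cexp: "smooth (\<lambda>t::real. exp (w * complex_of_real t))"
proof (rule smooth_coinduct[where P = "\<lambda>f. \<exists>a. f = (\<lambda>t::real. a * exp (w * complex_of_real t))"])
  fix f :: "real \<Rightarrow> complex" assume "\<exists>a. f = (\<lambda>t. a * exp (w * complex_of_real t))"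
  then obtain a where a: "f = (\<lambda>t. a * exp (w * complex_of_real t))" by blast
  have "(f has_vector_derivative a * (w * exp (w * complex_of_real t))) (at t)" for t
    unfolding a
    by (rule has_vector_derivative_real_field[of "\<lambda>z. a * exp (w * z)"]) (auto intro!: derivative_eq_intros)
  then show "\<exists>f'. (\<exists>a. f' = (\<lambda>t. a * exp (w * complex_of_real t))) \<and> (\<forall>t. (f has_vector_derivative f' t) (at t))"
    by (intro exI[of _ "\<lambda>t. (a * w) * exp (w * complex_of_real t)"]) (auto simp: mult.assoc intro!: exI[of _ "a * w"])
qed (intro exI[of _ 1], simp)

lemma test_function_cnj: "test_function \<phi> \<Longrightarrow> test_function (\<lambda>t. cnj (\<phi> t))"
  by (rule test_function_linear[OF bounded_linear_cnj])

text \<open>The functions against which the definition of the distributional derivative tests, moved to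
  the unweighted space.\<close>

definition weighted_test :: "real \<Rightarrow> (real \<Rightarrow> complex) \<Rightarrow> 'a::separable_chilbert \<Rightarrow> real \<Rightarrow> 'a" where
  "weighted_test \<nu> \<phi> a t = exp (\<nu> * t) *\<^sub>R (cnj (\<phi> t) *\<^sub>C a)"

lemma test_function_weighted: "test_function \<phi> \<Longrightarrow> test_function (weighted_test \<nu> \<phi> a)"
  unfolding weighted_test_def[abs_def]
  by (intro test_function_exp_scaleR test_function_linear[OF scaleC.bounded_linear_left] test_function_cnj)

lemma ccont_power2_norm: "ccont f \<Longrightarrow> ccont (\<lambda>t. (norm (f t))\<^sup>2)"
  by (rule ccont_from_zeros[of f]) (auto simp: ccont_def intro!: continuous_intros)

lemma integrable_test_scaleC:
  assumes \<phi>: "test_function \<phi>" and f: "f \<in> hcarrier (L2w \<nu>)"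
  shows "integrable lborel (\<lambda>t. \<phi> t *\<^sub>C rep_mfun f t)"
proof (rule Bochner_Integration.integrable_bound)
  have "ccont (\<lambda>t. exp (\<nu> * t) *\<^sub>R \<phi> t)" by (intro test_function_ccont test_function_exp_scaleR \<phi>)
  then have "ccont (\<lambda>t. (norm (exp (\<nu> * t) *\<^sub>R \<phi> t))\<^sup>2)" by (rule ccont_power2_norm)
  from ccont_integrable[OF this]
  show "integrable lborel (\<lambda>t. (norm (exp (\<nu> * t) *\<^sub>R \<phi> t))\<^sup>2 + (norm (exp (- \<nu> * t) *\<^sub>R rep_mfun f t))\<^sup>2)"
    using f by (intro Bochner_Integration.integrable_add) (auto simp: L2w_carrier_iff sq_int_def)
  have [measurable]: "\<phi> \<in> borel_measurable borel" by (intro ccont_measurable test_function_ccont \<phi>)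
  show "(\<lambda>t. \<phi> t *\<^sub>C rep_mfun f t) \<in> borel_measurable lborel" by measurable
  show "AE t in lborel. norm (\<phi> t *\<^sub>C rep_mfun f t)
      \<le> norm ((norm (exp (\<nu> * t) *\<^sub>R \<phi> t))\<^sup>2 + (norm (exp (- \<nu> * t) *\<^sub>R rep_mfun f t))\<^sup>2)"
  proof (rule AE_I2)
    fix t
    have "norm (\<phi> t *\<^sub>C rep_mfun f t) = norm (exp (\<nu> * t) *\<^sub>R \<phi> t) * norm (exp (- \<nu> * t) *\<^sub>R rep_mfun f t)"
      by (simp add: norm_scaleC exp_minus)
    also have "\<dots> \<le> (norm (exp (\<nu> * t) *\<^sub>R \<phi> t))\<^sup>2 + (norm (exp (- \<nu> * t) *\<^sub>R rep_mfun f t))\<^sup>2"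
      by (rule norm_mult_le_sum_squares)
    finally show "norm (\<phi> t *\<^sub>C rep_mfun f t)
      \<le> norm ((norm (exp (\<nu> * t) *\<^sub>R \<phi> t))\<^sup>2 + (norm (exp (- \<nu> * t) *\<^sub>R rep_mfun f t))\<^sup>2)" by simp
  qed
qed

lemma cinner_weighted_test:
  assumes \<phi>: "test_function \<phi>" and f: "f \<in> hcarrier (L2w \<nu>)"
  shows "cinner (l2_of (weighted_test \<nu> \<phi> a)) (wl2 \<nu> f) = cinner a (\<integral>t. \<phi> t *\<^sub>C rep_mfun f t \<partial>lborel)"
proof -
  have "cinner (l2_of (weighted_test \<nu> \<phi> a)) (wl2 \<nu> f)
      = (\<integral>t. cinner (weighted_test \<nu> \<phi> a t) (exp (- \<nu> * t) *\<^sub>R rep_mfun f t) \<partial>lborel)"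
    unfolding wl2_def
    by (intro cinner_l2_of[OF sq_int_test_function[OF test_function_weighted[OF \<phi>]]]) (use f in \<open>simp add: L2w_carrier_iff\<close>)
  also have "\<dots> = (\<integral>t. cinner a (\<phi> t *\<^sub>C rep_mfun f t) \<partial>lborel)"
    by (simp add: weighted_test_def scaleR_scaleC cinner_scaleC_left cinner_scaleC_right
        mult.assoc[symmetric] of_real_mult[symmetric] exp_add[symmetric] del: of_real_mult)
  also have "\<dots> = cinner a (\<integral>t. \<phi> t *\<^sub>C rep_mfun f t \<partial>lborel)"
    by (rule integral_bounded_linear[OF cinner.bounded_linear_right integrable_test_scaleC[OF \<phi> f]])
  finally show ?thesis .
qed

text \<open>Integration by parts: on the transforms of the test functions, differentiation is
  multiplication by \<open>- (\<nu> - \<i> x)\<close>.\<close>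

lemma fourier_int_weighted_derivative:
  assumes \<phi>: "test_function \<phi>"
  shows "fourier_int 1 (weighted_test \<nu> (vder \<phi>) a) x
    = - ((complex_of_real \<nu> - \<i> * complex_of_real x) *\<^sub>C fourier_int 1 (weighted_test \<nu> \<phi> a) x)"
proof -
  define w where "w = complex_of_real \<nu> - \<i> * complex_of_real x"
  define \<theta> where "\<theta> t = cnj (\<phi> t)" for t
  have d\<phi>: "(\<phi> has_vector_derivative vder \<phi> t) (at t)" for t
    using \<phi> by (intro has_vector_derivative_vder smooth_differentiable) (simp add: test_function_iff)
  have d\<theta>: "(\<theta> has_vector_derivative cnj (vder \<phi> t)) (at t)" for t
    unfolding \<theta>_def by (rule bounded_linear.has_vector_derivative[OF bounded_linear_cnj d\<phi>])
  have de: "((\<lambda>t. exp (w * complex_of_real t)) has_vector_derivative w * exp (w * complex_of_real t)) (at t)" for t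
    by (rule has_vector_derivative_real_field[of "\<lambda>z. exp (w * z)"]) (auto intro!: derivative_eq_intros)
  define c where "c t = exp (w * complex_of_real t) * \<theta> t" for t
  have dc: "(c has_vector_derivative exp (w * complex_of_real t) * cnj (vder \<phi> t) + w * exp (w * complex_of_real t) * \<theta> t) (at t)" for t
    unfolding c_def by (rule has_vector_derivative_mult[OF de d\<theta>])
  have tc: "test_function c"
    using smooth_bilinear[OF bounded_bilinear_mult smooth_cexp] test_function_cnj[OF \<phi>]
    unfolding test_function_iff c_def \<theta>_def by fastforce
  have ve: "exp (w * complex_of_real t) = cis (- (1 * x * t)) * complex_of_real (exp (\<nu> * t))" for t
    by (simp add: w_def cis_conv_exp exp_of_real[symmetric] exp_add[symmetric] algebra_simps)
  have eq: "cis (- (1 * x * t)) *\<^sub>C weighted_test \<nu> \<psi> a t = (exp (w * complex_of_real t) * cnj (\<psi> t)) *\<^sub>C a" for \<psi> t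
    by (simp add: ve weighted_test_def scaleR_scaleC scaleC_scaleC mult_ac)
  have int: "integrable lborel (\<lambda>t. cis (- (1 * x * t)) *\<^sub>C weighted_test \<nu> \<psi> a t)" if "test_function \<psi>" for \<psi>
    by (intro ccont_integrable ccont_cis_scaleC test_function_ccont test_function_weighted that)
  have "(\<integral>t. cis (- (1 * x * t)) *\<^sub>C weighted_test \<nu> (vder \<phi>) a t \<partial>lborel)
      + w *\<^sub>C (\<integral>t. cis (- (1 * x * t)) *\<^sub>C weighted_test \<nu> \<phi> a t \<partial>lborel)
      = (\<integral>t. cis (- (1 * x * t)) *\<^sub>C weighted_test \<nu> (vder \<phi>) a t + w *\<^sub>C cis (- (1 * x * t)) *\<^sub>C weighted_test \<nu> \<phi> a t \<partial>lborel)"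
    by (subst Bochner_Integration.integral_add)
       (use int[OF \<phi>] int[OF test_function_vder[OF \<phi>]] integral_bounded_linear[OF bounded_linear_scaleC int[OF \<phi>], of w]
         integrable_bounded_linear[OF bounded_linear_scaleC int[OF \<phi>], of w] in auto)
  also have "\<dots> = (\<integral>t. vder c t *\<^sub>C a \<partial>lborel)"
    unfolding eq fun_cong[OF vder_eqI[OF dc]] by (simp add: scaleC_scaleC scaleC_add_left \<theta>_def mult.assoc)
  also have "\<dots> = (\<integral>t. vder c t \<partial>lborel) *\<^sub>C a"
    by (rule integral_bounded_linear[OF scaleC.bounded_linear_left ccont_integrable[OF test_function_ccont[OF test_function_vder[OF tc]]]])
  also have "\<dots> = 0" by (simp add: integral_vder_test_function[OF tc])
  finally have "(\<integral>t. cis (- (1 * x * t)) *\<^sub>C weighted_test \<nu> (vder \<phi>) a t \<partial>lborel)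
      = - (w *\<^sub>C (\<integral>t. cis (- (1 * x * t)) *\<^sub>C weighted_test \<nu> \<phi> a t \<partial>lborel))"
    by (simp add: eq_neg_iff_add_eq_0)
  then show ?thesis
    by (simp add: fourier_int_def w_def scaleR_scaleC scaleC_scaleC scaleC.minus_right mult.commute)
qed

text \<open>Both sides of the defining equation of the distributional derivative are inner products with weighted test
  functions. By Plancherel they can be computed after the transform, where differentiating the test function
  multiplies by the number that cancels, up to sign, the symbol of \<open>\<partial>\<^sub>0\<^sup>-\<^sup>1\<close>.\<close>

lemma distr_derivative_from_FL:
  assumes \<nu>: "\<nu> > 0" and f: "f \<in> hcarrier (L2w \<nu>)" and g: "g \<in> hcarrier (L2w \<nu>)"
    and J: "FL \<nu> f = J_op \<nu> (FL \<nu> g)"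
  shows "distr_derivative f (g :: 'a::separable_chilbert mfun)"
  unfolding distr_derivative_def
proof (intro allI impI cinner_extensionality)
  fix \<phi> :: "real \<Rightarrow> complex" and a :: 'a assume \<phi>: "test_function \<phi>"
  define p where "p = weighted_test \<nu> \<phi> a"
  define q where "q = weighted_test \<nu> (vder \<phi>) a"
  have tp: "test_function p" "test_function q"
    by (simp_all add: p_def q_def test_function_weighted test_function_vder \<phi>)
  define G where "G = FL \<nu> g"
  have sq: "sq_int (fourier_int 1 p)" "sq_int (fourier_int 1 q)"
    by (intro plancherel_fourier_int(1) test_function_ccont tp; simp)+
  have "cinner a (\<integral>t. vder \<phi> t *\<^sub>C rep_mfun f t \<partial>lborel) = cinner (l2_of q) (wl2 \<nu> f)"
    unfolding q_def by (rule cinner_weighted_test[OF test_function_vder[OF \<phi>] f, symmetric])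
  also have "\<dots> = cinner (l2_of (fourier_int 1 q)) (FL \<nu> f)"
    by (simp add: FL_def fourier_l2_test[OF _ tp(2), symmetric] cinner_fourier_l2)
  also have "\<dots> = (\<integral>x. cinner (fourier_int 1 q x) (inv_line \<nu> x *\<^sub>C rep_l2 G x) \<partial>lborel)"
    unfolding J cinner_l2_def
    by (rule integral_cong_AE)
       (use rep_l2_of[OF sq(2)] rep_J_op[OF \<nu>, of G] sq_int_measurable[OF sq(2)] in
         \<open>auto simp: G_def intro!: measurable_cinner measurable_scaleC2
           borel_measurable_continuous_onI[OF continuous_inv_line[OF \<nu>]]\<close>)
  also have "\<dots> = (\<integral>x. - cinner (fourier_int 1 p x) (rep_l2 G x) \<partial>lborel)"
  proof (rule Bochner_Integration.integral_cong[OF refl])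
    fix x
    have "cnj (complex_of_real \<nu> - \<i> * complex_of_real x) * inv_line \<nu> x = 1"
      using line_nonzero[OF \<nu>, of x] by (simp add: inv_line_def add.commute)
    then have "inv_line \<nu> x * cnj (complex_of_real \<nu> - \<i> * complex_of_real x) = 1" by (simp only: mult.commute)
    then show "cinner (fourier_int 1 q x) (inv_line \<nu> x *\<^sub>C rep_l2 G x) = - cinner (fourier_int 1 p x) (rep_l2 G x)"
      unfolding q_def fourier_int_weighted_derivative[OF \<phi>] p_def[symmetric]
      by (simp add: cinner.minus_left cinner_scaleC_left cinner_scaleC_right mult.assoc[symmetric])
  qed
  also have "\<dots> = - cinner (l2_of (fourier_int 1 p)) G"
    using cinner_l2_of[OF sq(1) sq_int_rep_l2[of G]] by simp
  also have "\<dots> = - cinner (l2_of p) (wl2 \<nu> g)"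
    by (simp add: G_def FL_def fourier_l2_test[OF _ tp(1), symmetric] cinner_fourier_l2)
  also have "\<dots> = - cinner a (\<integral>t. \<phi> t *\<^sub>C rep_mfun g t \<partial>lborel)"
    unfolding p_def by (simp add: cinner_weighted_test[OF \<phi> g])
  finally show "cinner a (\<integral>t. \<phi> t *\<^sub>C rep_mfun g t \<partial>lborel) = cinner a (- (\<integral>t. vder \<phi> t *\<^sub>C rep_mfun f t \<partial>lborel))"
    by (simp add: cinner.minus_right)
qed

text \<open>The weight excludes the constants: a function in \<open>L\<^sup>2\<^sub>\<nu>\<close> with vanishing distributional
  derivative is zero. Given a test function \<open>\<theta>\<close>, subtract from it a multiple of a bump that sits at
  \<open>- n\<close>, so that the difference has a primitive with compact support. The pairing with the bump
  decays like \<open>exp (- \<nu> n)\<close>.\<close>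

lemma L2w_derivative_0:
  assumes \<nu>: "\<nu> > 0" and u: "u \<in> hcarrier (L2w \<nu>)"
    and zero: "\<And>\<phi>. test_function \<phi> \<Longrightarrow> (\<integral>t. vder \<phi> t *\<^sub>C rep_mfun u t \<partial>lborel) = 0"
  shows "wl2 \<nu> u = (0 :: 'a::separable_chilbert l2)"
proof -
  define b where "b t = complex_of_real (bump 0 1 0 t)" for t
  have tb: "test_function b" unfolding b_def by (rule test_function_linear[OF bounded_linear_of_real test_function_bump])
  define I where "I = (\<integral>t. b t \<partial>lborel)"
  have I: "I \<noteq> 0"
  proof
    assume "I = 0"
    then have "(\<integral>t. bump 0 1 0 t \<partial>lborel) = 0" by (simp add: I_def b_def)
    moreover have int: "integrable lborel (bump 0 1 0)"
      by (intro ccont_integrable test_function_ccont test_function_bump)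
    ultimately have "AE t in lborel. bump 0 1 0 t = 0"
      using integral_nonneg_eq_0_iff_AE[OF int] by (simp add: bump_nonneg)
    then have "AE t in lborel. t \<notin> {0<..<1::real}"
      using bump_pos[of 0 _ 1 0] by (auto elim!: eventually_mono) (metis less_irrefl)
    then have "emeasure lborel {0<..<1::real} = 0"
      by (subst (asm) AE_iff_measurable[of "{0<..<1}"]) auto
    then show False by simp
  qed
  define bn where "bn n t = b (1 * t + real n)" for n t
  have tbn: "test_function (bn n)" for n
  proof -
    obtain R where R: "\<And>t. R < \<bar>t\<bar> \<Longrightarrow> b t = 0" using tb by (auto simp: test_function_iff)
    have "bn n t = 0" if "R + real n < \<bar>t\<bar>" for t unfolding bn_def by (rule R) (use that in auto)
    moreover have "smooth (bn n)" unfolding bn_def using tb by (intro smooth_affine) (simp add: test_function_iff)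
    ultimately show ?thesis unfolding test_function_iff by blast
  qed
  have Ibn: "(\<integral>t. bn n t \<partial>lborel) = I" for n
    using lborel_integral_real_affine[of 1 b "real n"] by (simp add: bn_def I_def add.commute)
  have orth: "cinner (l2_of (weighted_test \<nu> \<theta> a)) (wl2 \<nu> u) = 0" if \<theta>: "test_function \<theta>" for \<theta> a
  proof -
    define k where "k = (\<integral>t. \<theta> t \<partial>lborel) / I"
    have eq: "(\<integral>t. \<theta> t *\<^sub>C rep_mfun u t \<partial>lborel) = k *\<^sub>C (\<integral>t. bn n t *\<^sub>C rep_mfun u t \<partial>lborel)" for n
    proof -
      have tk: "test_function (\<lambda>t. - k * bn n t)"
        by (rule test_function_linear[OF bounded_linear_mult_right tbn])
      define h where "h t = \<theta> t + - k * bn n t" for t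
      have th: "test_function h" unfolding h_def by (rule test_function_add[OF \<theta> tk])
      have i: "integrable lborel \<theta>" "integrable lborel (bn n)"
        by (intro ccont_integrable test_function_ccont \<theta> tbn)+
      have "(\<integral>t. h t \<partial>lborel) = 0"
        using i I by (simp add: h_def Ibn k_def)
      then obtain \<psi> where \<psi>: "test_function \<psi>" "vder \<psi> = h" using test_function_primitive[OF th] by blast
      have "(\<integral>t. h t *\<^sub>C rep_mfun u t \<partial>lborel) = 0" using zero[OF \<psi>(1)] fun_cong[OF \<psi>(2)] by simp
      moreover have "(\<lambda>t. h t *\<^sub>C rep_mfun u t) = (\<lambda>t. \<theta> t *\<^sub>C rep_mfun u t - k *\<^sub>C bn n t *\<^sub>C rep_mfun u t)"
        by (simp add: h_def scaleC.diff_left scaleC_scaleC)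
      ultimately show ?thesis
        using integrable_test_scaleC[OF \<theta> u] integral_bounded_linear[OF bounded_linear_scaleC integrable_test_scaleC[OF tbn u], of k n]
          integrable_bounded_linear[OF bounded_linear_scaleC integrable_test_scaleC[OF tbn u], of k n]
        by simp
    qed
    have nb: "norm (l2_of (weighted_test \<nu> (bn n) a)) = exp (- \<nu> * real n) * norm (l2_of (weighted_test \<nu> b a))" for n
    proof -
      have "(norm (l2_of (weighted_test \<nu> (bn n) a)))\<^sup>2 = (\<integral>t. (norm (weighted_test \<nu> (bn n) a t))\<^sup>2 \<partial>lborel)"
        by (intro power2_norm_l2_of sq_int_test_function test_function_weighted tbn)
      also have "\<dots> = (\<integral>s. (norm (weighted_test \<nu> (bn n) a (- real n + 1 * s)))\<^sup>2 \<partial>lborel)"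
        using lborel_integral_real_affine[of 1 "\<lambda>t. (norm (weighted_test \<nu> (bn n) a t))\<^sup>2" "- real n"] by simp
      also have "(\<lambda>s. (norm (weighted_test \<nu> (bn n) a (- real n + 1 * s)))\<^sup>2)
          = (\<lambda>s. (exp (- \<nu> * real n))\<^sup>2 * (norm (weighted_test \<nu> b a s))\<^sup>2)"
      proof
        fix s
        have "exp (\<nu> * (- real n + 1 * s)) = exp (- \<nu> * real n) * exp (\<nu> * s)"
          by (simp add: exp_add[symmetric] right_diff_distrib)
        then have "norm (weighted_test \<nu> (bn n) a (- real n + 1 * s)) = exp (- \<nu> * real n) * norm (weighted_test \<nu> b a s)"
          by (simp add: weighted_test_def bn_def)
        then show "(norm (weighted_test \<nu> (bn n) a (- real n + 1 * s)))\<^sup>2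
            = (exp (- \<nu> * real n))\<^sup>2 * (norm (weighted_test \<nu> b a s))\<^sup>2"
          by (simp only: power_mult_distrib)
      qed
      also have "(\<integral>s. (exp (- \<nu> * real n))\<^sup>2 * (norm (weighted_test \<nu> b a s))\<^sup>2 \<partial>lborel)
          = (exp (- \<nu> * real n))\<^sup>2 * (norm (l2_of (weighted_test \<nu> b a)))\<^sup>2"
        by (simp add: power2_norm_l2_of sq_int_test_function test_function_weighted tb)
      finally show ?thesis by (simp add: power_mult_distrib[symmetric])
    qed
    have le: "cmod (cinner (l2_of (weighted_test \<nu> \<theta> a)) (wl2 \<nu> u))
        \<le> exp (- \<nu> * real n) * (cmod k * norm (l2_of (weighted_test \<nu> b a)) * norm (wl2 \<nu> u))" for n
    proof -
      have "cinner (l2_of (weighted_test \<nu> \<theta> a)) (wl2 \<nu> u) = k * cinner (l2_of (weighted_test \<nu> (bn n) a)) (wl2 \<nu> u)"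
        by (simp add: cinner_weighted_test[OF \<theta> u] cinner_weighted_test[OF tbn u] eq[of n] cinner_scaleC_right)
      moreover have "cmod k * cmod (cinner (l2_of (weighted_test \<nu> (bn n) a)) (wl2 \<nu> u))
          \<le> cmod k * (norm (l2_of (weighted_test \<nu> (bn n) a)) * norm (wl2 \<nu> u))"
        by (intro mult_left_mono norm_cinner_le) simp
      ultimately show ?thesis by (simp add: norm_mult nb mult_ac)
    qed
    have "(\<lambda>n. exp (- \<nu> * real n) * (cmod k * norm (l2_of (weighted_test \<nu> b a)) * norm (wl2 \<nu> u))) \<longlonglongrightarrow>
        0 * (cmod k * norm (l2_of (weighted_test \<nu> b a)) * norm (wl2 \<nu> u))"
    proof (rule tendsto_mult_right)
      have "(\<lambda>n. exp (- \<nu>) ^ n) \<longlonglongrightarrow> 0" by (rule LIMSEQ_realpow_zero) (use \<nu> in auto)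
      then show "(\<lambda>n. exp (- \<nu> * real n)) \<longlonglongrightarrow> 0" by (simp add: exp_of_nat_mult[symmetric] mult.commute)
    qed
    then have "cmod (cinner (l2_of (weighted_test \<nu> \<theta> a)) (wl2 \<nu> u)) \<le> 0"
      using le by (intro LIMSEQ_le_const) auto
    then show ?thesis by simp
  qed
  have "{v. cinner v (wl2 \<nu> u) = 0} = UNIV"
  proof (rule bumps_total)
    show "closed {v. cinner v (wl2 \<nu> u) = 0}"
      by (intro closed_Collect_eq cinner.continuous_on continuous_intros)
    fix c d n and a :: 'a
    have t: "test_function (\<lambda>t. complex_of_real (exp ((- \<nu>) * t) *\<^sub>R bump c d n t))"
      by (intro test_function_linear[OF bounded_linear_of_real] test_function_exp_scaleR test_function_bump)
    have "weighted_test \<nu> (\<lambda>t. complex_of_real (exp ((- \<nu>) * t) *\<^sub>R bump c d n t)) a = (\<lambda>t. bump c d n t *\<^sub>R a)"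
      by (simp add: weighted_test_def fun_eq_iff scaleR_scaleC[symmetric] mult.assoc[symmetric] exp_add[symmetric]
          del: of_real_mult)
    with orth[OF t, of a] show "l2_of (\<lambda>t. bump c d n t *\<^sub>R a) \<in> {v. cinner v (wl2 \<nu> u) = 0}" by simp
  qed (auto simp: cinner_add_left scaleR_scaleC cinner_scaleC_left)
  then have "cinner (wl2 \<nu> u) (wl2 \<nu> u) = 0" by blast
  then show ?thesis by (simp add: cinner_self)
qed

text \<open>If \<open>g\<close> is the derivative of \<open>f\<close>, then it is also the derivative of the function with transform
  \<open>J (FL \<nu> g)\<close>, where \<open>J\<close> is multiplication by the symbol of \<open>\<partial>\<^sub>0\<^sup>-\<^sup>1\<close>. The difference of the two
  functions has derivative zero, so it vanishes.\<close>

lemma distr_derivative_iff_FL: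
  assumes \<nu>: "\<nu> > 0" and f: "f \<in> hcarrier (L2w \<nu>)" and g: "g \<in> hcarrier (L2w \<nu>)"
  shows "distr_derivative f (g :: 'a::separable_chilbert mfun) \<longleftrightarrow> FL \<nu> f = J_op \<nu> (FL \<nu> g)"
proof
  note U = unitary_FL[of \<nu>, where 'a = 'a] and W = unitary_wl2[of \<nu>, where 'a = 'a]
  assume fg: "distr_derivative f g"
  define f' where "f' = unitary_inv (L2w \<nu>) (FL \<nu>) (J_op \<nu> (FL \<nu> g))"
  have f': "f' \<in> hcarrier (L2w \<nu>)" "FL \<nu> f' = J_op \<nu> (FL \<nu> g)"
    by (simp_all add: f'_def unitary_inv_carrier[OF U] unitary_map_inv[OF U])
  have fg': "distr_derivative f' g" by (rule distr_derivative_from_FL[OF \<nu> f'(1) g f'(2)])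
  have u: "f - f' \<in> hcarrier (L2w \<nu>)" by (rule unitary_map_carrier_diff[OF W f f'(1)])
  have "wl2 \<nu> (f - f') = 0"
  proof (rule L2w_derivative_0[OF \<nu> u])
    fix \<phi> :: "real \<Rightarrow> complex" assume \<phi>: "test_function \<phi>"
    note i = integrable_test_scaleC[OF test_function_vder[OF \<phi>]]
    have "(\<integral>t. vder \<phi> t *\<^sub>C rep_mfun (f - f') t \<partial>lborel)
        = (\<integral>t. vder \<phi> t *\<^sub>C rep_mfun f t - vder \<phi> t *\<^sub>C rep_mfun f' t \<partial>lborel)"
      by (rule integral_cong_AE)
         (use i[OF u] i[OF f] i[OF f'(1)] rep_mfun_diff[of f f'] in \<open>auto simp: scaleC.diff_right\<close>)
    also have "\<dots> = 0"
      using i[OF f] i[OF f'(1)] fg fg' \<phi> by (simp add: distr_derivative_def)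
    finally show "(\<integral>t. vder \<phi> t *\<^sub>C rep_mfun (f - f') t \<partial>lborel) = 0" .
  qed
  then have "wl2 \<nu> f = wl2 \<nu> f'" by (simp add: unitary_map_diff[OF W f f'(1)])
  then show "FL \<nu> f = J_op \<nu> (FL \<nu> g)" using f'(2) by (simp add: FL_def)
qed (rule distr_derivative_from_FL[OF \<nu> f g])

lemma H1w_iff:
  assumes \<nu>: "\<nu> > 0"
  shows "f \<in> H1w \<nu> \<longleftrightarrow> f \<in> hcarrier (L2w \<nu>) \<and> (\<exists>v. FL \<nu> f = J_op \<nu> v)"
proof
  assume "f \<in> H1w \<nu>"
  then show "f \<in> hcarrier (L2w \<nu>) \<and> (\<exists>v. FL \<nu> f = J_op \<nu> v)"
    using distr_derivative_iff_FL[OF \<nu>] by (auto simp: H1w_def)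
next
  note U = unitary_FL[of \<nu>]
  assume "f \<in> hcarrier (L2w \<nu>) \<and> (\<exists>v. FL \<nu> f = J_op \<nu> v)"
  then obtain v where v: "f \<in> hcarrier (L2w \<nu>)" "FL \<nu> f = J_op \<nu> v" by blast
  have "distr_derivative f (unitary_inv (L2w \<nu>) (FL \<nu>) v)"
    using v by (intro distr_derivative_from_FL[OF \<nu>]) (auto simp: unitary_inv_carrier[OF U] unitary_map_inv[OF U])
  with v(1) show "f \<in> H1w \<nu>" using unitary_inv_carrier[OF U] by (auto simp: H1w_def)
qed

lemma d0_FL:
  assumes \<nu>: "\<nu> > 0" and f: "f \<in> hcarrier (L2w \<nu>)" and v: "FL \<nu> f = J_op \<nu> v"
  shows "d0 \<nu> f \<in> hcarrier (L2w \<nu>)" and "FL \<nu> (d0 \<nu> f) = v"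
proof -
  note U = unitary_FL[of \<nu>]
  define g where "g = unitary_inv (L2w \<nu>) (FL \<nu>) v"
  have g: "g \<in> hcarrier (L2w \<nu>)" "FL \<nu> g = v"
    by (simp_all add: g_def unitary_inv_carrier[OF U] unitary_map_inv[OF U])
  have "d0 \<nu> f = g"
    unfolding d0_def
  proof (rule the_equality)
    show "g \<in> hcarrier (L2w \<nu>) \<and> distr_derivative f g"
      using g v by (simp add: distr_derivative_iff_FL[OF \<nu> f])
    fix h assume "h \<in> hcarrier (L2w \<nu>) \<and> distr_derivative f h"
    then have h: "h \<in> hcarrier (L2w \<nu>)" "J_op \<nu> (FL \<nu> h) = J_op \<nu> (FL \<nu> g)"
      using distr_derivative_iff_FL[OF \<nu> f] g v by auto
    from J_op_inj[OF \<nu> h(2)] show "h = g" using unitary_map_inj[OF U h(1) g(1)] by blast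
  qed
  with g show "d0 \<nu> f \<in> hcarrier (L2w \<nu>)" "FL \<nu> (d0 \<nu> f) = v" by simp_all
qed

lemma d0_inv_FL:
  assumes \<nu>: "\<nu> > 0" and g: "g \<in> hcarrier (L2w \<nu>)"
  shows "d0_inv \<nu> g \<in> hcarrier (L2w \<nu>)" and "FL \<nu> (d0_inv \<nu> g) = J_op \<nu> (FL \<nu> g)"
proof -
  note U = unitary_FL[of \<nu>]
  define f where "f = unitary_inv (L2w \<nu>) (FL \<nu>) (J_op \<nu> (FL \<nu> g))"
  have f: "f \<in> hcarrier (L2w \<nu>)" "FL \<nu> f = J_op \<nu> (FL \<nu> g)"
    by (simp_all add: f_def unitary_inv_carrier[OF U] unitary_map_inv[OF U])
  have inj: "inj_on (d0 \<nu>) (H1w \<nu>)"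
  proof (rule inj_onI)
    fix x y assume "x \<in> H1w \<nu>" "y \<in> H1w \<nu>" and eq: "d0 \<nu> x = d0 \<nu> y"
    then obtain v w where x: "x \<in> hcarrier (L2w \<nu>)" "FL \<nu> x = J_op \<nu> v" and y: "y \<in> hcarrier (L2w \<nu>)" "FL \<nu> y = J_op \<nu> w"
      using H1w_iff[OF \<nu>] by blast
    then have "v = w" using d0_FL(2)[OF \<nu> x] d0_FL(2)[OF \<nu> y] eq by simp
    then show "x = y" using unitary_map_inj[OF U x(1) y(1)] x y by simp
  qed
  have "d0 \<nu> f = g"
    using unitary_map_inj[OF U d0_FL(1)[OF \<nu> f] g] d0_FL(2)[OF \<nu> f] by blast
  moreover have "f \<in> H1w \<nu>" using f H1w_iff[OF \<nu>] by blast
  ultimately have "d0_inv \<nu> g = f"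
    unfolding d0_inv_def inv_op_def by (simp add: the_inv_into_f_eq[OF inj])
  with f show "d0_inv \<nu> g \<in> hcarrier (L2w \<nu>)" "FL \<nu> (d0_inv \<nu> g) = J_op \<nu> (FL \<nu> g)" by simp_all
qed

section \<open>Transfer along unitary maps\<close>

text \<open>The operator \<open>A\<close> is \<open>B\<close> seen through the identifications \<open>U\<close> and \<open>V\<close>. Nothing is said about \<open>A\<close> off the
  carrier.\<close>

definition represents ::
  "'v hilb \<Rightarrow> ('v \<Rightarrow> 'h::real_normed_vector) \<Rightarrow> 'w hilb \<Rightarrow> ('w \<Rightarrow> 'k::real_normed_vector) \<Rightarrow>
    ('v \<Rightarrow> 'w) \<Rightarrow> ('h \<Rightarrow>\<^sub>L 'k) \<Rightarrow> bool" where
  "represents X U Y V A B \<longleftrightarrow> (\<forall>x\<in>hcarrier X. A x \<in> hcarrier Y \<and> V (A x) = B (U x))"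

lemma represents_compose:
  "represents X U Y V A A' \<Longrightarrow> represents Y V Z W B B' \<Longrightarrow> represents X U Z W (B \<circ> A) (B' o\<^sub>L A')"
  by (simp add: represents_def)

lemma represents_funpow:
  assumes A: "represents X U X U A A'"
  shows "represents X U X U (A ^^ n) (blinfun_pow A' n)"
proof (induction n)
  case 0
  then show ?case by (simp add: represents_def)
next
  case (Suc n)
  from represents_compose[OF this A] show ?case by (simp add: blinfun_pow_Suc comp_def)
qed

lemma represents_add:
  assumes "unitary_map Y V" "represents X U Y V A A'" "represents X U Y V B B'"
  shows "represents X U Y V (\<lambda>x. A x + B x) (A' + B')"
  using assms by (simp add: represents_def unitary_map_add unitary_map_carrier_add blinfun.add_left)

lemma represents_uminus:
  assumes V: "unitary_map Y V" and A: "represents X U Y V A A'"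
  shows "represents X U Y V (\<lambda>x. - A x) (- A')"
proof -
  have "- y \<in> hcarrier Y \<and> V (- y) = - V y" if "y \<in> hcarrier Y" for y
    using unitary_map_scaleC[OF V that, of "-1"] unitary_map_carrier_scaleC[OF V that, of "-1"]
    by (simp add: cvec.scale_minus_left scaleC_one)
  then show ?thesis using A by (simp add: represents_def blinfun.minus_left)
qed

lemma represents_bounded_op:
  assumes U: "unitary_map X U" and V: "unitary_map Y V" and A: "represents X U Y V A A'"
    and lin: "complex_linear A'"
  shows "bounded_op X Y A"
proof -
  have c: "A x \<in> hcarrier Y" and v: "V (A x) = A' (U x)" if "x \<in> hcarrier X" for x
    using A that by (auto simp: represents_def)
  have "A (x + y) = A x + A y" if x: "x \<in> hcarrier X" and y: "y \<in> hcarrier X" for x y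
  proof -
    have "V (A (x + y)) = V (A x + A y)"
      using x y by (simp add: v unitary_map_carrier_add[OF U] unitary_map_add[OF U] unitary_map_add[OF V] c blinfun.add_right)
    then show ?thesis
      using unitary_map_inj[OF V c[OF unitary_map_carrier_add[OF U x y]] unitary_map_carrier_add[OF V c[OF x] c[OF y]]]
      by simp
  qed
  moreover have "A (k *\<^sub>C x) = k *\<^sub>C A x" if x: "x \<in> hcarrier X" for k x
  proof -
    have "V (A (k *\<^sub>C x)) = V (k *\<^sub>C A x)"
      using x lin by (simp add: v unitary_map_carrier_scaleC[OF U] unitary_map_scaleC[OF U] unitary_map_scaleC[OF V] c complex_linear_def)
    then show ?thesis
      using unitary_map_inj[OF V c[OF unitary_map_carrier_scaleC[OF U x]] unitary_map_carrier_scaleC[OF V c[OF x]]]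
      by simp
  qed
  moreover have "hnorm Y (A x) \<le> norm A' * hnorm X x" if "x \<in> hcarrier X" for x
    using that by (simp add: unitary_map_hnorm[OF U] unitary_map_hnorm[OF V] c v norm_blinfun)
  ultimately show ?thesis unfolding bounded_op_def clinear_on_def using c by blast
qed

lemma op_sumsI:
  assumes U: "unitary_map X U" and V: "unitary_map Y V"
    and F: "\<And>l. represents X U Y V (F l) (F' l)" and lin: "\<And>l. complex_linear (F' l)"
    and S: "represents X U Y V S S'" and S': "F' sums S'" and linS: "complex_linear S'"
  shows "op_sums X Y F S"
  unfolding op_sums_def
proof (intro conjI allI impI)
  show "bounded_op X Y (F l)" for l by (rule represents_bounded_op[OF U V F lin])
  show "bounded_op X Y S" by (rule represents_bounded_op[OF U V S linS])
  fix e :: real assume "e > 0"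
  then obtain n0 where n0: "\<And>n. n \<ge> n0 \<Longrightarrow> norm ((\<Sum>l<n. F' l) - S') < e"
    using S' unfolding sums_def by (meson LIMSEQ_D)
  have sum: "(\<Sum>l<n. F l x) \<in> hcarrier Y \<and> V (\<Sum>l<n. F l x) = (\<Sum>l<n. F' l) (U x)" if "x \<in> hcarrier X" for n x
  proof (induction n)
    case 0
    have "V 0 = 0" using unitary_map_scaleC[OF V unitary_map_carrier_0[OF V], of 0] by simp
    then show ?case by (simp add: unitary_map_carrier_0[OF V])
  next
    case (Suc n)
    then show ?case
      using F[of n] that by (simp add: represents_def unitary_map_carrier_add[OF V] unitary_map_add[OF V] blinfun.add_left)
  qed
  show "\<exists>n0. \<forall>n\<ge>n0. \<forall>x\<in>hcarrier X. hnorm Y ((\<Sum>l<n. F l x) - S x) \<le> e * hnorm X x"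
  proof (intro exI allI impI ballI)
    fix n x assume n: "n0 \<le> n" and x: "x \<in> hcarrier X"
    have s: "S x \<in> hcarrier Y" "V (S x) = S' (U x)" using S x by (auto simp: represents_def)
    note a = sum[OF x, of n, THEN conjunct1] and b = sum[OF x, of n, THEN conjunct2]
    have "hnorm Y ((\<Sum>l<n. F l x) - S x) = norm (((\<Sum>l<n. F' l) - S') (U x))"
      by (simp add: unitary_map_hnorm[OF V unitary_map_carrier_diff[OF V a s(1)]] unitary_map_diff[OF V a s(1)] b s(2)
          blinfun.diff_left)
    also have "\<dots> \<le> norm ((\<Sum>l<n. F' l) - S') * norm (U x)" by (rule norm_blinfun)
    also have "\<dots> \<le> e * norm (U x)" using n0[OF n] by (intro mult_right_mono) auto
    finally show "hnorm Y ((\<Sum>l<n. F l x) - S x) \<le> e * hnorm X x" by (simp add: unitary_map_hnorm[OF U x])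
  qed
qed

text \<open>An unbounded operator is best described by its bounded inverse \<open>R\<close>: its domain is the range of
  \<open>R\<close>, and linearity, bijectivity and the inverse can be read off.\<close>

lemma
  assumes U: "unitary_map X U" and lin: "complex_linear R" and inj: "\<And>y y'. R y = R y' \<Longrightarrow> y = y'"
    and dom: "\<And>u. u \<in> D \<longleftrightarrow> u \<in> hcarrier X \<and> (\<exists>y. U u = R y)"
    and val: "\<And>u y. u \<in> hcarrier X \<Longrightarrow> U u = blinfun_apply R y \<Longrightarrow> A u \<in> hcarrier X \<and> U (A u) = y"
  shows linear_op_by_inverse: "linear_op X (D, A)"
    and cont_invertible_by_inverse: "cont_invertible X (D, A)"
    and inv_op_by_inverse: "f \<in> hcarrier X \<Longrightarrow> inv_op (D, A) f \<in> D \<and> U (inv_op (D, A) f) = R (U f)"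
    and solvable_by_inverse: "f \<in> hcarrier X \<Longrightarrow> \<exists>u\<in>D. A u = f \<and> U u = R (U f)"
    and inj_on_by_inverse: "inj_on A D"
proof -
  have A: "A u \<in> hcarrier X" "U u = R (U (A u))" "u \<in> hcarrier X" if "u \<in> D" for u
  proof -
    from that obtain y where u: "u \<in> hcarrier X" "U u = R y" unfolding dom by blast
    from val[OF u] u show "A u \<in> hcarrier X" "U u = R (U (A u))" "u \<in> hcarrier X" by simp_all
  qed
  have sol: "\<exists>u\<in>D. A u = f \<and> U u = R (U f)" if f: "f \<in> hcarrier X" for f
  proof -
    define u where "u = unitary_inv X U (R (U f))"
    have u: "u \<in> hcarrier X" "U u = R (U f)" by (simp_all add: u_def unitary_inv_carrier[OF U] unitary_map_inv[OF U])
    then have "u \<in> D" unfolding dom by blast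
    moreover have "A u = f" using val[OF u] unitary_map_inj[OF U _ f, of "A u"] by simp
    ultimately show ?thesis using u by blast
  qed
  show "\<exists>u\<in>D. A u = f \<and> U u = R (U f)" if f: "f \<in> hcarrier X" for f by (rule sol[OF f])
  show injA: "inj_on A D"
  proof (rule inj_onI)
    fix x y assume x: "x \<in> D" and y: "y \<in> D" and "A x = A y"
    then have "U x = U y" using A(2)[OF x] A(2)[OF y] by simp
    then show "x = y" using unitary_map_inj[OF U A(3)[OF x] A(3)[OF y]] by simp
  qed
  have ex: "u \<in> D" "A u = f" if u: "u \<in> hcarrier X" and f: "f \<in> hcarrier X" and eq: "U u = R (U f)" for u f
  proof -
    show "u \<in> D" unfolding dom using u eq by blast
    show "A u = f" using val[OF u eq] unitary_map_inj[OF U _ f, of "A u"] by simp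
  qed
  have add: "x + y \<in> D \<and> A (x + y) = A x + A y" if x: "x \<in> D" and y: "y \<in> D" for x y
  proof -
    have "U (x + y) = R (U (A x + A y))"
      using A[OF x] A[OF y] by (simp add: unitary_map_add[OF U] blinfun.add_right)
    note e = ex[OF unitary_map_carrier_add[OF U A(3)[OF x] A(3)[OF y]]
        unitary_map_carrier_add[OF U A(1)[OF x] A(1)[OF y]] this]
    show ?thesis using e by simp
  qed
  have scale: "c *\<^sub>C x \<in> D \<and> A (c *\<^sub>C x) = c *\<^sub>C A x" if x: "x \<in> D" for c x
  proof -
    have "U (c *\<^sub>C x) = R (U (c *\<^sub>C A x))"
      using A[OF x] lin by (simp add: unitary_map_scaleC[OF U] complex_linear_def)
    note e = ex[OF unitary_map_carrier_scaleC[OF U A(3)[OF x]] unitary_map_carrier_scaleC[OF U A(1)[OF x]] this]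
    show ?thesis using e by simp
  qed
  have zero: "0 \<in> D"
  proof -
    have "U 0 = 0" using unitary_map_scaleC[OF U unitary_map_carrier_0[OF U], of 0] by simp
    then show ?thesis using ex(1)[of 0 0] unitary_map_carrier_0[OF U] by (simp add: blinfun.zero_right)
  qed
  show lin_op: "linear_op X (D, A)"
    unfolding linear_op_def cvec.subspace_def clinear_on_def using add scale zero A by auto
  have surj: "A ` D = hcarrier X" using A(1) sol by blast
  show inv: "inv_op (D, A) f \<in> D \<and> U (inv_op (D, A) f) = R (U f)" if f: "f \<in> hcarrier X" for f
  proof -
    obtain u where u: "u \<in> D" "A u = f" "U u = R (U f)" using sol[OF f] by blast
    then have "inv_op (D, A) f = u" by (simp add: inv_op_def the_inv_into_f_eq[OF injA])
    with u show ?thesis by simp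
  qed
  have "hnorm X (inv_op (D, A) f) \<le> norm R * hnorm X f" if f: "f \<in> hcarrier X" for f
    using inv[OF f] A(3) by (simp add: unitary_map_hnorm[OF U] f norm_blinfun)
  then show "cont_invertible X (D, A)"
    unfolding cont_invertible_def using lin_op injA surj by (auto simp: bij_betw_def)
qed

lemma
  assumes U: "unitary_map X U" and A: "represents X U X U A A'" and lin: "complex_linear A'"
    and inv: "B' o\<^sub>L A' = id_blinfun" "A' o\<^sub>L B' = id_blinfun"
  shows cont_invertible_represents: "cont_invertible X (hcarrier X, A)"
    and inv_op_represents: "represents X U X U (inv_op (hcarrier X, A)) B'"
proof -
  have linB: "complex_linear B'" by (rule complex_linear_inv[OF lin inv])
  have BA: "B' (A' x) = x" and AB: "A' (B' x) = x" for x using inv by (simp_all add: blinfun_comp_idD)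
  have injB: "y = y'" if "B' y = B' y'" for y y' using arg_cong[OF that, of A'] by (simp add: AB)
  have dom: "u \<in> hcarrier X \<longleftrightarrow> u \<in> hcarrier X \<and> (\<exists>y. U u = B' y)" for u using BA by metis
  have val: "A u \<in> hcarrier X \<and> U (A u) = y" if "u \<in> hcarrier X" "U u = B' y" for u y
    using A that by (simp add: represents_def AB)
  show "cont_invertible X (hcarrier X, A)"
    by (rule cont_invertible_by_inverse[OF U linB injB dom val])
  show "represents X U X U (inv_op (hcarrier X, A)) B'"
    unfolding represents_def
  proof
    fix f assume f: "f \<in> hcarrier X"
    show "inv_op (hcarrier X, A) f \<in> hcarrier X \<and> U (inv_op (hcarrier X, A) f) = B' (U f)"
      by (rule inv_op_by_inverse[where D = "hcarrier X" and A = A and R = B', OF U linB injB dom val f])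
  qed
qed

section \<open>Block operators\<close>

definition block_blinfun ::
  "('h \<Rightarrow>\<^sub>L 'h) \<Rightarrow> ('k \<Rightarrow>\<^sub>L 'h) \<Rightarrow> ('h \<Rightarrow>\<^sub>L 'k) \<Rightarrow> ('k \<Rightarrow>\<^sub>L 'k) \<Rightarrow>
    ('h::real_normed_vector \<times> 'k::real_normed_vector) \<Rightarrow>\<^sub>L ('h \<times> 'k)" where
  "block_blinfun a b c d = Blinfun (block_op a b c d)"

lemma block_blinfun_apply: "block_blinfun a b c d w = (a (fst w) + b (snd w), c (fst w) + d (snd w))"
proof -
  have "bounded_linear (block_op a b c d)"
    unfolding block_op_def
    by (intro bounded_linear_Pair bounded_linear_add
        bounded_linear_compose[OF blinfun.bounded_linear_right] bounded_linear_fst bounded_linear_snd)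
  then show ?thesis by (simp add: block_blinfun_def bounded_linear_Blinfun_apply block_op_def)
qed

lemma complex_linear_block:
  "complex_linear a \<Longrightarrow> complex_linear b \<Longrightarrow> complex_linear c \<Longrightarrow> complex_linear d \<Longrightarrow>
    complex_linear (block_blinfun a b c d)"
  by (simp add: complex_linear_def block_blinfun_apply scaleC_prod_def scaleC_add_right)

lemma wot_tendsto_block:
  assumes "wot_tendsto a a'" "wot_tendsto b b'" "wot_tendsto c c'" "wot_tendsto d d'"
  shows "wot_tendsto (\<lambda>k. block_blinfun (a k) (b k) (c k) (d k)) (block_blinfun a' b' c' d')"
  using assms unfolding wot_tendsto_def
  by (auto simp: block_blinfun_apply cinner_prod_def cinner_add_right intro!: tendsto_add)

lemma unitary_map_hsum:
  assumes U: "unitary_map X U" and V: "unitary_map Y V"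
  shows "unitary_map (X \<oplus>\<^sub>H Y) (map_prod U V)"
proof -
  have c: "hcarrier (X \<oplus>\<^sub>H Y) = hcarrier X \<times> hcarrier Y" by (simp add: hsum_def)
  have "bij_betw (map_prod U V) (hcarrier X \<times> hcarrier Y) (UNIV \<times> UNIV)"
    by (intro bij_betw_map_prod unitary_map_bij U V)
  moreover have "clinear_on (hcarrier X \<times> hcarrier Y) (map_prod U V)"
    by (auto simp: clinear_on_def scaleC_prod_def unitary_map_add[OF U] unitary_map_add[OF V]
        unitary_map_scaleC[OF U] unitary_map_scaleC[OF V])
  moreover have "cvec.subspace (hcarrier X \<times> hcarrier Y)"
    unfolding cvec.subspace_def
    by (auto simp: scaleC_prod_def zero_prod_def unitary_map_carrier_0[OF U] unitary_map_carrier_0[OF V]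
        unitary_map_carrier_add[OF U] unitary_map_carrier_add[OF V]
        unitary_map_carrier_scaleC[OF U] unitary_map_carrier_scaleC[OF V])
  ultimately show ?thesis
    unfolding unitary_map_def c
    by (auto simp: hsum_def cinner_prod_def unitary_map_inner[OF U] unitary_map_inner[OF V])
qed

lemma represents_block:
  assumes U: "unitary_map X U" and V: "unitary_map Y V"
    and "represents X U X U A a" "represents Y V X U B b" "represents X U Y V C c" "represents Y V Y V D d"
  shows "represents (X \<oplus>\<^sub>H Y) (map_prod U V) (X \<oplus>\<^sub>H Y) (map_prod U V) (block_op A B C D) (block_blinfun a b c d)"
  using assms
  by (auto simp: represents_def hsum_def block_op_def block_blinfun_apply unitary_map_add unitary_map_carrier_add)

lemma represents_zero:
  assumes "unitary_map Y V"
  shows "represents X U Y V (\<lambda>_. 0) 0"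
  using unitary_map_scaleC[OF assms unitary_map_carrier_0[OF assms], of 0] unitary_map_carrier_0[OF assms]
  by (simp add: represents_def)

text \<open>If all entries but the lower left one are small, then the norm of the block operator need not be
  small, but its powers decay. In the norm \<open>(4 K + 1) \<parallel>w\<^sub>1\<parallel> + \<parallel>w\<^sub>2\<parallel>\<close> it is a contraction.\<close>

lemma norm_block_pow_le:
  assumes a: "norm a \<le> \<epsilon>" and b: "norm b \<le> \<epsilon>" and c: "norm c \<le> K" and d: "norm d \<le> \<epsilon>"
    and \<epsilon>: "\<epsilon> * (4 * K + 2) \<le> 1 / 4"
  shows "norm (blinfun_pow (block_blinfun a b c d) n) \<le> (4 * K + 2) * (1 / 2) ^ n"
proof -
  define Q where "Q = block_blinfun a b c d"
  define \<theta> where "\<theta> = 4 * K + 1"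
  define p where "p w = \<theta> * norm (fst w) + norm (snd w)" for w :: "'a \<times> 'b"
  have K: "0 \<le> K" using c norm_ge_zero order_trans by blast
  have e: "0 \<le> \<epsilon>" using a norm_ge_zero order_trans by blast
  have \<theta>: "1 \<le> \<theta>" "K \<le> \<theta> / 4" using K by (simp_all add: \<theta>_def)
  have \<theta>e: "\<theta> * \<epsilon> + \<epsilon> \<le> 1 / 4" using \<epsilon> by (simp add: \<theta>_def algebra_simps)
  have ap: "norm (A x) \<le> k * norm x" if "norm A \<le> k" for A :: "'c::real_normed_vector \<Rightarrow>\<^sub>L 'd::real_normed_vector" and k x
    using norm_blinfun[of A x] mult_right_mono[OF that norm_ge_zero[of x]] by linarith
  have contr: "p (Q w) \<le> p w / 2" for w
  proof -
    have "norm (fst (Q w)) \<le> \<epsilon> * norm (fst w) + \<epsilon> * norm (snd w)"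
      unfolding Q_def block_blinfun_apply fst_conv
      by (intro order_trans[OF norm_triangle_ineq] add_mono ap a b)
    then have "\<theta> * norm (fst (Q w)) \<le> \<theta> * (\<epsilon> * norm (fst w) + \<epsilon> * norm (snd w))"
      using \<theta> by (intro mult_left_mono) auto
    moreover have "norm (snd (Q w)) \<le> K * norm (fst w) + \<epsilon> * norm (snd w)"
      unfolding Q_def block_blinfun_apply snd_conv
      by (intro order_trans[OF norm_triangle_ineq] add_mono ap c d)
    ultimately have "p (Q w) \<le> (\<theta> * \<epsilon> + K) * norm (fst w) + (\<theta> * \<epsilon> + \<epsilon>) * norm (snd w)"
      by (simp add: p_def algebra_simps)
    also have "\<dots> \<le> (\<theta> / 2) * norm (fst w) + (1 / 2) * norm (snd w)"
      using \<theta> \<theta>e e by (intro add_mono mult_right_mono) auto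
    finally show ?thesis by (simp add: p_def field_simps)
  qed
  have pow: "p (blinfun_pow Q n w) \<le> (1 / 2) ^ n * p w" for w
  proof (induction n)
    case (Suc n)
    then show ?case using contr[of "blinfun_pow Q n w"] by (simp add: blinfun_pow_Suc)
  qed simp
  have low: "norm w \<le> p w" for w
  proof -
    have "norm w \<le> norm (fst w) + norm (snd w)" by (metis norm_Pair_le prod.collapse)
    also have "\<dots> \<le> p w" unfolding p_def using mult_right_mono[OF \<theta>(1) norm_ge_zero[of "fst w"]] by simp
    finally show ?thesis .
  qed
  have up: "p w \<le> (4 * K + 2) * norm w" for w
  proof -
    have "\<theta> * norm (fst w) \<le> \<theta> * norm w" "norm (snd w) \<le> norm w"
      using \<theta> norm_fst_le[of "fst w" "snd w"] norm_snd_le[of "snd w" "fst w"] by (auto intro: mult_left_mono)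
    then show ?thesis by (simp add: p_def \<theta>_def algebra_simps)
  qed
  show ?thesis unfolding Q_def[symmetric]
  proof (rule norm_blinfun_bound)
    fix w
    have "norm (blinfun_pow Q n w) \<le> (1 / 2) ^ n * p w" using low pow order_trans by blast
    also have "\<dots> \<le> (1 / 2) ^ n * ((4 * K + 2) * norm w)" by (intro mult_left_mono up) simp
    finally show "norm (blinfun_pow Q n w) \<le> (4 * K + 2) * (1 / 2) ^ n * norm w" by (simp add: mult_ac)
  qed (use K in simp)
qed

section \<open>Series of operators\<close>

lemma geometric_sums:
  fixes X :: "nat \<Rightarrow> 'x::banach"
  assumes le: "\<And>l. norm (X l) \<le> C * q ^ l" and q: "0 \<le> q" "q \<le> 1 / 2"
  shows "\<exists>S. X sums S \<and> norm S \<le> 2 * C"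
proof -
  have C: "0 \<le> C" using le[of 0] order_trans[OF norm_ge_zero, of "X 0"] by simp
  have geo: "summable (\<lambda>l. C * q ^ l)" using q by (intro summable_mult summable_geometric) simp
  have sm: "summable (\<lambda>l. norm (X l))" by (rule summable_comparison_test'[OF geo, of 0]) (simp add: le)
  have "norm (suminf X) \<le> (\<Sum>l. norm (X l))" by (rule summable_norm[OF sm])
  also have "\<dots> \<le> (\<Sum>l. C * q ^ l)" by (rule suminf_le[OF le sm geo])
  also have "\<dots> = C * (1 / (1 - q))" using q by (simp add: suminf_mult suminf_geometric)
  also have "\<dots> \<le> C * 2" using C q by (intro mult_left_mono) (auto simp: field_simps)
  finally show ?thesis using summable_norm_cancel[OF sm] by (intro exI[of _ "suminf X"]) (simp add: summable_sums mult.commute)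
qed

lemma complex_linear_sums:
  fixes X :: "nat \<Rightarrow> 'a::complex_inner \<Rightarrow>\<^sub>L 'b::complex_inner"
  assumes "X sums S" and "\<And>l. complex_linear (X l)"
  shows "complex_linear S"
  unfolding complex_linear_def
proof (intro allI)
  fix c x
  have s: "(\<lambda>l. X l y) sums S y" for y
    by (rule bounded_linear.sums[OF blinfun.bounded_linear_left assms(1)])
  have "(\<lambda>l. X l (c *\<^sub>C x)) sums (c *\<^sub>C S x)"
    using bounded_linear.sums[OF bounded_linear_scaleC s[of x], of c] assms(2) by (simp add: complex_linear_def)
  then show "S (c *\<^sub>C x) = c *\<^sub>C S x" using s sums_unique2 by blast
qed

lemma sums_compose_right:
  "X sums S \<Longrightarrow> (\<lambda>l. X l o\<^sub>L B) sums (S o\<^sub>L B)"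
  by (rule bounded_linear.sums[OF blinfun_compose.bounded_linear_left])

lemma sums_compose_left:
  "X sums S \<Longrightarrow> (\<lambda>l. B o\<^sub>L X l) sums (B o\<^sub>L S)"
  by (rule bounded_linear.sums[OF blinfun_compose.bounded_linear_right])

lemma wot_tendsto_compose_right:
  "wot_tendsto A L \<Longrightarrow> wot_tendsto (\<lambda>k. A k o\<^sub>L B) (L o\<^sub>L B)"
  by (simp add: wot_tendsto_def)

lemma wot_tendsto_add: "wot_tendsto A L \<Longrightarrow> wot_tendsto B K \<Longrightarrow> wot_tendsto (\<lambda>k. A k + B k) (L + K)"
  by (simp add: wot_tendsto_def blinfun.add_left cinner_add_right tendsto_add)

text \<open>Tannery's theorem for each matrix coefficient.\<close>

lemma wot_tendsto_sums:
  fixes X :: "nat \<Rightarrow> nat \<Rightarrow> 'a::complex_inner \<Rightarrow>\<^sub>L 'b::complex_inner"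
  assumes lim: "\<And>l. wot_tendsto (\<lambda>k. X k l) (Y l)" and le: "\<And>k l. norm (X k l) \<le> b l" and b: "summable b"
    and X: "\<And>k. X k sums S k" and Y: "Y sums T"
  shows "wot_tendsto S T"
  unfolding wot_tendsto_def
proof (intro allI)
  fix x :: 'a and y :: 'b
  have lin: "bounded_linear (\<lambda>A. cinner y (blinfun_apply A x))"
    by (rule bounded_linear_compose[OF cinner.bounded_linear_right blinfun.bounded_linear_left])
  have S: "(\<lambda>l. cinner y (X k l x)) sums cinner y (S k x)" for k by (rule bounded_linear.sums[OF lin X])
  have T: "(\<lambda>l. cinner y (Y l x)) sums cinner y (T x)" by (rule bounded_linear.sums[OF lin Y])
  have "cmod (cinner y (X k l x)) \<le> b l * (norm x * norm y)" for k l
  proof -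
    have "cmod (cinner y (X k l x)) \<le> norm y * norm (X k l x)" by (rule norm_cinner_le)
    also have "\<dots> \<le> norm y * (b l * norm x)"
      using norm_blinfun[of "X k l" x] mult_right_mono[OF le[of k l] norm_ge_zero[of x]] by (intro mult_left_mono) auto
    finally show ?thesis by (simp add: mult_ac)
  qed
  then have ev: "eventually (\<lambda>(l, k). norm (cinner y (X k l x)) \<le> b l * (norm x * norm y)) (at_top \<times>\<^sub>F sequentially)"
    by (intro always_eventually) auto
  have "(\<lambda>k. cinner y (X k l x)) \<longlonglongrightarrow> cinner y (Y l x)" for l
    using lim by (simp add: wot_tendsto_def)
  from tannerys_theorem[OF this ev summable_mult2[OF b]]
  have "(\<lambda>k. \<Sum>l. cinner y (X k l x)) \<longlonglongrightarrow> (\<Sum>l. cinner y (Y l x))" by simp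
  then show "(\<lambda>k. cinner y (S k x)) \<longlonglongrightarrow> cinner y (T x)"
    using S T by (simp add: sums_iff)
qed

lemma blinfun_pow_commute:
  assumes "A o\<^sub>L B = B o\<^sub>L C"
  shows "blinfun_pow A l o\<^sub>L B = B o\<^sub>L blinfun_pow C l"
proof (rule blinfun_eqI)
  have AB: "A (B x) = B (C x)" for x using arg_cong[OF assms, of "\<lambda>F. F x"] by simp
  show "(blinfun_pow A l o\<^sub>L B) x = (B o\<^sub>L blinfun_pow C l) x" for x
    by (induction l) (simp_all add: blinfun_pow_Suc AB)
qed

lemma blinfun_pow_compose:
  assumes "A o\<^sub>L B = B o\<^sub>L A"
  shows "blinfun_pow (A o\<^sub>L B) l = blinfun_pow A l o\<^sub>L blinfun_pow B l"
proof (rule blinfun_eqI)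
  have c: "B (blinfun_pow A l x) = blinfun_pow A l (B x)" for l x
    using arg_cong[OF blinfun_pow_commute[OF assms, of l], of "\<lambda>F. F x"] by simp
  show "blinfun_pow (A o\<^sub>L B) l x = (blinfun_pow A l o\<^sub>L blinfun_pow B l) x" for x
  proof (induction l arbitrary: x)
    case (Suc l)
    then show ?case by (simp add: blinfun_pow_Suc c)
  qed simp
qed

section \<open>The inverse of the evolutionary operator\<close>

text \<open>With \<open>J = \<partial>\<^sub>0\<^sup>-\<^sup>1\<close>, the system \<open>\<partial>\<^sub>0 m u + n\<^sub>0\<^sub>0 u + n\<^sub>0\<^sub>1 v = f\<close>, \<open>n\<^sub>1\<^sub>0 u + n\<^sub>1\<^sub>1 v = g\<close> is solved by
  eliminating \<open>v\<close>. For \<open>y = \<partial>\<^sub>0 m u\<close> the Schur complement gives \<open>y - a J y = f - n\<^sub>0\<^sub>1 n\<^sub>1\<^sub>1\<^sup>-\<^sup>1 g\<close> with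
  \<open>a = - (n\<^sub>0\<^sub>0 - n\<^sub>0\<^sub>1 n\<^sub>1\<^sub>1\<^sup>-\<^sup>1 n\<^sub>1\<^sub>0) m\<^sup>-\<^sup>1\<close>, and \<open>a J\<close> is small for large weights.\<close>

locale evo_system =
  fixes m mi n00 :: "'h::{complex_inner,banach} \<Rightarrow>\<^sub>L 'h" and n01 :: "'k::{complex_inner,banach} \<Rightarrow>\<^sub>L 'h"
    and n10 :: "'h \<Rightarrow>\<^sub>L 'k" and n11 ni :: "'k \<Rightarrow>\<^sub>L 'k"
    and J :: "'h \<Rightarrow>\<^sub>L 'h" and J' :: "'k \<Rightarrow>\<^sub>L 'k" and q j :: real
  assumes mi: "mi o\<^sub>L m = id_blinfun" "m o\<^sub>L mi = id_blinfun"
    and ni: "ni o\<^sub>L n11 = id_blinfun" "n11 o\<^sub>L ni = id_blinfun"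
    and comm: "mi o\<^sub>L J = J o\<^sub>L mi" "n00 o\<^sub>L J = J o\<^sub>L n00" "n01 o\<^sub>L J' = J o\<^sub>L n01"
      "n10 o\<^sub>L J = J' o\<^sub>L n10" "ni o\<^sub>L J' = J' o\<^sub>L ni"
    and J_inj: "\<And>x y. J x = J y \<Longrightarrow> x = y"
    and q: "norm (- ((n00 - (n01 o\<^sub>L ni o\<^sub>L n10)) o\<^sub>L mi)) \<le> q" and j: "norm J \<le> j" and qj: "q * j \<le> 1 / 2"
begin

definition a :: "'h \<Rightarrow>\<^sub>L 'h" where "a = - ((n00 - (n01 o\<^sub>L ni o\<^sub>L n10)) o\<^sub>L mi)"
definition f00 :: "nat \<Rightarrow> 'h \<Rightarrow>\<^sub>L 'h" where "f00 l = mi o\<^sub>L blinfun_pow a l"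
definition f01 :: "nat \<Rightarrow> 'k \<Rightarrow>\<^sub>L 'h" where "f01 l = - (mi o\<^sub>L blinfun_pow a l o\<^sub>L n01 o\<^sub>L ni)"
definition f10 :: "nat \<Rightarrow> 'h \<Rightarrow>\<^sub>L 'k" where "f10 l = - (ni o\<^sub>L n10 o\<^sub>L mi o\<^sub>L blinfun_pow a l)"
definition f11 :: "nat \<Rightarrow> 'k \<Rightarrow>\<^sub>L 'k" where
  "f11 l = ni o\<^sub>L n10 o\<^sub>L mi o\<^sub>L blinfun_pow a l o\<^sub>L n01 o\<^sub>L ni"
definition \<Theta> :: "'h \<Rightarrow>\<^sub>L 'h" where "\<Theta> = (\<Sum>l. blinfun_pow (a o\<^sub>L J) l)"
definition r00 :: "'h \<Rightarrow>\<^sub>L 'h" where "r00 = mi o\<^sub>L \<Theta> o\<^sub>L J"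
definition r01 :: "'k \<Rightarrow>\<^sub>L 'h" where "r01 = - (r00 o\<^sub>L n01 o\<^sub>L ni)"
definition r10 :: "'h \<Rightarrow>\<^sub>L 'k" where "r10 = - (ni o\<^sub>L n10 o\<^sub>L r00)"
definition r11 :: "'k \<Rightarrow>\<^sub>L 'k" where "r11 = ni o\<^sub>L n10 o\<^sub>L r00 o\<^sub>L n01 o\<^sub>L ni"
definition R :: "('h \<times> 'k) \<Rightarrow>\<^sub>L ('h \<times> 'k)" where "R = block_blinfun r00 r01 r10 (r11 + ni)"

lemma inverse_apply: "mi (m x) = x" "m (mi x) = x" "ni (n11 y) = y" "n11 (ni y) = y"
  using mi ni by (simp_all add: blinfun_comp_idD)

lemma comm_apply: "mi (J x) = J (mi x)" "n00 (J x) = J (n00 x)" "n01 (J' y) = J (n01 y)"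
  "n10 (J x) = J' (n10 x)" "ni (J' y) = J' (ni y)"
  using comm[THEN arg_cong, of "\<lambda>F. blinfun_apply F _"] by simp_all

lemma a_comm: "a o\<^sub>L J = J o\<^sub>L a"
  by (rule blinfun_eqI)
     (simp add: a_def blinfun.minus_left blinfun.minus_right blinfun.diff_left blinfun.diff_right comm_apply)

lemma \<Theta>: "blinfun_pow (a o\<^sub>L J) sums \<Theta>" "\<Theta> o\<^sub>L (id_blinfun - (a o\<^sub>L J)) = id_blinfun"
  "(id_blinfun - (a o\<^sub>L J)) o\<^sub>L \<Theta> = id_blinfun"
proof -
  have "norm (a o\<^sub>L J) \<le> q * j"
    using q j by (intro order_trans[OF norm_blinfun_compose] mult_mono) (auto simp: a_def intro: order_trans[OF norm_ge_zero])
  then have "norm (blinfun_pow (a o\<^sub>L J) l) \<le> 1 * (q * j) ^ l" for l by (simp add: norm_blinfun_pow_le)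
  moreover have "0 \<le> q * j"
    using q j norm_ge_zero order_trans by (metis mult_nonneg_nonneg)
  ultimately obtain T where T: "blinfun_pow (a o\<^sub>L J) sums T" "T o\<^sub>L (id_blinfun - (a o\<^sub>L J)) = id_blinfun"
      "(id_blinfun - (a o\<^sub>L J)) o\<^sub>L T = id_blinfun"
    using neumann_series[of "a o\<^sub>L J" 1 "q * j"] qj by auto
  moreover have "\<Theta> = T" unfolding \<Theta>_def using T(1) by (simp add: sums_iff)
  ultimately show "blinfun_pow (a o\<^sub>L J) sums \<Theta>" "\<Theta> o\<^sub>L (id_blinfun - (a o\<^sub>L J)) = id_blinfun"
    "(id_blinfun - (a o\<^sub>L J)) o\<^sub>L \<Theta> = id_blinfun" by simp_all
qed

lemma \<Theta>_J: "\<Theta> (J x) = J (\<Theta> x)"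
proof -
  have "(a o\<^sub>L J) o\<^sub>L J = J o\<^sub>L (a o\<^sub>L J)"
    by (rule blinfun_eqI) (use arg_cong[OF a_comm, of "\<lambda>F. F _"] in simp)
  from blinfun_pow_commute[OF this] have "(\<lambda>l. blinfun_pow (a o\<^sub>L J) l o\<^sub>L J) = (\<lambda>l. J o\<^sub>L blinfun_pow (a o\<^sub>L J) l)"
    by simp
  with sums_compose_right[OF \<Theta>(1), of J] sums_compose_left[OF \<Theta>(1), of J]
  have "\<Theta> o\<^sub>L J = J o\<^sub>L \<Theta>" by (metis sums_unique2)
  then show ?thesis by (drule_tac arg_cong[where f = "\<lambda>F. blinfun_apply F x"]) simp
qed

lemma R_apply:
  assumes "h = f - n01 (ni g)" and "u = mi (J (\<Theta> h))"
  shows "R (f, g) = (u, ni (g - n10 u))"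
  by (simp add: R_def block_blinfun_apply r00_def r01_def r10_def r11_def assms \<Theta>_J blinfun.add_left
      blinfun.minus_left blinfun.diff_right blinfun.add_right)

text \<open>The variable \<open>y\<close> stands for \<open>\<partial>\<^sub>0 m u\<close>. The equation \<open>m u = J y\<close> says both that \<open>m u\<close> lies in the domain
  of \<open>\<partial>\<^sub>0\<close> and what its derivative is.\<close>

lemma R_solves:
  assumes "R (f, g) = (u, v)"
  obtains y where "m u = J y" "y + n00 u + n01 v = f" "n10 u + n11 v = g"
proof -
  define h where "h = f - n01 (ni g)"
  define y where "y = \<Theta> h"
  have u: "u = mi (J y)" and v: "v = ni (g - n10 u)"
    using R_apply[OF h_def refl] assms by (auto simp: y_def)
  have "y - a (J y) = h"
    using blinfun_comp_idD[OF \<Theta>(3), of h] by (simp add: y_def blinfun.diff_left)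
  moreover have "a (J y) = - (n00 u - n01 (ni (n10 u)))"
    by (simp add: a_def u blinfun.minus_left blinfun.diff_left)
  ultimately have "y + n00 u + n01 v = f"
    by (simp add: h_def v blinfun.diff_right algebra_simps)
  moreover have "m u = J y" by (simp add: u inverse_apply)
  moreover have "n10 u + n11 v = g" by (simp add: v inverse_apply)
  ultimately show ?thesis using that by blast
qed

lemma R_left:
  assumes mu: "m u = J y"
  shows "R (y + n00 u + n01 v, n10 u + n11 v) = (u, v)"
proof -
  define f where "f = y + n00 u + n01 v"
  define g where "g = n10 u + n11 v"
  define h where "h = f - n01 (ni g)"
  have u: "u = mi (J y)" using mu[symmetric] by (simp add: inverse_apply)
  have "a (J y) = - (n00 u - n01 (ni (n10 u)))"
    by (simp add: a_def u blinfun.minus_left blinfun.diff_left)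
  then have "h = (id_blinfun - (a o\<^sub>L J)) y"
    by (simp add: h_def f_def g_def blinfun.diff_left blinfun.add_right inverse_apply)
  then have "\<Theta> h = y" using blinfun_comp_idD[OF \<Theta>(2), of y] by simp
  then have "R (f, g) = (u, ni (g - n10 u))" using R_apply[OF h_def refl] u by simp
  then show ?thesis by (simp add: f_def g_def inverse_apply)
qed

lemma R_inj:
  assumes "R w = R w'"
  shows "w = w'"
proof -
  obtain f g f' g' where w: "w = (f, g)" "w' = (f', g')" by (cases w, cases w') blast
  obtain u v where uv: "R (f, g) = (u, v)" by (cases "R (f, g)") blast
  obtain y where y: "m u = J y" "y + n00 u + n01 v = f" "n10 u + n11 v = g" using R_solves[OF uv] by blast
  have "R (f', g') = (u, v)" using assms uv w by simp
  then obtain y' where y': "m u = J y'" "y' + n00 u + n01 v = f'" "n10 u + n11 v = g'" using R_solves by blast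
  have "y = y'" using J_inj y y' by metis
  with y y' w show ?thesis by simp
qed

lemma J_pow_comm: "n01 (ni (blinfun_pow J' l x)) = blinfun_pow J l (n01 (ni x))"
proof -
  have "J o\<^sub>L (n01 o\<^sub>L ni) = (n01 o\<^sub>L ni) o\<^sub>L J'" by (rule blinfun_eqI) (simp add: comm_apply)
  from arg_cong[OF blinfun_pow_commute[OF this, of l], of "\<lambda>F. F x"] show ?thesis by simp
qed

lemma r00_sums: "(\<lambda>l. f00 l o\<^sub>L blinfun_pow J (Suc l)) sums r00"
proof -
  have "(\<lambda>l. f00 l o\<^sub>L blinfun_pow J (Suc l)) = (\<lambda>l. mi o\<^sub>L blinfun_pow (a o\<^sub>L J) l o\<^sub>L J)"
    by (rule ext, rule blinfun_eqI)
       (simp add: f00_def blinfun_pow_compose[OF a_comm] blinfun_pow_Suc2)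
  moreover have "(\<lambda>l. mi o\<^sub>L blinfun_pow (a o\<^sub>L J) l o\<^sub>L J) sums r00"
    unfolding r00_def by (intro sums_compose_right sums_compose_left \<Theta>(1))
  ultimately show ?thesis by simp
qed

lemma r01_sums: "(\<lambda>l. f01 l o\<^sub>L blinfun_pow J' (Suc l)) sums r01"
proof -
  have "(\<lambda>l. f01 l o\<^sub>L blinfun_pow J' (Suc l)) = (\<lambda>l. - ((f00 l o\<^sub>L blinfun_pow J (Suc l)) o\<^sub>L n01 o\<^sub>L ni))"
    by (rule ext, rule blinfun_eqI) (simp add: f01_def f00_def J_pow_comm blinfun.minus_left)
  moreover have "(\<lambda>l. - ((f00 l o\<^sub>L blinfun_pow J (Suc l)) o\<^sub>L n01 o\<^sub>L ni)) sums r01"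
    unfolding r01_def by (intro sums_minus sums_compose_right r00_sums)
  ultimately show ?thesis by simp
qed

lemma r10_sums: "(\<lambda>l. f10 l o\<^sub>L blinfun_pow J (Suc l)) sums r10"
proof -
  have "(\<lambda>l. f10 l o\<^sub>L blinfun_pow J (Suc l)) = (\<lambda>l. - (ni o\<^sub>L n10 o\<^sub>L (f00 l o\<^sub>L blinfun_pow J (Suc l))))"
    by (rule ext, rule blinfun_eqI) (simp add: f10_def f00_def blinfun.minus_left)
  moreover have "(\<lambda>l. - (ni o\<^sub>L n10 o\<^sub>L (f00 l o\<^sub>L blinfun_pow J (Suc l)))) sums r10"
    unfolding r10_def by (intro sums_minus sums_compose_left r00_sums)
  ultimately show ?thesis by simp
qed

lemma r11_sums: "(\<lambda>l. f11 l o\<^sub>L blinfun_pow J' (Suc l)) sums r11"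
proof -
  have "(\<lambda>l. f11 l o\<^sub>L blinfun_pow J' (Suc l)) = (\<lambda>l. ni o\<^sub>L n10 o\<^sub>L (f00 l o\<^sub>L blinfun_pow J (Suc l)) o\<^sub>L n01 o\<^sub>L ni)"
    by (rule ext, rule blinfun_eqI) (simp add: f11_def f00_def J_pow_comm)
  moreover have "(\<lambda>l. ni o\<^sub>L n10 o\<^sub>L (f00 l o\<^sub>L blinfun_pow J (Suc l)) o\<^sub>L n01 o\<^sub>L ni) sums r11"
    unfolding r11_def by (intro sums_compose_left sums_compose_right r00_sums)
  ultimately show ?thesis by simp
qed

end

section \<open>Functions of the inverse time derivative\<close>

text \<open>Inversion maps the half-plane \<open>Re w > \<nu>1\<close> to this disc.\<close>

lemma inv_line_in_disc:
  assumes "0 < \<nu>1" "\<nu>1 < \<nu>"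
  shows "inv_line \<nu> t \<in> ball (complex_of_real (1 / (2 * \<nu>1))) (1 / (2 * \<nu>1))"
proof -
  define w where "w = \<i> * complex_of_real t + complex_of_real \<nu>"
  have w0: "w \<noteq> 0" using assms by (simp add: w_def complex_eq_iff)
  have il: "inv_line \<nu> t = 1 / w" by (simp add: inv_line_def w_def)
  have "(cmod (2 * complex_of_real \<nu>1 - w))\<^sup>2 < (cmod w)\<^sup>2"
    using assms mult_strict_left_mono[of \<nu>1 \<nu> \<nu>1]
    unfolding cmod_power2 by (simp add: w_def power2_eq_square algebra_simps)
  then have lt: "cmod (2 * complex_of_real \<nu>1 - w) < cmod w" by (rule power2_less_imp_less) simp
  have "complex_of_real (1 / (2 * \<nu>1)) - inv_line \<nu> t = - (2 * complex_of_real \<nu>1 - w) / (2 * complex_of_real \<nu>1 * w)"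
    using w0 assms unfolding il by (simp add: field_simps)
  then have "cmod (complex_of_real (1 / (2 * \<nu>1)) - inv_line \<nu> t) = cmod (2 * complex_of_real \<nu>1 - w) / (2 * \<nu>1 * cmod w)"
    using assms by (simp add: norm_divide norm_mult norm_minus_commute)
  also have "\<dots> < cmod w / (2 * \<nu>1 * cmod w)"
    using lt w0 assms by (intro divide_strict_right_mono) auto
  also have "\<dots> = 1 / (2 * \<nu>1)" using w0 by simp
  finally show ?thesis by (simp add: dist_norm)
qed

lemma disc_subset:
  assumes "0 \<le> s" "s \<le> r"
  shows "ball (complex_of_real s) s \<subseteq> ball (complex_of_real r) r"
proof
  fix z assume "z \<in> ball (complex_of_real s) s"
  then have "dist (complex_of_real r) z < (r - s) + s"
    using dist_triangle[of "complex_of_real r" z "complex_of_real s"] assms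
    by (simp add: dist_of_real dist_real_def)
  then show "z \<in> ball (complex_of_real r) r" by simp
qed

lemma mulop_diff:
  assumes F: "symbol F" and G: "symbol G" and FG: "symbol (\<lambda>t. F t - G t)"
  shows "mulop (\<lambda>t. F t - G t) = mulop F - mulop G"
proof (rule blinfun_eqI)
  fix v
  show "mulop (\<lambda>t. F t - G t) v = (mulop F - mulop G) v"
    by (rule mulop_eqI[OF FG])
       (use rep_mulop[OF F, of v] rep_mulop[OF G, of v] rep_l2_diff[of "mulop F v" "mulop G v"] in
         \<open>auto simp: blinfun.diff_left\<close>)
qed

text \<open>The Fourier-Laplace transform of \<open>F(\<partial>\<^sub>0\<^sup>-\<^sup>1)\<close>.\<close>

definition mop :: "real \<Rightarrow> (complex \<Rightarrow> 'a \<Rightarrow>\<^sub>L 'b) \<Rightarrow> 'a::separable_chilbert l2 \<Rightarrow>\<^sub>L 'b::separable_chilbert l2" where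
  "mop \<nu> F = mulop (\<lambda>t. F (inv_line \<nu> t))"

context
  fixes \<nu> :: real and U :: "complex set"
  assumes \<nu>: "\<nu> > 0" and line: "\<And>t. inv_line \<nu> t \<in> U"
begin

lemma symbol_Hinfty:
  assumes F: "F \<in> Hinfty U"
  shows "symbol (\<lambda>t. F (inv_line \<nu> t))"
proof -
  obtain C where C: "C \<ge> 0" "\<And>z. z \<in> U \<Longrightarrow> norm (F z) \<le> C" using HinftyE[OF F] by blast
  have "continuous_on UNIV (\<lambda>t. F (inv_line \<nu> t))"
    by (rule continuous_on_compose2[OF Hinfty_continuous_on[OF F] continuous_inv_line[OF \<nu>]]) (use line in auto)
  moreover have "bounded (range (\<lambda>t. F (inv_line \<nu> t)))" using C line by (auto simp: bounded_iff)
  ultimately show ?thesis by (simp add: symbol_def Hinfty_complex_linear[OF F line])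
qed

lemma mop_cong: "(\<And>z. z \<in> U \<Longrightarrow> F z = G z) \<Longrightarrow> mop \<nu> F = mop \<nu> G"
  unfolding mop_def using line by simp

lemma mop_compose: "F \<in> Hinfty U \<Longrightarrow> G \<in> Hinfty U \<Longrightarrow> mop \<nu> (\<lambda>z. F z o\<^sub>L G z) = mop \<nu> F o\<^sub>L mop \<nu> G"
  unfolding mop_def by (intro mulop_compose symbol_Hinfty)

lemma mop_diff: "F \<in> Hinfty U \<Longrightarrow> G \<in> Hinfty U \<Longrightarrow> mop \<nu> (\<lambda>z. F z - G z) = mop \<nu> F - mop \<nu> G"
  unfolding mop_def by (intro mulop_diff symbol_Hinfty symbol_Hinfty[OF Hinfty_diff])

lemma mop_0: "mop \<nu> (\<lambda>_. 0) = 0"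
proof (rule blinfun_eqI)
  fix v
  show "mop \<nu> (\<lambda>_. 0) v = blinfun_apply 0 v"
    unfolding mop_def
    by (rule mulop_eqI[OF symbol_Hinfty[OF Hinfty_const[OF complex_linear_0]]]) (use rep_l2_0 in auto)
qed

lemma mop_uminus: "F \<in> Hinfty U \<Longrightarrow> mop \<nu> (\<lambda>z. - F z) = - mop \<nu> F"
  using mop_diff[OF Hinfty_const[OF complex_linear_0], of F] by (simp add: mop_0)

lemma mop_id: "mop \<nu> (\<lambda>_. id_blinfun) = id_blinfun"
proof (rule blinfun_eqI)
  fix v
  show "mop \<nu> (\<lambda>_. id_blinfun) v = id_blinfun v"
    unfolding mop_def
    by (rule mulop_eqI[OF symbol_Hinfty[OF Hinfty_const[OF complex_linear_id]]]) auto
qed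

lemma mop_pow: "F \<in> Hinfty U \<Longrightarrow> mop \<nu> (\<lambda>z. blinfun_pow (F z) l) = blinfun_pow (mop \<nu> F) l"
  by (induction l) (simp_all add: mop_id blinfun_pow_Suc mop_compose Hinfty_pow)

lemma norm_mop_le: "F \<in> Hinfty U \<Longrightarrow> (\<And>z. z \<in> U \<Longrightarrow> norm (F z) \<le> C) \<Longrightarrow> norm (mop \<nu> F) \<le> C"
  unfolding mop_def using line by (intro norm_mulop_le symbol_Hinfty) auto

lemma complex_linear_mop: "F \<in> Hinfty U \<Longrightarrow> complex_linear (mop \<nu> F)"
  unfolding mop_def by (intro mulop_complex_linear symbol_Hinfty)

lemma mop_J: "F \<in> Hinfty U \<Longrightarrow> mop \<nu> F o\<^sub>L J_op \<nu> = J_op \<nu> o\<^sub>L mop \<nu> F"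
  unfolding mop_def by (intro J_op_commute[OF \<nu>] symbol_Hinfty)

lemma mop_wot_tendsto:
  assumes "\<And>k. F k \<in> Hinfty U" "G \<in> Hinfty U" "\<And>k z. z \<in> U \<Longrightarrow> norm (F k z) \<le> C"
    and "\<And>z. z \<in> U \<Longrightarrow> wot_tendsto (\<lambda>k. F k z) (G z)"
  shows "wot_tendsto (\<lambda>k. mop \<nu> (F k)) (mop \<nu> G)"
  unfolding mop_def using assms line by (intro mulop_wot_tendsto[where C = C] symbol_Hinfty) auto

lemma mop_coercive:
  assumes "F \<in> Hinfty U" "\<And>z x. z \<in> U \<Longrightarrow> c * (norm x)\<^sup>2 \<le> x \<bullet> F z x"
  shows "c * (norm v)\<^sup>2 \<le> v \<bullet> mop \<nu> F v"
  unfolding mop_def using assms line by (intro mulop_coercive symbol_Hinfty) auto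

lemma fct_calc_represents:
  assumes F: "F \<in> Hinfty U"
  shows "represents (L2w \<nu>) (FL \<nu>) (L2w \<nu>) (FL \<nu>) (fct_calc \<nu> F) (mop \<nu> F)"
  using fct_calc_FL[OF symbol_Hinfty[OF F, unfolded inv_line_def]]
  by (simp add: represents_def mop_def inv_line_def)

lemma d0_inv_represents: "represents (L2w \<nu>) (FL \<nu>) (L2w \<nu>) (FL \<nu>) (d0_inv \<nu>) (J_op \<nu>)"
  unfolding represents_def by (intro ballI conjI d0_inv_FL[OF \<nu>])

text \<open>After the transform, the evolutionary operator is the inverse of the bounded operator \<open>R\<close> constructed from
  the Schur complement: its domain is the range of \<open>R\<close>. This is where the unbounded \<open>\<partial>\<^sub>0\<close> is traded for the
  bounded multiplication operator \<open>J\<close>.\<close>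

lemma evo_op_domain_value:
  fixes M N00 :: "complex \<Rightarrow> 'a::separable_chilbert \<Rightarrow>\<^sub>L 'a" and N01 :: "complex \<Rightarrow> 'b::separable_chilbert \<Rightarrow>\<^sub>L 'a"
  assumes H: "M \<in> Hinfty U" "N00 \<in> Hinfty U" "N01 \<in> Hinfty U" "N10 \<in> Hinfty U" "N11 \<in> Hinfty U"
    and sys: "evo_system (mop \<nu> M) mi (mop \<nu> N00) (mop \<nu> N01) (mop \<nu> N10) (mop \<nu> N11) ni (J_op \<nu>) (J_op \<nu>) q j"
    and R: "R = evo_system.R mi (mop \<nu> N00) (mop \<nu> N01) (mop \<nu> N10) ni (J_op \<nu>)"
    and A: "evo_op \<nu> M N00 N01 N10 N11 = (D, A)"
  shows "w \<in> D \<longleftrightarrow> w \<in> hcarrier (L2w \<nu> \<oplus>\<^sub>H L2w \<nu>) \<and> (\<exists>y. map_prod (FL \<nu>) (FL \<nu>) w = R y)"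
    and "w \<in> hcarrier (L2w \<nu> \<oplus>\<^sub>H L2w \<nu>) \<Longrightarrow> map_prod (FL \<nu>) (FL \<nu>) w = R y \<Longrightarrow>
      A w \<in> hcarrier (L2w \<nu> \<oplus>\<^sub>H L2w \<nu>) \<and> map_prod (FL \<nu>) (FL \<nu>) (A w) = y"
proof -
  interpret evo_system "mop \<nu> M" mi "mop \<nu> N00" "mop \<nu> N01" "mop \<nu> N10" "mop \<nu> N11" ni "J_op \<nu>" "J_op \<nu>" q j
    by (rule sys)
  note UF = unitary_FL[of \<nu>, where 'a = 'a] unitary_FL[of \<nu>, where 'a = 'b]
  note rep = H[THEN fct_calc_represents, unfolded represents_def, rule_format]
  have D: "w \<in> D \<longleftrightarrow> fst w \<in> hcarrier (L2w \<nu>) \<and> snd w \<in> hcarrier (L2w \<nu>) \<and> fct_calc \<nu> M (fst w) \<in> H1w \<nu>" for w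
    using A by (auto simp: evo_op_def hsum_def mem_Times_iff)
  have Aw: "A w = (d0 \<nu> (fct_calc \<nu> M (fst w)) + (fct_calc \<nu> N00 (fst w) + fct_calc \<nu> N01 (snd w)),
      fct_calc \<nu> N10 (fst w) + fct_calc \<nu> N11 (snd w))" for w
    using A by (auto simp: evo_op_def block_op_def)
  have solve: "fct_calc \<nu> M (fst w) \<in> H1w \<nu> \<and> A w \<in> hcarrier (L2w \<nu> \<oplus>\<^sub>H L2w \<nu>) \<and> map_prod (FL \<nu>) (FL \<nu>) (A w) = y"
    if w: "fst w \<in> hcarrier (L2w \<nu>)" "snd w \<in> hcarrier (L2w \<nu>)" and eq: "map_prod (FL \<nu>) (FL \<nu>) w = R y" for w y
  proof -
    obtain f g where y: "y = (f, g)" by (cases y)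
    have "evo_system.R mi (mop \<nu> N00) (mop \<nu> N01) (mop \<nu> N10) ni (J_op \<nu>) (f, g) = (FL \<nu> (fst w), FL \<nu> (snd w))"
      using eq by (simp add: R y map_prod_def split_beta)
    then obtain y' where y': "mop \<nu> M (FL \<nu> (fst w)) = J_op \<nu> y'"
        "y' + mop \<nu> N00 (FL \<nu> (fst w)) + mop \<nu> N01 (FL \<nu> (snd w)) = f"
        "mop \<nu> N10 (FL \<nu> (fst w)) + mop \<nu> N11 (FL \<nu> (snd w)) = g" by (rule R_solves)
    have Mw: "fct_calc \<nu> M (fst w) \<in> hcarrier (L2w \<nu>)" "FL \<nu> (fct_calc \<nu> M (fst w)) = J_op \<nu> y'"
      using rep(1)[OF w(1)] y' by auto
    note d = d0_FL[OF \<nu> Mw]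
    note r = rep(2)[OF w(1)] rep(3)[OF w(2)] rep(4)[OF w(1)] rep(5)[OF w(2)]
    have c1: "fct_calc \<nu> N00 (fst w) + fct_calc \<nu> N01 (snd w) \<in> hcarrier (L2w \<nu>)"
      using unitary_map_carrier_add[OF UF(1)] r by blast
    have c2: "d0 \<nu> (fct_calc \<nu> M (fst w)) + (fct_calc \<nu> N00 (fst w) + fct_calc \<nu> N01 (snd w)) \<in> hcarrier (L2w \<nu>)"
      by (rule unitary_map_carrier_add[OF UF(1) d(1) c1])
    have c3: "fct_calc \<nu> N10 (fst w) + fct_calc \<nu> N11 (snd w) \<in> hcarrier (L2w \<nu>)"
      using unitary_map_carrier_add[OF UF(2)] r by blast
    have c: "A w \<in> hcarrier (L2w \<nu> \<oplus>\<^sub>H L2w \<nu>)" using c2 c3 by (simp add: Aw hsum_def)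
    have "FL \<nu> (d0 \<nu> (fct_calc \<nu> M (fst w)) + (fct_calc \<nu> N00 (fst w) + fct_calc \<nu> N01 (snd w))) = f"
      using y'(2) r d(2) unitary_map_add[OF UF(1) d(1) c1] unitary_map_add[OF UF(1) r(1)[THEN conjunct1] r(2)[THEN conjunct1]]
      by (simp add: add.assoc)
    moreover have "FL \<nu> (fct_calc \<nu> N10 (fst w) + fct_calc \<nu> N11 (snd w)) = g"
      using r y'(3) unitary_map_add[OF UF(2) r(3)[THEN conjunct1] r(4)[THEN conjunct1]] by simp
    ultimately have "map_prod (FL \<nu>) (FL \<nu>) (A w) = y" by (simp add: Aw y)
    moreover have "fct_calc \<nu> M (fst w) \<in> H1w \<nu>" using Mw H1w_iff[OF \<nu>] by blast
    ultimately show ?thesis using c by blast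
  qed
  show "w \<in> hcarrier (L2w \<nu> \<oplus>\<^sub>H L2w \<nu>) \<Longrightarrow> map_prod (FL \<nu>) (FL \<nu>) w = R y \<Longrightarrow>
      A w \<in> hcarrier (L2w \<nu> \<oplus>\<^sub>H L2w \<nu>) \<and> map_prod (FL \<nu>) (FL \<nu>) (A w) = y" for y
    using solve[of w y] by (auto simp: hsum_def)
  show "w \<in> D \<longleftrightarrow> w \<in> hcarrier (L2w \<nu> \<oplus>\<^sub>H L2w \<nu>) \<and> (\<exists>y. map_prod (FL \<nu>) (FL \<nu>) w = R y)"
  proof
    assume "w \<in> D"
    then have w: "fst w \<in> hcarrier (L2w \<nu>)" "snd w \<in> hcarrier (L2w \<nu>)" "fct_calc \<nu> M (fst w) \<in> H1w \<nu>"
      by (simp_all add: D)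
    then obtain y where "FL \<nu> (fct_calc \<nu> M (fst w)) = J_op \<nu> y" using H1w_iff[OF \<nu>] by blast
    then have "mop \<nu> M (FL \<nu> (fst w)) = J_op \<nu> y" using rep(1)[OF w(1)] by simp
    from R_left[OF this] have "\<exists>z. map_prod (FL \<nu>) (FL \<nu>) w = R z"
      unfolding R by (metis map_prod_simp prod.collapse)
    with w show "w \<in> hcarrier (L2w \<nu> \<oplus>\<^sub>H L2w \<nu>) \<and> (\<exists>y. map_prod (FL \<nu>) (FL \<nu>) w = R y)"
      by (simp add: hsum_def mem_Times_iff)
  next
    assume "w \<in> hcarrier (L2w \<nu> \<oplus>\<^sub>H L2w \<nu>) \<and> (\<exists>y. map_prod (FL \<nu>) (FL \<nu>) w = R y)"
    then show "w \<in> D" using solve[of w] by (auto simp: D hsum_def mem_Times_iff)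
  qed
qed

text \<open>Likewise the limit operator: since \<open>\<partial>\<^sub>0\<close> has the inverse \<open>J\<close>, the operator \<open>diag(\<partial>\<^sub>0, 1) T\<close> has the inverse
  \<open>T\<^sup>-\<^sup>1 diag(J, 1)\<close>.\<close>

lemma d0_one_op_domain_value:
  fixes T :: "'a::separable_chilbert mfun \<times> 'b::separable_chilbert mfun \<Rightarrow> 'a mfun \<times> 'b mfun"
  assumes T: "represents (L2w \<nu> \<oplus>\<^sub>H L2w \<nu>) (map_prod (FL \<nu>) (FL \<nu>)) (L2w \<nu> \<oplus>\<^sub>H L2w \<nu>) (map_prod (FL \<nu>) (FL \<nu>)) T T'"
    and V: "V o\<^sub>L T' = id_blinfun" "T' o\<^sub>L V = id_blinfun"
    and R: "R = V o\<^sub>L block_blinfun (J_op \<nu>) 0 0 id_blinfun"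
    and A: "d0_one_op \<nu> T = (D, A)"
  shows "w \<in> D \<longleftrightarrow> w \<in> hcarrier (L2w \<nu> \<oplus>\<^sub>H L2w \<nu>) \<and> (\<exists>y. map_prod (FL \<nu>) (FL \<nu>) w = R y)"
    and "w \<in> hcarrier (L2w \<nu> \<oplus>\<^sub>H L2w \<nu>) \<Longrightarrow> map_prod (FL \<nu>) (FL \<nu>) w = R y \<Longrightarrow>
      A w \<in> hcarrier (L2w \<nu> \<oplus>\<^sub>H L2w \<nu>) \<and> map_prod (FL \<nu>) (FL \<nu>) (A w) = y"
    and "R y = R y' \<Longrightarrow> y = y'"
proof -
  let ?X = "L2w \<nu> \<oplus>\<^sub>H L2w \<nu> :: ('a mfun \<times> 'b mfun) hilb" and ?U = "map_prod (FL \<nu>) (FL \<nu>) :: 'a mfun \<times> 'b mfun \<Rightarrow> 'a l2 \<times> 'b l2"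
  have R': "R y = V (J_op \<nu> (fst y), snd y)" for y by (simp add: R block_blinfun_apply)
  have VT: "V (T' x) = x" and TV: "T' (V x) = x" for x using V by (simp_all add: blinfun_comp_idD)
  have c: "w \<in> hcarrier ?X \<longleftrightarrow> fst w \<in> hcarrier (L2w \<nu>) \<and> snd w \<in> hcarrier (L2w \<nu>)" for w
    by (simp add: hsum_def mem_Times_iff)
  have Tw: "T w \<in> hcarrier ?X" "?U (T w) = T' (?U w)" if "w \<in> hcarrier ?X" for w
    using T that by (auto simp: represents_def)
  have D: "w \<in> D \<longleftrightarrow> w \<in> hcarrier ?X \<and> fst (T w) \<in> H1w \<nu>" for w
    using A by (auto simp: d0_one_op_def)
  have Aw: "A w = (d0 \<nu> (fst (T w)), snd (T w))" for w
    using A by (auto simp: d0_one_op_def)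
  have solve: "fst (T w) \<in> H1w \<nu> \<and> A w \<in> hcarrier ?X \<and> ?U (A w) = y"
    if w: "w \<in> hcarrier ?X" and eq: "?U w = R y" for w y
  proof -
    have "?U (T w) = (J_op \<nu> (fst y), snd y)" by (simp add: Tw[OF w] eq R' TV)
    then have e: "FL \<nu> (fst (T w)) = J_op \<nu> (fst y)" "FL \<nu> (snd (T w)) = snd y"
      by (simp_all add: map_prod_def split_beta)
    have t: "fst (T w) \<in> hcarrier (L2w \<nu>)" "snd (T w) \<in> hcarrier (L2w \<nu>)" using Tw(1)[OF w] c by auto
    note d = d0_FL[OF \<nu> t(1) e(1)]
    have "fst (T w) \<in> H1w \<nu>" using t(1) e(1) H1w_iff[OF \<nu>] by blast
    then show ?thesis using d e t by (simp add: Aw c)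
  qed
  show "w \<in> hcarrier ?X \<Longrightarrow> ?U w = R y \<Longrightarrow> A w \<in> hcarrier ?X \<and> ?U (A w) = y" for y
    using solve by blast
  show "w \<in> D \<longleftrightarrow> w \<in> hcarrier ?X \<and> (\<exists>y. ?U w = R y)"
  proof
    assume "w \<in> D"
    then have w: "w \<in> hcarrier ?X" "fst (T w) \<in> H1w \<nu>" by (simp_all add: D)
    then obtain y where y: "FL \<nu> (fst (T w)) = J_op \<nu> y" using H1w_iff[OF \<nu>] by blast
    have "?U (T w) = (J_op \<nu> y, FL \<nu> (snd (T w)))" using y by (simp add: map_prod_def split_beta)
    then have "?U w = V (J_op \<nu> y, FL \<nu> (snd (T w)))" using Tw(2)[OF w(1)] VT[of "?U w"] by simp
    then have "?U w = R (y, FL \<nu> (snd (T w)))" by (simp add: R')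
    with w show "w \<in> hcarrier ?X \<and> (\<exists>y. ?U w = R y)" by blast
  qed (use solve D in blast)
  assume "R y = R y'"
  then have "T' (R y) = T' (R y')" by simp
  then show "y = y'" by (simp add: R' TV prod_eq_iff) (metis J_op_inj[OF \<nu>])
qed

end

section \<open>The limit operator\<close>

text \<open>The weak limits of the four entries of the inverses are power series in \<open>J\<close> whose coefficients are the
  weak limits of the coefficients. Factoring \<open>J\<close> out of the first column leaves \<open>V = D\<^sup>-\<^sup>1 + M\<^sub>1\<close> with
  \<open>D\<^sup>-\<^sup>1\<close> diagonal, so \<open>V\<^sup>-\<^sup>1 = (1 + D M\<^sub>1)\<^sup>-\<^sup>1 D\<close> is a Neumann series. The lower left entry of \<open>D M\<^sub>1\<close>
  starts with a term without \<open>J\<close> and is not small, but the other three entries carry a factor \<open>j\<close>, the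
  bound for \<open>J\<close>; the last assumption makes the powers of \<open>D M\<^sub>1\<close> decay.\<close>

lemma limit_operator:
  fixes J :: "'h::{complex_inner,banach} \<Rightarrow>\<^sub>L 'h" and J' :: "'k::{complex_inner,banach} \<Rightarrow>\<^sub>L 'k"
    and h00 :: "nat \<Rightarrow> 'h \<Rightarrow>\<^sub>L 'h" and h01 :: "nat \<Rightarrow> 'k \<Rightarrow>\<^sub>L 'h" and h10 :: "nat \<Rightarrow> 'h \<Rightarrow>\<^sub>L 'k"
    and h11 :: "nat \<Rightarrow> 'k \<Rightarrow>\<^sub>L 'k"
  assumes j: "norm J \<le> j" "norm J' \<le> j" and C: "0 \<le> C" and q: "0 \<le> q" "q * j \<le> 1 / 2"
    and le: "\<And>k l. norm (F00 k l) \<le> C * q ^ l" "\<And>k l. norm (F01 k l) \<le> C * q ^ l"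
      "\<And>k l. norm (F10 k l) \<le> C * q ^ l" "\<And>k l. norm (F11 k l) \<le> C * q ^ l"
    and lim: "\<And>l. wot_tendsto (\<lambda>k. F00 k l) (h00 l)" "\<And>l. wot_tendsto (\<lambda>k. F01 k l) (h01 l)"
      "\<And>l. wot_tendsto (\<lambda>k. F10 k l) (h10 l)" "\<And>l. wot_tendsto (\<lambda>k. F11 k l) (h11 l)"
    and limn: "wot_tendsto ni nh"
    and sums: "\<And>k. (\<lambda>l. F00 k l o\<^sub>L blinfun_pow J (Suc l)) sums r00 k"
      "\<And>k. (\<lambda>l. F01 k l o\<^sub>L blinfun_pow J' (Suc l)) sums r01 k"
      "\<And>k. (\<lambda>l. F10 k l o\<^sub>L blinfun_pow J (Suc l)) sums r10 k"
      "\<And>k. (\<lambda>l. F11 k l o\<^sub>L blinfun_pow J' (Suc l)) sums r11 k"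
    and d1: "d1 o\<^sub>L h00 0 = id_blinfun" "h00 0 o\<^sub>L d1 = id_blinfun" "norm d1 \<le> \<kappa>"
    and d2: "d2 o\<^sub>L nh = id_blinfun" "nh o\<^sub>L d2 = id_blinfun" "norm d2 \<le> \<kappa>"
    and small: "(\<kappa> * (2 * C * (q + 1) * j)) * (4 * (\<kappa> * (2 * C)) + 2) \<le> 1 / 4"
  shows "\<exists>s00 s01 s10 s11 sh V.
    (\<lambda>l. h00 (Suc l) o\<^sub>L blinfun_pow J (Suc l)) sums s00 \<and> (\<lambda>l. h01 l o\<^sub>L blinfun_pow J' (l + 1)) sums s01 \<and>
    (\<lambda>l. h10 l o\<^sub>L blinfun_pow J l) sums s10 \<and> (\<lambda>l. h11 l o\<^sub>L blinfun_pow J' (l + 1)) sums s11 \<and>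
    (\<lambda>l. blinfun_pow (- (block_blinfun d1 0 0 d2 o\<^sub>L block_blinfun s00 s01 s10 s11)) (Suc l) o\<^sub>L block_blinfun d1 0 0 d2) sums sh \<and>
    V o\<^sub>L (block_blinfun d1 0 0 d2 + sh) = id_blinfun \<and> (block_blinfun d1 0 0 d2 + sh) o\<^sub>L V = id_blinfun \<and>
    wot_tendsto (\<lambda>k. block_blinfun (r00 k) (r01 k) (r10 k) (r11 k + ni k)) (V o\<^sub>L block_blinfun J 0 0 id_blinfun)"
proof -
  have j0: "0 \<le> j" using j(1) norm_ge_zero order_trans by blast
  have k0: "0 \<le> \<kappa>" using d1(3) norm_ge_zero order_trans by blast
  have qj0: "0 \<le> q * j" using q j0 by simp
  have hle: "norm (h00 l) \<le> C * q ^ l" "norm (h01 l) \<le> C * q ^ l" "norm (h10 l) \<le> C * q ^ l" "norm (h11 l) \<le> C * q ^ l" for l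
    by (rule wot_tendsto_norm_le[OF lim(1) le(1)], rule wot_tendsto_norm_le[OF lim(2) le(2)],
        rule wot_tendsto_norm_le[OF lim(3) le(3)], rule wot_tendsto_norm_le[OF lim(4) le(4)])
  have comp: "norm (A o\<^sub>L blinfun_pow B (l + i)) \<le> (C * j ^ i) * (q * j) ^ l"
    if "norm A \<le> C * q ^ l" "norm B \<le> j" for A :: "'x::banach \<Rightarrow>\<^sub>L 'y::banach" and B l i
  proof -
    have "norm (A o\<^sub>L blinfun_pow B (l + i)) \<le> norm A * norm (blinfun_pow B (l + i))" by (rule norm_blinfun_compose)
    also have "\<dots> \<le> (C * q ^ l) * j ^ (l + i)"
      using that C q by (intro mult_mono norm_blinfun_pow_le) auto
    finally show ?thesis by (simp add: power_add power_mult_distrib mult_ac)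
  qed
  have comp1: "norm (A o\<^sub>L blinfun_pow B (Suc l)) \<le> (C * j) * (q * j) ^ l"
    if "norm A \<le> C * q ^ l" "norm B \<le> j" for A :: "'x::banach \<Rightarrow>\<^sub>L 'y::banach" and B l
    using comp[OF that, of 1] by simp
  note geo = geometric_sums[OF _ qj0 q(2)]
  have "norm (h00 (Suc l) o\<^sub>L blinfun_pow J (Suc l)) \<le> (C * (q * j)) * (q * j) ^ l" for l
    using comp[OF hle(1)[of "Suc l"] j(1), of 0] by (simp add: mult_ac)
  from geo[OF this] obtain s00 where s00: "(\<lambda>l. h00 (Suc l) o\<^sub>L blinfun_pow J (Suc l)) sums s00" "norm s00 \<le> 2 * (C * (q * j))" by blast
  from geo[OF comp1[OF hle(2) j(2)]] obtain s01 where s01: "(\<lambda>l. h01 l o\<^sub>L blinfun_pow J' (Suc l)) sums s01" "norm s01 \<le> 2 * (C * j)" by blast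
  have "norm (h10 l o\<^sub>L blinfun_pow J l) \<le> C * (q * j) ^ l" for l
    using comp[OF hle(3)[of l] j(1), of 0] by simp
  from geo[OF this] obtain s10 where s10: "(\<lambda>l. h10 l o\<^sub>L blinfun_pow J l) sums s10" "norm s10 \<le> 2 * C" by blast
  from geo[OF comp1[OF hle(4) j(2)]] obtain s11 where s11: "(\<lambda>l. h11 l o\<^sub>L blinfun_pow J' (Suc l)) sums s11" "norm s11 \<le> 2 * (C * j)" by blast
  define Dd where "Dd = block_blinfun d1 0 0 d2"
  define M1 where "M1 = block_blinfun s00 s01 s10 s11"
  define Q where "Q = - (Dd o\<^sub>L M1)"
  have Qblock: "Q = block_blinfun (- (d1 o\<^sub>L s00)) (- (d1 o\<^sub>L s01)) (- (d2 o\<^sub>L s10)) (- (d2 o\<^sub>L s11))"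
    by (rule blinfun_eqI)
       (simp add: Q_def Dd_def M1_def block_blinfun_apply blinfun.minus_left blinfun.add_right)
  define \<epsilon> where "\<epsilon> = \<kappa> * (2 * C * (q + 1) * j)"
  have prod: "norm (- (d o\<^sub>L s)) \<le> \<kappa> * b" if "norm d \<le> \<kappa>" "norm s \<le> b"
    for d :: "'y::real_normed_vector \<Rightarrow>\<^sub>L 'z::real_normed_vector" and s :: "'x::real_normed_vector \<Rightarrow>\<^sub>L 'y" and b
    using that k0 by (simp add: order_trans[OF norm_blinfun_compose] mult_mono)
  have b1: "2 * (C * (q * j)) \<le> 2 * C * (q + 1) * j" "2 * (C * j) \<le> 2 * C * (q + 1) * j"
    using C q j0 by (simp_all add: algebra_simps)
  have ent: "norm (- (d1 o\<^sub>L s00)) \<le> \<epsilon>" "norm (- (d1 o\<^sub>L s01)) \<le> \<epsilon>" "norm (- (d2 o\<^sub>L s10)) \<le> \<kappa> * (2 * C)" "norm (- (d2 o\<^sub>L s11)) \<le> \<epsilon>"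
    unfolding \<epsilon>_def by (intro prod d1 d2 order_trans[OF s00(2) b1(1)] order_trans[OF s01(2) b1(2)] s10 order_trans[OF s11(2) b1(2)])+
  have "norm (blinfun_pow Q n) \<le> (4 * (\<kappa> * (2 * C)) + 2) * (1 / 2) ^ n" for n
    unfolding Qblock by (rule norm_block_pow_le[OF ent]) (use small in \<open>simp add: \<epsilon>_def\<close>)
  from neumann_series[OF this] obtain \<Theta> where \<Theta>: "blinfun_pow Q sums \<Theta>"
    "\<Theta> o\<^sub>L (id_blinfun - Q) = id_blinfun" "(id_blinfun - Q) o\<^sub>L \<Theta> = id_blinfun" by auto
  define sh where "sh = (\<Theta> - id_blinfun) o\<^sub>L Dd"
  have "(\<lambda>l. blinfun_pow Q (Suc l)) sums (\<Theta> - id_blinfun)"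
    using sums_Suc_iff[of "blinfun_pow Q" "\<Theta> - id_blinfun"] \<Theta>(1) by simp
  then have sh: "(\<lambda>l. blinfun_pow Q (Suc l) o\<^sub>L Dd) sums sh" unfolding sh_def by (rule sums_compose_right)
  have DT: "Dd + sh = \<Theta> o\<^sub>L Dd" by (rule blinfun_eqI) (simp add: sh_def blinfun.add_left blinfun.diff_left)
  define Di where "Di = block_blinfun (h00 0) 0 0 nh"
  have ap: "d1 (h00 0 x) = x" "h00 0 (d1 x) = x" "d2 (nh y) = y" "nh (d2 y) = y" for x y
    using d1 d2 by (simp_all add: blinfun_comp_idD)
  have DDi: "Dd (Di w) = w" "Di (Dd w) = w" for w by (simp_all add: Dd_def Di_def block_blinfun_apply ap)
  define V where "V = Di + M1"
  have V: "V w = Di (w - Q w)" "w - Q w = Dd (V w)" for w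
    by (simp_all add: V_def Q_def blinfun.add_left blinfun.minus_left blinfun.add_right DDi)
  have T1: "\<Theta> (w - Q w) = w" "\<Theta> w - Q (\<Theta> w) = w" for w
    using blinfun_comp_idD[OF \<Theta>(2), of w] blinfun_comp_idD[OF \<Theta>(3), of w] by (simp_all add: blinfun.diff_left)
  have inv: "V o\<^sub>L (Dd + sh) = id_blinfun" "(Dd + sh) o\<^sub>L V = id_blinfun"
    unfolding DT by (rule blinfun_eqI, simp add: V(1) T1 DDi, rule blinfun_eqI, simp add: V(2)[symmetric] T1)
  have b: "summable (\<lambda>l. (C * j) * (q * j) ^ l)"
    using q qj0 by (intro summable_mult summable_geometric) simp
  \<comment> \<open>The diagonal term \<open>l = 0\<close>, kept apart in \<open>D\<^sup>-\<^sup>1\<close>, is put back.\<close>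
  have S00: "(\<lambda>l. h00 l o\<^sub>L blinfun_pow J (Suc l)) sums ((h00 0 + s00) o\<^sub>L J)"
  proof -
    have "(\<lambda>l. (h00 (Suc l) o\<^sub>L blinfun_pow J (Suc l)) o\<^sub>L J) sums (s00 o\<^sub>L J)" by (rule sums_compose_right[OF s00(1)])
    moreover have "(h00 (Suc l) o\<^sub>L blinfun_pow J (Suc l)) o\<^sub>L J = h00 (Suc l) o\<^sub>L blinfun_pow J (Suc (Suc l))" for l
      by (rule blinfun_eqI) (simp add: blinfun_pow_Suc2[of J "Suc l"])
    ultimately have "(\<lambda>l. h00 (Suc l) o\<^sub>L blinfun_pow J (Suc (Suc l))) sums (s00 o\<^sub>L J)" by simp
    moreover have "(h00 0 + s00) o\<^sub>L J = (s00 o\<^sub>L J) + (h00 0 o\<^sub>L blinfun_pow J (Suc 0))"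
      by (rule blinfun_eqI) (simp add: blinfun_pow_Suc blinfun.add_left add.commute)
    ultimately show ?thesis using sums_Suc[of "\<lambda>l. h00 l o\<^sub>L blinfun_pow J (Suc l)" "s00 o\<^sub>L J"] by simp
  qed
  have S10: "(\<lambda>l. h10 l o\<^sub>L blinfun_pow J (Suc l)) sums (s10 o\<^sub>L J)"
  proof -
    have "(h10 l o\<^sub>L blinfun_pow J l) o\<^sub>L J = h10 l o\<^sub>L blinfun_pow J (Suc l)" for l
      by (rule blinfun_eqI) (simp add: blinfun_pow_Suc2)
    with sums_compose_right[OF s10(1), of J] show ?thesis by simp
  qed
  have w: "wot_tendsto r00 ((h00 0 + s00) o\<^sub>L J)" "wot_tendsto r01 s01" "wot_tendsto r10 (s10 o\<^sub>L J)" "wot_tendsto r11 s11"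
    by (rule wot_tendsto_sums[OF wot_tendsto_compose_right[OF lim(1)] comp1[OF le(1) j(1)] b sums(1) S00],
        rule wot_tendsto_sums[OF wot_tendsto_compose_right[OF lim(2)] comp1[OF le(2) j(2)] b sums(2) s01(1)],
        rule wot_tendsto_sums[OF wot_tendsto_compose_right[OF lim(3)] comp1[OF le(3) j(1)] b sums(3) S10],
        rule wot_tendsto_sums[OF wot_tendsto_compose_right[OF lim(4)] comp1[OF le(4) j(2)] b sums(4) s11(1)])
  have "V o\<^sub>L block_blinfun J 0 0 id_blinfun = block_blinfun ((h00 0 + s00) o\<^sub>L J) s01 (s10 o\<^sub>L J) (s11 + nh)"
    by (rule blinfun_eqI) (simp add: V_def Di_def M1_def block_blinfun_apply blinfun.add_left add_ac)
  then have "wot_tendsto (\<lambda>k. block_blinfun (r00 k) (r01 k) (r10 k) (r11 k + ni k)) (V o\<^sub>L block_blinfun J 0 0 id_blinfun)"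
    by (simp add: wot_tendsto_block wot_tendsto_add w limn)
  with s00(1) s01(1) s10(1) s11(1) sh inv show ?thesis unfolding Q_def Dd_def M1_def by (auto intro!: exI)
qed

section \<open>Families of material laws\<close>

text \<open>The constant \<open>K\<close> bounds all coefficients and all inverses at once. The functions \<open>F00\<close>, \<open>F01\<close>, \<open>F10\<close>,
  \<open>F11\<close> below are those whose limits are the homogenized coefficients. With \<open>q\<close> a bound for \<open>A\<close> they are
  bounded by \<open>C q\<^sup>l\<close>, because besides the \<open>l\<close> factors \<open>A\<close> they contain at most five factors bounded by
  \<open>K \<ge> 1\<close>.\<close>

locale coefficient_families =
  fixes U :: "complex set" and c K :: real
    and M N00 :: "nat \<Rightarrow> complex \<Rightarrow> 'a::separable_chilbert \<Rightarrow>\<^sub>L 'a"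
    and N01 :: "nat \<Rightarrow> complex \<Rightarrow> 'b::separable_chilbert \<Rightarrow>\<^sub>L 'a"
    and N10 :: "nat \<Rightarrow> complex \<Rightarrow> 'a \<Rightarrow>\<^sub>L 'b"
    and N11 :: "nat \<Rightarrow> complex \<Rightarrow> 'b \<Rightarrow>\<^sub>L 'b"
  assumes U: "open U" and c: "c > 0" and K: "1 \<le> K" "1 / c \<le> K"
    and hol: "\<And>k. M k \<in> Hinfty U" "\<And>k. N00 k \<in> Hinfty U" "\<And>k. N01 k \<in> Hinfty U"
      "\<And>k. N10 k \<in> Hinfty U" "\<And>k. N11 k \<in> Hinfty U"
    and bd: "\<And>k z. z \<in> U \<Longrightarrow> norm (M k z) \<le> K" "\<And>k z. z \<in> U \<Longrightarrow> norm (N00 k z) \<le> K"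
      "\<And>k z. z \<in> U \<Longrightarrow> norm (N01 k z) \<le> K" "\<And>k z. z \<in> U \<Longrightarrow> norm (N10 k z) \<le> K"
      "\<And>k z. z \<in> U \<Longrightarrow> norm (N11 k z) \<le> K"
    and co: "\<And>k z x. z \<in> U \<Longrightarrow> c * (norm x)\<^sup>2 \<le> x \<bullet> M k z x"
      "\<And>k z x. z \<in> U \<Longrightarrow> c * (norm x)\<^sup>2 \<le> x \<bullet> N11 k z x"
begin

definition Mi :: "nat \<Rightarrow> complex \<Rightarrow> 'a \<Rightarrow>\<^sub>L 'a" where "Mi k z = blinfun_inv (M k z)"
definition Ni :: "nat \<Rightarrow> complex \<Rightarrow> 'b \<Rightarrow>\<^sub>L 'b" where "Ni k z = blinfun_inv (N11 k z)"
definition A :: "nat \<Rightarrow> complex \<Rightarrow> 'a \<Rightarrow>\<^sub>L 'a" where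
  "A k z = - ((N00 k z - (N01 k z o\<^sub>L Ni k z o\<^sub>L N10 k z)) o\<^sub>L Mi k z)"
definition F00 :: "nat \<Rightarrow> nat \<Rightarrow> complex \<Rightarrow> 'a \<Rightarrow>\<^sub>L 'a" where
  "F00 l k z = Mi k z o\<^sub>L blinfun_pow (A k z) l"
definition F01 :: "nat \<Rightarrow> nat \<Rightarrow> complex \<Rightarrow> 'b \<Rightarrow>\<^sub>L 'a" where
  "F01 l k z = - (Mi k z o\<^sub>L blinfun_pow (A k z) l o\<^sub>L N01 k z o\<^sub>L Ni k z)"
definition F10 :: "nat \<Rightarrow> nat \<Rightarrow> complex \<Rightarrow> 'a \<Rightarrow>\<^sub>L 'b" where
  "F10 l k z = - (Ni k z o\<^sub>L N10 k z o\<^sub>L Mi k z o\<^sub>L blinfun_pow (A k z) l)"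
definition F11 :: "nat \<Rightarrow> nat \<Rightarrow> complex \<Rightarrow> 'b \<Rightarrow>\<^sub>L 'b" where
  "F11 l k z = Ni k z o\<^sub>L N10 k z o\<^sub>L Mi k z o\<^sub>L blinfun_pow (A k z) l o\<^sub>L N01 k z o\<^sub>L Ni k z"
definition q :: real where "q = (K + K * K * K) * K"
definition C :: real where "C = K * K * K * K * K"

lemma Mi: "Mi k z o\<^sub>L M k z = id_blinfun" "M k z o\<^sub>L Mi k z = id_blinfun" "norm (Mi k z) \<le> K" if "z \<in> U"
  using coercive_inverse[OF c co(1)[OF that], of k] K(2) unfolding Mi_def by auto

lemma Ni: "Ni k z o\<^sub>L N11 k z = id_blinfun" "N11 k z o\<^sub>L Ni k z = id_blinfun" "norm (Ni k z) \<le> K" if "z \<in> U"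
  using coercive_inverse[OF c co(2)[OF that], of k] K(2) unfolding Ni_def by auto

lemma hol_Mi: "Mi k \<in> Hinfty U" and hol_Ni: "Ni k \<in> Hinfty U"
  unfolding Mi_def[abs_def] Ni_def[abs_def]
  by (intro Hinfty_inverse[OF U hol(1) c co(1)], assumption) (intro Hinfty_inverse[OF U hol(5) c co(2)])

lemma hol_A: "A k \<in> Hinfty U"
  unfolding A_def[abs_def] by (intro Hinfty_uminus Hinfty_compose Hinfty_diff hol hol_Mi hol_Ni)

lemma hol_F: "F00 l k \<in> Hinfty U" "F01 l k \<in> Hinfty U" "F10 l k \<in> Hinfty U" "F11 l k \<in> Hinfty U"
  unfolding F00_def[abs_def] F01_def[abs_def] F10_def[abs_def] F11_def[abs_def]
  by (intro Hinfty_uminus Hinfty_compose Hinfty_pow hol hol_Mi hol_Ni hol_A)+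

lemma norm_compose_le: "norm A' \<le> a \<Longrightarrow> norm B \<le> b \<Longrightarrow> norm (A' o\<^sub>L B) \<le> a * b"
  by (meson norm_blinfun_compose mult_mono norm_ge_zero order_trans)

lemma K0: "0 \<le> K" using K by simp

lemma q0: "0 \<le> q" using K0 by (simp add: q_def)

lemma norm_A: "z \<in> U \<Longrightarrow> norm (A k z) \<le> q"
  unfolding A_def q_def norm_minus_cancel
  by (intro norm_compose_le order_trans[OF norm_triangle_ineq4] add_mono bd Mi(3) Ni(3))

lemma norm_F:
  assumes z: "z \<in> U"
  shows "norm (F00 l k z) \<le> C * q ^ l" "norm (F01 l k z) \<le> C * q ^ l"
    "norm (F10 l k z) \<le> C * q ^ l" "norm (F11 l k z) \<le> C * q ^ l"
proof -
  note p = norm_blinfun_pow_le[OF norm_A[OF z], of k l]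
  have C5: "C = K ^ 5" by (simp add: C_def eval_nat_numeral mult_ac)
  have mono: "K ^ m * q ^ l \<le> C * q ^ l" if "m \<le> 5" for m
    unfolding C5 using power_increasing[OF that K(1)] zero_le_power[OF q0] by (rule mult_right_mono)
  have K3: "K * q ^ l * K * K = K ^ 3 * q ^ l" "K * K * K * q ^ l = K ^ 3 * q ^ l"
    by (simp_all add: power3_eq_cube mult_ac)
  have "norm (F00 l k z) \<le> K * q ^ l" unfolding F00_def by (intro norm_compose_le Mi(3) p z)
  also have "\<dots> \<le> C * q ^ l" using mono[of 1] by simp
  finally show "norm (F00 l k z) \<le> C * q ^ l" .
  have "norm (F01 l k z) \<le> K * q ^ l * K * K"
    unfolding F01_def norm_minus_cancel by (intro norm_compose_le Mi(3) Ni(3) bd p z)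
  also have "\<dots> \<le> C * q ^ l" using mono[of 3] by (simp add: K3)
  finally show "norm (F01 l k z) \<le> C * q ^ l" .
  have "norm (F10 l k z) \<le> K * K * K * q ^ l"
    unfolding F10_def norm_minus_cancel by (intro norm_compose_le Mi(3) Ni(3) bd p z)
  also have "\<dots> \<le> C * q ^ l" using mono[of 3] by (simp add: K3)
  finally show "norm (F10 l k z) \<le> C * q ^ l" .
  have "norm (F11 l k z) \<le> K * K * K * q ^ l * K * K"
    unfolding F11_def by (intro norm_compose_le Mi(3) Ni(3) bd p z)
  also have "\<dots> = C * q ^ l" by (simp add: C_def mult_ac)
  finally show "norm (F11 l k z) \<le> C * q ^ l" .
qed

text \<open>The weak Montel theorem is applied four times, each time to the subsequence found before. The last
  application also covers the inverses of \<open>N11\<close>, which are put in front of the family \<open>F11\<close>.\<close>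

lemma common_subsequence:
  "\<exists>\<sigma> Mh00 Mh01 Mh10 Mh11 Nh. strict_mono (\<sigma> :: nat \<Rightarrow> nat) \<and>
    (\<forall>l. Mh00 l \<in> Hinfty U \<and> Mh01 l \<in> Hinfty U \<and> Mh10 l \<in> Hinfty U \<and> Mh11 l \<in> Hinfty U) \<and> Nh \<in> Hinfty U \<and>
    (\<forall>z\<in>U. (\<forall>l. wot_tendsto (\<lambda>k. F00 l (\<sigma> k) z) (Mh00 l z) \<and> wot_tendsto (\<lambda>k. F01 l (\<sigma> k) z) (Mh01 l z) \<and>
      wot_tendsto (\<lambda>k. F10 l (\<sigma> k) z) (Mh10 l z) \<and> wot_tendsto (\<lambda>k. F11 l (\<sigma> k) z) (Mh11 l z)) \<and>
      wot_tendsto (\<lambda>k. Ni (\<sigma> k) z) (Nh z))"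
proof -
  obtain s1 G1 where 1: "strict_mono (s1 :: nat \<Rightarrow> nat)"
    "\<forall>l. G1 l \<in> Hinfty U \<and> (\<forall>z\<in>U. wot_tendsto (\<lambda>k. F00 l (s1 k) z) (G1 l z))"
    using weak_montel[of U F00 "\<lambda>l. C * q ^ l", OF U hol_F(1) norm_F(1)] by blast
  obtain s2 G2 where 2: "strict_mono (s2 :: nat \<Rightarrow> nat)"
    "\<forall>l. G2 l \<in> Hinfty U \<and> (\<forall>z\<in>U. wot_tendsto (\<lambda>k. F01 l (s1 (s2 k)) z) (G2 l z))"
    using weak_montel[of U "\<lambda>l k. F01 l (s1 k)" "\<lambda>l. C * q ^ l", OF U hol_F(2) norm_F(2)] by blast
  obtain s3 G3 where 3: "strict_mono (s3 :: nat \<Rightarrow> nat)"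
    "\<forall>l. G3 l \<in> Hinfty U \<and> (\<forall>z\<in>U. wot_tendsto (\<lambda>k. F10 l (s1 (s2 (s3 k))) z) (G3 l z))"
    using weak_montel[of U "\<lambda>l k. F10 l (s1 (s2 k))" "\<lambda>l. C * q ^ l", OF U hol_F(3) norm_F(3)] by blast
  define H where "H j k = (case j of 0 \<Rightarrow> Ni (s1 (s2 (s3 k))) | Suc l \<Rightarrow> F11 l (s1 (s2 (s3 k))))" for j k
  have H: "H j k \<in> Hinfty U" for j k by (simp add: H_def hol_Ni hol_F split: nat.split)
  have Hle: "norm (H j k z) \<le> (case j of 0 \<Rightarrow> K | Suc l \<Rightarrow> C * q ^ l)" if "z \<in> U" for j k z
    using Ni(3)[OF that] norm_F(4)[OF that] by (simp add: H_def split: nat.split)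
  obtain s4 G4 where 4: "strict_mono (s4 :: nat \<Rightarrow> nat)"
    "\<forall>l. G4 l \<in> Hinfty U \<and> (\<forall>z\<in>U. wot_tendsto (\<lambda>k. H l (s4 k) z) (G4 l z))"
    using weak_montel[of U H, OF U H Hle] by blast
  define \<sigma> where "\<sigma> k = s1 (s2 (s3 (s4 k)))" for k
  have sm: "strict_mono \<sigma>" using 1(1) 2(1) 3(1) 4(1) by (simp add: \<sigma>_def strict_mono_def)
  have s34: "strict_mono (\<lambda>k. s3 (s4 k))" "strict_mono (\<lambda>k. s2 (s3 (s4 k)))"
    using 2(1) 3(1) 4(1) by (simp_all add: strict_mono_def)
  have lims: "wot_tendsto (\<lambda>k. F00 l (\<sigma> k) z) (G1 l z)" "wot_tendsto (\<lambda>k. F01 l (\<sigma> k) z) (G2 l z)"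
    "wot_tendsto (\<lambda>k. F10 l (\<sigma> k) z) (G3 l z)" "wot_tendsto (\<lambda>k. F11 l (\<sigma> k) z) (G4 (Suc l) z)"
    "wot_tendsto (\<lambda>k. Ni (\<sigma> k) z) (G4 0 z)" if z: "z \<in> U" for l z
    using wot_tendsto_subseq[OF 1(2)[rule_format, THEN conjunct2, rule_format, OF z, of l] s34(2)]
      wot_tendsto_subseq[OF 2(2)[rule_format, THEN conjunct2, rule_format, OF z, of l] s34(1)]
      wot_tendsto_subseq[OF 3(2)[rule_format, THEN conjunct2, rule_format, OF z, of l] 4(1)]
      4(2)[rule_format, THEN conjunct2, rule_format, OF z, of "Suc l"]
      4(2)[rule_format, THEN conjunct2, rule_format, OF z, of 0]
    by (simp_all add: \<sigma>_def H_def)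
  show ?thesis
    by (rule exI[of _ \<sigma>], rule exI[of _ G1], rule exI[of _ G2], rule exI[of _ G3], rule exI[of _ "\<lambda>l. G4 (Suc l)"],
        rule exI[of _ "G4 0"])
       (use sm lims 1(2) 2(2) 3(2) 4(2) in blast)
qed

text \<open>The functional calculus is multiplicative, so the pointwise identities between the coefficients become
  identities between multiplication operators, all of which commute with \<open>J\<close>. The functions of the family
  turn into the coefficients of the power series for the inverse.\<close>

lemma
  assumes \<nu>: "\<nu> > 0" and line: "\<And>t. inv_line \<nu> t \<in> U" and small: "q * (1 / \<nu>) \<le> 1 / 2"
  shows evo_system_mop: "evo_system (mop \<nu> (M k)) (mop \<nu> (Mi k)) (mop \<nu> (N00 k)) (mop \<nu> (N01 k)) (mop \<nu> (N10 k))
      (mop \<nu> (N11 k)) (mop \<nu> (Ni k)) (J_op \<nu>) (J_op \<nu>) q (1 / \<nu>)"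
    and f00_mop: "evo_system.f00 (mop \<nu> (Mi k)) (mop \<nu> (N00 k)) (mop \<nu> (N01 k)) (mop \<nu> (N10 k)) (mop \<nu> (Ni k)) l = mop \<nu> (F00 l k)"
    and f01_mop: "evo_system.f01 (mop \<nu> (Mi k)) (mop \<nu> (N00 k)) (mop \<nu> (N01 k)) (mop \<nu> (N10 k)) (mop \<nu> (Ni k)) l = mop \<nu> (F01 l k)"
    and f10_mop: "evo_system.f10 (mop \<nu> (Mi k)) (mop \<nu> (N00 k)) (mop \<nu> (N01 k)) (mop \<nu> (N10 k)) (mop \<nu> (Ni k)) l = mop \<nu> (F10 l k)"
    and f11_mop: "evo_system.f11 (mop \<nu> (Mi k)) (mop \<nu> (N00 k)) (mop \<nu> (N01 k)) (mop \<nu> (N10 k)) (mop \<nu> (Ni k)) l = mop \<nu> (F11 l k)"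
proof -
  note [intro] = Hinfty_uminus Hinfty_compose Hinfty_diff Hinfty_pow hol hol_Mi hol_Ni hol_A
  note comp = mop_compose[OF \<nu> line] and dif = mop_diff[OF \<nu> line] and um = mop_uminus[OF \<nu> line] and pow = mop_pow[OF \<nu> line]
  have A: "mop \<nu> (A k) = - ((mop \<nu> (N00 k) - (mop \<nu> (N01 k) o\<^sub>L mop \<nu> (Ni k) o\<^sub>L mop \<nu> (N10 k))) o\<^sub>L mop \<nu> (Mi k))"
    unfolding A_def[abs_def] by (simp add: um comp dif Hinfty_uminus Hinfty_compose Hinfty_diff hol hol_Mi hol_Ni)
  have inv: "mop \<nu> (Mi k) o\<^sub>L mop \<nu> (M k) = id_blinfun" "mop \<nu> (M k) o\<^sub>L mop \<nu> (Mi k) = id_blinfun"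
    "mop \<nu> (Ni k) o\<^sub>L mop \<nu> (N11 k) = id_blinfun" "mop \<nu> (N11 k) o\<^sub>L mop \<nu> (Ni k) = id_blinfun"
    using Mi(1,2)[of _ k] Ni(1,2)[of _ k]
    by (auto simp: comp[symmetric] hol hol_Mi hol_Ni mop_id[OF \<nu> line, symmetric] intro!: mop_cong[OF \<nu> line])
  show sys: "evo_system (mop \<nu> (M k)) (mop \<nu> (Mi k)) (mop \<nu> (N00 k)) (mop \<nu> (N01 k)) (mop \<nu> (N10 k))
      (mop \<nu> (N11 k)) (mop \<nu> (Ni k)) (J_op \<nu>) (J_op \<nu>) q (1 / \<nu>)"
  proof
    show "x = y" if "J_op \<nu> x = J_op \<nu> y" for x y :: "'a l2" by (rule J_op_inj[OF \<nu> that])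
    show "norm (- ((mop \<nu> (N00 k) - (mop \<nu> (N01 k) o\<^sub>L mop \<nu> (Ni k) o\<^sub>L mop \<nu> (N10 k))) o\<^sub>L mop \<nu> (Mi k))) \<le> q"
      unfolding A[symmetric] by (rule norm_mop_le[OF \<nu> line hol_A norm_A])
  qed (intro inv mop_J[OF \<nu> line] hol hol_Mi hol_Ni norm_J_op_le[OF \<nu>] small)+
  have a: "evo_system.a (mop \<nu> (Mi k)) (mop \<nu> (N00 k)) (mop \<nu> (N01 k)) (mop \<nu> (N10 k)) (mop \<nu> (Ni k)) = mop \<nu> (A k)"
    unfolding evo_system.a_def[OF sys] A ..
  show "evo_system.f00 (mop \<nu> (Mi k)) (mop \<nu> (N00 k)) (mop \<nu> (N01 k)) (mop \<nu> (N10 k)) (mop \<nu> (Ni k)) l = mop \<nu> (F00 l k)"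
    "evo_system.f01 (mop \<nu> (Mi k)) (mop \<nu> (N00 k)) (mop \<nu> (N01 k)) (mop \<nu> (N10 k)) (mop \<nu> (Ni k)) l = mop \<nu> (F01 l k)"
    "evo_system.f10 (mop \<nu> (Mi k)) (mop \<nu> (N00 k)) (mop \<nu> (N01 k)) (mop \<nu> (N10 k)) (mop \<nu> (Ni k)) l = mop \<nu> (F10 l k)"
    "evo_system.f11 (mop \<nu> (Mi k)) (mop \<nu> (N00 k)) (mop \<nu> (N01 k)) (mop \<nu> (N10 k)) (mop \<nu> (Ni k)) l = mop \<nu> (F11 l k)"
    unfolding evo_system.f00_def[OF sys] evo_system.f01_def[OF sys] evo_system.f10_def[OF sys] evo_system.f11_def[OF sys] a
      F00_def[abs_def] F01_def[abs_def] F10_def[abs_def] F11_def[abs_def]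
    by (simp_all add: um comp pow Hinfty_uminus Hinfty_compose Hinfty_diff Hinfty_pow hol hol_Mi hol_Ni hol_A)
qed

end

text \<open>The operator between the carriers that is represented by \<open>B\<close>.\<close>

definition pullback :: "'v hilb \<Rightarrow> ('v \<Rightarrow> 'h::real_normed_vector) \<Rightarrow> 'w hilb \<Rightarrow> ('w \<Rightarrow> 'k::real_normed_vector) \<Rightarrow> ('h \<Rightarrow>\<^sub>L 'k) \<Rightarrow> 'v \<Rightarrow> 'w" where
  "pullback X U Y V B x = unitary_inv Y V (B (U x))"

lemma represents_pullback: "unitary_map Y V \<Longrightarrow> represents X U Y V (pullback X U Y V B) B"
  by (simp add: represents_def pullback_def unitary_inv_carrier unitary_map_inv)

lemma wot_limit_coercive:
  assumes "wot_tendsto A L" and "\<And>k. c * (norm x)\<^sup>2 \<le> x \<bullet> A k x"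
  shows "c * (norm x)\<^sup>2 \<le> x \<bullet> L x"
  using assms unfolding wot_tendsto_iff_inner by (intro LIMSEQ_le_const[of "\<lambda>k. x \<bullet> A k x"]) auto

theorem theorem4p1:
  fixes \<nu>0 r :: real
    and M N00 N :: "nat \<Rightarrow> complex \<Rightarrow> 'a::separable_chilbert \<Rightarrow>\<^sub>L 'a"
    and N01 :: "nat \<Rightarrow> complex \<Rightarrow> 'b::separable_chilbert \<Rightarrow>\<^sub>L 'a"
    and N10 :: "nat \<Rightarrow> complex \<Rightarrow> 'a \<Rightarrow>\<^sub>L 'b"
    and N11 :: "nat \<Rightarrow> complex \<Rightarrow> 'b \<Rightarrow>\<^sub>L 'b"
  assumes "\<nu>0 > 0" and "r > 1 / (2 * \<nu>0)"
    and "bounded_family (ball (of_real r) r) M"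
    and "bounded_family (ball (of_real r) r) N00"
    and "bounded_family (ball (of_real r) r) N01"
    and "bounded_family (ball (of_real r) r) N10"
    and "bounded_family (ball (of_real r) r) N11"
    and "\<exists>c>0. \<forall>n \<phi> \<psi>. \<forall>z\<in>ball (of_real r) r.
           Re (cinner (M n z \<phi>) \<phi>) \<ge> c * (norm \<phi>)\<^sup>2 \<and>
           Re (cinner (N11 n z \<psi>) \<psi>) \<ge> c * (norm \<psi>)\<^sup>2"
    and "\<forall>n. \<forall>z\<in>ball (of_real r) r.
           N n z = N00 n z - (N01 n z o\<^sub>L blinfun_inv (N11 n z) o\<^sub>L N10 n z)"
  shows "\<exists>\<nu> \<nu>1 \<sigma> Mh00 Mh01 Mh10 Mh11 Nh S00 S01 S10 S11 S.
    \<nu> > \<nu>1 \<and> \<nu>1 \<ge> \<nu>0 \<and> strict_mono (\<sigma> :: nat \<Rightarrow> nat) \<and>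
    (let U = ball (of_real (1 / (2 * \<nu>1))) (1 / (2 * \<nu>1)) in
      (\<forall>l. Mh00 l \<in> Hinfty U \<and> Mh01 l \<in> Hinfty U \<and> Mh10 l \<in> Hinfty U \<and> Mh11 l \<in> Hinfty U) \<and>
      Nh \<in> Hinfty U \<and>
      (\<forall>z\<in>U.
        let Mi = (\<lambda>k. blinfun_inv (M (\<sigma> k) z));
            Ni = (\<lambda>k. blinfun_inv (N11 (\<sigma> k) z));
            P = (\<lambda>l k. blinfun_pow (- (N (\<sigma> k) z o\<^sub>L Mi k)) l)
        in
          (\<forall>l.
            wot_tendsto (\<lambda>k. Mi k o\<^sub>L P l k) (Mh00 l z) \<and>
            wot_tendsto (\<lambda>k. - (Mi k o\<^sub>L P l k o\<^sub>L N01 (\<sigma> k) z o\<^sub>L Ni k)) (Mh01 l z) \<and>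
            wot_tendsto (\<lambda>k. - (Ni k o\<^sub>L N10 (\<sigma> k) z o\<^sub>L Mi k o\<^sub>L P l k)) (Mh10 l z) \<and>
            wot_tendsto (\<lambda>k. Ni k o\<^sub>L N10 (\<sigma> k) z o\<^sub>L Mi k o\<^sub>L P l k o\<^sub>L N01 (\<sigma> k) z o\<^sub>L Ni k)
              (Mh11 l z)) \<and>
          wot_tendsto Ni (Nh z))) \<and>
    op_sums (L2w \<nu>) (L2w \<nu>) (\<lambda>l. fct_calc \<nu> (Mh00 (Suc l)) \<circ> (d0_inv \<nu> ^^ Suc l)) S00 \<and>
    op_sums (L2w \<nu>) (L2w \<nu>) (\<lambda>l. fct_calc \<nu> (Mh01 l) \<circ> (d0_inv \<nu> ^^ (l + 1))) S01 \<and>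
    op_sums (L2w \<nu>) (L2w \<nu>) (\<lambda>l. fct_calc \<nu> (Mh10 l) \<circ> (d0_inv \<nu> ^^ l)) S10 \<and>
    op_sums (L2w \<nu>) (L2w \<nu>) (\<lambda>l. fct_calc \<nu> (Mh11 l) \<circ> (d0_inv \<nu> ^^ (l + 1))) S11 \<and>
    cont_invertible (L2w \<nu>) (hcarrier (L2w \<nu>), fct_calc \<nu> (Mh00 0)) \<and>
    cont_invertible (L2w \<nu>) (hcarrier (L2w \<nu>), fct_calc \<nu> Nh) \<and>
    (let X = L2w \<nu> \<oplus>\<^sub>H L2w \<nu>;
         M1 = block_op S00 S01 S10 S11;
         D = block_op (inv_op (hcarrier (L2w \<nu>), fct_calc \<nu> (Mh00 0))) (\<lambda>_. 0)
               (\<lambda>_. 0) (inv_op (hcarrier (L2w \<nu>), fct_calc \<nu> Nh))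
     in
       op_sums X X (\<lambda>l. ((\<lambda>w. - D (M1 w)) ^^ Suc l) \<circ> D) S \<and>
       G_converges X
         (\<lambda>k. evo_op \<nu> (M (\<sigma> k)) (N00 (\<sigma> k)) (N01 (\<sigma> k)) (N10 (\<sigma> k)) (N11 (\<sigma> k)))
         (d0_one_op \<nu> (\<lambda>w. D w + S w)))"
proof -
  let ?B = "ball (complex_of_real r) r"
  let ?U = "ball (complex_of_real (1 / (2 * \<nu>0))) (1 / (2 * \<nu>0))"
  have sub: "?U \<subseteq> ?B" using assms(1,2) by (intro disc_subset) auto
  obtain c where c: "c > 0" "\<And>n \<phi> \<psi> z. z \<in> ?B \<Longrightarrow> Re (cinner (M n z \<phi>) \<phi>) \<ge> c * (norm \<phi>)\<^sup>2 \<and>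
      Re (cinner (N11 n z \<psi>) \<psi>) \<ge> c * (norm \<psi>)\<^sup>2" using assms(8) by blast
  obtain C1 where C1: "\<And>k z. z \<in> ?B \<Longrightarrow> norm (M k z) \<le> C1" using assms(3) unfolding bounded_family_def by blast
  obtain C2 where C2: "\<And>k z. z \<in> ?B \<Longrightarrow> norm (N00 k z) \<le> C2" using assms(4) unfolding bounded_family_def by blast
  obtain C3 where C3: "\<And>k z. z \<in> ?B \<Longrightarrow> norm (N01 k z) \<le> C3" using assms(5) unfolding bounded_family_def by blast
  obtain C4 where C4: "\<And>k z. z \<in> ?B \<Longrightarrow> norm (N10 k z) \<le> C4" using assms(6) unfolding bounded_family_def by blast
  obtain C5 where C5: "\<And>k z. z \<in> ?B \<Longrightarrow> norm (N11 k z) \<le> C5" using assms(7) unfolding bounded_family_def by blast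
  define K where "K = Max {1, 1 / c, C1, C2, C3, C4, C5}"
  have K: "1 \<le> K" "1 / c \<le> K" "C1 \<le> K" "C2 \<le> K" "C3 \<le> K" "C4 \<le> K" "C5 \<le> K"
    unfolding K_def by (rule Max_ge; simp)+
  interpret coefficient_families ?U c K M N00 N01 N10 N11
  proof
    show "open ?U" by simp
    show "c > 0" "1 \<le> K" "1 / c \<le> K" using c K by auto
    show "M k \<in> Hinfty ?U" "N00 k \<in> Hinfty ?U" "N01 k \<in> Hinfty ?U" "N10 k \<in> Hinfty ?U" "N11 k \<in> Hinfty ?U" for k
      using assms(3-7) unfolding bounded_family_def by (blast intro: Hinfty_subset[OF _ sub])+
    show "norm (M k z) \<le> K" "norm (N00 k z) \<le> K" "norm (N01 k z) \<le> K" "norm (N10 k z) \<le> K" "norm (N11 k z) \<le> K"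
      if "z \<in> ?U" for k z
      using subsetD[OF sub that] C1[of z k] C2[of z k] C3[of z k] C4[of z k] C5[of z k] K by (meson order_trans)+
    show "c * (norm x)\<^sup>2 \<le> x \<bullet> M k z x" if "z \<in> ?U" for k z x
      unfolding inner_commute[of x "M k z x"] unfolding inner_eq_Re_cinner using c(2)[OF subsetD[OF sub that], of x k] by blast
    show "c * (norm x)\<^sup>2 \<le> x \<bullet> N11 k z x" if "z \<in> ?U" for k z x
      unfolding inner_commute[of x "N11 k z x"] unfolding inner_eq_Re_cinner using c(2)[OF subsetD[OF sub that], of _ k x] by blast
  qed
  obtain \<sigma> Mh00 Mh01 Mh10 Mh11 Nh where \<sigma>: "strict_mono (\<sigma> :: nat \<Rightarrow> nat)"
    and hol_lim: "\<And>l. Mh00 l \<in> Hinfty ?U" "\<And>l. Mh01 l \<in> Hinfty ?U" "\<And>l. Mh10 l \<in> Hinfty ?U" "\<And>l. Mh11 l \<in> Hinfty ?U" "Nh \<in> Hinfty ?U"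
    and lim: "\<And>z l. z \<in> ?U \<Longrightarrow> wot_tendsto (\<lambda>k. F00 l (\<sigma> k) z) (Mh00 l z)"
      "\<And>z l. z \<in> ?U \<Longrightarrow> wot_tendsto (\<lambda>k. F01 l (\<sigma> k) z) (Mh01 l z)"
      "\<And>z l. z \<in> ?U \<Longrightarrow> wot_tendsto (\<lambda>k. F10 l (\<sigma> k) z) (Mh10 l z)"
      "\<And>z l. z \<in> ?U \<Longrightarrow> wot_tendsto (\<lambda>k. F11 l (\<sigma> k) z) (Mh11 l z)"
      "\<And>z. z \<in> ?U \<Longrightarrow> wot_tendsto (\<lambda>k. Ni (\<sigma> k) z) (Nh z)"
    using common_subsequence by blast

  \<comment> \<open>The constant \<open>\<kappa>\<close> will bound the inverses of the limits of \<open>M\<^sup>-\<^sup>1\<close> and \<open>N11\<^sup>-\<^sup>1\<close>. The weight \<open>\<nu>\<close> is so large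
    that \<open>q / \<nu> \<le> 1 / 2\<close>, for the Neumann series of the single operators, and \<open>x / \<nu> \<le> 1 / 4\<close>, for that of
    the limit; \<open>\<nu>1 = \<nu>0\<close> can be taken.\<close>
  define \<kappa> where "\<kappa> = 1 / (c / K\<^sup>2)"
  define x where "x = (\<kappa> * (2 * C * (q + 1))) * (4 * (\<kappa> * (2 * C)) + 2)"
  define \<nu> where "\<nu> = \<nu>0 + 1 + 2 * q + 4 * x"
  have C0: "0 \<le> C" using K0 by (simp add: C_def)
  have k0: "0 \<le> \<kappa>" using c by (simp add: \<kappa>_def)
  have x0: "0 \<le> x" unfolding x_def using k0 C0 q0 by (intro mult_nonneg_nonneg add_nonneg_nonneg) auto
  have \<nu>: "\<nu> > \<nu>0" "\<nu> > 0" "2 * q \<le> \<nu>" "4 * x \<le> \<nu>" using assms(1) q0 x0 by (simp_all add: \<nu>_def)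
  have line: "inv_line \<nu> t \<in> ?U" for t by (rule inv_line_in_disc[OF assms(1) \<nu>(1)])
  have qj: "q * (1 / \<nu>) \<le> 1 / 2" using \<nu> by (simp add: field_simps)
  have small: "(\<kappa> * (2 * C * (q + 1) * (1 / \<nu>))) * (4 * (\<kappa> * (2 * C)) + 2) \<le> 1 / 4"
  proof -
    have "(\<kappa> * (2 * C * (q + 1) * (1 / \<nu>))) * (4 * (\<kappa> * (2 * C)) + 2) = x / \<nu>" by (simp add: x_def)
    also have "\<dots> \<le> 1 / 4" using \<nu> by (simp add: field_simps)
    finally show ?thesis .
  qed
  have c': "c / K\<^sup>2 > 0" using c K by simp
  note mlin = complex_linear_mop[OF \<nu>(2) line]

  \<comment> \<open>Coercivity passes to inverses, to weak limits and to multiplication operators; this gives the two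
    inverses that make up \<open>D\<close>.\<close>
  have co_lim: "c / K\<^sup>2 * (norm y)\<^sup>2 \<le> y \<bullet> Mh00 0 z y" "c / K\<^sup>2 * (norm y')\<^sup>2 \<le> y' \<bullet> Nh z y'" if z: "z \<in> ?U" for z y y'
  proof -
    have "c / K\<^sup>2 * (norm y)\<^sup>2 \<le> y \<bullet> F00 0 k z y" for k
      using inner_inverse_coercive[OF _ co(1)[OF z] Mi(2)[OF z] bd(1)[OF z], of y k] c K by (simp add: F00_def)
    from wot_limit_coercive[OF lim(1)[OF z] this] show "c / K\<^sup>2 * (norm y)\<^sup>2 \<le> y \<bullet> Mh00 0 z y" .
    have "c / K\<^sup>2 * (norm y')\<^sup>2 \<le> y' \<bullet> Ni k z y'" for k
      using inner_inverse_coercive[OF _ co(2)[OF z] Ni(2)[OF z] bd(5)[OF z], of y' k] c K by simp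
    from wot_limit_coercive[OF lim(5)[OF z] this] show "c / K\<^sup>2 * (norm y')\<^sup>2 \<le> y' \<bullet> Nh z y'" .
  qed
  define d1 where "d1 = blinfun_inv (mop \<nu> (Mh00 0))"
  define d2 where "d2 = blinfun_inv (mop \<nu> Nh)"
  have co_mop: "c / K\<^sup>2 * (norm v)\<^sup>2 \<le> v \<bullet> mop \<nu> (Mh00 0) v" "c / K\<^sup>2 * (norm w)\<^sup>2 \<le> w \<bullet> mop \<nu> Nh w" for v w
    by (rule mop_coercive[OF \<nu>(2) line hol_lim(1) co_lim(1)] mop_coercive[OF \<nu>(2) line hol_lim(5) co_lim(2)], assumption)+
  note d1 = coercive_inverse[OF c' co_mop(1), folded d1_def \<kappa>_def]
  note d2 = coercive_inverse[OF c' co_mop(2), folded d2_def \<kappa>_def]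

  define r00 where "r00 k = evo_system.r00 (mop \<nu> (Mi k)) (mop \<nu> (N00 k)) (mop \<nu> (N01 k)) (mop \<nu> (N10 k)) (mop \<nu> (Ni k)) (J_op \<nu>)" for k
  define r01 where "r01 k = evo_system.r01 (mop \<nu> (Mi k)) (mop \<nu> (N00 k)) (mop \<nu> (N01 k)) (mop \<nu> (N10 k)) (mop \<nu> (Ni k)) (J_op \<nu>)" for k
  define r10 where "r10 k = evo_system.r10 (mop \<nu> (Mi k)) (mop \<nu> (N00 k)) (mop \<nu> (N01 k)) (mop \<nu> (N10 k)) (mop \<nu> (Ni k)) (J_op \<nu>)" for k
  define r11 where "r11 k = evo_system.r11 (mop \<nu> (Mi k)) (mop \<nu> (N00 k)) (mop \<nu> (N01 k)) (mop \<nu> (N10 k)) (mop \<nu> (Ni k)) (J_op \<nu>)" for k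
  define R where "R k = evo_system.R (mop \<nu> (Mi k)) (mop \<nu> (N00 k)) (mop \<nu> (N01 k)) (mop \<nu> (N10 k)) (mop \<nu> (Ni k)) (J_op \<nu>)" for k
  note sys = evo_system_mop[OF \<nu>(2) line qj]
  have Rb: "R k = block_blinfun (r00 k) (r01 k) (r10 k) (r11 k + mop \<nu> (Ni k))" for k
    unfolding R_def r00_def r01_def r10_def r11_def by (rule evo_system.R_def[OF sys])
  have rsums: "(\<lambda>l. mop \<nu> (F00 l k) o\<^sub>L blinfun_pow (J_op \<nu>) (Suc l)) sums r00 k"
    "(\<lambda>l. mop \<nu> (F01 l k) o\<^sub>L blinfun_pow (J_op \<nu>) (Suc l)) sums r01 k"
    "(\<lambda>l. mop \<nu> (F10 l k) o\<^sub>L blinfun_pow (J_op \<nu>) (Suc l)) sums r10 k"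
    "(\<lambda>l. mop \<nu> (F11 l k) o\<^sub>L blinfun_pow (J_op \<nu>) (Suc l)) sums r11 k" for k
    using evo_system.r00_sums[OF sys[of k]] evo_system.r01_sums[OF sys[of k]]
      evo_system.r10_sums[OF sys[of k]] evo_system.r11_sums[OF sys[of k]]
    unfolding f00_mop[OF \<nu>(2) line qj] f01_mop[OF \<nu>(2) line qj] f10_mop[OF \<nu>(2) line qj] f11_mop[OF \<nu>(2) line qj]
      r00_def r01_def r10_def r11_def by simp_all
  note mle = norm_mop_le[OF \<nu>(2) line]
  have "\<exists>s00 s01 s10 s11 sh V.
    (\<lambda>l. mop \<nu> (Mh00 (Suc l)) o\<^sub>L blinfun_pow (J_op \<nu>) (Suc l)) sums s00 \<and> (\<lambda>l. mop \<nu> (Mh01 l) o\<^sub>L blinfun_pow (J_op \<nu>) (l + 1)) sums s01 \<and>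
    (\<lambda>l. mop \<nu> (Mh10 l) o\<^sub>L blinfun_pow (J_op \<nu>) l) sums s10 \<and> (\<lambda>l. mop \<nu> (Mh11 l) o\<^sub>L blinfun_pow (J_op \<nu>) (l + 1)) sums s11 \<and>
    (\<lambda>l. blinfun_pow (- (block_blinfun d1 0 0 d2 o\<^sub>L block_blinfun s00 s01 s10 s11)) (Suc l) o\<^sub>L block_blinfun d1 0 0 d2) sums sh \<and>
    V o\<^sub>L (block_blinfun d1 0 0 d2 + sh) = id_blinfun \<and> (block_blinfun d1 0 0 d2 + sh) o\<^sub>L V = id_blinfun \<and>
    wot_tendsto (\<lambda>k. block_blinfun (r00 (\<sigma> k)) (r01 (\<sigma> k)) (r10 (\<sigma> k)) (r11 (\<sigma> k) + mop \<nu> (Ni (\<sigma> k)))) (V o\<^sub>L block_blinfun (J_op \<nu>) 0 0 id_blinfun)"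
    by (rule limit_operator[where j = "1 / \<nu>" and C = C and q = q and \<kappa> = \<kappa> and
          ?F00.0 = "\<lambda>k l. mop \<nu> (F00 l (\<sigma> k))" and ?F01.0 = "\<lambda>k l. mop \<nu> (F01 l (\<sigma> k))" and
          ?F10.0 = "\<lambda>k l. mop \<nu> (F10 l (\<sigma> k))" and ?F11.0 = "\<lambda>k l. mop \<nu> (F11 l (\<sigma> k))" and
          ?h00.0 = "\<lambda>l. mop \<nu> (Mh00 l)" and ?h01.0 = "\<lambda>l. mop \<nu> (Mh01 l)" and
          ?h10.0 = "\<lambda>l. mop \<nu> (Mh10 l)" and ?h11.0 = "\<lambda>l. mop \<nu> (Mh11 l)" and nh = "mop \<nu> Nh"])
       (intro norm_J_op_le \<nu>(2) C0 q0 qj mle hol_F norm_F d1 d2 small rsums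
          mop_wot_tendsto[OF \<nu>(2) line hol_F(1) hol_lim(1) norm_F(1) lim(1)]
          mop_wot_tendsto[OF \<nu>(2) line hol_F(2) hol_lim(2) norm_F(2) lim(2)]
          mop_wot_tendsto[OF \<nu>(2) line hol_F(3) hol_lim(3) norm_F(3) lim(3)]
          mop_wot_tendsto[OF \<nu>(2) line hol_F(4) hol_lim(4) norm_F(4) lim(4)]
          mop_wot_tendsto[OF \<nu>(2) line hol_Ni hol_lim(5) Ni(3) lim(5)]; assumption)+
  then obtain s00 s01 s10 s11 sh V where
    s: "(\<lambda>l. mop \<nu> (Mh00 (Suc l)) o\<^sub>L blinfun_pow (J_op \<nu>) (Suc l)) sums s00"
      "(\<lambda>l. mop \<nu> (Mh01 l) o\<^sub>L blinfun_pow (J_op \<nu>) (l + 1)) sums s01"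
      "(\<lambda>l. mop \<nu> (Mh10 l) o\<^sub>L blinfun_pow (J_op \<nu>) l) sums s10"
      "(\<lambda>l. mop \<nu> (Mh11 l) o\<^sub>L blinfun_pow (J_op \<nu>) (l + 1)) sums s11"
    and sh: "(\<lambda>l. blinfun_pow (- (block_blinfun d1 0 0 d2 o\<^sub>L block_blinfun s00 s01 s10 s11)) (Suc l) o\<^sub>L block_blinfun d1 0 0 d2) sums sh"
    and V: "V o\<^sub>L (block_blinfun d1 0 0 d2 + sh) = id_blinfun" "(block_blinfun d1 0 0 d2 + sh) o\<^sub>L V = id_blinfun"
    and Rlim: "wot_tendsto (\<lambda>k. R (\<sigma> k)) (V o\<^sub>L block_blinfun (J_op \<nu>) 0 0 id_blinfun)"
    unfolding Rb by blast

  \<comment> \<open>Everything is now transported back from the transformed side.\<close>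
  let ?Ha = "L2w \<nu> :: 'a mfun hilb" and ?Hb = "L2w \<nu> :: 'b mfun hilb"
  let ?X = "?Ha \<oplus>\<^sub>H ?Hb" and ?W = "map_prod (FL \<nu>) (FL \<nu>) :: 'a mfun \<times> 'b mfun \<Rightarrow> 'a l2 \<times> 'b l2"
  note U0 = unitary_FL[of \<nu>, where 'a = 'a] and U1 = unitary_FL[of \<nu>, where 'a = 'b]
  note W = unitary_map_hsum[OF U0 U1]
  have Jlin: "complex_linear (J_op \<nu> :: 'a l2 \<Rightarrow>\<^sub>L 'a l2)" "complex_linear (J_op \<nu> :: 'b l2 \<Rightarrow>\<^sub>L 'b l2)"
    by (rule J_op_complex_linear[OF \<nu>(2)])+
  have slin: "complex_linear s00" "complex_linear s01" "complex_linear s10" "complex_linear s11"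
    by (rule complex_linear_sums[OF s(1)] complex_linear_sums[OF s(2)] complex_linear_sums[OF s(3)] complex_linear_sums[OF s(4)],
        intro complex_linear_compose mlin hol_lim complex_linear_pow Jlin)+
  define S00 where "S00 = pullback ?Ha (FL \<nu>) ?Ha (FL \<nu>) s00"
  define S01 where "S01 = pullback ?Hb (FL \<nu>) ?Ha (FL \<nu>) s01"
  define S10 where "S10 = pullback ?Ha (FL \<nu>) ?Hb (FL \<nu>) s10"
  define S11 where "S11 = pullback ?Hb (FL \<nu>) ?Hb (FL \<nu>) s11"
  define S where "S = pullback ?X ?W ?X ?W sh"
  have repS: "represents ?Ha (FL \<nu>) ?Ha (FL \<nu>) S00 s00" "represents ?Hb (FL \<nu>) ?Ha (FL \<nu>) S01 s01"
    "represents ?Ha (FL \<nu>) ?Hb (FL \<nu>) S10 s10" "represents ?Hb (FL \<nu>) ?Hb (FL \<nu>) S11 s11"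
    "represents ?X ?W ?X ?W S sh"
    unfolding S00_def S01_def S10_def S11_def S_def by (intro represents_pullback U0 U1 W)+
  note rf = fct_calc_represents[OF \<nu>(2) line]
  note rj = represents_funpow[OF d0_inv_represents[OF \<nu>(2) line]]
  note cl = complex_linear_compose mlin hol_lim complex_linear_pow Jlin
  have sums_S: "op_sums ?Ha ?Ha (\<lambda>l. fct_calc \<nu> (Mh00 (Suc l)) \<circ> (d0_inv \<nu> ^^ Suc l)) S00"
    "op_sums ?Hb ?Ha (\<lambda>l. fct_calc \<nu> (Mh01 l) \<circ> (d0_inv \<nu> ^^ (l + 1))) S01"
    "op_sums ?Ha ?Hb (\<lambda>l. fct_calc \<nu> (Mh10 l) \<circ> (d0_inv \<nu> ^^ l)) S10"
    "op_sums ?Hb ?Hb (\<lambda>l. fct_calc \<nu> (Mh11 l) \<circ> (d0_inv \<nu> ^^ (l + 1))) S11"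
    by (rule op_sumsI[OF U0 U0 _ _ repS(1) s(1) slin(1)] op_sumsI[OF U1 U0 _ _ repS(2) s(2) slin(2)]
        op_sumsI[OF U0 U1 _ _ repS(3) s(3) slin(3)] op_sumsI[OF U1 U1 _ _ repS(4) s(4) slin(4)],
        rule represents_compose[OF rj rf[OF hol_lim(1)]] represents_compose[OF rj rf[OF hol_lim(2)]]
          represents_compose[OF rj rf[OF hol_lim(3)]] represents_compose[OF rj rf[OF hol_lim(4)]], intro cl)+
  have ci: "cont_invertible ?Ha (hcarrier ?Ha, fct_calc \<nu> (Mh00 0))" "cont_invertible ?Hb (hcarrier ?Hb, fct_calc \<nu> Nh)"
    by (rule cont_invertible_represents[OF U0 rf[OF hol_lim(1)] mlin[OF hol_lim(1)] d1(1,2)]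
        cont_invertible_represents[OF U1 rf[OF hol_lim(5)] mlin[OF hol_lim(5)] d2(1,2)])+
  note rd1 = inv_op_represents[OF U0 rf[OF hol_lim(1)] mlin[OF hol_lim(1)] d1(1,2)]
  note rd2 = inv_op_represents[OF U1 rf[OF hol_lim(5)] mlin[OF hol_lim(5)] d2(1,2)]
  define M1 where "M1 = block_op S00 S01 S10 S11"
  define D where "D = block_op (inv_op (hcarrier ?Ha, fct_calc \<nu> (Mh00 0))) (\<lambda>_. 0) (\<lambda>_. 0) (inv_op (hcarrier ?Hb, fct_calc \<nu> Nh))"
  have rM1: "represents ?X ?W ?X ?W M1 (block_blinfun s00 s01 s10 s11)"
    unfolding M1_def by (intro represents_block U0 U1 repS)
  have rD: "represents ?X ?W ?X ?W D (block_blinfun d1 0 0 d2)"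
    unfolding D_def by (intro represents_block U0 U1 rd1 rd2 represents_zero)
  have dlin: "complex_linear d1" "complex_linear d2"
    by (rule complex_linear_inv[OF mlin[OF hol_lim(1)] d1(1,2)] complex_linear_inv[OF mlin[OF hol_lim(5)] d2(1,2)])+
  have Dlin: "complex_linear (block_blinfun d1 0 0 d2)" by (intro complex_linear_block dlin complex_linear_0)
  have Qlin: "complex_linear (blinfun_pow (- (block_blinfun d1 0 0 d2 o\<^sub>L block_blinfun s00 s01 s10 s11)) (Suc l) o\<^sub>L block_blinfun d1 0 0 d2)" for l
    by (intro complex_linear_compose complex_linear_pow complex_linear_uminus Dlin complex_linear_block slin)
  have shlin: "complex_linear sh" by (rule complex_linear_sums[OF sh Qlin])
  have rQ: "represents ?X ?W ?X ?W (\<lambda>w. - D (M1 w)) (- (block_blinfun d1 0 0 d2 o\<^sub>L block_blinfun s00 s01 s10 s11))"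
    using represents_uminus[OF W represents_compose[OF rM1 rD]] by (simp add: comp_def)
  have sum_S: "op_sums ?X ?X (\<lambda>l. ((\<lambda>w. - D (M1 w)) ^^ Suc l) \<circ> D) S"
    by (rule op_sumsI[OF W W represents_compose[OF rD represents_funpow[OF rQ]] Qlin repS(5) sh shlin])
  have rT: "represents ?X ?W ?X ?W (\<lambda>w. D w + S w) (block_blinfun d1 0 0 d2 + sh)"
    by (rule represents_add[OF W rD repS(5)])

  have Vlin: "complex_linear V" by (rule complex_linear_inv[OF complex_linear_add[OF Dlin shlin] V])
  have Rlin: "complex_linear (R k)" for k
  proof -
    have "complex_linear (r00 k)" "complex_linear (r01 k)" "complex_linear (r10 k)" "complex_linear (r11 k)"
      by (rule complex_linear_sums[OF rsums(1)] complex_linear_sums[OF rsums(2)] complex_linear_sums[OF rsums(3)] complex_linear_sums[OF rsums(4)],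
          intro complex_linear_compose mlin hol_F complex_linear_pow Jlin)+
    then show ?thesis unfolding Rb by (intro complex_linear_block complex_linear_add mlin hol_Ni)
  qed
  let ?E = "\<lambda>k. evo_op \<nu> (M k) (N00 k) (N01 k) (N10 k) (N11 k)"
  have E: "cont_invertible ?X (?E k) \<and>
      (\<forall>f\<in>hcarrier ?X. inv_op (?E k) f \<in> hcarrier ?X \<and> ?W (inv_op (?E k) f) = R k (?W f))" for k
  proof -
    obtain D' A' where E: "?E k = (D', A')" by (cases "?E k")
    note dv = evo_op_domain_value[OF \<nu>(2) line hol sys R_def[of k] E]
    note inj = evo_system.R_inj[OF sys[of k], folded R_def[of k]]
    show ?thesis
      unfolding E
    proof (intro conjI ballI)
      show "cont_invertible ?X (D', A')" by (rule cont_invertible_by_inverse[OF W Rlin inj dv])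
      fix f assume "f \<in> hcarrier ?X"
      note i = inv_op_by_inverse[OF W Rlin inj dv this]
      show "inv_op (D', A') f \<in> hcarrier ?X" by (rule iffD1[OF dv(1) i[THEN conjunct1], THEN conjunct1])
      show "?W (inv_op (D', A') f) = R k (?W f)" by (rule i[THEN conjunct2])
    qed
  qed
  let ?L = "d0_one_op \<nu> (\<lambda>w. D w + S w)"
  define R' where "R' = V o\<^sub>L block_blinfun (J_op \<nu>) 0 0 id_blinfun"
  have R'lin: "complex_linear R'"
    unfolding R'_def by (intro complex_linear_compose Vlin complex_linear_block Jlin complex_linear_0 complex_linear_id)
  obtain D\<^sub>L A\<^sub>L where L: "?L = (D\<^sub>L, A\<^sub>L)" by (cases ?L)
  note dvL = d0_one_op_domain_value[OF \<nu>(2) line rT V R'_def L]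
  note inverse_L = W R'lin dvL(3) dvL(1) dvL(2)
  have G: "G_converges ?X (\<lambda>k. ?E (\<sigma> k)) ?L"
    unfolding G_converges_def
  proof (intro conjI allI ballI)
    show "cont_invertible ?X (?E (\<sigma> k))" for k using E by blast
    show "linear_op ?X ?L" unfolding L by (rule linear_op_by_inverse[OF inverse_L])
    show "inj_on (snd ?L) (fst ?L)" unfolding L fst_conv snd_conv by (rule inj_on_by_inverse[OF inverse_L])
    fix f assume f: "f \<in> hcarrier ?X"
    have "\<exists>u\<in>D\<^sub>L. A\<^sub>L u = f \<and> ?W u = R' (?W f)" by (rule solvable_by_inverse[OF inverse_L f])
    then obtain u where u: "u \<in> fst ?L" "snd ?L u = f" "?W u = R' (?W f)"
      unfolding L fst_conv snd_conv by blast
    have uc: "u \<in> hcarrier ?X" using u(1) dvL(1) unfolding L fst_conv by blast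
    have "(\<lambda>k. hinner ?X g (inv_op (?E (\<sigma> k)) f)) \<longlonglongrightarrow> hinner ?X g u" if g: "g \<in> hcarrier ?X" for g
    proof -
      have "hinner ?X g (inv_op (?E k) f) = cinner (?W g) (R k (?W f))" for k
        using unitary_map_inner[OF W g] E[of k] f by simp
      moreover have "hinner ?X g u = cinner (?W g) (R' (?W f))"
        using unitary_map_inner[OF W g uc] u(3) by simp
      ultimately show ?thesis
        using Rlim[folded R'_def, unfolded wot_tendsto_def, rule_format, of "?W g" "?W f"] by (simp only:)
    qed
    with u show "\<exists>u\<in>fst ?L. snd ?L u = f \<and> (\<forall>g\<in>hcarrier ?X. (\<lambda>k. hinner ?X g (inv_op (?E (\<sigma> k)) f)) \<longlonglongrightarrow> hinner ?X g u)"
      by blast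
  qed
  have Nz: "N k z = N00 k z - (N01 k z o\<^sub>L blinfun_inv (N11 k z) o\<^sub>L N10 k z)" if "z \<in> ?U" for k z
    using assms(9) subsetD[OF sub that] by blast
  show ?thesis
    unfolding Let_def
    apply (rule exI[of _ \<nu>], rule exI[of _ \<nu>0], rule exI[of _ \<sigma>], rule exI[of _ Mh00], rule exI[of _ Mh01],
        rule exI[of _ Mh10], rule exI[of _ Mh11], rule exI[of _ Nh], rule exI[of _ S00], rule exI[of _ S01],
        rule exI[of _ S10], rule exI[of _ S11], rule exI[of _ S])
    using \<nu>(1) \<sigma> hol_lim sums_S ci sum_S G lim
    by (simp add: M1_def D_def Nz F00_def F01_def F10_def F11_def A_def Mi_def Ni_def)
qed

end
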